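(* Let $n\ge 2$, let $\Omega\subset\mathbb R^n$ be a bounded domain with $\partial\Omega\in C^3$, and let $\gamma$ be the inward unit normal to $\partial\Omega$. Let $M_0,L_1,L_2,b_0$ be positive constants with $b_0<1$, let $f=f(x,z)$ be a $C^1$ function on $\overline\Omega\times[-M_0,M_0]$ and $\psi=\psi(x)$ a $C^1$ function on $\overline\Omega$ such that $$f_z(x,z)\ge 0\ \text{ and }\ |f(x,z)|+|f_x(x,z)|\le L_1\quad\text{in }\overline\Omega\times[-M_0,M_0],$$ $$|\psi|_{C^1(\overline\Omega)}\le L_2,\qquad |\psi|_{C^0(\partial\Omega)}\le b_0<1 .$$ Suppose $u\in C^2(\overline\Omega)\cap C^3(\Omega)$ satisfies $|u|\le M_0$ in $\overline\Omega$ and solves the capillary problem $$\operatorname{div}\Big(\frac{Du}{\sqrt{1+|Du|^2}}\Big)=f(x,u)\ \text{ in }\Omega,\qquad \frac1v\frac{\partial u}{\partial\gamma}+\psi(x)=0\ \text{ on }\partial\Omega,\qquad v=\sqrt{1+|Du|^2}.$$ Then there exists a small positive constant $\mu_0$ (determined by the data and not depending on $u$) such that $$\sup_{\overline\Omega_{\mu_0}}|Du|\le\max\{M_1,M_2\},$$ where $M_1$ is a positive constant depending only on $n,\mu_0,M_0,L_1$ (the constant coming from the interior gradient estimate), and $M_2$ is a positive constant depending only on $n,\Omega,\mu_0,M_0,L_1,L_2,b_0$.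
   Context: Notation: $d(x)=\operatorname{dist}(x,\partial\Omega)$ and, for $\mu>0$, $\Omega_\mu=\{x\in\Omega: d(x)<\mu\}$. $f_x$ denotes the gradient of $f$ in the $x$ variable and $f_z$ the partial derivative in $z$. The interior gradient estimate referred to is the standard one: if $u\in C^3(\Omega)$ solves $\operatorname{div}(Du/\sqrt{1+|Du|^2})=f(x,u)$ in $\Omega$ with $|u|\le M_0$, and $f\in C^1(\overline\Omega\times[-M_0,M_0])$ satisfies $f_z\ge0$ and $|f|+|f_x|\le L_1$, then for every subdomain $\Omega'\subset\subset\Omega$ one has $\sup_{\Omega'}|Du|\le M_1$ with $M_1$ depending only on $n,M_0,\operatorname{dist}(\Omega',\partial\Omega),L_1$. *)

theory Defs
  imports "HOL-Analysis.Analysis"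
begin

section \<open>Derivatives and spaces of continuously differentiable functions\<close>

definition partial_deriv :: "'a::euclidean_space \<Rightarrow> ('a \<Rightarrow> real) \<Rightarrow> 'a \<Rightarrow> real" where
  "partial_deriv b f x = frechet_derivative f (at x) b"

definition grad :: "('a::euclidean_space \<Rightarrow> real) \<Rightarrow> 'a \<Rightarrow> 'a" where
  "grad f x = (\<Sum>b\<in>Basis. partial_deriv b f x *\<^sub>R b)"

definition divergence :: "('a::euclidean_space \<Rightarrow> 'a) \<Rightarrow> 'a \<Rightarrow> real" where
  "divergence F x = (\<Sum>b\<in>Basis. frechet_derivative F (at x) b \<bullet> b)"

text \<open>A multi-index is given as a list of basis vectors, one for each differentiation.\<close>

definition iter_partial :: "'a::euclidean_space list \<Rightarrow> ('a \<Rightarrow> real) \<Rightarrow> 'a \<Rightarrow> real" where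
  "iter_partial bs f = foldr partial_deriv bs f"

text \<open>The space \<open>C\<^sup>k(S)\<close>, for open \<open>S\<close>.\<close>

definition Ck_on :: "nat \<Rightarrow> 'a::euclidean_space set \<Rightarrow> ('a \<Rightarrow> real) \<Rightarrow> bool" where
  "Ck_on k S f \<longleftrightarrow>
     (\<forall>bs. set bs \<subseteq> Basis \<and> length bs < k \<longrightarrow> (\<forall>x\<in>S. iter_partial bs f differentiable (at x))) \<and>
     (\<forall>bs. set bs \<subseteq> Basis \<and> length bs \<le> k \<longrightarrow> continuous_on S (iter_partial bs f))"

text \<open>The space \<open>C\<^sup>k\<close> on the closure of the open set \<open>S\<close>: all derivatives up to order \<open>k\<close> extend
  continuously from \<open>S\<close> to its closure. The values of \<open>f\<close> itself on the boundary are those of the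
  continuous extension.\<close>

definition Ck_closure :: "nat \<Rightarrow> 'a::euclidean_space set \<Rightarrow> ('a \<Rightarrow> real) \<Rightarrow> bool" where
  "Ck_closure k S f \<longleftrightarrow>
     Ck_on k S f \<and> continuous_on (closure S) f \<and>
     (\<forall>bs. set bs \<subseteq> Basis \<and> length bs \<le> k \<longrightarrow>
        (\<exists>g. continuous_on (closure S) g \<and> (\<forall>x\<in>S. g x = iter_partial bs f x)))"

text \<open>The gradient on the closure of \<open>S\<close>. Values of \<open>f\<close> outside \<open>S\<close> play no role, so that at
  boundary points this is the continuous extension of the gradient, which exists
  for \<open>f\<close> in \<open>C\<^sup>1\<close> of the closure.\<close>

definition grad_ext :: "'a::euclidean_space set \<Rightarrow> ('a \<Rightarrow> real) \<Rightarrow> 'a \<Rightarrow> 'a" where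
  "grad_ext S f x = Lim (at x within S) (grad f)"

lemma GDERIV_grad:
  assumes "f differentiable (at x)"
  shows "GDERIV f x :> grad f x"
proof -
  let ?D = "frechet_derivative f (at x)"
  have D: "(f has_derivative ?D) (at x)"
    using assms frechet_derivative_works by blast
  then have "linear ?D" by (rule has_derivative_linear)
  then have "?D h = h \<bullet> grad f x" for h
    by (subst euclidean_representation[of h, symmetric], subst linear_sum, assumption)
       (simp add: linear_scale grad_def partial_deriv_def inner_sum_right inner_commute mult.commute)
  then have "?D = (\<lambda>h. h \<bullet> grad f x)" by blast
  with D show ?thesis by (simp add: gderiv_def)
qed

lemma grad_ext_eqI:
  assumes "continuous_on (closure S) g" "\<And>y. y \<in> S \<Longrightarrow> g y = grad f y"
    and "open S" "x \<in> closure S"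
  shows "grad_ext S f x = g x"
proof -
  have nt: "at x within S \<noteq> bot"
    using islimpt_closure_open[OF \<open>open S\<close> refl \<open>x \<in> closure S\<close>] by (simp add: trivial_limit_within limpt_of_closure)
  have "(g \<longlongrightarrow> g x) (at x within closure S)"
    using assms(1,4) by (simp add: continuous_on_def)
  then have "(g \<longlongrightarrow> g x) (at x within S)"
    using closure_subset by (rule tendsto_within_subset)
  then have "(grad f \<longlongrightarrow> g x) (at x within S)"
    by (rule Lim_transform_eventually) (simp add: eventually_at_filter assms(2))
  then show ?thesis
    unfolding grad_ext_def by (rule tendsto_Lim[OF nt])
qed

section \<open>Norms\<close>

definition C0_norm :: "'a set \<Rightarrow> ('a \<Rightarrow> 'b::real_normed_vector) \<Rightarrow> real" where
  "C0_norm A g = (SUP x\<in>A. norm (g x))"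

definition C1_norm :: "'a::euclidean_space set \<Rightarrow> ('a \<Rightarrow> real) \<Rightarrow> real" where
  "C1_norm \<Omega> \<psi> = C0_norm (closure \<Omega>) \<psi> + C0_norm (closure \<Omega>) (grad_ext \<Omega> \<psi>)"

section \<open>Domains\<close>

definition bounded_domain :: "'a::euclidean_space set \<Rightarrow> bool" where
  "bounded_domain \<Omega> \<longleftrightarrow> open \<Omega> \<and> connected \<Omega> \<and> \<Omega> \<noteq> {} \<and> bounded \<Omega>"

text \<open>Near each boundary point, \<open>\<Omega>\<close> is the region above the graph of a \<open>C\<^sup>k\<close> function of the
  variables orthogonal to some unit vector \<open>e\<close>. Only the values of \<open>\<phi>\<close> on the hyperplane
  orthogonal to \<open>e\<close> matter.\<close>

definition Ck_boundary :: "nat \<Rightarrow> 'a::euclidean_space set \<Rightarrow> bool" where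
  "Ck_boundary k \<Omega> \<longleftrightarrow>
     (\<forall>x\<^sub>0\<in>frontier \<Omega>. \<exists>r>0. \<exists>e \<phi>. norm e = 1 \<and> Ck_on k UNIV \<phi> \<and>
        \<Omega> \<inter> ball x\<^sub>0 r = {x \<in> ball x\<^sub>0 r. x \<bullet> e > \<phi> (x - (x \<bullet> e) *\<^sub>R e)})"

text \<open>A unit vector orthogonal to the velocities of all curves in the boundary through \<open>x\<close>,
  and pointing into \<open>\<Omega>\<close>.\<close>

definition inward_unit_normal :: "'a::euclidean_space set \<Rightarrow> 'a \<Rightarrow> 'a \<Rightarrow> bool" where
  "inward_unit_normal \<Omega> x \<nu> \<longleftrightarrow>
     norm \<nu> = 1 \<and>
     (\<forall>c w. c 0 = x \<and> (\<forall>t::real. c t \<in> frontier \<Omega>) \<and> (c has_vector_derivative w) (at 0)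
        \<longrightarrow> w \<bullet> \<nu> = 0) \<and>
     (\<exists>\<epsilon>>0. \<forall>t. 0 < t \<and> t < \<epsilon> \<longrightarrow> x + t *\<^sub>R \<nu> \<in> \<Omega>)"

definition near_boundary :: "'a::euclidean_space set \<Rightarrow> real \<Rightarrow> 'a set" where
  "near_boundary \<Omega> \<mu> = {x \<in> \<Omega>. infdist x (frontier \<Omega>) < \<mu>}"

section \<open>The capillary problem\<close>

text \<open>\<open>f\<close> is \<open>C\<^sup>1\<close> on the closure of \<open>\<Omega> \<times> (-M\<^sub>0, M\<^sub>0)\<close>. The gradient of \<open>f\<close> at \<open>(x, z)\<close> is the pair
  of \<open>f\<^sub>x\<close> and \<open>f\<^sub>z\<close>.\<close>

definition admissible_rhs ::
    "'a::euclidean_space set \<Rightarrow> real \<Rightarrow> real \<Rightarrow> ('a \<times> real \<Rightarrow> real) \<Rightarrow> bool" where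
  "admissible_rhs \<Omega> M\<^sub>0 L\<^sub>1 f \<longleftrightarrow>
     (let Q = \<Omega> \<times> {-M\<^sub>0<..<M\<^sub>0} in
      Ck_closure 1 Q f \<and>
      (\<forall>x\<in>closure \<Omega>. \<forall>z\<in>{-M\<^sub>0..M\<^sub>0}.
         snd (grad_ext Q f (x, z)) \<ge> 0 \<and>
         \<bar>f (x, z)\<bar> + norm (fst (grad_ext Q f (x, z))) \<le> L\<^sub>1))"

definition mean_curvature_eq ::
    "'a::euclidean_space set \<Rightarrow> ('a \<times> real \<Rightarrow> real) \<Rightarrow> ('a \<Rightarrow> real) \<Rightarrow> bool" where
  "mean_curvature_eq \<Omega> f u \<longleftrightarrow>
     (\<forall>x\<in>\<Omega>. divergence (\<lambda>y. grad u y /\<^sub>R sqrt (1 + (norm (grad u y))\<^sup>2)) x = f (x, u x))"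

definition capillary_bc ::
    "'a::euclidean_space set \<Rightarrow> ('a \<Rightarrow> 'a) \<Rightarrow> ('a \<Rightarrow> real) \<Rightarrow> ('a \<Rightarrow> real) \<Rightarrow> bool" where
  "capillary_bc \<Omega> \<gamma> \<psi> u \<longleftrightarrow>
     (\<forall>x\<in>frontier \<Omega>.
        (grad_ext \<Omega> u x \<bullet> \<gamma> x) / sqrt (1 + (norm (grad_ext \<Omega> u x))\<^sup>2) + \<psi> x = 0)"

text \<open>\<open>M\<^sub>1 \<delta> M\<^sub>0 L\<^sub>1\<close> is a constant for the interior gradient estimate in the space \<open>'a\<close>, valid on all
  subdomains at distance \<open>\<delta>\<close> from the boundary of any bounded domain. It does not depend on the
  domain.\<close>

definition interior_gradient_estimate ::
    "'a::euclidean_space itself \<Rightarrow> (real \<Rightarrow> real \<Rightarrow> real \<Rightarrow> real) \<Rightarrow> bool" where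
  "interior_gradient_estimate _ M\<^sub>1 \<longleftrightarrow>
     (\<forall>(\<Omega> :: 'a set) M\<^sub>0 L\<^sub>1 f u.
        bounded_domain \<Omega> \<and> 0 < M\<^sub>0 \<and> 0 < L\<^sub>1 \<and> admissible_rhs \<Omega> M\<^sub>0 L\<^sub>1 f \<and>
        Ck_on 3 \<Omega> u \<and> (\<forall>x\<in>\<Omega>. \<bar>u x\<bar> \<le> M\<^sub>0) \<and> mean_curvature_eq \<Omega> f u \<longrightarrow>
        (\<forall>\<Omega>'. bounded_domain \<Omega>' \<and> closure \<Omega>' \<subseteq> \<Omega> \<longrightarrow>
           (\<forall>x\<in>\<Omega>'. norm (grad u x) \<le> M\<^sub>1 (setdist \<Omega>' (frontier \<Omega>)) M\<^sub>0 L\<^sub>1)))"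

end

theory Submission
  imports Defs
begin

text \<open>Both estimates follow from the maximum principle. Let \<open>v = sqrt (1 + |Du|\<^sup>2)\<close>, let \<open>B\<close> be the second
  fundamental form of the graph and \<open>\<theta> = Du \<bullet> \<gamma>\<close>. At an interior maximum of \<open>ln v + \<Psi>\<close> the differentiated
  equation bounds \<open>|B|\<^sup>2\<close> plus the Laplacian of \<open>exp \<Psi>\<close> on the graph, divided by \<open>exp \<Psi>\<close>, by a constant; with
  Korevaar's cutoff \<open>exp \<Psi> = exp (K \<phi>) - 1\<close>, \<open>\<phi> = 1 + u / (2 M\<^sub>0) - 2 |x - x\<^sub>0|\<^sup>2 / r\<^sup>2\<close>, this bounds \<open>v\<close>.

  Near the boundary, \<open>v\<close> is replaced by the length \<open>sqrt (v\<^sup>2 - \<theta>\<^sup>2)\<close> of the tangential part of \<open>(Du, -1)\<close>.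
  Differentiating the boundary condition along the boundary shows that its conormal derivative is of
  lower order, and no second derivatives of \<open>\<psi>\<close> enter. As this quantity does not control \<open>v\<close> where \<open>|\<theta>|\<close> is
  close to \<open>v\<close>, it is continued there by its tangents \<open>v - q\<^sup>2 |\<theta>|\<close>. With \<open>\<beta> u + \<alpha> rt\<close> added to its logarithm, a
  large \<open>\<alpha>\<close> excludes maxima on the boundary, and \<open>\<beta>\<close> much larger than \<open>\<alpha>\<close> excludes interior maxima with large \<open>v\<close>.
  In the tangential case the quadratic form in \<open>B\<close> degenerates in one direction, and the bound on the mean
  curvature supplies the missing coefficient.\<close>

section \<open>Functions with continuous partial derivatives\<close>

text \<open>The constants are fixed in an order that avoids a circle. The cut q^2 = (1 + b_0) / 2
  lies above b_0, so every boundary point falls in the regime of the tangential length. There the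
  conormal derivative of u is of order 1 / v; as long as \<beta> \<le> v, the term \<beta> u costs
  at most 1 on the boundary, and \<alpha> can be chosen without knowing \<beta>. In the interior all
  errors are at most a multiple of (1 + \<alpha>)^2 (1 + N + \<beta>), where N is the norm of B,
  against a positive multiple of N^2 + \<beta>^2; hence \<beta> can be chosen in terms of \<alpha>.
  The two regimes need no matching of second derivatives. The continued function lies above the
  tangential length and equals it where |\<theta>| \<le> q^2 v, so a maximum of the former at such a
  point is a local maximum of the latter. Beyond the cut the function is locally affine in v and
  \<theta>, and the concavity that makes the tangential form degenerate is absent. The price is a
  cross term of order \<beta> N, which is absorbed by a sharp bound for the entries of a symmetric
  map.\<close>

lemma GDERIV_imp_grad_eq:
  assumes "GDERIV f x :> D"
  shows "grad f x = D"
proof -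
  have "frechet_derivative f (at x) = (\<lambda>h. h \<bullet> D)"
    using assms unfolding gderiv_def by (rule frechet_derivative_at[symmetric])
  then show ?thesis
    by (simp add: grad_def partial_deriv_def inner_commute[of _ D] euclidean_representation)
qed

lemma GDERIV_imp_differentiable:
  "GDERIV f x :> D \<Longrightarrow> f differentiable (at x)"
  unfolding gderiv_def differentiable_def by blast

lemma partial_deriv_eq_grad:
  assumes "b \<in> Basis"
  shows "partial_deriv b f x = grad f x \<bullet> b"
  using assms unfolding grad_def
  by (simp add: inner_sum_left inner_Basis if_distrib sum.delta cong: if_cong)

lemma GDERIV_cong_open:
  assumes "open S" "x \<in> S" "\<And>y. y \<in> S \<Longrightarrow> f y = g y" "GDERIV f x :> D"
  shows "GDERIV g x :> D"
  using assms(4) unfolding gderiv_def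
  by (rule has_derivative_transform_within_open[OF _ assms(1,2,3)])

lemma grad_cong_open:
  assumes "open S" "x \<in> S" "\<And>y. y \<in> S \<Longrightarrow> f y = g y" "f differentiable (at x)"
  shows "grad f x = grad g x"
  using GDERIV_imp_grad_eq[OF GDERIV_cong_open[OF assms(1-3) GDERIV_grad[OF assms(4)]]] ..

lemma GDERIV_sum:
  assumes "\<And>i. i \<in> I \<Longrightarrow> GDERIV (f i) x :> D i"
  shows "GDERIV (\<lambda>y. \<Sum>i\<in>I. f i y) x :> (\<Sum>i\<in>I. D i)"
  using assms unfolding gderiv_def inner_sum_right by (rule has_derivative_sum)

section \<open>Recursive description and closure properties of C^k\<close>

lemma Ck_on_0: "Ck_on 0 S f \<longleftrightarrow> continuous_on S f"
  by (simp add: Ck_on_def iter_partial_def)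

text \<open>As \<open>foldr\<close> applies the last entry of the list first, splitting at the end
  of the list exposes the innermost derivative.\<close>

lemma iter_partial_snoc: "iter_partial (bs @ [b]) f = iter_partial bs (partial_deriv b f)"
  by (simp add: iter_partial_def)

text \<open>The recursion behind the closure properties: later inductions on k see only first
  partial derivatives and need not treat lists of directions.\<close>

lemma Ck_on_Suc:
  "Ck_on (Suc k) S f \<longleftrightarrow>
     (\<forall>x\<in>S. f differentiable (at x)) \<and> (\<forall>b\<in>Basis. Ck_on k S (partial_deriv b f))"
    (is "?l \<longleftrightarrow> ?r")
proof
  assume l: ?l
  have "f differentiable (at x)" if "x \<in> S" for x
    using l that unfolding Ck_on_def iter_partial_def
    by (metis empty_subsetI foldr.simps(1) id_apply list.set(1) list.size(3) zero_less_Suc)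
  moreover have "Ck_on k S (partial_deriv b f)" if "b \<in> Basis" for b
    unfolding Ck_on_def
  proof (intro conjI allI impI)
    fix bs :: "'a list" assume "set bs \<subseteq> Basis \<and> length bs < k"
    then have "set (bs @ [b]) \<subseteq> Basis \<and> length (bs @ [b]) < Suc k" using that by auto
    then show "\<forall>x\<in>S. iter_partial bs (partial_deriv b f) differentiable (at x)"
      using l unfolding Ck_on_def iter_partial_snoc[symmetric] by blast
  next
    fix bs :: "'a list" assume "set bs \<subseteq> Basis \<and> length bs \<le> k"
    then have "set (bs @ [b]) \<subseteq> Basis \<and> length (bs @ [b]) \<le> Suc k" using that by auto
    then show "continuous_on S (iter_partial bs (partial_deriv b f))"
      using l unfolding Ck_on_def iter_partial_snoc[symmetric] by blast
  qed
  ultimately show ?r by blast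
next
  assume r: ?r
  show ?l
    unfolding Ck_on_def
  proof (intro conjI allI impI)
    fix bs :: "'a list" assume bs: "set bs \<subseteq> Basis \<and> length bs < Suc k"
    show "\<forall>x\<in>S. iter_partial bs f differentiable (at x)"
    proof (cases bs rule: rev_cases)
      case Nil then show ?thesis using r by (simp add: iter_partial_def)
    next
      case (snoc cs b)
      then show ?thesis using bs r unfolding snoc iter_partial_snoc Ck_on_def by simp
    qed
  next
    fix bs :: "'a list" assume bs: "set bs \<subseteq> Basis \<and> length bs \<le> Suc k"
    show "continuous_on S (iter_partial bs f)"
    proof (cases bs rule: rev_cases)
      case Nil then show ?thesis
        using r by (auto simp: iter_partial_def intro!: continuous_at_imp_continuous_on
            differentiable_imp_continuous_within)
    next
      case (snoc cs b)
      then show ?thesis using bs r unfolding snoc iter_partial_snoc Ck_on_def by simp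
    qed
  qed
qed

lemma Ck_on_cong:
  assumes "open S" "\<And>x. x \<in> S \<Longrightarrow> f x = g x" "Ck_on k S f"
  shows "Ck_on k S g"
  using assms(2,3)
proof (induction k arbitrary: f g)
  case 0
  then show ?case by (metis Ck_on_0 continuous_on_cong)
next
  case (Suc k)
  have d: "f differentiable (at x)" if "x \<in> S" for x using Suc.prems(2) that by (simp add: Ck_on_Suc)
  have d': "g differentiable (at x)" if "x \<in> S" for x
    using GDERIV_imp_differentiable[OF GDERIV_cong_open[OF assms(1) that Suc.prems(1) GDERIV_grad[OF d[OF that]]]] .
  have "Ck_on k S (partial_deriv b g)" if b: "b \<in> Basis" for b
  proof (rule Suc.IH)
    show "Ck_on k S (partial_deriv b f)" using Suc.prems(2) b by (simp add: Ck_on_Suc)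
    show "partial_deriv b f x = partial_deriv b g x" if "x \<in> S" for x
      using b partial_deriv_eq_grad[OF b, of f x] partial_deriv_eq_grad[OF b, of g x]
        grad_cong_open[OF assms(1) that Suc.prems(1) d[OF that]] by simp
  qed
  with d' show ?case by (simp add: Ck_on_Suc)
qed

lemma Ck_on_SucI:
  assumes "open S" "\<And>x. x \<in> S \<Longrightarrow> GDERIV f x :> G x" "\<And>b. b \<in> Basis \<Longrightarrow> Ck_on k S (\<lambda>x. G x \<bullet> b)"
  shows "Ck_on (Suc k) S f"
  unfolding Ck_on_Suc
proof (intro conjI ballI)
  fix x assume "x \<in> S" then show "f differentiable (at x)" using assms(2) GDERIV_imp_differentiable by blast
next
  fix b :: 'a assume b: "b \<in> Basis"
  show "Ck_on k S (partial_deriv b f)"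
    by (rule Ck_on_cong[OF assms(1) _ assms(3)[OF b]])
      (metis GDERIV_imp_grad_eq assms(2) b partial_deriv_eq_grad)
qed

lemma Ck_on_GDERIV: "Ck_on (Suc k) S f \<Longrightarrow> x \<in> S \<Longrightarrow> GDERIV f x :> grad f x"
  by (simp add: Ck_on_Suc GDERIV_grad)

lemma Ck_on_partial: "Ck_on (Suc k) S f \<Longrightarrow> b \<in> Basis \<Longrightarrow> Ck_on k S (partial_deriv b f)"
  by (simp add: Ck_on_Suc)

lemma Ck_on_grad_inner:
  assumes "Ck_on (Suc k) S f" "b \<in> Basis" "open S"
  shows "Ck_on k S (\<lambda>x. grad f x \<bullet> b)"
  by (rule Ck_on_cong[OF assms(3) _ Ck_on_partial[OF assms(1,2)]])
    (use assms(2) in \<open>auto simp: partial_deriv_eq_grad\<close>)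

lemma Ck_on_imp_continuous: "Ck_on k S f \<Longrightarrow> continuous_on S f"
  unfolding Ck_on_def iter_partial_def
  by (metis empty_subsetI foldr.simps(1) id_apply le0 list.set(1) list.size(3))

lemma Ck_on_mono: "Ck_on k S f \<Longrightarrow> j \<le> k \<Longrightarrow> Ck_on j S f"
  unfolding Ck_on_def by auto

lemma Ck_on_subset: "Ck_on k S f \<Longrightarrow> T \<subseteq> S \<Longrightarrow> Ck_on k T f"
  unfolding Ck_on_def by (meson continuous_on_subset subset_iff)

lemma Ck_on_const: "open S \<Longrightarrow> Ck_on k S (\<lambda>x. c)"
proof (induction k arbitrary: c)
  case 0 show ?case by (simp add: Ck_on_0)
next
  case (Suc k)
  show ?case
    by (rule Ck_on_SucI[where G="\<lambda>x. 0"]) (use Suc in \<open>auto intro: GDERIV_const\<close>)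
qed

lemma Ck_on_inner: "open S \<Longrightarrow> Ck_on k S (\<lambda>x. x \<bullet> e)"
proof (cases k)
  case 0 then show ?thesis by (simp add: Ck_on_0 continuous_intros)
next
  case (Suc j)
  assume "open S"
  then show ?thesis unfolding Suc
    by (intro Ck_on_SucI[where G="\<lambda>x. e"])
      (auto simp: gderiv_def intro!: Ck_on_const bounded_linear_imp_has_derivative bounded_linear_inner_left)
qed

lemma Ck_on_add: "open S \<Longrightarrow> Ck_on k S f \<Longrightarrow> Ck_on k S g \<Longrightarrow> Ck_on k S (\<lambda>x. f x + g x)"
proof (induction k arbitrary: f g)
  case 0 then show ?case by (simp add: Ck_on_0 continuous_on_add)
next
  case (Suc k)
  show ?case
    by (rule Ck_on_SucI[where G="\<lambda>x. grad f x + grad g x"])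
      (use Suc in \<open>auto simp: inner_add_left intro: GDERIV_add Ck_on_GDERIV Ck_on_grad_inner\<close>)
qed

lemma Ck_on_mult: "open S \<Longrightarrow> Ck_on k S f \<Longrightarrow> Ck_on k S g \<Longrightarrow> Ck_on k S (\<lambda>x. f x * g x)"
proof (induction k arbitrary: f g)
  case 0 then show ?case by (simp add: Ck_on_0 continuous_on_mult)
next
  case (Suc k)
  have m: "Ck_on k S f" "Ck_on k S g" by (auto intro: Ck_on_mono[OF Suc.prems(2)] Ck_on_mono[OF Suc.prems(3)])
  show ?case
  proof (rule Ck_on_SucI[where G="\<lambda>x. f x *\<^sub>R grad g x + g x *\<^sub>R grad f x"])
    fix x assume "x \<in> S"
    then show "GDERIV (\<lambda>x. f x * g x) x :> f x *\<^sub>R grad g x + g x *\<^sub>R grad f x"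
      by (intro GDERIV_mult Ck_on_GDERIV[OF Suc.prems(2)] Ck_on_GDERIV[OF Suc.prems(3)])
  next
    fix b :: 'a assume b: "b \<in> Basis"
    show "Ck_on k S (\<lambda>x. (f x *\<^sub>R grad g x + g x *\<^sub>R grad f x) \<bullet> b)"
      unfolding inner_add_left inner_scaleR_left
      by (intro Ck_on_add Suc.IH m Ck_on_grad_inner[OF Suc.prems(2) b] Ck_on_grad_inner[OF Suc.prems(3) b] Suc.prems(1))
  qed (rule Suc.prems(1))
qed

lemma Ck_on_cmult: "open S \<Longrightarrow> Ck_on k S f \<Longrightarrow> Ck_on k S (\<lambda>x. c * f x)"
  by (intro Ck_on_mult Ck_on_const)

lemma Ck_on_diff: "open S \<Longrightarrow> Ck_on k S f \<Longrightarrow> Ck_on k S g \<Longrightarrow> Ck_on k S (\<lambda>x. f x - g x)"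
  using Ck_on_add[of S k f "\<lambda>x. (-1) * g x"] Ck_on_cmult[of S k g "-1"] by simp

lemma Ck_on_sum:
  "open S \<Longrightarrow> (\<And>i. i \<in> I \<Longrightarrow> Ck_on k S (f i)) \<Longrightarrow> Ck_on k S (\<lambda>x. \<Sum>i\<in>I. f i x)"
  by (induction I rule: infinite_finite_induct) (auto intro: Ck_on_add Ck_on_const)

lemma Ck_on_inverse:
  "open S \<Longrightarrow> Ck_on k S f \<Longrightarrow> (\<And>x. x \<in> S \<Longrightarrow> f x \<noteq> 0) \<Longrightarrow> Ck_on k S (\<lambda>x. inverse (f x))"
proof (induction k)
  case 0 then show ?case by (simp add: Ck_on_0 continuous_on_inverse)
next
  case (Suc k)
  have m: "Ck_on k S (\<lambda>x. inverse (f x))" using Suc.prems by (intro Suc.IH) (auto intro: Ck_on_mono[OF Suc.prems(2)])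
  show ?case
  proof (rule Ck_on_SucI[where G="\<lambda>x. - (inverse (f x))\<^sup>2 *\<^sub>R grad f x"])
    fix x assume "x \<in> S"
    then show "GDERIV (\<lambda>x. inverse (f x)) x :> - (inverse (f x))\<^sup>2 *\<^sub>R grad f x"
      by (intro GDERIV_inverse Ck_on_GDERIV[OF Suc.prems(2)] Suc.prems(3))
  next
    fix b :: 'a assume b: "b \<in> Basis"
    have "Ck_on k S (\<lambda>x. (-1) * (inverse (f x) * (inverse (f x) * (grad f x \<bullet> b))))"
      by (intro Ck_on_cmult Ck_on_mult m Ck_on_grad_inner[OF Suc.prems(2) b] Suc.prems(1))
    then show "Ck_on k S (\<lambda>x. - (inverse (f x))\<^sup>2 *\<^sub>R grad f x \<bullet> b)"
      by (simp add: power2_eq_square mult.assoc)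
  qed (rule Suc.prems(1))
qed

lemma Ck_on_sqrt:
  "open S \<Longrightarrow> Ck_on k S f \<Longrightarrow> (\<And>x. x \<in> S \<Longrightarrow> f x > 0) \<Longrightarrow> Ck_on k S (\<lambda>x. sqrt (f x))"
proof (induction k)
  case 0 then show ?case by (simp add: Ck_on_0 continuous_on_real_sqrt)
next
  case (Suc k)
  have m: "Ck_on k S (\<lambda>x. sqrt (f x))" using Suc.prems by (intro Suc.IH) (auto intro: Ck_on_mono[OF Suc.prems(2)])
  have sq: "sqrt (f x) \<noteq> 0" if "x \<in> S" for x using Suc.prems(3)[OF that] by simp
  show ?case
  proof (rule Ck_on_SucI[where G="\<lambda>x. (inverse (sqrt (f x)) / 2) *\<^sub>R grad f x"])
    fix x assume "x \<in> S"
    then show "GDERIV (\<lambda>x. sqrt (f x)) x :> (inverse (sqrt (f x)) / 2) *\<^sub>R grad f x"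
      by (intro GDERIV_DERIV_compose[OF Ck_on_GDERIV[OF Suc.prems(2)] DERIV_real_sqrt] Suc.prems(3))
  next
    fix b :: 'a assume "b \<in> Basis"
    then have "Ck_on k S (\<lambda>x. (1/2) * (inverse (sqrt (f x)) * (grad f x \<bullet> b)))"
      by (intro Ck_on_cmult Ck_on_mult Ck_on_inverse Ck_on_grad_inner[OF Suc.prems(2)] m sq Suc.prems(1))
    then show "Ck_on k S (\<lambda>x. (inverse (sqrt (f x)) / 2) *\<^sub>R grad f x \<bullet> b)"
      by simp
  qed (rule Suc.prems(1))
qed

text \<open>Truncated powers with exponent k + 1 are of class C^k and serve as profiles of bump
  functions. At zero the difference quotient is \<open>max 0 h * max 0 h ^ j\<close>, so an exponent
  of at least two is required.\<close>

lemma DERIV_max0_power: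
  "((\<lambda>t::real. (max 0 t) ^ Suc (Suc j)) has_real_derivative (real (Suc (Suc j)) * (max 0 t) ^ Suc j)) (at t)"
proof (cases "t = 0")
  case False
  show ?thesis
  proof (cases "t > 0")
    case True
    have "((\<lambda>t::real. t ^ Suc (Suc j)) has_real_derivative (real (Suc (Suc j)) * t ^ Suc j)) (at t)"
      using DERIV_pow[of "Suc (Suc j)" t] by simp
    then have "((\<lambda>t::real. (max 0 t) ^ Suc (Suc j)) has_real_derivative (real (Suc (Suc j)) * t ^ Suc j)) (at t)"
      by (rule has_field_derivative_transform_within_open[where S="{0<..}"]) (use True in auto)
    then show ?thesis using True by simp
  next
    case f: False
    have "((\<lambda>t::real. 0) has_real_derivative 0) (at t)" by simp
    then have "((\<lambda>t::real. (max 0 t) ^ Suc (Suc j)) has_real_derivative 0) (at t)"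
      by (rule has_field_derivative_transform_within_open[where S="{..<0}"]) (use f False in auto)
    then show ?thesis using f by simp
  qed
next
  case True
  have "((\<lambda>h::real. max 0 h * max 0 h ^ j) \<longlongrightarrow> max 0 0 * max 0 0 ^ j) (at 0)"
    by (intro tendsto_intros)
  moreover have "max 0 h * max 0 h ^ j = (max 0 h ^ Suc (Suc j) - max 0 0 ^ Suc (Suc j)) / h" if "h \<noteq> 0" for h :: real
    using that by (simp add: max_def)
  ultimately have "((\<lambda>h::real. (max 0 h ^ Suc (Suc j) - max 0 0 ^ Suc (Suc j)) / h) \<longlongrightarrow> 0) (at 0)"
    by (auto intro: Lim_transform_eventually simp: eventually_at_filter)
  then show ?thesis unfolding True has_field_derivative_iff by simp
qed

lemma Ck_on_max0_power:
  "open S \<Longrightarrow> Ck_on k S f \<Longrightarrow> Ck_on k S (\<lambda>x. (max 0 (f x)) ^ Suc k)"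
proof (induction k)
  case 0 then show ?case by (simp add: Ck_on_0 continuous_intros)
next
  case (Suc k)
  have m: "Ck_on k S (\<lambda>x. (max 0 (f x)) ^ Suc k)" using Suc.prems by (intro Suc.IH) (auto intro: Ck_on_mono[OF Suc.prems(2)])
  show ?case
  proof (rule Ck_on_SucI[where G="\<lambda>x. (real (Suc (Suc k)) * (max 0 (f x)) ^ Suc k) *\<^sub>R grad f x"])
    fix x assume "x \<in> S"
    then show "GDERIV (\<lambda>x. (max 0 (f x)) ^ Suc (Suc k)) x :> (real (Suc (Suc k)) * (max 0 (f x)) ^ Suc k) *\<^sub>R grad f x"
      by (intro GDERIV_DERIV_compose[OF Ck_on_GDERIV[OF Suc.prems(2)] DERIV_max0_power])
  next
    fix b :: 'a assume b: "b \<in> Basis"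
    have "Ck_on k S (\<lambda>x. real (Suc (Suc k)) * ((max 0 (f x)) ^ Suc k * (grad f x \<bullet> b)))"
      by (intro Ck_on_cmult Ck_on_mult m Ck_on_grad_inner[OF Suc.prems(2) b] Suc.prems(1))
    then show "Ck_on k S (\<lambda>x. (real (Suc (Suc k)) * (max 0 (f x)) ^ Suc k) *\<^sub>R grad f x \<bullet> b)"
      by (simp add: mult.assoc)
  qed (rule Suc.prems(1))
qed

text \<open>For self-adjoint P the gradient of f o P is P applied to the gradient of f at P x; its
  components are fixed linear combinations of functions of the same form, so the induction closes.
  It is applied to the orthogonal projection onto the hyperplane over which the boundary is a
  graph.\<close>

lemma Ck_on_compose_linear:
  fixes P :: "'a::euclidean_space \<Rightarrow> 'a"
  assumes P: "linear P" "\<And>x y. P x \<bullet> y = x \<bullet> P y"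
  shows "Ck_on k UNIV f \<Longrightarrow> Ck_on k UNIV (\<lambda>x. f (P x))"
proof (induction k arbitrary: f)
  case 0 then show ?case
    by (simp add: Ck_on_0) (intro continuous_on_compose2[OF _ linear_continuous_on[OF linear_conv_bounded_linear[THEN iffD1, OF P(1)]]], auto)
next
  case (Suc k)
  show ?case
  proof (rule Ck_on_SucI[where G="\<lambda>x. P (grad f (P x))"])
    fix x
    have 1: "(f has_derivative (\<lambda>h. h \<bullet> grad f (P x))) (at (P x))"
      using Ck_on_GDERIV[OF Suc.prems, of "P x"] by (simp add: gderiv_def)
    have "(P has_derivative P) (at x)"
      using P(1) by (simp add: linear_conv_bounded_linear bounded_linear_imp_has_derivative)
    from has_derivative_compose[OF this 1]
    show "GDERIV (\<lambda>x. f (P x)) x :> P (grad f (P x))"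
      by (simp add: gderiv_def P(2))
  next
    fix b :: 'a assume b: "b \<in> Basis"
    have "P (grad f (P x)) \<bullet> b = (\<Sum>c\<in>Basis. (P b \<bullet> c) * (grad f (P x) \<bullet> c))" for x
      by (simp add: P(2) euclidean_inner[of "grad f (P x)" "P b"] mult.commute)
    moreover have "Ck_on k UNIV (\<lambda>x. \<Sum>c\<in>Basis. (P b \<bullet> c) * (grad f (P x) \<bullet> c))"
      by (intro Ck_on_sum Ck_on_cmult Suc.IH[of "\<lambda>x. grad f x \<bullet> _"] Ck_on_grad_inner[OF Suc.prems]) auto
    ultimately show "Ck_on k UNIV (\<lambda>x. P (grad f (P x)) \<bullet> b)" by simp
  qed auto
qed

section \<open>Restriction to lines and symmetry of the second partial derivatives\<close>

lemma GDERIV_line: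
  assumes "GDERIV f (x + t *\<^sub>R e) :> D"
  shows "((\<lambda>t. f (x + t *\<^sub>R e)) has_real_derivative (D \<bullet> e)) (at t)"
proof -
  have "((\<lambda>t. x + t *\<^sub>R e) has_derivative (\<lambda>h. h *\<^sub>R e)) (at t)"
    by (auto intro!: derivative_eq_intros)
  from has_derivative_compose[OF this] assms[unfolded gderiv_def]
  have "((\<lambda>t. f (x + t *\<^sub>R e)) has_derivative (\<lambda>h. (h *\<^sub>R e) \<bullet> D)) (at t)" by blast
  then show ?thesis by (simp add: has_field_derivative_def mult_commute_abs inner_commute mult.commute)
qed

text \<open>The mean value theorem is used twice: in direction b for the increment of f over a step
  along c, then in direction c for the first partial derivative. The left side is symmetric in b and
  c while the right side is not, which yields the equality of mixed derivatives as t tends to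
  zero.\<close>

lemma second_difference_mvt:
  fixes x :: "'a::euclidean_space"
  assumes "Ck_on 2 (ball x r) f" "b \<in> Basis" "c \<in> Basis" "0 < t" "2 * t < r"
  obtains y where "dist x y \<le> 2 * t"
    "f (x + t *\<^sub>R b + t *\<^sub>R c) - f (x + t *\<^sub>R b) - f (x + t *\<^sub>R c) + f x = t\<^sup>2 * partial_deriv c (partial_deriv b f) y"
proof -
  have C1: "Ck_on 1 (ball x r) (partial_deriv b f)"
    using Ck_on_partial[of 1 "ball x r" f b] assms(1,2) by (simp add: numeral_2_eq_2)
  have nb: "norm (s *\<^sub>R b + s' *\<^sub>R c) \<le> 2 * t" if "0 \<le> s" "s \<le> t" "0 \<le> s'" "s' \<le> t" for s s'
    using norm_triangle_ineq[of "s *\<^sub>R b" "s' *\<^sub>R c"] assms(2,3) that by (simp add: norm_Basis)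
  have inb: "x + s *\<^sub>R b + s' *\<^sub>R c \<in> ball x r" if "0 \<le> s" "s \<le> t" "0 \<le> s'" "s' \<le> t" for s s'
  proof -
    have "dist x (x + (s *\<^sub>R b + s' *\<^sub>R c)) = norm (s *\<^sub>R b + s' *\<^sub>R c)"
      unfolding dist_norm by (metis add_diff_cancel_left' norm_minus_commute)
    then show ?thesis using nb[OF that] assms(5) by (simp add: add.assoc)
  qed
  have d0: "f differentiable (at z)" if "z \<in> ball x r" for z
    using assms(1) that by (simp add: numeral_2_eq_2 Ck_on_Suc)
  have d1: "((\<lambda>s. f (x + s *\<^sub>R b + s' *\<^sub>R c)) has_real_derivative partial_deriv b f (x + s *\<^sub>R b + s' *\<^sub>R c)) (at s)"
    if "0 \<le> s" "s \<le> t" "0 \<le> s'" "s' \<le> t" for s s'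
  proof -
    have "GDERIV f ((x + s' *\<^sub>R c) + s *\<^sub>R b) :> grad f (x + s *\<^sub>R b + s' *\<^sub>R c)"
      using GDERIV_grad[OF d0[OF inb[OF that]]] by (simp add: algebra_simps)
    from GDERIV_line[OF this] show ?thesis
      using partial_deriv_eq_grad[OF assms(2), of f] by (simp add: algebra_simps)
  qed
  have d2: "((\<lambda>s'. partial_deriv b f (x + s *\<^sub>R b + s' *\<^sub>R c)) has_real_derivative partial_deriv c (partial_deriv b f) (x + s *\<^sub>R b + s' *\<^sub>R c)) (at s')"
    if "0 \<le> s" "s \<le> t" "0 \<le> s'" "s' \<le> t" for s s'
  proof -
    have d: "partial_deriv b f differentiable (at (x + s *\<^sub>R b + s' *\<^sub>R c))"
      using C1 inb[OF that] by (simp add: One_nat_def Ck_on_Suc del: One_nat_def)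
        (simp add: Ck_on_Suc)
    from GDERIV_line[OF GDERIV_grad[OF d]] show ?thesis
      using partial_deriv_eq_grad[OF assms(3), of "partial_deriv b f"] by simp
  qed
  define \<phi> where "\<phi> s = f (x + s *\<^sub>R b + t *\<^sub>R c) - f (x + s *\<^sub>R b + 0 *\<^sub>R c)" for s
  have "\<exists>s>0. s < t \<and> \<phi> t - \<phi> 0 = (t - 0) * (partial_deriv b f (x + s *\<^sub>R b + t *\<^sub>R c) - partial_deriv b f (x + s *\<^sub>R b + 0 *\<^sub>R c))"
    by (rule MVT2) (use assms(4) in \<open>auto simp: \<phi>_def intro!: DERIV_diff d1[of _ t] d1[of _ 0, simplified]\<close>)
  then obtain s where s: "0 < s" "s < t" and e1: "\<phi> t - \<phi> 0 = t * (partial_deriv b f (x + s *\<^sub>R b + t *\<^sub>R c) - partial_deriv b f (x + s *\<^sub>R b + 0 *\<^sub>R c))"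
    by auto
  have "\<exists>s'>0. s' < t \<and> partial_deriv b f (x + s *\<^sub>R b + t *\<^sub>R c) - partial_deriv b f (x + s *\<^sub>R b + 0 *\<^sub>R c) = (t - 0) * partial_deriv c (partial_deriv b f) (x + s *\<^sub>R b + s' *\<^sub>R c)"
    by (rule MVT2) (use assms(4) s in \<open>auto intro!: d2\<close>)
  then obtain s' where s': "0 < s'" "s' < t" and e2: "partial_deriv b f (x + s *\<^sub>R b + t *\<^sub>R c) - partial_deriv b f (x + s *\<^sub>R b + 0 *\<^sub>R c) = t * partial_deriv c (partial_deriv b f) (x + s *\<^sub>R b + s' *\<^sub>R c)"
    by auto
  show ?thesis
  proof
    show "dist x (x + s *\<^sub>R b + s' *\<^sub>R c) \<le> 2 * t"
    proof -
      have "dist x (x + (s *\<^sub>R b + s' *\<^sub>R c)) = norm (s *\<^sub>R b + s' *\<^sub>R c)"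
        unfolding dist_norm by (metis add_diff_cancel_left' norm_minus_commute)
      then show ?thesis using nb[of s s'] s s' by (simp add: add.assoc)
    qed
    show "f (x + t *\<^sub>R b + t *\<^sub>R c) - f (x + t *\<^sub>R b) - f (x + t *\<^sub>R c) + f x = t\<^sup>2 * partial_deriv c (partial_deriv b f) (x + s *\<^sub>R b + s' *\<^sub>R c)"
      using e1 e2 by (simp add: \<phi>_def power2_eq_square)
  qed
qed

theorem Ck_on_partial_commute:
  fixes x :: "'a::euclidean_space"
  assumes "open S" "Ck_on 2 S f" "x \<in> S" "b \<in> Basis" "c \<in> Basis"
  shows "partial_deriv b (partial_deriv c f) x = partial_deriv c (partial_deriv b f) x"
proof -
  obtain r where r: "r > 0" "ball x r \<subseteq> S" using assms(1,3) openE by blast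
  note C = Ck_on_subset[OF assms(2) r(2)]
  define t where "t n = r / (3 * real (Suc n))" for n
  have t: "0 < t n" "2 * t n < r" for n
    using r(1) by (auto simp: t_def field_simps intro!: add_pos_nonneg)
  have "\<exists>y. dist x y \<le> 2 * t n \<and>
     f (x + t n *\<^sub>R b + t n *\<^sub>R c) - f (x + t n *\<^sub>R b) - f (x + t n *\<^sub>R c) + f x = (t n)\<^sup>2 * partial_deriv c (partial_deriv b f) y" for n
    using second_difference_mvt[OF C assms(4,5) t] by metis
  then obtain y where y: "\<And>n. dist x (y n) \<le> 2 * t n"
    "\<And>n. f (x + t n *\<^sub>R b + t n *\<^sub>R c) - f (x + t n *\<^sub>R b) - f (x + t n *\<^sub>R c) + f x = (t n)\<^sup>2 * partial_deriv c (partial_deriv b f) (y n)"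
    by metis
  have "\<exists>z. dist x z \<le> 2 * t n \<and>
     f (x + t n *\<^sub>R c + t n *\<^sub>R b) - f (x + t n *\<^sub>R c) - f (x + t n *\<^sub>R b) + f x = (t n)\<^sup>2 * partial_deriv b (partial_deriv c f) z" for n
    using second_difference_mvt[OF C assms(5,4) t] by metis
  then obtain z where z: "\<And>n. dist x (z n) \<le> 2 * t n"
    "\<And>n. f (x + t n *\<^sub>R c + t n *\<^sub>R b) - f (x + t n *\<^sub>R c) - f (x + t n *\<^sub>R b) + f x = (t n)\<^sup>2 * partial_deriv b (partial_deriv c f) (z n)"
    by metis
  have eq: "partial_deriv c (partial_deriv b f) (y n) = partial_deriv b (partial_deriv c f) (z n)" for n
  proof -
    have "(t n)\<^sup>2 * partial_deriv c (partial_deriv b f) (y n) = (t n)\<^sup>2 * partial_deriv b (partial_deriv c f) (z n)"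
      using y(2)[of n] z(2)[of n] by (simp add: algebra_simps)
    then show ?thesis using t(1)[of n] by simp
  qed
  have t0: "(\<lambda>n. 2 * t n) \<longlonglongrightarrow> 0"
  proof -
    have "(\<lambda>n. (2 * r / 3) * (1 / real (Suc n))) \<longlonglongrightarrow> (2 * r / 3) * 0"
      by (intro tendsto_mult_left) (use LIMSEQ_inverse_real_of_nat in \<open>simp add: divide_inverse\<close>)
    then show ?thesis by (simp add: t_def field_simps)
  qed
  have ylim: "w \<longlonglongrightarrow> x" if "\<And>n. dist x (w n) \<le> 2 * t n" for w
    by (rule tendsto_dist_iff[THEN iffD2], rule tendsto_sandwich[OF _ _ tendsto_const t0])
      (use that in \<open>auto simp: dist_commute\<close>)
  have cont: "isCont (partial_deriv b' (partial_deriv c' f)) x" if "b' \<in> Basis" "c' \<in> Basis" for b' c'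
  proof -
    have "Ck_on 0 S (partial_deriv b' (partial_deriv c' f))"
      using assms(2) that by (simp add: numeral_2_eq_2 Ck_on_Suc)
    then show ?thesis using assms(1,3) by (simp add: Ck_on_0 continuous_on_eq_continuous_at)
  qed
  have "(\<lambda>n. partial_deriv c (partial_deriv b f) (y n)) \<longlonglongrightarrow> partial_deriv c (partial_deriv b f) x"
    using isCont_tendsto_compose[OF cont ylim[OF y(1)]] assms(4,5) by simp
  moreover have "(\<lambda>n. partial_deriv b (partial_deriv c f) (z n)) \<longlonglongrightarrow> partial_deriv b (partial_deriv c f) x"
    using isCont_tendsto_compose[OF cont ylim[OF z(1)]] assms(4,5) by simp
  ultimately show ?thesis unfolding eq by (metis LIMSEQ_unique)
qed

section \<open>Second order jets and the mean curvature operator\<close>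

text \<open>Pointwise second order data: the gradient D at x and the derivative X at x of a gradient
  field given near x. Being a relation, it has direct rules for sums, products and compositions, and
  no C^2 statement is needed for a composed function.\<close>

definition jet2 :: "('a::euclidean_space \<Rightarrow> real) \<Rightarrow> 'a \<Rightarrow> 'a \<Rightarrow> ('a \<Rightarrow> 'a) \<Rightarrow> bool" where
  "jet2 g x D X \<longleftrightarrow>
     (\<exists>G. (\<forall>\<^sub>F y in nhds x. GDERIV g y :> G y) \<and> (G has_derivative X) (at x) \<and> G x = D)"

lemma jet2I:
  assumes "open S" "x \<in> S" "\<And>y. y \<in> S \<Longrightarrow> GDERIV g y :> G y" "(G has_derivative X) (at x)" "G x = D"
  shows "jet2 g x D X"
  unfolding jet2_def using assms eventually_nhds by blast

lemma jet2_GDERIV: "jet2 g x D X \<Longrightarrow> GDERIV g x :> D"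
  unfolding jet2_def using eventually_nhds_x_imp_x by blast

lemma jet2_linear: "jet2 g x D X \<Longrightarrow> linear X"
  unfolding jet2_def by (auto dest: has_derivative_linear)

lemma jet2_const: "jet2 (\<lambda>y. c) x 0 (\<lambda>h. 0)"
  unfolding jet2_def by (intro exI[of _ "\<lambda>y. 0"]) (auto simp: GDERIV_const)

lemma jet2_add:
  assumes "jet2 f x D X" "jet2 g x E Y"
  shows "jet2 (\<lambda>y. f y + g y) x (D + E) (\<lambda>h. X h + Y h)"
proof -
  obtain F where F: "\<forall>\<^sub>F y in nhds x. GDERIV f y :> F y" "(F has_derivative X) (at x)" "F x = D"
    using assms(1) unfolding jet2_def by blast
  obtain G where G: "\<forall>\<^sub>F y in nhds x. GDERIV g y :> G y" "(G has_derivative Y) (at x)" "G x = E"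
    using assms(2) unfolding jet2_def by blast
  have "\<forall>\<^sub>F y in nhds x. GDERIV (\<lambda>y. f y + g y) y :> F y + G y"
    using F(1) G(1) by eventually_elim (rule GDERIV_add)
  then show ?thesis unfolding jet2_def
    using F(2,3) G(2,3) by (intro exI[of _ "\<lambda>y. F y + G y"]) (auto intro: has_derivative_add)
qed

lemma jet2_mult:
  assumes "jet2 f x D X" "jet2 g x E Y"
  shows "jet2 (\<lambda>y. f y * g y) x (f x *\<^sub>R E + g x *\<^sub>R D)
     (\<lambda>h. f x *\<^sub>R Y h + (D \<bullet> h) *\<^sub>R E + (g x *\<^sub>R X h + (E \<bullet> h) *\<^sub>R D))"
proof -
  obtain F where F: "\<forall>\<^sub>F y in nhds x. GDERIV f y :> F y" "(F has_derivative X) (at x)" "F x = D"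
    using assms(1) unfolding jet2_def by blast
  obtain G where G: "\<forall>\<^sub>F y in nhds x. GDERIV g y :> G y" "(G has_derivative Y) (at x)" "G x = E"
    using assms(2) unfolding jet2_def by blast
  have 1: "\<forall>\<^sub>F y in nhds x. GDERIV (\<lambda>y. f y * g y) y :> f y *\<^sub>R G y + g y *\<^sub>R F y"
    using F(1) G(1) by eventually_elim (rule GDERIV_mult)
  have d: "(f has_derivative (\<lambda>h. D \<bullet> h)) (at x)" "(g has_derivative (\<lambda>h. E \<bullet> h)) (at x)"
    using jet2_GDERIV[OF assms(1)] jet2_GDERIV[OF assms(2)] by (simp_all add: gderiv_def inner_commute)
  have 2: "((\<lambda>y. f y *\<^sub>R G y + g y *\<^sub>R F y) has_derivative
     (\<lambda>h. f x *\<^sub>R Y h + (D \<bullet> h) *\<^sub>R E + (g x *\<^sub>R X h + (E \<bullet> h) *\<^sub>R D))) (at x)"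
    using has_derivative_add[OF has_derivative_scaleR[OF d(1) G(2)] has_derivative_scaleR[OF d(2) F(2)]]
    unfolding F(3) G(3) .
  show ?thesis unfolding jet2_def
    using 1 2 F(3) G(3) by (intro exI[of _ "\<lambda>y. f y *\<^sub>R G y + g y *\<^sub>R F y"]) auto
qed

lemma jet2_compose:
  assumes "jet2 f x D X" and h: "open T" "f x \<in> T" "\<And>t. t \<in> T \<Longrightarrow> (h has_real_derivative h' t) (at t)"
    "(h' has_real_derivative h2) (at (f x))"
  shows "jet2 (\<lambda>y. h (f y)) x (h' (f x) *\<^sub>R D) (\<lambda>k. h' (f x) *\<^sub>R X k + (h2 * (D \<bullet> k)) *\<^sub>R D)"
proof -
  obtain F where F: "\<forall>\<^sub>F y in nhds x. GDERIV f y :> F y" "(F has_derivative X) (at x)" "F x = D"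
    using assms(1) unfolding jet2_def by blast
  have d: "(f has_derivative (\<lambda>h. h \<bullet> D)) (at x)"
    using jet2_GDERIV[OF assms(1)] by (simp add: gderiv_def)
  have "isCont f x" using d has_derivative_continuous by blast
  then have "\<forall>\<^sub>F y in nhds x. f y \<in> T"
    unfolding continuous_at tendsto_at_iff_tendsto_nhds using h(1,2) by (rule topological_tendstoD)
  with F(1) have 1: "\<forall>\<^sub>F y in nhds x. GDERIV (\<lambda>y. h (f y)) y :> h' (f y) *\<^sub>R F y"
    by eventually_elim (auto intro: GDERIV_DERIV_compose h(3))
  have "((\<lambda>y. h' (f y)) has_derivative (\<lambda>k. h2 * (D \<bullet> k))) (at x)"
    using has_derivative_compose[OF d h(4)[unfolded has_field_derivative_def]] by (simp add: inner_commute)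
  from has_derivative_scaleR[OF this F(2)]
  have 2: "((\<lambda>y. h' (f y) *\<^sub>R F y) has_derivative (\<lambda>k. h' (f x) *\<^sub>R X k + (h2 * (D \<bullet> k)) *\<^sub>R D)) (at x)"
    unfolding F(3) .
  show ?thesis unfolding jet2_def
    using 1 2 F(3) by (intro exI[of _ "\<lambda>y. h' (f y) *\<^sub>R F y"]) auto
qed

text \<open>If X k . k were positive, the derivative of g along k would increase through its value 0
  at x and be positive just beyond x; by the mean value theorem g would exceed its maximum
  there.\<close>

lemma jet2_local_max:
  assumes j: "jet2 g x D X" and m: "\<forall>\<^sub>F y in nhds x. g y \<le> g x"
  shows "D = 0" "X k \<bullet> k \<le> 0"
proof -
  obtain G where G: "\<forall>\<^sub>F y in nhds x. GDERIV g y :> G y" "(G has_derivative X) (at x)" "G x = D"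
    using j unfolding jet2_def by blast
  obtain d where d: "d > 0" "\<And>y. dist y x < d \<Longrightarrow> GDERIV g y :> G y \<and> g y \<le> g x"
    using eventually_conj[OF G(1) m] unfolding eventually_nhds_metric by blast
  have D0: "D \<bullet> e = 0" for e
  proof (cases "e = 0")
    case False
    have "GDERIV g (x + 0 *\<^sub>R e) :> D" using jet2_GDERIV[OF j] by simp
    note l = GDERIV_line[OF this]
    show ?thesis
    proof (rule DERIV_local_max[OF l, of "d / norm e"])
      show "0 < d / norm e" using d(1) False by simp
      show "\<forall>t. \<bar>0 - t\<bar> < d / norm e \<longrightarrow> g (x + t *\<^sub>R e) \<le> g (x + 0 *\<^sub>R e)"
        using d(2) False by (auto simp: dist_norm field_simps)
    qed
  qed simp
  then show "D = 0" by (metis inner_eq_zero_iff)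
  show "X k \<bullet> k \<le> 0"
  proof (rule ccontr)
    assume "\<not> X k \<bullet> k \<le> 0"
    then have pos: "X k \<bullet> k > 0" by simp
    then have k0: "k \<noteq> 0" by auto
    define \<phi> where "\<phi> t = G (x + t *\<^sub>R k) \<bullet> k" for t :: real
    have "((\<lambda>t. x + t *\<^sub>R k) has_derivative (\<lambda>h. h *\<^sub>R k)) (at 0)" by (auto intro!: derivative_eq_intros)
    from has_derivative_compose[OF this, of G X] G(2)
    have "((\<lambda>t. G (x + t *\<^sub>R k)) has_derivative (\<lambda>h. X (h *\<^sub>R k))) (at 0)" by simp
    from has_derivative_inner_left[OF this, of k]
    have "(\<phi> has_real_derivative X k \<bullet> k) (at 0)"
      by (simp add: \<phi>_def[abs_def] has_field_derivative_def mult_commute_abs linear_scale[OF jet2_linear[OF j]] mult.commute)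
    from DERIV_pos_inc_right[OF this pos] obtain \<delta> where \<delta>: "\<delta> > 0" "\<And>h. 0 < h \<Longrightarrow> h < \<delta> \<Longrightarrow> \<phi> 0 < \<phi> h"
      by auto
    define t where "t = min (\<delta> / 2) (d / (2 * norm k))"
    have t: "0 < t" "t < \<delta>" "t * norm k < d"
      using \<delta>(1) d(1) k0 by (auto simp: t_def min_def field_simps)
    have dk: "dist (x + s *\<^sub>R k) x < d" if "0 \<le> s" "s \<le> t" for s
      using t that by (simp add: dist_norm) (meson le_less_trans mult_right_mono norm_ge_zero)
    have "\<exists>z>0. z < t \<and> g (x + t *\<^sub>R k) - g (x + 0 *\<^sub>R k) = (t - 0) * \<phi> z"
      by (rule MVT2) (use t(1) in \<open>auto simp: \<phi>_def intro!: GDERIV_line conjunct1[OF d(2)] dk\<close>)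
    then obtain z where z: "0 < z" "z < t" "g (x + t *\<^sub>R k) - g x = t * \<phi> z" by auto
    have "\<phi> 0 = 0" using D0 G(3) by (simp add: \<phi>_def)
    then have "\<phi> z > 0" using \<delta>(2)[of z] z t by simp
    then have "g (x + t *\<^sub>R k) > g x" using z t(1) by (simp add: algebra_simps)
    moreover have "g (x + t *\<^sub>R k) \<le> g x" using d(2)[OF dk[of t]] t(1) by simp
    ultimately show False by simp
  qed
qed

section \<open>The Hessian as a symmetric linear map\<close>

lemma linear_inner_expand:
  fixes X :: "'a::euclidean_space \<Rightarrow> 'b::real_inner"
  assumes "linear X"
  shows "(\<Sum>e\<in>Basis. (h \<bullet> e) * (X e \<bullet> k)) = X h \<bullet> k"
  by (subst (2) euclidean_representation[of h, symmetric])
    (simp add: linear_sum[OF assms] linear_scale[OF assms] inner_sum_left)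

lemma inner_expand: "(\<Sum>e\<in>Basis. (h \<bullet> e) * (e \<bullet> k)) = h \<bullet> (k::'a::euclidean_space)"
  by (subst euclidean_inner[of h k]) (simp add: inner_commute)

definition hess :: "('a::euclidean_space \<Rightarrow> real) \<Rightarrow> 'a \<Rightarrow> 'a \<Rightarrow> 'a" where
  "hess f x h = (\<Sum>c\<in>Basis. (grad (partial_deriv c f) x \<bullet> h) *\<^sub>R c)"

lemma linear_hess: "linear (hess f x)"
  unfolding hess_def
  by (intro linear_compose_sum ballI linearI) (auto simp: inner_add_right scaleR_add_left)

lemma hess_inner_Basis: "c \<in> Basis \<Longrightarrow> hess f x h \<bullet> c = grad (partial_deriv c f) x \<bullet> h"
  unfolding hess_def by (simp add: inner_sum_left inner_Basis if_distrib sum.delta cong: if_cong)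

lemma grad_has_derivative:
  assumes "open S" "Ck_on 2 S f" "x \<in> S"
  shows "(grad f has_derivative hess f x) (at x)"
proof -
  have "((\<lambda>y. \<Sum>c\<in>Basis. partial_deriv c f y *\<^sub>R c) has_derivative
      (\<lambda>h. \<Sum>c\<in>Basis. (h \<bullet> grad (partial_deriv c f) x) *\<^sub>R c)) (at x)"
  proof (intro has_derivative_sum has_derivative_scaleR_left)
    fix c :: 'a assume "c \<in> Basis"
    then have "Ck_on (Suc 0) S (partial_deriv c f)"
      using assms(2) by (intro Ck_on_partial) (simp_all add: numeral_2_eq_2)
    from Ck_on_GDERIV[OF this assms(3)]
    show "(partial_deriv c f has_derivative (\<lambda>h. h \<bullet> grad (partial_deriv c f) x)) (at x)"
      by (simp add: gderiv_def)
  qed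
  then show ?thesis unfolding grad_def[abs_def] hess_def[abs_def]
    by (simp add: grad_def inner_commute)
qed

lemma Ck_on_jet2:
  assumes "open S" "Ck_on 2 S f" "x \<in> S"
  shows "jet2 f x (grad f x) (hess f x)"
proof (rule jet2I[OF assms(1,3)])
  have "Ck_on (Suc 1) S f" using assms(2) by (simp add: numeral_2_eq_2)
  then show "GDERIV f y :> grad f y" if "y \<in> S" for y using that by (rule Ck_on_GDERIV)
qed (use grad_has_derivative[OF assms] in auto)

lemma partial_differentiable:
  assumes "Ck_on 2 S f" "x \<in> S" "c \<in> Basis"
  shows "partial_deriv c f differentiable (at x)"
  using assms by (simp add: numeral_2_eq_2 Ck_on_Suc)

lemma hess_symmetric:
  assumes "open S" "Ck_on 2 S f" "x \<in> S"
  shows "hess f x h \<bullet> k = h \<bullet> hess f x k"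
proof -
  have s: "hess f x b \<bullet> c = b \<bullet> hess f x c" if "b \<in> Basis" "c \<in> Basis" for b c
    using Ck_on_partial_commute[OF assms that] partial_deriv_eq_grad[of _ "partial_deriv _ f" x] that
    by (simp add: inner_commute[of b] hess_inner_Basis)
  have s1: "hess f x h \<bullet> c = h \<bullet> hess f x c" if "c \<in> Basis" for c
  proof -
    have "hess f x h \<bullet> c = (\<Sum>b\<in>Basis. (h \<bullet> b) * (hess f x b \<bullet> c))"
      by (simp add: linear_inner_expand[OF linear_hess])
    also have "\<dots> = (\<Sum>b\<in>Basis. (h \<bullet> b) * (b \<bullet> hess f x c))" using s that by (intro sum.cong) auto
    also have "\<dots> = h \<bullet> hess f x c" by (simp add: inner_expand)
    finally show ?thesis .
  qed
  have "hess f x h \<bullet> k = (\<Sum>c\<in>Basis. (k \<bullet> c) * (hess f x h \<bullet> c))"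
    by (subst euclidean_inner) (simp add: mult.commute)
  also have "\<dots> = (\<Sum>c\<in>Basis. (k \<bullet> c) * (h \<bullet> hess f x c))" using s1 by (intro sum.cong) auto
  also have "\<dots> = h \<bullet> hess f x k"
    using linear_inner_expand[OF linear_hess, of k f x h] by (simp add: inner_commute)
  finally show ?thesis .
qed

section \<open>The metric of a graph and its square roots\<close>

definition slope :: "'a::real_inner \<Rightarrow> real" where
  "slope p = sqrt (1 + p \<bullet> p)"

text \<open>\<open>rho p\<close> is the square root of the inverse metric \<open>I - p p\<^sup>T / (1 + |p|\<^sup>2)\<close> of a graph with
  gradient \<open>p\<close>, and \<open>sigma p\<close> is the inverse of \<open>rho p\<close>.\<close>

definition rho :: "'a::real_inner \<Rightarrow> 'a \<Rightarrow> 'a" where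
  "rho p h = h - ((p \<bullet> h) / (slope p * (slope p + 1))) *\<^sub>R p"

definition sigma :: "'a::real_inner \<Rightarrow> 'a \<Rightarrow> 'a" where
  "sigma p h = h + ((p \<bullet> h) / (slope p + 1)) *\<^sub>R p"

definition aform :: "'a::real_inner \<Rightarrow> 'a \<Rightarrow> 'a \<Rightarrow> real" where
  "aform p d e = d \<bullet> e - (p \<bullet> d) * (p \<bullet> e) / (slope p)\<^sup>2"

text \<open>Trace with respect to the inverse metric of a graph with gradient p. Applied to the
  Hessian of u at its own gradient, it is v times the mean curvature.\<close>

definition mc_trace :: "'a::euclidean_space \<Rightarrow> ('a \<Rightarrow> 'a) \<Rightarrow> real" where
  "mc_trace p X = (\<Sum>e\<in>Basis. X e \<bullet> e) - (p \<bullet> X p) / (slope p)\<^sup>2"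

lemma aform_commute: "aform p d e = aform p e d"
  by (simp add: aform_def inner_commute mult.commute)

lemma slope_sq: "(slope p)\<^sup>2 = 1 + p \<bullet> p"
  by (simp add: slope_def)

lemma slope_ge_1: "slope p \<ge> 1"
  by (simp add: slope_def)

lemma slope_pos [simp]: "slope p > 0" "slope p \<noteq> 0" "slope p + 1 > 0" "slope p + 1 \<noteq> 0"
  using slope_ge_1[of p] by auto

lemma inner_self_slope: "p \<bullet> p = (slope p - 1) * (slope p + 1)"
  using slope_sq[of p] by (simp add: algebra_simps power2_eq_square)

lemma norm_le_slope: "norm p \<le> slope p"
  by (simp add: slope_def norm_eq_sqrt_inner)

lemma linear_rho: "linear (rho p)"
  by (rule linearI) (simp_all add: rho_def inner_add_right add_divide_distrib scaleR_add_left scaleR_diff_right)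

lemma linear_sigma: "linear (sigma p)"
  by (rule linearI) (simp_all add: sigma_def inner_add_right add_divide_distrib scaleR_add_left scaleR_add_right)

lemma rho_symmetric: "rho p h \<bullet> k = h \<bullet> rho p k"
  by (simp add: rho_def inner_diff_left inner_diff_right inner_commute)

lemma sigma_symmetric: "sigma p h \<bullet> k = h \<bullet> sigma p k"
  by (simp add: sigma_def inner_add_left inner_add_right inner_commute)

lemma rho_self: "rho p p = (1 / slope p) *\<^sub>R p"
proof -
  have "1 - (p \<bullet> p) / (slope p * (slope p + 1)) = 1 / slope p"
  proof -
    have "1 - ((v - 1) * (v + 1)) / (v * (v + 1)) = 1 / v" if "v > 0" for v :: real
      using that by (simp add: diff_divide_distrib)
    then show ?thesis unfolding inner_self_slope by simp
  qed
  then show ?thesis unfolding rho_def by (metis scaleR_left_diff_distrib scaleR_one)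
qed

lemma sigma_self: "sigma p p = slope p *\<^sub>R p"
proof -
  have "1 + (p \<bullet> p) / (slope p + 1) = slope p" unfolding inner_self_slope by simp
  then show ?thesis unfolding sigma_def by (metis scaleR_left_distrib scaleR_one)
qed

lemma rho_sigma: "rho p (sigma p h) = h"
  by (simp add: sigma_def linear_add[OF linear_rho] linear_scale[OF linear_rho] rho_self)
    (simp add: rho_def mult.commute)

lemma sigma_rho: "sigma p (rho p h) = h"
  by (simp add: rho_def linear_diff[OF linear_sigma] linear_scale[OF linear_sigma] sigma_self)
    (simp add: sigma_def mult.commute)

lemma sigma_eq_rho: "sigma p h = rho p h + ((p \<bullet> h) / slope p) *\<^sub>R p"
proof -
  have num: "1 / (v + 1) = 1 / v - 1 / (v * (v + 1))" if "v > 0" for v :: real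
    using that by (simp add: divide_simps)
  have "1 / (slope p + 1) = 1 / slope p - 1 / (slope p * (slope p + 1))"
    using num[OF slope_pos(1)] .
  then have "(p \<bullet> h) / (slope p + 1) = (p \<bullet> h) / slope p - (p \<bullet> h) / (slope p * (slope p + 1))"
    by (metis (no_types) mult.right_neutral right_diff_distrib times_divide_eq_right)
  then show ?thesis by (simp add: sigma_def rho_def scaleR_diff_left)
qed

lemma aform_rho: "aform p d e = rho p d \<bullet> rho p e"
proof -
  have "rho p d \<bullet> rho p e = d \<bullet> rho p (rho p e)" by (simp add: rho_symmetric)
  also have "rho p (rho p e) = e - ((p \<bullet> e) / (slope p)\<^sup>2) *\<^sub>R p"
  proof -
    have "rho p (rho p e) = rho p (e - ((p \<bullet> e) / (slope p * (slope p + 1))) *\<^sub>R p)"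
      by (simp add: rho_def[of p e])
    then have "rho p (rho p e) = rho p e - ((p \<bullet> e) / (slope p * (slope p + 1)) / slope p) *\<^sub>R p"
      by (simp add: linear_diff[OF linear_rho] linear_scale[OF linear_rho] rho_self)
    moreover have "x / (v * (v + 1)) + x / (v * (v + 1)) / v = x / v\<^sup>2" if "v > 0" for x v :: real
    proof -
      have "x / (v * (v + 1)) + x / (v * (v + 1)) / v = x * (v + 1) / (v * (v + 1) * v)"
        using that by (simp add: add_divide_distrib distrib_left)
      then show ?thesis using that by (simp add: power2_eq_square)
    qed
    then have "(p \<bullet> e) / (slope p * (slope p + 1)) + (p \<bullet> e) / (slope p * (slope p + 1)) / slope p = (p \<bullet> e) / (slope p)\<^sup>2"
      by simp
    moreover have "rho p e = e - ((p \<bullet> e) / (slope p * (slope p + 1))) *\<^sub>R p" by (simp add: rho_def)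
    ultimately show ?thesis by (simp only: diff_diff_eq scaleR_left_distrib[symmetric])
  qed
  finally show ?thesis by (simp add: aform_def inner_diff_right inner_commute)
qed

lemma norm_rho_le: "norm (rho p d) \<le> norm d"
proof -
  have "(norm (rho p d))\<^sup>2 = (norm d)\<^sup>2 - (p \<bullet> d)\<^sup>2 / (slope p)\<^sup>2"
    using aform_rho[of p d d] unfolding aform_def power2_norm_eq_inner by (simp add: power2_eq_square[of "p \<bullet> d"])
  then have "(norm (rho p d))\<^sup>2 \<le> (norm d)\<^sup>2" by simp
  then show ?thesis by (rule power2_le_imp_le) simp
qed

text \<open>The weighted trace is an ordinary sum of values of the quadratic form of X at the
  vectors \<open>rho p e\<close>. In this form ellipticity is visible: at a maximum every summand is
  nonpositive.\<close>

lemma mc_trace_rho: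
  assumes "linear X"
  shows "mc_trace p X = (\<Sum>e\<in>Basis. X (rho p e) \<bullet> rho p e)"
proof -
  define c where "c = 1 / (slope p * (slope p + 1))"
  have r: "rho p e = e - (c * (p \<bullet> e)) *\<^sub>R p" for e by (simp add: rho_def c_def)
  have num: "- 2 * (1 / (v * (v + 1))) + (1 / (v * (v + 1)))\<^sup>2 * ((v - 1) * (v + 1)) = - 1 / v\<^sup>2" if "v > 0" for v :: real
  proof -
    have "(1 / (v * (v + 1)))\<^sup>2 * ((v - 1) * (v + 1)) = (v - 1) / (v\<^sup>2 * (v + 1))"
      using that by (simp add: power2_eq_square)
    then show ?thesis using that by (simp add: divide_simps power2_eq_square)
  qed
  have c: "- 2 * c + c\<^sup>2 * (p \<bullet> p) = - 1 / (slope p)\<^sup>2"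
    unfolding c_def inner_self_slope using num[OF slope_pos(1)] .
  have "X (rho p e) \<bullet> rho p e = X e \<bullet> e - c * ((p \<bullet> e) * (X e \<bullet> p)) - c * ((p \<bullet> e) * (e \<bullet> X p))
      + c\<^sup>2 * (X p \<bullet> p) * ((p \<bullet> e) * (e \<bullet> p))" for e
    unfolding r linear_diff[OF assms] linear_scale[OF assms]
    by (simp add: inner_diff_left inner_diff_right inner_commute algebra_simps power2_eq_square)
  then have "(\<Sum>e\<in>Basis. X (rho p e) \<bullet> rho p e) = (\<Sum>e\<in>Basis. X e \<bullet> e) - c * (X p \<bullet> p) - c * (p \<bullet> X p)
      + c\<^sup>2 * (X p \<bullet> p) * (p \<bullet> p)"
    by (simp add: sum.distrib sum_subtractf sum_distrib_left[symmetric] linear_inner_expand[OF assms] inner_expand)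
  also have "\<dots> = (\<Sum>e\<in>Basis. X e \<bullet> e) + (- 2 * c + c\<^sup>2 * (p \<bullet> p)) * (p \<bullet> X p)"
    by (simp add: inner_commute algebra_simps)
  finally show ?thesis unfolding c by (simp add: mc_trace_def)
qed

text \<open>Here \<open>l\<close> is the value at \<open>x\<close> of the operator \<open>\<Sum> a\<^sup>i\<^sup>j D\<^sub>i\<^sub>j\<close> whose coefficients
  \<open>a\<^sup>i\<^sup>j = \<delta>\<^sup>i\<^sup>j - p\<^sup>i p\<^sup>j / (1 + |p|\<^sup>2)\<close> are frozen at \<open>p\<close>.\<close>

definition mc_jet :: "'a::euclidean_space \<Rightarrow> ('a \<Rightarrow> real) \<Rightarrow> 'a \<Rightarrow> 'a \<Rightarrow> real \<Rightarrow> bool" where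
  "mc_jet p g x D l \<longleftrightarrow> (\<exists>X. jet2 g x D X \<and> mc_trace p X = l)"

lemma mc_jet_GDERIV: "mc_jet p g x D l \<Longrightarrow> GDERIV g x :> D"
  unfolding mc_jet_def using jet2_GDERIV by blast

lemma mc_jet_const: "mc_jet p (\<lambda>y. c) x 0 0"
  unfolding mc_jet_def by (intro exI[of _ "\<lambda>h. 0"]) (simp add: jet2_const mc_trace_def)

lemma mc_trace_add: "mc_trace p (\<lambda>h. X h + Y h) = mc_trace p X + mc_trace p Y"
  by (simp add: mc_trace_def inner_add_left inner_add_right sum.distrib add_divide_distrib)

lemma mc_trace_scaleR: "mc_trace p (\<lambda>h. c *\<^sub>R X h) = c * mc_trace p X"
  by (simp add: mc_trace_def sum_distrib_left right_diff_distrib)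

lemma mc_trace_rank1: "mc_trace p (\<lambda>h. (d \<bullet> h) *\<^sub>R e) = aform p d e"
  by (simp add: mc_trace_def aform_def inner_expand inner_commute[of p d] inner_commute[of _ e] mult.commute)
    (metis (no_types, lifting) inner_commute inner_expand sum.cong)

lemma mc_jet_add:
  "mc_jet p f x D l \<Longrightarrow> mc_jet p g x E m \<Longrightarrow> mc_jet p (\<lambda>y. f y + g y) x (D + E) (l + m)"
  unfolding mc_jet_def using jet2_add mc_trace_add by blast

lemma mc_jet_mult:
  assumes "mc_jet p f x D l" "mc_jet p g x E m"
  shows "mc_jet p (\<lambda>y. f y * g y) x (f x *\<^sub>R E + g x *\<^sub>R D) (f x * m + g x * l + 2 * aform p D E)"
proof -
  obtain X Y where X: "jet2 f x D X" "mc_trace p X = l" and Y: "jet2 g x E Y" "mc_trace p Y = m"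
    using assms unfolding mc_jet_def by blast
  have "mc_trace p (\<lambda>h. f x *\<^sub>R Y h + (D \<bullet> h) *\<^sub>R E + (g x *\<^sub>R X h + (E \<bullet> h) *\<^sub>R D)) = f x * m + g x * l + 2 * aform p D E"
    using X(2) Y(2) by (simp add: mc_trace_add mc_trace_scaleR mc_trace_rank1 aform_commute[of p E D])
  with jet2_mult[OF X(1) Y(1)] show ?thesis unfolding mc_jet_def by blast
qed

lemma mc_jet_cmult: "mc_jet p f x D l \<Longrightarrow> mc_jet p (\<lambda>y. c * f y) x (c *\<^sub>R D) (c * l)"
  using mc_jet_mult[OF mc_jet_const, of p f x D l c] by (simp add: aform_def)

lemma mc_jet_sum:
  assumes "\<And>i. i \<in> I \<Longrightarrow> mc_jet p (f i) x (D i) (l i)"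
  shows "mc_jet p (\<lambda>y. \<Sum>i\<in>I. f i y) x (\<Sum>i\<in>I. D i) (\<Sum>i\<in>I. l i)"
  using assms by (induction I rule: infinite_finite_induct) (auto intro: mc_jet_add mc_jet_const)

lemma mc_jet_compose:
  assumes "mc_jet p f x D l" and h: "open T" "f x \<in> T" "\<And>t. t \<in> T \<Longrightarrow> (h has_real_derivative h' t) (at t)"
    "(h' has_real_derivative h2) (at (f x))"
  shows "mc_jet p (\<lambda>y. h (f y)) x (h' (f x) *\<^sub>R D) (h' (f x) * l + h2 * aform p D D)"
proof -
  obtain X where X: "jet2 f x D X" "mc_trace p X = l" using assms unfolding mc_jet_def by blast
  have "mc_trace p (\<lambda>k. (h2 * (D \<bullet> k)) *\<^sub>R D) = h2 * aform p D D"
    using mc_trace_scaleR[of p h2 "\<lambda>k. (D \<bullet> k) *\<^sub>R D"] by (simp add: mc_trace_rank1)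
  then have "mc_trace p (\<lambda>k. h' (f x) *\<^sub>R X k + (h2 * (D \<bullet> k)) *\<^sub>R D) = h' (f x) * l + h2 * aform p D D"
    by (simp add: mc_trace_add mc_trace_scaleR X(2))
  moreover have "jet2 (\<lambda>y. h (f y)) x (h' (f x) *\<^sub>R D) (\<lambda>k. h' (f x) *\<^sub>R X k + (h2 * (D \<bullet> k)) *\<^sub>R D)"
    by (rule jet2_compose[OF X(1) h])
  ultimately show ?thesis unfolding mc_jet_def by blast
qed

lemma mc_jet_local_max:
  assumes "mc_jet p g x D l" "\<forall>\<^sub>F y in nhds x. g y \<le> g x"
  shows "D = 0" "l \<le> 0"
proof -
  obtain X where X: "jet2 g x D X" "mc_trace p X = l" using assms(1) unfolding mc_jet_def by blast
  show "D = 0" by (rule jet2_local_max(1)[OF X(1) assms(2)])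
  show "l \<le> 0" unfolding X(2)[symmetric] mc_trace_rho[OF jet2_linear[OF X(1)]]
    by (intro sum_nonpos jet2_local_max(2)[OF X(1) assms(2)])
qed

section \<open>Self-adjoint maps and the Hilbert--Schmidt norm\<close>

definition hs_norm :: "('a::euclidean_space \<Rightarrow> 'a) \<Rightarrow> real" where
  "hs_norm B = sqrt (\<Sum>e\<in>Basis. B e \<bullet> B e)"

lemma hs_norm_nonneg: "hs_norm B \<ge> 0"
  by (simp add: hs_norm_def sum_nonneg)

lemma hs_norm_sq: "(hs_norm B)\<^sup>2 = (\<Sum>e\<in>Basis. B e \<bullet> B e)"
  by (simp add: hs_norm_def sum_nonneg)

lemma norm_le_hs_norm_Basis:
  assumes "e \<in> Basis" shows "norm (B e) \<le> hs_norm B"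
proof -
  have "(norm (B e))\<^sup>2 \<le> (\<Sum>e\<in>Basis. B e \<bullet> B e)"
    unfolding power2_norm_eq_inner by (rule member_le_sum[OF assms]) auto
  then show ?thesis unfolding hs_norm_def by (rule real_le_rsqrt)
qed

lemma inner_sum_Basis_le:
  fixes Y :: "'a::euclidean_space \<Rightarrow> 'a"
  shows "\<bar>\<Sum>e\<in>Basis. B e \<bullet> Y e\<bar> \<le> hs_norm B * hs_norm Y"
proof -
  have "\<bar>\<Sum>e\<in>Basis. B e \<bullet> Y e\<bar> \<le> (\<Sum>e\<in>Basis. \<bar>norm (B e)\<bar> * \<bar>norm (Y e)\<bar>)"
    by (rule order_trans[OF sum_abs sum_mono]) (simp add: Cauchy_Schwarz_ineq2)
  also have "\<dots> \<le> L2_set (\<lambda>e. norm (B e)) Basis * L2_set (\<lambda>e. norm (Y e)) Basis"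
    by (rule L2_set_mult_ineq)
  finally show ?thesis by (simp add: L2_set_def hs_norm_def power2_norm_eq_inner)
qed

lemma norm_le_hs_norm:
  assumes "linear B" shows "norm (B x) \<le> hs_norm B * norm x"
proof (cases "B x = 0")
  case False
  have "(norm (B x))\<^sup>2 = (\<Sum>e\<in>Basis. B e \<bullet> ((x \<bullet> e) *\<^sub>R B x))"
    by (simp add: linear_inner_expand[OF assms] power2_norm_eq_inner)
  also have "\<dots> \<le> hs_norm B * hs_norm (\<lambda>e. (x \<bullet> e) *\<^sub>R B x)"
    using inner_sum_Basis_le[of B "\<lambda>e. (x \<bullet> e) *\<^sub>R B x"] by linarith
  also have "hs_norm (\<lambda>e. (x \<bullet> e) *\<^sub>R B x) = norm x * norm (B x)"
  proof -
    have "(\<Sum>e\<in>Basis. ((x \<bullet> e) *\<^sub>R B x) \<bullet> ((x \<bullet> e) *\<^sub>R B x)) = (x \<bullet> x) * (B x \<bullet> B x)"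
      by (subst euclidean_inner[of x x]) (simp add: sum_distrib_right mult.assoc)
    then show ?thesis by (simp add: hs_norm_def norm_eq_sqrt_inner real_sqrt_mult)
  qed
  finally show ?thesis using False by (simp add: power2_eq_square)
qed (simp add: hs_norm_nonneg)

text \<open>The rank two map \<open>sym (g \<otimes> k)\<close> has squared norm \<open>(|g|\<^sup>2|k|\<^sup>2 + (g \<bullet> k)\<^sup>2) / 2\<close>. Using it
  instead of \<open>g \<otimes> k\<close> gains the factor one half that keeps the case of contact angles
  close to zero under control.\<close>

lemma selfadjoint_inner_bound:
  assumes "linear B" "\<And>x y. B x \<bullet> y = x \<bullet> B y"
  shows "(B g \<bullet> k)\<^sup>2 \<le> (hs_norm B)\<^sup>2 * ((g \<bullet> g) * (k \<bullet> k) + (g \<bullet> k)\<^sup>2) / 2"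
proof -
  define Y where "Y e = (g \<bullet> e) *\<^sub>R k + (k \<bullet> e) *\<^sub>R g" for e
  have "(\<Sum>e\<in>Basis. B e \<bullet> Y e) = B g \<bullet> k + B k \<bullet> g"
    by (simp add: Y_def inner_add_right sum.distrib linear_inner_expand[OF assms(1)])
  then have "2 * (B g \<bullet> k) = (\<Sum>e\<in>Basis. B e \<bullet> Y e)"
    using assms(2)[of k g] by (simp add: inner_commute)
  then have "\<bar>2 * (B g \<bullet> k)\<bar> \<le> hs_norm B * hs_norm Y" using inner_sum_Basis_le by metis
  then have "(2 * (B g \<bullet> k))\<^sup>2 \<le> (hs_norm B * hs_norm Y)\<^sup>2"
    by (metis abs_ge_zero power2_abs power_mono)
  moreover have "(hs_norm Y)\<^sup>2 = 2 * ((g \<bullet> g) * (k \<bullet> k) + (g \<bullet> k)\<^sup>2)"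
  proof -
    have "Y e \<bullet> Y e = (k \<bullet> k) * ((g \<bullet> e) * (e \<bullet> g)) + (g \<bullet> g) * ((k \<bullet> e) * (e \<bullet> k)) + 2 * (g \<bullet> k) * ((g \<bullet> e) * (e \<bullet> k))" for e
      by (simp add: Y_def inner_add_left inner_add_right inner_commute algebra_simps)
    then show ?thesis unfolding hs_norm_sq
      by (simp add: sum.distrib sum_distrib_left[symmetric] inner_expand power2_eq_square)
  qed
  ultimately have "4 * (B g \<bullet> k)\<^sup>2 \<le> (hs_norm B)\<^sup>2 * (2 * ((g \<bullet> g) * (k \<bullet> k) + (g \<bullet> k)\<^sup>2))"
    by (simp only: power_mult_distrib) simp
  then show ?thesis by (simp add: algebra_simps)
qed

text \<open>C is B composed with the projection onto the complement of g, and N is its squared norm.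
  N vanishes when B is a multiple of the projection onto g, so it does not control B by itself. The
  invisible entry B g . g is the trace of B minus the trace of C; the rest of B g is seen by C
  because B is symmetric.\<close>

lemma selfadjoint_unit_bounds:
  fixes B :: "'a::euclidean_space \<Rightarrow> 'a" and N :: real
  assumes B: "linear B" "\<And>x y. B x \<bullet> y = x \<bullet> B y" and g: "g \<bullet> g = 1"
    and N: "N = (hs_norm B)\<^sup>2 - B g \<bullet> B g"
  shows "N \<ge> 0"
    and "(hs_norm B)\<^sup>2 \<le> 2 * (\<Sum>e\<in>Basis. B e \<bullet> e)\<^sup>2 + (2 + 2 * DIM('a)) * N"
    and "\<bar>B g \<bullet> k\<bar> \<le> sqrt N * norm k + hs_norm B * \<bar>g \<bullet> k\<bar>"
proof -
  define C where "C e = B e - (g \<bullet> e) *\<^sub>R B g" for e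
  have linC: "linear C"
    by (rule linearI)
      (simp_all add: C_def linear_add[OF B(1)] linear_scale[OF B(1)] inner_add_right scaleR_add_left scaleR_diff_right)
  have NC: "N = (hs_norm C)\<^sup>2"
  proof -
    have "C e \<bullet> C e = B e \<bullet> B e - 2 * ((g \<bullet> e) * (B e \<bullet> B g)) + (B g \<bullet> B g) * ((g \<bullet> e) * (e \<bullet> g))" for e
      by (simp add: C_def inner_diff_left inner_diff_right inner_commute algebra_simps)
    then have "(hs_norm C)\<^sup>2 = (hs_norm B)\<^sup>2 - 2 * (B g \<bullet> B g) + (B g \<bullet> B g) * (g \<bullet> g)"
      unfolding hs_norm_sq
      by (simp add: sum.distrib sum_subtractf sum_distrib_left[symmetric] inner_expand linear_inner_expand[OF B(1)])
    then show ?thesis using N g by simp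
  qed
  then show N0: "N \<ge> 0" by simp
  have sN: "sqrt N = hs_norm C" using NC hs_norm_nonneg[of C] by simp
  have perp: "\<bar>B g \<bullet> k\<bar> \<le> sqrt N * norm k" if "g \<bullet> k = 0" for k
  proof -
    have "B g \<bullet> k = g \<bullet> C k" using that B(2) by (simp add: C_def)
    also have "\<bar>\<dots>\<bar> \<le> norm g * norm (C k)" by (rule Cauchy_Schwarz_ineq2)
    also have "\<dots> \<le> sqrt N * norm k"
      using norm_le_hs_norm[OF linC, of k] g sN by (simp add: norm_eq_sqrt_inner)
    finally show ?thesis .
  qed
  define b where "b = B g \<bullet> g"
  have ng: "norm g = 1" using g by (simp add: norm_eq_sqrt_inner)
  show "\<bar>B g \<bullet> k\<bar> \<le> sqrt N * norm k + hs_norm B * \<bar>g \<bullet> k\<bar>"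
  proof -
    define k' where "k' = k - (g \<bullet> k) *\<^sub>R g"
    have k': "g \<bullet> k' = 0" using g by (simp add: k'_def inner_diff_right)
    have "k' \<bullet> k' = k \<bullet> k - (g \<bullet> k)\<^sup>2"
      using g by (simp add: k'_def inner_diff_left inner_diff_right inner_commute power2_eq_square)
    then have nk: "norm k' \<le> norm k" by (simp add: norm_eq_sqrt_inner)
    have "B g \<bullet> k = B g \<bullet> k' + (g \<bullet> k) * b" by (simp add: k'_def b_def inner_diff_right)
    moreover have "\<bar>b\<bar> \<le> hs_norm B"
      using norm_le_hs_norm[OF B(1), of g] Cauchy_Schwarz_ineq2[of "B g" g] ng by (simp add: b_def)
    then have "\<bar>(g \<bullet> k) * b\<bar> \<le> hs_norm B * \<bar>g \<bullet> k\<bar>"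
      unfolding abs_mult by (subst mult.commute) (rule mult_right_mono, simp_all)
    moreover have "\<bar>B g \<bullet> k'\<bar> \<le> sqrt N * norm k"
      using perp[OF k'] mult_left_mono[OF nk, of "sqrt N"] N0 by simp
    ultimately show ?thesis by linarith
  qed
  have bb: "B g \<bullet> B g \<le> N + b\<^sup>2"
  proof -
    define h where "h = B g - b *\<^sub>R g"
    have h: "g \<bullet> h = 0" using g by (simp add: h_def b_def inner_diff_right inner_commute)
    have hh: "B g \<bullet> h = h \<bullet> h" using h by (simp add: h_def inner_diff_left inner_commute)
    have "norm h * norm h \<le> sqrt N * norm h"
      using perp[OF h] unfolding hh by (simp add: dot_square_norm power2_eq_square)
    then have "norm h \<le> sqrt N" using N0 by (cases "h = 0") auto
    then have "h \<bullet> h \<le> N" using N0 by (simp add: norm_eq_sqrt_inner)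
    moreover have "B g \<bullet> B g = h \<bullet> h + b\<^sup>2"
      using g by (simp add: h_def b_def inner_diff_left inner_diff_right inner_commute power2_eq_square)
    ultimately show ?thesis by simp
  qed
  define t where "t = (\<Sum>e\<in>Basis. B e \<bullet> e)"
  define c where "c = (\<Sum>e\<in>Basis. C e \<bullet> e)"
  have "c = t - (\<Sum>e\<in>Basis. (g \<bullet> e) * (e \<bullet> B g))"
    by (simp add: c_def t_def C_def inner_diff_left sum_subtractf inner_commute[of _ "B g"])
  then have btc: "b = t - c" unfolding inner_expand b_def by (simp add: inner_commute)
  have cc: "c\<^sup>2 \<le> DIM('a) * N"
  proof -
    have "\<bar>c\<bar> \<le> hs_norm C * hs_norm (\<lambda>e::'a. e)"
      unfolding c_def by (rule inner_sum_Basis_le)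
    then have "c\<^sup>2 \<le> (hs_norm C * hs_norm (\<lambda>e::'a. e))\<^sup>2" by (metis abs_ge_zero power2_abs power_mono)
    also have "\<dots> = N * DIM('a)"
      unfolding power_mult_distrib NC[symmetric] by (subst hs_norm_sq) simp
    finally show ?thesis by (simp add: mult.commute)
  qed
  have "b\<^sup>2 \<le> 2 * t\<^sup>2 + 2 * c\<^sup>2" unfolding btc using sum_squares_ge_zero[of "t + c" 0]
    by (simp add: power2_eq_square algebra_simps)
  then have "(hs_norm B)\<^sup>2 \<le> 2 * t\<^sup>2 + 2 * (DIM('a) * N) + 2 * N" using N bb cc by simp
  then show "(hs_norm B)\<^sup>2 \<le> 2 * (\<Sum>e\<in>Basis. B e \<bullet> e)\<^sup>2 + (2 + 2 * DIM('a)) * N"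
    unfolding t_def by (simp add: algebra_simps)
qed

section \<open>The differentiated mean curvature equation\<close>

text \<open>Full symmetry of the third derivatives. The middle exchange happens under a further
  derivative and therefore uses the equality of mixed partials on a whole neighbourhood.\<close>

lemma hess_partial_commute:
  assumes "open S" "Ck_on 3 S u" "x \<in> S" "b \<in> Basis" "c \<in> Basis"
  shows "hess (partial_deriv c u) x b = hess (partial_deriv b u) x c"
proof -
  have C2: "Ck_on 2 S (partial_deriv d u)" if "d \<in> Basis" for d
    using assms(2) that by (intro Ck_on_partial) (simp_all add: numeral_3_eq_3 numeral_2_eq_2)
  have u2: "Ck_on 2 S u" using assms(2) by (rule Ck_on_mono) simp
  have g: "grad (partial_deriv d (partial_deriv c u)) x \<bullet> b = grad (partial_deriv d (partial_deriv b u)) x \<bullet> c"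
    if d: "d \<in> Basis" for d
  proof -
    have "grad (partial_deriv d (partial_deriv c u)) x \<bullet> b = partial_deriv b (partial_deriv d (partial_deriv c u)) x"
      by (rule partial_deriv_eq_grad[OF assms(4), symmetric])
    also have "\<dots> = partial_deriv d (partial_deriv b (partial_deriv c u)) x"
      by (rule Ck_on_partial_commute[OF assms(1) C2[OF assms(5)] assms(3,4) d])
    also have "\<dots> = grad (partial_deriv b (partial_deriv c u)) x \<bullet> d"
      by (rule partial_deriv_eq_grad[OF d])
    also have "grad (partial_deriv b (partial_deriv c u)) x = grad (partial_deriv c (partial_deriv b u)) x"
      by (rule grad_cong_open[OF assms(1,3) _ partial_differentiable[OF C2[OF assms(5)] assms(3,4)]])
        (rule Ck_on_partial_commute[OF assms(1) u2 _ assms(4,5)])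
    also have "\<dots> \<bullet> d = partial_deriv d (partial_deriv c (partial_deriv b u)) x"
      by (rule partial_deriv_eq_grad[OF d, symmetric])
    also have "\<dots> = partial_deriv c (partial_deriv d (partial_deriv b u)) x"
      by (rule Ck_on_partial_commute[OF assms(1) C2[OF assms(4)] assms(3) d assms(5)])
    also have "\<dots> = grad (partial_deriv d (partial_deriv b u)) x \<bullet> c"
      by (rule partial_deriv_eq_grad[OF assms(5)])
    finally show ?thesis .
  qed
  show ?thesis unfolding hess_def by (intro sum.cong refl) (simp add: g)
qed

lemma has_derivative_slope:
  assumes "(g has_derivative g') (at x)"
  shows "((\<lambda>z. slope (g z)) has_derivative (\<lambda>h. (g x \<bullet> g' h) / slope (g x))) (at x)"
proof -
  have pos: "0 < 1 + g x \<bullet> g x" by (simp add: add_pos_nonneg)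
  have "((\<lambda>z. 1 + g z \<bullet> g z) has_derivative (\<lambda>h. 2 * (g x \<bullet> g' h))) (at x)"
    using has_derivative_add[OF has_derivative_const has_derivative_inner[OF assms assms], of 1]
    by (simp add: inner_commute)
  from has_derivative_compose[OF this DERIV_real_sqrt[OF pos, unfolded has_field_derivative_def]]
  have "((\<lambda>z. sqrt (1 + g z \<bullet> g z)) has_derivative (\<lambda>h. 2 * (g x \<bullet> g' h) * (inverse (sqrt (1 + g x \<bullet> g x)) / 2))) (at x)"
    by (rule has_derivative_eq_rhs) (rule ext, rule mult.commute)
  moreover have "2 * (g x \<bullet> g' h) * (inverse (sqrt (1 + g x \<bullet> g x)) / 2) = (g x \<bullet> g' h) / slope (g x)" for h
    unfolding slope_def by (simp only: divide_inverse) simp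
  ultimately show ?thesis unfolding slope_def by simp
qed

text \<open>F stands for the right-hand side composed with u. The equation holds on all of S, so
  that it can be differentiated at the single point x, where the gradient dF is given.\<close>

locale mc_graph =
  fixes S :: "'a::euclidean_space set" and u F :: "'a \<Rightarrow> real" and x dF :: 'a
  assumes S: "open S" and u: "Ck_on 3 S u" and x: "x \<in> S"
    and eq: "\<And>y. y \<in> S \<Longrightarrow> mc_trace (grad u y) (hess u y) = slope (grad u y) * F y"
    and dF: "GDERIV F x :> dF"
begin

definition p where "p = grad u x"
definition H where "H = hess u x"
definition v where "v = slope p"

text \<open>\<open>B\<close> is the second fundamental form of the graph of \<open>u\<close> in the orthonormal frame given by \<open>rho p\<close>.\<close>

definition B where "B e = (1 / v) *\<^sub>R rho p (H (rho p e))"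

text \<open>In the frame given by \<open>rho p\<close> this is the gradient of ln v: the gradient of
  v is H p / v, and \<open>rho p (H p) = v\<^sup>2 *\<^sub>R y\<close>.\<close>

definition y where "y = B p"

lemma u2: "Ck_on 2 S u" using u by (rule Ck_on_mono) simp

lemma Ck2_partial: "b \<in> Basis \<Longrightarrow> Ck_on 2 S (partial_deriv b u)"
  using u by (intro Ck_on_partial) (simp_all add: numeral_3_eq_3 numeral_2_eq_2)

lemma v_pos [simp]: "v > 0" "v \<noteq> 0" "v \<ge> 0" and v_ge_1: "v \<ge> 1"
  using slope_ge_1 slope_pos(1) by (auto simp: v_def less_imp_le)

lemma linear_H: "linear H" unfolding H_def by (rule linear_hess)

lemma H_symmetric: "H h \<bullet> k = h \<bullet> H k" unfolding H_def by (rule hess_symmetric[OF S u2 x])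

lemma linear_B: "linear B"
  unfolding B_def
  by (intro linear_compose_scale_right linear_compose[OF linear_compose[OF linear_rho linear_H] linear_rho, unfolded o_def])

lemma B_symmetric: "B h \<bullet> k = h \<bullet> B k"
  unfolding B_def by (simp add: rho_symmetric H_symmetric)

lemma rho_H: "rho p (H k) = v *\<^sub>R B (sigma p k)"
  by (simp add: B_def rho_sigma sigma_rho)

lemma rho_H_p: "rho p (H p) = v\<^sup>2 *\<^sub>R y"
  by (simp add: rho_H sigma_self v_def[symmetric] linear_scale[OF linear_B] y_def power2_eq_square)

lemma p_H: "p \<bullet> H k = v\<^sup>2 * (sigma p k \<bullet> y)"
proof -
  have "p \<bullet> H k = sigma p (rho p p) \<bullet> H k" by (simp only: sigma_rho)
  also have "\<dots> = rho p (H k) \<bullet> sigma p p"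
    by (metis inner_commute rho_symmetric sigma_symmetric rho_sigma sigma_rho)
  also have "\<dots> = v\<^sup>2 * (B (sigma p k) \<bullet> p)"
    unfolding rho_H sigma_self by (simp add: v_def power2_eq_square)
  finally show ?thesis by (simp add: y_def B_symmetric)
qed

lemma aform_H_H: "aform p (H k) (H l) = v\<^sup>2 * (B (sigma p k) \<bullet> B (sigma p l))"
  by (simp add: aform_rho rho_H power2_eq_square)

lemma B_sigma: "B (sigma p k) = B k + ((p \<bullet> k) / (v + 1)) *\<^sub>R y"
  by (simp add: sigma_def linear_add[OF linear_B] linear_scale[OF linear_B] y_def v_def)

text \<open>One index of H is contracted with the inverse metric and the other with the Euclidean
  one. The mismatch is the rank one part of \<open>sigma p\<close>, whose two contributions add up
  to exactly |y|^2.\<close>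

lemma sum_aform_H: "(\<Sum>e\<in>Basis. aform p (H e) (H e)) = v\<^sup>2 * ((hs_norm B)\<^sup>2 + y \<bullet> y)"
proof -
  have "B (sigma p e) \<bullet> B (sigma p e) = B e \<bullet> B e + (2 / (v + 1)) * ((p \<bullet> e) * (B e \<bullet> y))
     + ((y \<bullet> y) / (v + 1)\<^sup>2) * ((p \<bullet> e) * (e \<bullet> p))" for e
    unfolding B_sigma inner_add_left inner_add_right inner_scaleR_left inner_scaleR_right inner_commute[of y "B e"] inner_commute[of e p]
    by (simp add: power2_eq_square distrib_left add_divide_distrib mult_ac)
  then have "(\<Sum>e\<in>Basis. B (sigma p e) \<bullet> B (sigma p e)) = (hs_norm B)\<^sup>2 + (2 / (v + 1)) * (B p \<bullet> y) + ((y \<bullet> y) / (v + 1)\<^sup>2) * (p \<bullet> p)"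
    unfolding hs_norm_sq
    by (simp only: sum.distrib sum_distrib_left[symmetric] inner_expand linear_inner_expand[OF linear_B])
  also have "\<dots> = (hs_norm B)\<^sup>2 + y \<bullet> y"
  proof -
    have "2 / (v + 1) * Y + Y / (v + 1)\<^sup>2 * ((v - 1) * (v + 1)) = Y" for Y
    proof -
      have "Y / (v + 1)\<^sup>2 * ((v - 1) * (v + 1)) = Y * (v - 1) / (v + 1)"
        using v_ge_1 by (simp add: power2_eq_square)
      then have "2 / (v + 1) * Y + Y / (v + 1)\<^sup>2 * ((v - 1) * (v + 1)) = (2 * Y + Y * (v - 1)) / (v + 1)"
        by (simp add: add_divide_distrib)
      also have "2 * Y + Y * (v - 1) = Y * (v + 1)" by (simp add: algebra_simps)
      finally show ?thesis using v_ge_1 by simp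
    qed
    then show ?thesis using inner_self_slope[of p] by (simp add: y_def[symmetric] v_def[symmetric])
  qed
  finally show ?thesis by (simp add: aform_H_H sum_distrib_left[symmetric])
qed

lemma trace_B: "(\<Sum>e\<in>Basis. B e \<bullet> e) = F x"
proof -
  have "(\<Sum>e\<in>Basis. B e \<bullet> e) = (1 / v) * (\<Sum>e\<in>Basis. H (rho p e) \<bullet> rho p e)"
    by (simp add: B_def rho_symmetric sum_distrib_left)
  also have "(\<Sum>e\<in>Basis. H (rho p e) \<bullet> rho p e) = v * F x"
    using eq[OF x] mc_trace_rho[OF linear_H] by (simp add: p_def H_def v_def)
  finally show ?thesis by simp
qed

lemma grad_partial: "b \<in> Basis \<Longrightarrow> grad (partial_deriv b u) x = H b"
proof -
  assume b: "b \<in> Basis"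
  have "grad (partial_deriv b u) x \<bullet> h = H b \<bullet> h" for h
    using hess_inner_Basis[OF b, of u x h] hess_symmetric[OF S u2 x, of h b]
    by (simp add: H_def inner_commute)
  then show ?thesis by (metis inner_commute vector_eq_ldot)
qed

text \<open>The equation is first multiplied by v^2, so that its left side E is polynomial in the
  derivatives of u and can be differentiated termwise. The symmetry of the third derivatives gathers
  them into the Hessian of one partial derivative; the last term comes from differentiating the
  coefficients.\<close>

lemma differentiated_eq:
  assumes b: "b \<in> Basis"
  shows "mc_trace p (hess (partial_deriv b u) x) =
     F x * (p \<bullet> H b) / v + v * (dF \<bullet> b) + 2 / v\<^sup>2 * aform p (H b) (H p)"
proof -
  define G where "G c = grad (partial_deriv c u)" for c
  define E where "E z = (1 + grad u z \<bullet> grad u z) * (\<Sum>c\<in>Basis. G c z \<bullet> c)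
     - (\<Sum>c\<in>Basis. (grad u z \<bullet> c) * (G c z \<bullet> grad u z))" for z
  have Eeq: "E z = (1 + grad u z \<bullet> grad u z) * slope (grad u z) * F z" if "z \<in> S" for z
  proof -
    have "(\<Sum>c\<in>Basis. (grad u z \<bullet> c) * (G c z \<bullet> grad u z)) = (\<Sum>c\<in>Basis. (grad u z \<bullet> c) * (c \<bullet> hess u z (grad u z)))"
      by (intro sum.cong) (auto simp: G_def hess_inner_Basis inner_commute[of _ "hess u z _"])
    also have "\<dots> = grad u z \<bullet> hess u z (grad u z)" by (rule inner_expand)
    finally have "E z = (slope (grad u z))\<^sup>2 * mc_trace (grad u z) (hess u z)"
      unfolding E_def mc_trace_def slope_sq[symmetric]
      by (simp add: right_diff_distrib G_def hess_inner_Basis)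
    then show ?thesis using eq[OF that] by (simp add: slope_sq mult.assoc)
  qed
  have dp: "(grad u has_derivative H) (at x)" unfolding H_def by (rule grad_has_derivative[OF S u2 x])
  have dG: "(G c has_derivative hess (partial_deriv c u) x) (at x)" if "c \<in> Basis" for c
    unfolding G_def by (rule grad_has_derivative[OF S Ck2_partial[OF that] x])
  have dpp: "((\<lambda>z. grad u z \<bullet> grad u z) has_derivative (\<lambda>h. 2 * (p \<bullet> H h))) (at x)"
    using has_derivative_inner[OF dp dp] by (simp add: p_def inner_commute)
  have dE: "(E has_derivative (\<lambda>h. (2 * (p \<bullet> H h)) * (\<Sum>c\<in>Basis. H c \<bullet> c) + v\<^sup>2 * (\<Sum>c\<in>Basis. hess (partial_deriv c u) x h \<bullet> c)
      - (\<Sum>c\<in>Basis. (p \<bullet> c) * (H c \<bullet> H h + hess (partial_deriv c u) x h \<bullet> p) + (H h \<bullet> c) * (H c \<bullet> p)))) (at x)"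
  proof -
    have 1: "((\<lambda>z. 1 + grad u z \<bullet> grad u z) has_derivative (\<lambda>h. 2 * (p \<bullet> H h))) (at x)"
      using has_derivative_add[OF has_derivative_const dpp, of 1] by simp
    have 2: "((\<lambda>z. \<Sum>c\<in>Basis. G c z \<bullet> c) has_derivative (\<lambda>h. \<Sum>c\<in>Basis. hess (partial_deriv c u) x h \<bullet> c)) (at x)"
      by (intro has_derivative_sum has_derivative_inner_left dG)
    have 3: "((\<lambda>z. \<Sum>c\<in>Basis. (grad u z \<bullet> c) * (G c z \<bullet> grad u z)) has_derivative
       (\<lambda>h. \<Sum>c\<in>Basis. (grad u x \<bullet> c) * (G c x \<bullet> H h + hess (partial_deriv c u) x h \<bullet> grad u x) + (H h \<bullet> c) * (G c x \<bullet> grad u x))) (at x)"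
      by (intro has_derivative_sum has_derivative_mult has_derivative_inner_left dp has_derivative_inner dG)
    have Gx: "G c x = H c" if "c \<in> Basis" for c using grad_partial[OF that] by (simp add: G_def)
    have 4: "(\<Sum>c\<in>Basis. (grad u x \<bullet> c) * (G c x \<bullet> H h + hess (partial_deriv c u) x h \<bullet> grad u x) + (H h \<bullet> c) * (G c x \<bullet> grad u x))
      = (\<Sum>c\<in>Basis. (p \<bullet> c) * (H c \<bullet> H h + hess (partial_deriv c u) x h \<bullet> p) + (H h \<bullet> c) * (H c \<bullet> p))" for h
      by (intro sum.cong) (auto simp: Gx p_def)
    have 5: "(\<Sum>c\<in>Basis. G c x \<bullet> c) = (\<Sum>c\<in>Basis. H c \<bullet> c)" by (intro sum.cong) (auto simp: Gx)
    show ?thesis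
      using has_derivative_diff[OF has_derivative_mult[OF 1 2] 3] unfolding 4 5 E_def[abs_def]
      unfolding p_def[symmetric] v_def slope_sq by (simp only: add.commute)
  qed
  have dv: "((\<lambda>z. slope (grad u z)) has_derivative (\<lambda>h. (p \<bullet> H h) / v)) (at x)"
    using has_derivative_slope[OF dp] by (simp add: p_def v_def)
  have dFd: "(F has_derivative (\<lambda>h. h \<bullet> dF)) (at x)" using dF by (simp add: gderiv_def)
  have dR: "((\<lambda>z. (1 + grad u z \<bullet> grad u z) * slope (grad u z) * F z) has_derivative
      (\<lambda>h. (v\<^sup>2 * v) * (h \<bullet> dF) + (v\<^sup>2 * ((p \<bullet> H h) / v) + (2 * (p \<bullet> H h)) * v) * F x)) (at x)"
    using has_derivative_mult[OF has_derivative_mult[OF has_derivative_add[OF has_derivative_const dpp, of 1] dv] dFd]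
    by (simp add: v_def slope_sq p_def)
  have "(E has_derivative (\<lambda>h. (v\<^sup>2 * v) * (h \<bullet> dF) + (v\<^sup>2 * ((p \<bullet> H h) / v) + (2 * (p \<bullet> H h)) * v) * F x)) (at x)"
    by (rule has_derivative_transform_within_open[OF dR S x]) (simp add: Eeq)
  from has_derivative_unique[OF dE this, THEN fun_cong, of b]
  have key: "2 * (p \<bullet> H b) * (\<Sum>c\<in>Basis. H c \<bullet> c) + v\<^sup>2 * (\<Sum>c\<in>Basis. hess (partial_deriv c u) x b \<bullet> c)
      - (\<Sum>c\<in>Basis. (p \<bullet> c) * (H c \<bullet> H b + hess (partial_deriv c u) x b \<bullet> p) + (H b \<bullet> c) * (H c \<bullet> p))
      = (v\<^sup>2 * v) * (b \<bullet> dF) + (v\<^sup>2 * ((p \<bullet> H b) / v) + (2 * (p \<bullet> H b)) * v) * F x" by simp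
  define T where "T = hess (partial_deriv b u) x"
  have linT: "linear T" unfolding T_def by (rule linear_hess)
  have T: "hess (partial_deriv c u) x b = T c" if "c \<in> Basis" for c
    unfolding T_def by (rule hess_partial_commute[OF S u x b that])
  have s1: "(\<Sum>c\<in>Basis. hess (partial_deriv c u) x b \<bullet> c) = (\<Sum>c\<in>Basis. T c \<bullet> c)"
    by (intro sum.cong) (auto simp: T)
  have "(\<Sum>c\<in>Basis. (p \<bullet> c) * (H c \<bullet> H b + hess (partial_deriv c u) x b \<bullet> p) + (H b \<bullet> c) * (H c \<bullet> p))
    = (\<Sum>c\<in>Basis. (p \<bullet> c) * (H c \<bullet> H b) + (p \<bullet> c) * (T c \<bullet> p) + (H b \<bullet> c) * (H c \<bullet> p))"
    by (intro sum.cong) (auto simp: T distrib_left)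
  also have "\<dots> = H p \<bullet> H b + T p \<bullet> p + H (H b) \<bullet> p"
    by (simp add: sum.distrib linear_inner_expand[OF linT] linear_inner_expand[OF linear_H])
  also have "\<dots> = 2 * (H b \<bullet> H p) + p \<bullet> T p"
    using H_symmetric[of "H b" p] by (simp add: inner_commute)
  finally have s2: "(\<Sum>c\<in>Basis. (p \<bullet> c) * (H c \<bullet> H b + hess (partial_deriv c u) x b \<bullet> p) + (H b \<bullet> c) * (H c \<bullet> p))
    = 2 * (H b \<bullet> H p) + p \<bullet> T p" .
  have tr: "(\<Sum>c\<in>Basis. H c \<bullet> c) = v * F x + (p \<bullet> H p) / v\<^sup>2"
    using eq[OF x] by (simp add: mc_trace_def p_def H_def v_def)
  define t where "t = (\<Sum>c\<in>Basis. T c \<bullet> c)"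
  have mt: "mc_trace p T = t - (p \<bullet> T p) / v\<^sup>2" by (simp add: mc_trace_def t_def v_def)
  have "v\<^sup>2 * mc_trace p T = v\<^sup>2 * t - p \<bullet> T p" unfolding mt by (simp add: right_diff_distrib)
  also have "\<dots> = v ^ 3 * (b \<bullet> dF) + 3 * v * (p \<bullet> H b) * F x + 2 * (H b \<bullet> H p) - 2 * (p \<bullet> H b) * (v * F x + (p \<bullet> H p) / v\<^sup>2)"
    using key unfolding s1 s2 tr t_def[symmetric] by (simp add: power2_eq_square power3_eq_cube algebra_simps)
  also have "\<dots> = v\<^sup>2 * (F x * (p \<bullet> H b) / v + v * (dF \<bullet> b) + 2 / v\<^sup>2 * aform p (H b) (H p))"
    unfolding aform_def v_def[symmetric]
    by (simp add: inner_commute[of b] inner_commute[of "H b" p] power2_eq_square power3_eq_cube algebra_simps)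
  finally show ?thesis unfolding T_def using v_pos(1) by simp
qed

lemma mc_jet_partial:
  assumes b: "b \<in> Basis"
  shows "mc_jet p (partial_deriv b u) x (H b) (F x * (p \<bullet> H b) / v + v * (dF \<bullet> b) + 2 / v\<^sup>2 * aform p (H b) (H p))"
  unfolding mc_jet_def
  using Ck_on_jet2[OF S Ck2_partial[OF b] x] differentiated_eq[OF b] grad_partial[OF b] by auto

lemma mc_jet_u: "mc_jet p u x p (v * F x)"
  unfolding mc_jet_def using Ck_on_jet2[OF S u2 x] eq[OF x] by (auto simp: p_def v_def)

lemma sum_l:
  "(\<Sum>b\<in>Basis. (k \<bullet> b) * (F x * (p \<bullet> H b) / v + v * (dF \<bullet> b) + 2 / v\<^sup>2 * aform p (H b) (H p)))
   = F x * v * (sigma p k \<bullet> y) + v * (dF \<bullet> k) + 2 * v * (B (sigma p k) \<bullet> y)"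
proof -
  define \<Lambda> where "\<Lambda> k = F x * (p \<bullet> H k) / v + v * (dF \<bullet> k) + 2 / v\<^sup>2 * aform p (H k) (H p)" for k
  have "linear \<Lambda>"
    by (rule linearI) (simp_all add: \<Lambda>_def aform_def linear_add[OF linear_H] linear_scale[OF linear_H]
      inner_add_left inner_add_right add_divide_distrib diff_divide_distrib algebra_simps)
  then have "(\<Sum>b\<in>Basis. (k \<bullet> b) * \<Lambda> b) = \<Lambda> k"
    using linear_inner_expand[of \<Lambda> k "1::real"] by simp
  also have "\<Lambda> k = F x * v * (sigma p k \<bullet> y) + v * (dF \<bullet> k) + 2 * v * (B (sigma p k) \<bullet> y)"
  proof -
    have "aform p (H k) (H p) = v\<^sup>2 * (v * (B (sigma p k) \<bullet> y))"
      unfolding aform_rho rho_H_p unfolding rho_H by (simp add: power2_eq_square)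
    then show ?thesis by (simp add: \<Lambda>_def p_H power2_eq_square)
  qed
  finally show ?thesis by (simp add: \<Lambda>_def)
qed

text \<open>Product rule for the sum of the squares of the partial derivatives. Two of the three
  |y|^2 come from the equations for these derivatives; the third comes, together with |B|^2, from
  the squares of their gradients.\<close>

lemma mc_jet_half_slope_sq:
  "mc_jet p (\<lambda>z. (slope (grad u z))\<^sup>2 / 2) x (H p)
     (F x * v\<^sup>2 * (p \<bullet> y) + v * (dF \<bullet> p) + 3 * v\<^sup>2 * (y \<bullet> y) + v\<^sup>2 * (hs_norm B)\<^sup>2)"
proof -
  define l where "l b = F x * (p \<bullet> H b) / v + v * (dF \<bullet> b) + 2 / v\<^sup>2 * aform p (H b) (H p)" for b
  have pb: "partial_deriv b u x = p \<bullet> b" if "b \<in> Basis" for b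
    using partial_deriv_eq_grad[OF that] by (simp add: p_def)
  have "mc_jet p (\<lambda>z. (1/2) * (1 + (\<Sum>b\<in>Basis. partial_deriv b u z * partial_deriv b u z))) x
     ((1/2) *\<^sub>R (0 + (\<Sum>b\<in>Basis. partial_deriv b u x *\<^sub>R H b + partial_deriv b u x *\<^sub>R H b)))
     ((1/2) * (0 + (\<Sum>b\<in>Basis. partial_deriv b u x * l b + partial_deriv b u x * l b + 2 * aform p (H b) (H b))))"
    unfolding l_def by (intro mc_jet_cmult mc_jet_add mc_jet_const mc_jet_sum mc_jet_mult mc_jet_partial)
  moreover have "(1/2) * (1 + (\<Sum>b\<in>Basis. partial_deriv b u z * partial_deriv b u z)) = (slope (grad u z))\<^sup>2 / 2" for z
    by (simp add: slope_sq euclidean_inner[of "grad u z" "grad u z"] partial_deriv_eq_grad)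
  moreover have "(1/2) *\<^sub>R (0 + (\<Sum>b\<in>Basis. partial_deriv b u x *\<^sub>R H b + partial_deriv b u x *\<^sub>R H b)) = H p"
  proof -
    have "(\<Sum>b\<in>Basis. partial_deriv b u x *\<^sub>R H b) = H (\<Sum>b\<in>Basis. (p \<bullet> b) *\<^sub>R b)"
      unfolding linear_sum[OF linear_H] linear_scale[OF linear_H] by (intro sum.cong) (auto simp: pb)
    then show ?thesis by (simp only: sum.distrib euclidean_representation) (simp add: scaleR_2[symmetric])
  qed
  moreover have "(1/2) * (0 + (\<Sum>b\<in>Basis. partial_deriv b u x * l b + partial_deriv b u x * l b + 2 * aform p (H b) (H b)))
      = F x * v\<^sup>2 * (p \<bullet> y) + v * (dF \<bullet> p) + 3 * v\<^sup>2 * (y \<bullet> y) + v\<^sup>2 * (hs_norm B)\<^sup>2"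
  proof -
    have "(\<Sum>b\<in>Basis. partial_deriv b u x * l b) = (\<Sum>b\<in>Basis. (p \<bullet> b) * l b)"
      by (intro sum.cong) (auto simp: pb)
    also have "\<dots> = F x * v\<^sup>2 * (p \<bullet> y) + v * (dF \<bullet> p) + 2 * v\<^sup>2 * (y \<bullet> y)"
      unfolding l_def sum_l sigma_self v_def[symmetric] linear_scale[OF linear_B] y_def
      by (simp add: power2_eq_square)
    finally have "(\<Sum>b\<in>Basis. partial_deriv b u x * l b) = F x * v\<^sup>2 * (p \<bullet> y) + v * (dF \<bullet> p) + 2 * v\<^sup>2 * (y \<bullet> y)" .
    then show ?thesis
      by (simp add: sum.distrib sum_distrib_left[symmetric] sum_aform_H) (simp add: algebra_simps)
  qed
  ultimately show ?thesis by (simp only:)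
qed

text \<open>For constant \<gamma> the result would be the differentiated equation contracted with
  \<gamma>. Q and E collect the derivatives of \<gamma>: they are of first order in v, and E is also
  linear in the norms of B and y, which makes both of lower order in the maximum principle.\<close>

lemma mc_jet_normal_component:
  fixes C :: real
  assumes \<gamma>: "\<And>b. b \<in> Basis \<Longrightarrow> mc_jet p (\<lambda>z. \<gamma> z \<bullet> b) x (D b) (l b)"
    and C: "\<And>b. b \<in> Basis \<Longrightarrow> norm (D b) \<le> C" "\<And>b. b \<in> Basis \<Longrightarrow> \<bar>l b\<bar> \<le> C"
  obtains Q E where
    "mc_jet p (\<lambda>z. grad u z \<bullet> \<gamma> z) x (H (\<gamma> x) + Q)
       (F x * v * (sigma p (\<gamma> x) \<bullet> y) + v * (dF \<bullet> \<gamma> x) + 2 * v * (B (sigma p (\<gamma> x)) \<bullet> y) + E)"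
    "norm Q \<le> DIM('a) * C * v" "\<bar>E\<bar> \<le> DIM('a) * C * v * (1 + 2 * (hs_norm B + norm y))"
proof
  define m where "m b = F x * (p \<bullet> H b) / v + v * (dF \<bullet> b) + 2 / v\<^sup>2 * aform p (H b) (H p)" for b
  define Q where "Q = (\<Sum>b\<in>Basis. (p \<bullet> b) *\<^sub>R D b)"
  define E where "E = (\<Sum>b\<in>Basis. (p \<bullet> b) * l b + 2 * aform p (H b) (D b))"
  have pb: "partial_deriv b u x = p \<bullet> b" if "b \<in> Basis" for b
    using partial_deriv_eq_grad[OF that] by (simp add: p_def)
  have pv: "\<bar>p \<bullet> b\<bar> \<le> v" if "b \<in> Basis" for b
    using Basis_le_norm[OF that, of p] norm_le_slope[of p] by (simp add: v_def)
  have "mc_jet p (\<lambda>z. \<Sum>b\<in>Basis. partial_deriv b u z * (\<gamma> z \<bullet> b)) x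
     (\<Sum>b\<in>Basis. partial_deriv b u x *\<^sub>R D b + (\<gamma> x \<bullet> b) *\<^sub>R H b)
     (\<Sum>b\<in>Basis. partial_deriv b u x * l b + (\<gamma> x \<bullet> b) * m b + 2 * aform p (H b) (D b))"
    unfolding m_def by (intro mc_jet_sum mc_jet_mult mc_jet_partial \<gamma>)
  moreover have "(\<Sum>b\<in>Basis. partial_deriv b u z * (\<gamma> z \<bullet> b)) = grad u z \<bullet> \<gamma> z" for z
    by (simp add: euclidean_inner[of "grad u z" "\<gamma> z"] partial_deriv_eq_grad)
  moreover have "(\<Sum>b\<in>Basis. partial_deriv b u x *\<^sub>R D b + (\<gamma> x \<bullet> b) *\<^sub>R H b) = H (\<gamma> x) + Q"
  proof -
    have "(\<Sum>b\<in>Basis. (\<gamma> x \<bullet> b) *\<^sub>R H b) = H (\<Sum>b\<in>Basis. (\<gamma> x \<bullet> b) *\<^sub>R b)"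
      by (simp only: linear_sum[OF linear_H] linear_scale[OF linear_H])
    moreover have "(\<Sum>b\<in>Basis. partial_deriv b u x *\<^sub>R D b) = Q"
      unfolding Q_def by (intro sum.cong) (auto simp: pb)
    ultimately show ?thesis by (simp add: sum.distrib euclidean_representation)
  qed
  moreover have "(\<Sum>b\<in>Basis. partial_deriv b u x * l b + (\<gamma> x \<bullet> b) * m b + 2 * aform p (H b) (D b))
     = F x * v * (sigma p (\<gamma> x) \<bullet> y) + v * (dF \<bullet> \<gamma> x) + 2 * v * (B (sigma p (\<gamma> x)) \<bullet> y) + E"
  proof -
    have "(\<Sum>b\<in>Basis. partial_deriv b u x * l b) = (\<Sum>b\<in>Basis. (p \<bullet> b) * l b)"
      by (intro sum.cong) (auto simp: pb)
    moreover have "(\<Sum>b\<in>Basis. (\<gamma> x \<bullet> b) * m b) = F x * v * (sigma p (\<gamma> x) \<bullet> y) + v * (dF \<bullet> \<gamma> x) + 2 * v * (B (sigma p (\<gamma> x)) \<bullet> y)"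
      unfolding m_def by (rule sum_l)
    ultimately show ?thesis by (simp add: E_def sum.distrib)
  qed
  ultimately show "mc_jet p (\<lambda>z. grad u z \<bullet> \<gamma> z) x (H (\<gamma> x) + Q)
       (F x * v * (sigma p (\<gamma> x) \<bullet> y) + v * (dF \<bullet> \<gamma> x) + 2 * v * (B (sigma p (\<gamma> x)) \<bullet> y) + E)" by simp
  have "norm Q \<le> (\<Sum>b\<in>(Basis::'a set). v * C)"
    unfolding Q_def
  proof (rule sum_norm_le)
    fix b :: 'a assume b: "b \<in> Basis"
    show "norm ((p \<bullet> b) *\<^sub>R D b) \<le> v * C" unfolding norm_scaleR by (intro mult_mono pv C b) (auto simp: less_imp_le)
  qed
  then show "norm Q \<le> DIM('a) * C * v" by (simp add: mult_ac)
  have a: "\<bar>aform p (H b) (D b)\<bar> \<le> v * C * (hs_norm B + norm y)" if b: "b \<in> Basis" for b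
  proof -
    have "norm (((p \<bullet> b) / (v + 1)) *\<^sub>R y) \<le> 1 * norm y"
      unfolding norm_scaleR using pv[OF b] v_ge_1 by (intro mult_right_mono) (auto simp: abs_divide)
    then have "norm (B (sigma p b)) \<le> hs_norm B + norm y"
      unfolding B_sigma using norm_triangle_ineq[of "B b" "((p \<bullet> b) / (v + 1)) *\<^sub>R y"] norm_le_hs_norm_Basis[OF b, of B] by linarith
    moreover have "norm (rho p (D b)) \<le> C" using norm_rho_le[of p "D b"] C(1)[OF b] by linarith
    ultimately have "norm (B (sigma p b)) * norm (rho p (D b)) \<le> (hs_norm B + norm y) * C"
      by (intro mult_mono) (auto intro: add_nonneg_nonneg hs_norm_nonneg)
    then have "\<bar>B (sigma p b) \<bullet> rho p (D b)\<bar> \<le> (hs_norm B + norm y) * C"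
      using Cauchy_Schwarz_ineq2[of "B (sigma p b)" "rho p (D b)"] by linarith
    then have "v * \<bar>B (sigma p b) \<bullet> rho p (D b)\<bar> \<le> v * ((hs_norm B + norm y) * C)"
      by (intro mult_left_mono) (auto simp: less_imp_le)
    moreover have "\<bar>aform p (H b) (D b)\<bar> = v * \<bar>B (sigma p b) \<bullet> rho p (D b)\<bar>"
      by (simp add: aform_rho rho_H abs_mult abs_of_pos[OF v_pos(1)])
    ultimately show ?thesis by (simp add: mult_ac)
  qed
  have "\<bar>E\<bar> \<le> (\<Sum>b\<in>(Basis::'a set). v * C + 2 * (v * C * (hs_norm B + norm y)))"
    unfolding E_def
  proof (rule order_trans[OF sum_abs sum_mono])
    fix b :: 'a assume b: "b \<in> Basis"
    have "\<bar>(p \<bullet> b) * l b\<bar> \<le> v * C" unfolding abs_mult by (intro mult_mono pv C b) auto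
    then show "\<bar>(p \<bullet> b) * l b + 2 * aform p (H b) (D b)\<bar> \<le> v * C + 2 * (v * C * (hs_norm B + norm y))"
      using a[OF b] by linarith
  qed
  then show "\<bar>E\<bar> \<le> DIM('a) * C * v * (1 + 2 * (hs_norm B + norm y))"
    by (simp add: algebra_simps)
qed

end

section \<open>From the divergence form of the equation to the pointwise setting\<close>

lemma divergence_normal:
  fixes u :: "'a::euclidean_space \<Rightarrow> real"
  assumes "open S" "Ck_on 2 S u" "x \<in> S"
  shows "divergence (\<lambda>y. grad u y /\<^sub>R sqrt (1 + (norm (grad u y))\<^sup>2)) x
    = mc_trace (grad u x) (hess u x) / slope (grad u x)"
proof -
  define p H v where "p = grad u x" and "H = hess u x" and "v = slope p"
  have v: "v > 0" by (simp add: v_def)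
  have dp: "(grad u has_derivative H) (at x)" unfolding H_def by (rule grad_has_derivative[OF assms])
  have di: "((\<lambda>z. inverse (slope (grad u z))) has_derivative (\<lambda>h. - (inverse v * ((p \<bullet> H h) / v) * inverse v))) (at x)"
    using Deriv.has_derivative_inverse[OF _ has_derivative_slope[OF dp]] by (simp add: p_def v_def)
  have "((\<lambda>y. grad u y /\<^sub>R sqrt (1 + (norm (grad u y))\<^sup>2)) has_derivative
     (\<lambda>h. inverse v *\<^sub>R H h + (- (inverse v * ((p \<bullet> H h) / v) * inverse v)) *\<^sub>R p)) (at x)"
    using has_derivative_scaleR[OF di dp] by (simp add: p_def v_def slope_def power2_norm_eq_inner)
  note fd = frechet_derivative_at[OF this, symmetric]
  have "divergence (\<lambda>y. grad u y /\<^sub>R sqrt (1 + (norm (grad u y))\<^sup>2)) x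
     = (\<Sum>b\<in>Basis. inverse v * (H b \<bullet> b) - (1 / v ^ 3) * ((p \<bullet> b) * (H b \<bullet> p)))"
    unfolding divergence_def fd
  proof (intro sum.cong refl)
    fix b :: 'a
    have "inverse v * ((p \<bullet> H b) / v) * inverse v * (p \<bullet> b) = (1 / v ^ 3) * ((p \<bullet> b) * (H b \<bullet> p))"
      by (simp only: inner_commute[of "H b" p] divide_inverse power3_eq_cube inverse_mult_distrib mult_1_left mult_ac)
    then show "(inverse v *\<^sub>R H b + - (inverse v * ((p \<bullet> H b) / v) * inverse v) *\<^sub>R p) \<bullet> b
       = inverse v * (H b \<bullet> b) - (1 / v ^ 3) * ((p \<bullet> b) * (H b \<bullet> p))"
      by (simp only: inner_add_left inner_scaleR_left mult_minus_left)
  qed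
  also have "\<dots> = inverse v * (\<Sum>b\<in>Basis. H b \<bullet> b) - (1 / v ^ 3) * (p \<bullet> H p)"
    unfolding sum_subtractf sum_distrib_left[symmetric] H_def linear_inner_expand[OF linear_hess]
    by (simp add: inner_commute)
  also have "\<dots> = mc_trace p H / v"
    using v by (simp add: mc_trace_def v_def[symmetric] field_simps power3_eq_cube power2_eq_square)
  finally show ?thesis by (simp add: p_def H_def v_def)
qed

lemma continuous_on_grad:
  assumes "Ck_on 1 S f" shows "continuous_on S (grad f)"
  unfolding grad_def[abs_def]
  using assms by (intro continuous_intros) (auto simp: Ck_on_Suc Ck_on_0)

lemma grad_ext_open:
  assumes "open S" "Ck_on 1 S f" "x \<in> S"
  shows "grad_ext S f x = grad f x"
proof -
  have "at x within S = at x" by (rule at_within_open[OF assms(3,1)])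
  moreover have "(grad f \<longlongrightarrow> grad f x) (at x)"
    using continuous_on_grad[OF assms(2)] assms(1,3)
    by (simp add: continuous_on_eq_continuous_at isCont_def)
  ultimately show ?thesis unfolding grad_ext_def by (simp add: tendsto_Lim)
qed

lemma GDERIV_along_graph:
  fixes f :: "'a::euclidean_space \<times> real \<Rightarrow> real"
  assumes "f differentiable (at (x, u x))" "GDERIV u x :> p"
  shows "GDERIV (\<lambda>y. f (y, u y)) x :> fst (grad f (x, u x)) + snd (grad f (x, u x)) *\<^sub>R p"
proof -
  have "((\<lambda>y. (y, u y)) has_derivative (\<lambda>h. (h, h \<bullet> p))) (at x)"
    using assms(2) unfolding gderiv_def by (intro has_derivative_Pair has_derivative_ident)
  from has_derivative_compose[OF this GDERIV_grad[OF assms(1), unfolded gderiv_def]]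
  show ?thesis by (simp add: gderiv_def inner_prod_def inner_add_right mult.commute)
qed

lemma GDERIV_local_max_zero:
  assumes "GDERIV g x :> D" "\<forall>\<^sub>F y in nhds x. g y \<le> g x"
  shows "D = 0"
proof -
  obtain d where d: "d > 0" "\<And>y. dist y x < d \<Longrightarrow> g y \<le> g x"
    using assms(2) unfolding eventually_nhds_metric by blast
  have "(\<lambda>h. h \<bullet> D) = (\<lambda>h. 0)"
    by (rule differential_zero_maxmin[of x "ball x d" g])
      (use assms(1) d in \<open>auto simp: gderiv_def dist_commute\<close>)
  then show ?thesis by (metis inner_eq_zero_iff)
qed

definition mc_solution ::
    "'a::euclidean_space set \<Rightarrow> real \<Rightarrow> real \<Rightarrow> ('a \<times> real \<Rightarrow> real) \<Rightarrow> ('a \<Rightarrow> real) \<Rightarrow> bool" where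
  "mc_solution \<Omega> M\<^sub>0 L\<^sub>1 f u \<longleftrightarrow> open \<Omega> \<and> admissible_rhs \<Omega> M\<^sub>0 L\<^sub>1 f \<and> Ck_on 3 \<Omega> u \<and>
     (\<forall>x\<in>\<Omega>. \<bar>u x\<bar> \<le> M\<^sub>0) \<and> mean_curvature_eq \<Omega> f u"

text \<open>Where \<open>|u| = M\<^sub>0\<close> the right-hand side need not be differentiable, but there \<open>u\<close> is
  extremal and its gradient vanishes.\<close>

lemma mc_solution_graph:
  fixes u :: "'a::euclidean_space \<Rightarrow> real"
  assumes sol: "mc_solution \<Omega> M\<^sub>0 L\<^sub>1 f u" and x: "x \<in> \<Omega>" and p: "grad u x \<noteq> 0"
  obtains fx fz where "mc_graph \<Omega> u (\<lambda>y. f (y, u y)) x (fx + fz *\<^sub>R grad u x)"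
    "fz \<ge> 0" "norm fx \<le> L\<^sub>1" "\<bar>f (x, u x)\<bar> \<le> L\<^sub>1"
proof -
  note s = sol[unfolded mc_solution_def]
  have op: "open \<Omega>" and C3: "Ck_on 3 \<Omega> u" and uM: "\<And>y. y \<in> \<Omega> \<Longrightarrow> \<bar>u y\<bar> \<le> M\<^sub>0"
    and eq: "mean_curvature_eq \<Omega> f u" and adm: "admissible_rhs \<Omega> M\<^sub>0 L\<^sub>1 f"
    using s by auto
  have C2: "Ck_on 2 \<Omega> u" using C3 by (rule Ck_on_mono) simp
  have gu: "GDERIV u x :> grad u x"
    using Ck_on_GDERIV[of 2 \<Omega> u x] C3 x by (simp add: numeral_3_eq_3 numeral_2_eq_2)
  have ev: "\<forall>\<^sub>F y in nhds x. \<bar>u y\<bar> \<le> M\<^sub>0"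
    using eventually_nhds_in_open[OF op x] by eventually_elim (rule uM)
  have "u x < M\<^sub>0"
  proof (rule ccontr)
    assume "\<not> u x < M\<^sub>0"
    then have "\<forall>\<^sub>F y in nhds x. u y \<le> u x" using ev by (elim eventually_mono) auto
    from GDERIV_local_max_zero[OF gu this] p show False by simp
  qed
  moreover have "- M\<^sub>0 < u x"
  proof (rule ccontr)
    assume "\<not> - M\<^sub>0 < u x"
    then have "\<forall>\<^sub>F y in nhds x. - u y \<le> - u x" using ev by (elim eventually_mono) auto
    from GDERIV_local_max_zero[OF GDERIV_minus[OF gu] this] p show False by simp
  qed
  ultimately have ux: "u x \<in> {- M\<^sub>0<..<M\<^sub>0}" by simp
  define Q where "Q = \<Omega> \<times> {- M\<^sub>0<..<M\<^sub>0}"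
  have Q: "open Q" "(x, u x) \<in> Q" using op ux x by (auto simp: Q_def open_Times)
  have fQ: "Ck_on 1 Q f" using adm by (simp add: admissible_rhs_def Let_def Ck_closure_def Q_def)
  have ge: "grad_ext Q f (x, u x) = grad f (x, u x)" by (rule grad_ext_open[OF Q(1) fQ Q(2)])
  have fd: "f differentiable (at (x, u x))" using fQ Q(2) by (simp add: Ck_on_Suc)
  define fx fz where "fx = fst (grad f (x, u x))" and "fz = snd (grad f (x, u x))"
  have b: "fz \<ge> 0" "\<bar>f (x, u x)\<bar> + norm fx \<le> L\<^sub>1"
  proof -
    have "x \<in> closure \<Omega>" using x closure_subset by blast
    moreover have "u x \<in> {-M\<^sub>0..M\<^sub>0}" using ux by simp
    ultimately have "snd (grad_ext Q f (x, u x)) \<ge> 0 \<and> \<bar>f (x, u x)\<bar> + norm (fst (grad_ext Q f (x, u x))) \<le> L\<^sub>1"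
      using adm unfolding admissible_rhs_def Let_def Q_def by blast
    then show "fz \<ge> 0" "\<bar>f (x, u x)\<bar> + norm fx \<le> L\<^sub>1" unfolding ge fx_def fz_def by auto
  qed
  have "mc_graph \<Omega> u (\<lambda>y. f (y, u y)) x (fx + fz *\<^sub>R grad u x)"
  proof
    fix y assume y: "y \<in> \<Omega>"
    then have "mc_trace (grad u y) (hess u y) / slope (grad u y) = f (y, u y)"
      using eq divergence_normal[OF op C2 y] by (simp add: mean_curvature_eq_def)
    then show "mc_trace (grad u y) (hess u y) = slope (grad u y) * f (y, u y)"
      by (metis mult.commute nonzero_eq_divide_eq slope_pos(2))
  qed (use op C3 x GDERIV_along_graph[OF fd gu] in \<open>auto simp: fx_def fz_def\<close>)
  then show thesis
  proof (rule that)
    show "norm fx \<le> L\<^sub>1" "\<bar>f (x, u x)\<bar> \<le> L\<^sub>1" using b(2) norm_ge_zero[of fx] by linarith+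
  qed (use b in auto)
qed

section \<open>The interior gradient estimate\<close>

lemma DERIV_ln_twice:
  "t \<in> {0<..} \<Longrightarrow> (ln has_real_derivative inverse t) (at t)"
  "0 < t \<Longrightarrow> (inverse has_real_derivative - (inverse t)\<^sup>2) (at t)"
  for t :: real
  using DERIV_inverse[of t UNIV] by (auto intro: DERIV_ln simp: numeral_2_eq_2)

lemma mc_jet_ln:
  assumes "mc_jet p f x D l" "f x > 0"
  shows "mc_jet p (\<lambda>y. ln (f y)) x (inverse (f x) *\<^sub>R D) (inverse (f x) * l - (inverse (f x))\<^sup>2 * aform p D D)"
  using mc_jet_compose[OF assms(1) open_greaterThan, of 0 ln inverse "- (inverse (f x))\<^sup>2"] assms(2)
    DERIV_ln_twice by simp

text \<open>The gradient condition reads y = - rho p D, so |y|^2 is the squared gradient of \<Psi>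
  on the graph. The Laplacian of \<Psi> on the graph is l - F (p . D) / v; the first three terms are
  thus the Laplacian of exp \<Psi> divided by exp \<Psi>. The nonnegative |B|^2 is
  discarded.\<close>

lemma (in mc_graph) local_max_log_slope:
  assumes \<Psi>: "mc_jet p \<Psi> x D l"
    and m: "\<forall>\<^sub>F z in nhds x. ln (slope (grad u z)) + \<Psi> z \<le> ln (slope (grad u x)) + \<Psi> x"
  shows "aform p D D + l - F x * (p \<bullet> D) / v + (dF \<bullet> p) / v \<le> 0"
proof -
  define m0 where "m0 = (slope (grad u x))\<^sup>2 / 2"
  have m0: "m0 = v\<^sup>2 / 2" by (simp add: m0_def v_def p_def)
  define Lm where "Lm = F x * v\<^sup>2 * (p \<bullet> y) + v * (dF \<bullet> p) + 3 * v\<^sup>2 * (y \<bullet> y) + v\<^sup>2 * (hs_norm B)\<^sup>2"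
  have "m0 > 0" unfolding m0 using v_pos(1) by (simp del: v_pos)
  then have 1: "mc_jet p (\<lambda>z. (1/2) * ln ((slope (grad u z))\<^sup>2 / 2) + \<Psi> z) x
     ((1/2) *\<^sub>R (inverse m0 *\<^sub>R H p) + D) ((1/2) * (inverse m0 * Lm - (inverse m0)\<^sup>2 * aform p (H p) (H p)) + l)"
    unfolding Lm_def m0_def by (intro mc_jet_add mc_jet_cmult mc_jet_ln mc_jet_half_slope_sq \<Psi>) simp
  \<comment> \<open>The logarithm of v is taken as half the logarithm of v^2 / 2, whose jet is
    known; the constant cancels in the comparison.\<close>
  have lnq: "(1/2) * ln ((slope (grad u z))\<^sup>2 / 2) = ln (slope (grad u z)) - ln 2 / 2" for z
    by (simp add: ln_div ln_realpow)
  have 2: "\<forall>\<^sub>F z in nhds x. (1/2) * ln ((slope (grad u z))\<^sup>2 / 2) + \<Psi> z \<le> (1/2) * ln ((slope (grad u x))\<^sup>2 / 2) + \<Psi> x"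
    unfolding lnq using m by (elim eventually_mono) simp
  have D: "(1/2) *\<^sub>R (inverse m0 *\<^sub>R H p) + D = 0" by (rule mc_jet_local_max(1)[OF 1 2])
  have L: "(1/2) * (inverse m0 * Lm - (inverse m0)\<^sup>2 * aform p (H p) (H p)) + l \<le> 0"
    by (rule mc_jet_local_max(2)[OF 1 2])
  have "rho p ((1 / v\<^sup>2) *\<^sub>R H p + D) = 0"
    using D by (simp add: m0 linear_0[OF linear_rho])
  then have "y + rho p D = 0"
    by (simp add: linear_add[OF linear_rho] linear_scale[OF linear_rho] rho_H_p)
  then have y: "y = - rho p D" by (simp add: eq_neg_iff_add_eq_0)
  have yy: "y \<bullet> y = aform p D D" by (simp add: y aform_rho)
  have py: "p \<bullet> y = - (p \<bullet> D) / v"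
    by (simp add: y rho_symmetric[symmetric] rho_self v_def)
  have ah: "aform p (H p) (H p) = v\<^sup>2 * v\<^sup>2 * (y \<bullet> y)" unfolding aform_rho rho_H_p by simp
  have "(1/2) * (inverse m0 * Lm - (inverse m0)\<^sup>2 * aform p (H p) (H p)) = F x * (p \<bullet> y) + (dF \<bullet> p) / v + y \<bullet> y + (hs_norm B)\<^sup>2"
    unfolding ah Lm_def m0 by (simp add: field_simps power2_eq_square)
  then show ?thesis using L unfolding yy py by (smt (verit) minus_mult_right times_divide_eq_right zero_le_power2 minus_divide_left)
qed

lemma mc_jet_dist_sq: "mc_jet p (\<lambda>z. (z - a) \<bullet> (z - a)) x (2 *\<^sub>R (x - a)) (2 * (DIM('a) - (p \<bullet> p) / (slope p)\<^sup>2))"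
  for a :: "'a::euclidean_space"
proof -
  have "jet2 (\<lambda>z. (z - a) \<bullet> (z - a)) x (2 *\<^sub>R (x - a)) (\<lambda>h. 2 *\<^sub>R h)"
    by (rule jet2I[where S=UNIV and G="\<lambda>z. 2 *\<^sub>R (z - a)"])
      (auto simp: gderiv_def inner_commute intro!: derivative_eq_intros)
  moreover have "mc_trace p (\<lambda>h. 2 *\<^sub>R h) = 2 * (DIM('a) - (p \<bullet> p) / (slope p)\<^sup>2)"
    by (simp add: mc_trace_def algebra_simps)
  ultimately show ?thesis unfolding mc_jet_def by blast
qed

lemma mc_jet_exp_minus_1:
  assumes "mc_jet p f x D l"
  shows "mc_jet p (\<lambda>y. exp (K * f y) - 1) x ((K * exp (K * f x)) *\<^sub>R D)
     (K * exp (K * f x) * l + K\<^sup>2 * exp (K * f x) * aform p D D)"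
  by (rule mc_jet_compose[OF assms open_UNIV, where h="\<lambda>t. exp (K * t) - 1" and h'="\<lambda>t. K * exp (K * t)"])
    (auto intro!: derivative_eq_intros simp: power2_eq_square)

text \<open>For large v the gradient of u on the graph has length close to 1. Hence the squared
  gradient of \<phi> stays above 1 / (8 M_0^2), and the K^2 term from differentiating the
  exponential dominates everything that is merely bounded.\<close>

theorem interior_gradient_bound:
  assumes pos: "0 < M\<^sub>0" "0 < L\<^sub>1" "0 < r"
  shows "\<exists>C>0. \<forall>(\<Omega> :: 'a::euclidean_space set) f u x\<^sub>0.
     mc_solution \<Omega> M\<^sub>0 L\<^sub>1 f u \<and> cball x\<^sub>0 r \<subseteq> \<Omega> \<longrightarrow> slope (grad u x\<^sub>0) \<le> C"
proof -
  define n where "n = real DIM('a)"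
  \<comment> \<open>The Laplacian of \<phi> on the graph is at least - c. The summands come from u,
    from the second derivatives of |x - x_0|^2, and from the mean curvature times the derivative of
    |x - x_0|^2.\<close>
  define c where "c = L\<^sub>1 / (2 * M\<^sub>0) + 4 * n / r\<^sup>2 + 4 * L\<^sub>1 / r"
  \<comment> \<open>Gives K / (8 M_0^2) - c \<ge> L_1 + 1, one more than the loss L_1 caused by the
    x-derivative of f; the final summand ensures K \<ge> 1.\<close>
  define K where "K = 8 * M\<^sub>0\<^sup>2 * (c + L\<^sub>1 + 1) + 1"
  \<comment> \<open>v \<ge> 2 gives 1 - 1 / v^2 \<ge> 3/4, and v \<ge> 64 M_0 / r makes the mixed
    term of u and |x - x_0|^2 at most 1 / (16 M_0^2). The difference of 3/16 and 1/16 is the 1/8 in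
    K.\<close>
  define V where "V = max 2 (64 * M\<^sub>0 / r)"
  have c0: "c > 0" unfolding c_def n_def using pos by (intro add_nonneg_pos add_pos_nonneg) auto
  have K1: "K \<ge> 1" unfolding K_def using pos c0 by simp
  have Kc: "K / (8 * M\<^sub>0\<^sup>2) - c \<ge> L\<^sub>1 + 1"
    unfolding K_def using pos by (simp add: field_simps)
  have V2: "V \<ge> 2" "V \<ge> 64 * M\<^sub>0 / r" by (auto simp: V_def)
  show ?thesis
  proof (intro exI[of _ "V * exp (3 * K / 2) / (exp (K / 2) - 1)"] conjI allI impI)
    have "exp (K / 2) > 1" using K1 by simp
    then show "0 < V * exp (3 * K / 2) / (exp (K / 2) - 1)" using V2 by (intro divide_pos_pos mult_pos_pos) auto
    fix \<Omega> :: "'a set" and f u x\<^sub>0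
    assume A: "mc_solution \<Omega> M\<^sub>0 L\<^sub>1 f u \<and> cball x\<^sub>0 r \<subseteq> \<Omega>"
    then have sol: "mc_solution \<Omega> M\<^sub>0 L\<^sub>1 f u" and sub: "cball x\<^sub>0 r \<subseteq> \<Omega>" by auto
    have C3: "Ck_on 3 \<Omega> u" and op: "open \<Omega>" and uM: "\<And>y. y \<in> \<Omega> \<Longrightarrow> \<bar>u y\<bar> \<le> M\<^sub>0"
      using sol by (auto simp: mc_solution_def)
    define \<phi> where "\<phi> z = 1 + (1 / (2 * M\<^sub>0)) * u z + (- 2 / r\<^sup>2) * ((z - x\<^sub>0) \<bullet> (z - x\<^sub>0))" for z
    define \<eta> where "\<eta> z = exp (K * \<phi> z) - 1" for z
    have cu: "continuous_on \<Omega> u" by (rule Ck_on_imp_continuous[OF C3])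
    have cp: "continuous_on \<Omega> (grad u)" by (rule continuous_on_grad, rule Ck_on_mono[OF C3]) simp
    have c\<phi>: "continuous_on \<Omega> \<phi>" unfolding \<phi>_def by (intro continuous_intros cu)
    have cs: "continuous_on \<Omega> (\<lambda>z. slope (grad u z))" unfolding slope_def by (intro continuous_intros cp)
    have "continuous_on (cball x\<^sub>0 r) (\<lambda>z. slope (grad u z) * \<eta> z)"
      unfolding \<eta>_def by (rule continuous_on_subset[OF _ sub]) (intro continuous_intros cs c\<phi>)
    then obtain x where x: "x \<in> cball x\<^sub>0 r" and xmax: "\<And>z. z \<in> cball x\<^sub>0 r \<Longrightarrow> slope (grad u z) * \<eta> z \<le> slope (grad u x) * \<eta> x"
      using continuous_attains_sup[OF compact_cball, of x\<^sub>0 r "\<lambda>z. slope (grad u z) * \<eta> z"] pos(3) by (auto simp: cball_eq_empty)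
    have x0: "x\<^sub>0 \<in> cball x\<^sub>0 r" using pos by simp
    have uh: "\<bar>(1 / (2 * M\<^sub>0)) * u z\<bar> \<le> 1/2" if "z \<in> \<Omega>" for z
      using uM[OF that] pos(1) by (simp add: abs_mult field_simps)
    have "\<bar>(1 / (2 * M\<^sub>0)) * u x\<^sub>0\<bar> \<le> 1/2" using uh sub x0 by blast
    then have "\<phi> x\<^sub>0 \<ge> 1/2" unfolding \<phi>_def by (simp only: abs_le_iff) simp
    then have "K * \<phi> x\<^sub>0 \<ge> K * (1/2)" using K1 by (intro mult_left_mono) auto
    then have e0: "\<eta> x\<^sub>0 \<ge> exp (K / 2) - 1" by (simp add: \<eta>_def)
    have e0p: "exp (K / 2) - 1 > 0" using K1 by simp
    have "\<eta> x\<^sub>0 > 0" using e0 e0p by linarith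
    then have "0 < slope (grad u x\<^sub>0) * \<eta> x\<^sub>0" by simp
    also have "\<dots> \<le> slope (grad u x) * \<eta> x" by (rule xmax[OF x0])
    finally have ex: "\<eta> x > 0" using zero_less_mult_pos slope_pos(1) by blast
    then have \<phi>x: "\<phi> x > 0" using K1 by (simp add: \<eta>_def zero_less_mult_iff)
    have x\<Omega>: "x \<in> \<Omega>" using x sub by blast
    \<comment> \<open>On the sphere \<phi> is at most 1 + 1/2 - 2 < 0, so a maximum with \<eta> > 0
      lies in the open ball.\<close>
    have xr: "norm (x - x\<^sub>0) < r"
    proof (rule ccontr)
      assume "\<not> norm (x - x\<^sub>0) < r"
      then have "r\<^sup>2 \<le> (x - x\<^sub>0) \<bullet> (x - x\<^sub>0)" using pos(3) by (simp add: power2_norm_eq_inner[symmetric] power_mono)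
      then have "2 \<le> (2 / r\<^sup>2) * ((x - x\<^sub>0) \<bullet> (x - x\<^sub>0))" using pos(3) by (simp add: field_simps)
      moreover have "(- 2 / r\<^sup>2) * ((x - x\<^sub>0) \<bullet> (x - x\<^sub>0)) = - ((2 / r\<^sup>2) * ((x - x\<^sub>0) \<bullet> (x - x\<^sub>0)))" by simp
      ultimately show False using \<phi>x uh[OF x\<Omega>] unfolding \<phi>_def by linarith
    qed
    have \<phi>le: "\<phi> x \<le> 3/2"
    proof -
      have "(- 2 / r\<^sup>2) * ((x - x\<^sub>0) \<bullet> (x - x\<^sub>0)) \<le> 0" by (simp add: divide_nonpos_nonneg mult_nonpos_nonneg)
      then show ?thesis using uh[OF x\<Omega>] unfolding \<phi>_def by (simp only: abs_le_iff) linarith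
    qed
    have vV: "slope (grad u x) < V"
    proof (rule ccontr)
      assume "\<not> slope (grad u x) < V"
      then have vx: "slope (grad u x) \<ge> V" by simp
      then have "grad u x \<noteq> 0" using V2 by (auto simp: slope_def)
      then obtain fx fz where g: "mc_graph \<Omega> u (\<lambda>y. f (y, u y)) x (fx + fz *\<^sub>R grad u x)"
        and fz: "fz \<ge> 0" and fx: "norm fx \<le> L\<^sub>1" and fb: "\<bar>f (x, u x)\<bar> \<le> L\<^sub>1"
        using mc_solution_graph[OF sol x\<Omega>] by metis
      interpret mc_graph \<Omega> u "\<lambda>y. f (y, u y)" x "fx + fz *\<^sub>R grad u x" by (rule g)
      have v: "v \<ge> V" using vx by (simp add: v_def p_def)
      define F where "F = f (x, u x)"
      define \<xi> where "\<xi> = x - x\<^sub>0"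
      define D where "D = (1 / (2 * M\<^sub>0)) *\<^sub>R p + (- 2 / r\<^sup>2) *\<^sub>R (2 *\<^sub>R \<xi>)"
      define l where "l = (1 / (2 * M\<^sub>0)) * (v * F) + (- 2 / r\<^sup>2) * (2 * (n - (p \<bullet> p) / v\<^sup>2))"
      have "mc_jet p \<phi> x (0 + (1 / (2 * M\<^sub>0)) *\<^sub>R p + (- 2 / r\<^sup>2) *\<^sub>R (2 *\<^sub>R (x - x\<^sub>0)))
         (0 + (1 / (2 * M\<^sub>0)) * (v * f (x, u x)) + (- 2 / r\<^sup>2) * (2 * (DIM('a) - (p \<bullet> p) / (slope p)\<^sup>2)))"
        unfolding \<phi>_def by (intro mc_jet_add mc_jet_cmult mc_jet_const mc_jet_u mc_jet_dist_sq)
      then have j\<phi>: "mc_jet p \<phi> x D l" by (simp add: D_def l_def \<xi>_def F_def n_def v_def)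
      define e where "e = exp (K * \<phi> x)"
      define E where "E = (K * e) *\<^sub>R D"
      define m where "m = K * e * l + K\<^sup>2 * e * aform p D D"
      have "mc_jet p \<eta> x E m" unfolding \<eta>_def E_def m_def e_def by (rule mc_jet_exp_minus_1[OF j\<phi>])
      then have jl: "mc_jet p (\<lambda>z. ln (\<eta> z)) x (inverse (\<eta> x) *\<^sub>R E) (inverse (\<eta> x) * m - (inverse (\<eta> x))\<^sup>2 * aform p E E)"
        by (rule mc_jet_ln) (rule ex)
      have ev: "\<forall>\<^sub>F z in nhds x. z \<in> ball x\<^sub>0 r \<and> \<eta> z > 0"
      proof -
        have "isCont \<eta> x"
          using c\<phi> x\<Omega> op unfolding \<eta>_def continuous_on_eq_continuous_at[OF op] by (intro continuous_intros) auto
        then have "\<forall>\<^sub>F z in nhds x. \<eta> z > 0"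
          using ex unfolding continuous_at tendsto_at_iff_tendsto_nhds by (rule order_tendstoD(1))
        moreover have "\<forall>\<^sub>F z in nhds x. z \<in> ball x\<^sub>0 r"
          by (rule eventually_nhds_in_open) (use xr in \<open>auto simp: dist_norm norm_minus_commute\<close>)
        ultimately show ?thesis by eventually_elim auto
      qed
      have "\<forall>\<^sub>F z in nhds x. ln (slope (grad u z)) + ln (\<eta> z) \<le> ln (slope (grad u x)) + ln (\<eta> x)"
        using ev
      proof eventually_elim
        case (elim z)
        then have "ln (slope (grad u z) * \<eta> z) \<le> ln (slope (grad u x) * \<eta> x)"
          using xmax[of z] ex by (subst ln_le_cancel_iff) auto
        then show ?case using elim ex by (simp add: ln_mult)
      qed
      note L = local_max_log_slope[OF jl this]
      have e1: "F * (p \<bullet> (inverse (\<eta> x) *\<^sub>R E)) / v = inverse (\<eta> x) * (F * (p \<bullet> E) / v)" by simp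
      have e2: "aform p (inverse (\<eta> x) *\<^sub>R E) (inverse (\<eta> x) *\<^sub>R E) = (inverse (\<eta> x))\<^sup>2 * aform p E E"
        by (simp add: aform_def power2_eq_square algebra_simps)
      have L1: "inverse (\<eta> x) * (m - F * (p \<bullet> E) / v) + ((fx + fz *\<^sub>R p) \<bullet> p) / v \<le> 0"
        using L unfolding F_def[symmetric] p_def[symmetric] e1 e2 by (simp only: right_diff_distrib)
      \<comment> \<open>The condition f_z \<ge> 0 disposes of the contribution of order v.\<close>
      have "((fx + fz *\<^sub>R p) \<bullet> p) / v \<ge> - L\<^sub>1"
      proof -
        have "\<bar>fx \<bullet> p\<bar> \<le> L\<^sub>1 * v"
          using Cauchy_Schwarz_ineq2[of fx p] mult_mono[OF fx norm_le_slope[of p]] pos by (simp add: v_def)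
        then have "(fx + fz *\<^sub>R p) \<bullet> p \<ge> - L\<^sub>1 * v"
          using mult_nonneg_nonneg[OF fz inner_ge_zero[of p]]
          unfolding inner_add_left inner_scaleR_left by linarith
        then show ?thesis using v_pos(1) by (simp add: pos_le_divide_eq)
      qed
      then have "inverse (\<eta> x) * (m - F * (p \<bullet> E) / v) \<le> L\<^sub>1" using L1 by linarith
      then have L2: "m - F * (p \<bullet> E) / v \<le> L\<^sub>1 * \<eta> x" using ex by (simp add: field_simps)
      have mE: "m - F * (p \<bullet> E) / v = K * e * (l - F * (p \<bullet> D) / v + K * aform p D D)"
        by (simp add: m_def E_def power2_eq_square algebra_simps)
      have pp: "p \<bullet> p = v\<^sup>2 - 1" using slope_sq[of p] by (simp add: v_def)
      have px: "\<bar>p \<bullet> \<xi>\<bar> \<le> v * r"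
        using Cauchy_Schwarz_ineq2[of p \<xi>] mult_mono[OF norm_le_slope[of p] less_imp_le[OF xr]] pos
        by (simp add: \<xi>_def v_def less_imp_le)
      \<comment> \<open>The operator applied to u is v F, but v F and F (p . p) / v cancel up to F /
        v, the Laplacian of u on the graph. No term growing with v survives.\<close>
      have lower1: "l - F * (p \<bullet> D) / v \<ge> - c"
      proof -
        have "F * (p \<bullet> D) / v = F * (v - 1/v) / (2 * M\<^sub>0) - (4 * F / r\<^sup>2) * ((p \<bullet> \<xi>) / v)"
          unfolding D_def inner_add_right inner_scaleR_right pp using v_pos(1) pos
          by (simp add: field_simps power2_eq_square)
        then have "l - F * (p \<bullet> D) / v = F / (2 * M\<^sub>0) * (1/v) - 4 / r\<^sup>2 * (n - (p \<bullet> p) / v\<^sup>2) + (4 * F / r\<^sup>2) * ((p \<bullet> \<xi>) / v)"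
          unfolding l_def by (simp add: diff_divide_distrib add_divide_distrib algebra_simps)
        moreover have "\<bar>F / (2 * M\<^sub>0) * (1/v)\<bar> \<le> L\<^sub>1 / (2 * M\<^sub>0) * 1"
          unfolding abs_mult using fb pos v_ge_1 by (intro mult_mono) (auto simp: F_def divide_right_mono)
        moreover have "4 / r\<^sup>2 * (n - (p \<bullet> p) / v\<^sup>2) \<le> 4 / r\<^sup>2 * n" by (intro mult_left_mono) auto
        moreover have "\<bar>(4 * F / r\<^sup>2) * ((p \<bullet> \<xi>) / v)\<bar> \<le> (4 * L\<^sub>1 / r\<^sup>2) * r"
          unfolding abs_mult
          by (intro mult_mono) (use fb px pos v_pos in \<open>auto simp: F_def abs_mult divide_right_mono pos_divide_le_eq mult.commute\<close>)
        moreover have "(4 * L\<^sub>1 / r\<^sup>2) * r = 4 * L\<^sub>1 / r" using pos by (simp add: power2_eq_square)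
        moreover have "t \<ge> - (a' + b' + d')" if "t = a - b + d" "\<bar>a\<bar> \<le> a'" "b \<le> b'" "\<bar>d\<bar> \<le> d'" for t a b d a' b' d' :: real
          using that by linarith
        ultimately have "l - F * (p \<bullet> D) / v \<ge> - (L\<^sub>1 / (2 * M\<^sub>0) * 1 + 4 / r\<^sup>2 * n + (4 * L\<^sub>1 / r\<^sup>2) * r)" by blast
        then show ?thesis using pos by (simp add: c_def power2_eq_square)
      qed
      have lower2: "aform p D D \<ge> 1 / (8 * M\<^sub>0\<^sup>2)"
      proof -
        have a: "aform p p h = (p \<bullet> h) / v\<^sup>2" for h
          unfolding aform_def v_def[symmetric] pp using v_pos by (simp add: field_simps)
        have "aform p D D = (1 / (2 * M\<^sub>0))\<^sup>2 * aform p p p + 2 * (1 / (2 * M\<^sub>0)) * (- 4 / r\<^sup>2) * aform p p \<xi> + (4 / r\<^sup>2)\<^sup>2 * aform p \<xi> \<xi>"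
          unfolding aform_def D_def by (simp add: inner_add_left inner_add_right inner_commute power2_eq_square algebra_simps)
             (simp add: diff_divide_distrib add_divide_distrib algebra_simps)
        moreover have "aform p \<xi> \<xi> \<ge> 0" by (simp add: aform_rho)
        ultimately have "aform p D D \<ge> (1 / (2 * M\<^sub>0))\<^sup>2 * ((v\<^sup>2 - 1) / v\<^sup>2) + 2 * (1 / (2 * M\<^sub>0)) * (- 4 / r\<^sup>2) * ((p \<bullet> \<xi>) / v\<^sup>2)"
          unfolding a pp by simp
        moreover have "(1 / (2 * M\<^sub>0))\<^sup>2 * ((v\<^sup>2 - 1) / v\<^sup>2) \<ge> (1 / (2 * M\<^sub>0))\<^sup>2 * (3/4)"
        proof (intro mult_left_mono)
          have "v\<^sup>2 \<ge> 4" using v V2 power_mono[of 2 v 2] by simp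
          then show "3/4 \<le> (v\<^sup>2 - 1) / v\<^sup>2" by (simp add: pos_le_divide_eq)
        qed simp
        moreover have "\<bar>2 * (1 / (2 * M\<^sub>0)) * (- 4 / r\<^sup>2) * ((p \<bullet> \<xi>) / v\<^sup>2)\<bar> \<le> 1 / (16 * M\<^sub>0\<^sup>2)"
        proof -
          have "\<bar>p \<bullet> \<xi>\<bar> / v\<^sup>2 \<le> v * r / v\<^sup>2" using px by (intro divide_right_mono) auto
          also have "\<dots> = r / v" using v_pos by (simp add: power2_eq_square)
          also have "\<dots> \<le> r / (64 * M\<^sub>0 / r)" using v V2 pos by (intro divide_left_mono) auto
          finally have "\<bar>p \<bullet> \<xi>\<bar> / v\<^sup>2 \<le> r\<^sup>2 / (64 * M\<^sub>0)" by (simp add: power2_eq_square)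
          then have "4 / (M\<^sub>0 * r\<^sup>2) * (\<bar>p \<bullet> \<xi>\<bar> / v\<^sup>2) \<le> 4 / (M\<^sub>0 * r\<^sup>2) * (r\<^sup>2 / (64 * M\<^sub>0))"
            using pos by (intro mult_left_mono) auto
          also have "\<dots> = 1 / (16 * M\<^sub>0\<^sup>2)" using pos by (simp add: power2_eq_square)
          finally show ?thesis using pos by (simp add: abs_mult)
        qed
        moreover have "(1 / (2 * M\<^sub>0))\<^sup>2 * (3/4) - 1 / (16 * M\<^sub>0\<^sup>2) = 1 / (8 * M\<^sub>0\<^sup>2)"
          using pos by (simp add: power2_eq_square)
        ultimately show ?thesis by (simp only: abs_le_iff) linarith
      qed
      have "K * aform p D D \<ge> K * (1 / (8 * M\<^sub>0\<^sup>2))" using lower2 K1 by (intro mult_left_mono) auto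
      then have "l - F * (p \<bullet> D) / v + K * aform p D D \<ge> L\<^sub>1 + 1" using lower1 Kc by simp
      then have "K * e * (l - F * (p \<bullet> D) / v + K * aform p D D) \<ge> (1 * e) * (L\<^sub>1 + 1)"
        using K1 pos by (intro mult_mono) (auto simp: e_def)
      moreover have "L\<^sub>1 * \<eta> x \<le> L\<^sub>1 * e" using pos by (intro mult_left_mono) (auto simp: \<eta>_def e_def)
      moreover have "e > 0" by (simp add: e_def)
      ultimately show False using L2 unfolding mE by (simp add: algebra_simps)
    qed
    have "slope (grad u x\<^sub>0) * (exp (K / 2) - 1) \<le> slope (grad u x\<^sub>0) * \<eta> x\<^sub>0"
      using e0 by (intro mult_left_mono) (auto simp: less_imp_le)
    also have "\<dots> \<le> slope (grad u x) * \<eta> x" by (rule xmax[OF x0])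
    also have "\<dots> \<le> V * exp (3 * K / 2)"
    proof (intro mult_mono)
      have "K * \<phi> x \<le> K * (3/2)" using \<phi>le K1 by (intro mult_left_mono) auto
      then have "exp (K * \<phi> x) \<le> exp (3 * K / 2)" by simp
      then show "\<eta> x \<le> exp (3 * K / 2)" unfolding \<eta>_def by linarith
    qed (use vV V2 ex in auto)
    finally show "slope (grad u x\<^sub>0) \<le> V * exp (3 * K / 2) / (exp (K / 2) - 1)"
      using e0p by (simp add: pos_le_divide_eq)
  qed
qed

section \<open>Interior maxima of the boundary test functions\<close>

text \<open>Obtained from v^2 / 2 by a square root, whose concavity lowers the coefficient of |y|^2
  from 3 to 2.\<close>

lemma (in mc_graph) mc_jet_slope:
  "mc_jet p (\<lambda>z. slope (grad u z)) x ((1 / v) *\<^sub>R H p)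
     (F x * v * (p \<bullet> y) + dF \<bullet> p + 2 * v * (y \<bullet> y) + v * (hs_norm B)\<^sup>2)"
proof -
  define m0 where "m0 = (slope (grad u x))\<^sup>2 / 2"
  have m0: "m0 = v\<^sup>2 / 2" by (simp add: m0_def v_def p_def)
  have m0p: "m0 > 0" unfolding m0 using v_pos(1) by (simp del: v_pos)
  have sv: "sqrt (2 * m0) = v" unfolding m0 by simp
  have 1: "((\<lambda>t. sqrt (2 * t)) has_real_derivative inverse (sqrt (2 * t))) (at t)" if "t \<in> {0<..}" for t :: real
    using that by (auto intro!: derivative_eq_intros)
  have 2: "((\<lambda>t. inverse (sqrt (2 * t))) has_real_derivative (- (inverse v ^ 3))) (at m0)"
  proof -
    have "((\<lambda>t. inverse (sqrt (2 * t))) has_real_derivative - (inverse (sqrt (2 * m0)) * inverse (sqrt (2 * m0)) * inverse (sqrt (2 * m0)))) (at m0)"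
      using DERIV_inverse'[OF 1[of m0]] m0p by simp
    then show ?thesis unfolding sv by (simp add: power3_eq_cube mult.assoc)
  qed
  have ah: "aform p (H p) (H p) = v\<^sup>2 * v\<^sup>2 * (y \<bullet> y)" unfolding aform_rho rho_H_p by simp
  have "inverse v * (F x * v\<^sup>2 * (p \<bullet> y) + v * (dF \<bullet> p) + 3 * v\<^sup>2 * (y \<bullet> y) + v\<^sup>2 * (hs_norm B)\<^sup>2)
     + (- (inverse v ^ 3)) * (v\<^sup>2 * v\<^sup>2 * (y \<bullet> y))
     = F x * v * (p \<bullet> y) + dF \<bullet> p + 2 * v * (y \<bullet> y) + v * (hs_norm B)\<^sup>2"
    by (simp add: field_simps power2_eq_square power3_eq_cube)
  note l = this
  have sq: "sqrt (2 * ((slope (grad u z))\<^sup>2 / 2)) = slope (grad u z)" for z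
    by (simp add: abs_of_pos)
  have "mc_jet p (\<lambda>z. sqrt (2 * ((slope (grad u z))\<^sup>2 / 2))) x (inverse (sqrt (2 * ((slope (grad u x))\<^sup>2 / 2))) *\<^sub>R H p)
     (inverse (sqrt (2 * ((slope (grad u x))\<^sup>2 / 2))) *
        (F x * v\<^sup>2 * (p \<bullet> y) + v * (dF \<bullet> p) + 3 * v\<^sup>2 * (y \<bullet> y) + v\<^sup>2 * (hs_norm B)\<^sup>2)
     + (- (inverse v ^ 3)) * aform p (H p) (H p))"
    by (rule mc_jet_compose[OF mc_jet_half_slope_sq open_greaterThan[of 0] _ 1 2[unfolded m0_def]])
      (use m0p m0_def in auto)
  then show ?thesis
    unfolding sq unfolding ah p_def[symmetric] v_def[symmetric] l by (simp only: inverse_eq_divide)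
qed

text \<open>C bounds all data at once, and Q and E are the remainders from the derivatives of
  \<gamma>. The condition \<beta> \<le> v records that v is large at the maximum; it keeps \<beta> /
  v bounded.\<close>

locale mc_test = mc_graph +
  fixes \<gamma> :: "'a \<Rightarrow> 'a" and Q R fx :: 'a and E lr \<alpha> \<beta> C fz :: real and rt :: "'a \<Rightarrow> real"
  assumes jet_theta: "mc_jet p (\<lambda>z. grad u z \<bullet> \<gamma> z) x (H (\<gamma> x) + Q)
       (F x * v * (sigma p (\<gamma> x) \<bullet> y) + v * (dF \<bullet> \<gamma> x) + 2 * v * (B (sigma p (\<gamma> x)) \<bullet> y) + E)"
    and Q: "norm Q \<le> C * v" and E: "\<bar>E\<bar> \<le> C * v * (1 + 2 * (hs_norm B + norm y))"
    and jet_rt: "mc_jet p rt x R lr" and R: "norm R \<le> C" and lr: "\<bar>lr\<bar> \<le> C"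
    and \<gamma>: "norm (\<gamma> x) = 1"
    and dF_eq: "dF = fx + fz *\<^sub>R p" and fz: "fz \<ge> 0" and fx: "norm fx \<le> C" and FC: "\<bar>F x\<bar> \<le> C"
    and C1: "C \<ge> 1" and \<alpha>: "\<alpha> \<ge> 0" and \<beta>: "1 \<le> \<beta>" "\<beta> \<le> v"
begin

text \<open>In the frame of \<open>rho p\<close>, g is the image of \<gamma>, k is the gradient of
  u, V is the gradient of \<beta> u + \<alpha> rt, and z - s y + G is the gradient of \<theta>
  divided by v. The sign of s is such that the capillary condition reads s = \<psi>.\<close>

definition \<theta> where "\<theta> = p \<bullet> \<gamma> x"
definition s where "s = - \<theta> / v"
definition g where "g = rho p (\<gamma> x)"
definition z where "z = B g"
definition G where "G = (1 / v) *\<^sub>R rho p Q"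
definition k where "k = (1 / v) *\<^sub>R p"
definition V where "V = \<beta> *\<^sub>R k + \<alpha> *\<^sub>R rho p R"
definition N where "N = hs_norm B"
definition Z where "Z = C\<^sup>2 * (1 + \<alpha>)\<^sup>2 * (1 + N + \<beta>)"

lemma theta_s: "\<theta> = - s * v" by (simp add: s_def)

lemma abs_s: "\<bar>s\<bar> \<le> 1"
proof -
  have "\<bar>\<theta>\<bar> \<le> v" using Cauchy_Schwarz_ineq2[of p "\<gamma> x"] norm_le_slope[of p] by (simp add: \<theta>_def \<gamma> v_def)
  then show ?thesis by (simp add: s_def abs_divide)
qed

lemma sigma_gamma: "sigma p (\<gamma> x) = g - s *\<^sub>R p"
  using sigma_eq_rho[of p "\<gamma> x"] by (simp add: g_def s_def \<theta>_def v_def)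

lemma B_sigma_gamma: "B (sigma p (\<gamma> x)) = z - s *\<^sub>R y"
  unfolding sigma_gamma linear_diff[OF linear_B] linear_scale[OF linear_B] z_def y_def ..

lemma rho_V: "rho p (\<beta> *\<^sub>R p + \<alpha> *\<^sub>R R) = V"
  by (simp add: V_def k_def linear_add[OF linear_rho] linear_scale[OF linear_rho] rho_self v_def)

lemma gg: "g \<bullet> g = 1 - s\<^sup>2"
proof -
  have "g \<bullet> g = \<gamma> x \<bullet> \<gamma> x - \<theta> * \<theta> / v\<^sup>2" by (simp add: g_def aform_rho[symmetric] aform_def \<theta>_def v_def)
  then show ?thesis using \<gamma> by (simp add: norm_eq_1 s_def power2_eq_square)
qed

lemma norm_g: "norm g \<le> 1" unfolding g_def using norm_rho_le[of p "\<gamma> x"] \<gamma> by simp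

lemma kk: "k \<bullet> k = 1 - 1 / v\<^sup>2" "k \<bullet> k \<le> 1"
proof -
  have "p \<bullet> p = v\<^sup>2 - 1" using slope_sq[of p] by (simp add: v_def)
  then show "k \<bullet> k = 1 - 1 / v\<^sup>2" by (simp add: k_def field_simps power2_eq_square)
  then show "k \<bullet> k \<le> 1" by simp
qed

lemma norm_k: "norm k \<le> 1" using kk(2) by (simp add: norm_eq_sqrt_inner)

lemma gk: "g \<bullet> k = - s / v"
proof -
  have "g \<bullet> k = \<gamma> x \<bullet> rho p p / v" by (simp add: g_def k_def rho_symmetric)
  also have "\<dots> = - s / v" by (simp add: rho_self v_def[symmetric] s_def \<theta>_def inner_commute)
  finally show ?thesis .
qed

lemma N0: "N \<ge> 0" by (simp add: N_def hs_norm_nonneg)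

lemma norm_z: "norm z \<le> N"
  using norm_le_hs_norm[OF linear_B, of g] mult_left_mono[OF norm_g hs_norm_nonneg[of B]] by (simp add: z_def N_def)

lemma norm_G: "norm G \<le> C"
  unfolding G_def using norm_rho_le[of p Q] Q by (simp add: divide_le_eq)

lemma norm_rho_R: "norm (rho p R) \<le> C" using norm_rho_le[of p R] R by simp

lemma norm_V: "norm V \<le> \<beta> + \<alpha> * C"
proof -
  have "norm (\<beta> *\<^sub>R k) \<le> \<beta> * 1" using \<beta> norm_k by (simp add: mult_left_mono)
  moreover have "norm (\<alpha> *\<^sub>R rho p R) \<le> \<alpha> * C" using \<alpha> norm_rho_R by (simp add: mult_left_mono)
  ultimately show ?thesis unfolding V_def using norm_triangle_ineq[of "\<beta> *\<^sub>R k" "\<alpha> *\<^sub>R rho p R"] by linarith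
qed

text \<open>All error terms are linear in \<open>N\<close> and \<open>\<beta>\<close> and are bounded by multiples of \<open>Z\<close>; the good terms
  are quadratic.\<close>

lemma Z_ge:
  assumes "0 \<le> a" "a \<le> C\<^sup>2" "0 \<le> b" "b \<le> (1 + \<alpha>)\<^sup>2" "0 \<le> c" "c \<le> 1 + N + \<beta>"
  shows "a * b * c \<le> Z"
  unfolding Z_def using assms by (intro mult_mono) auto

lemma Z_simps: "1 \<le> C\<^sup>2" "C \<le> C\<^sup>2" "1 \<le> (1 + \<alpha>)\<^sup>2" "\<alpha> \<le> (1 + \<alpha>)\<^sup>2" "1 + \<alpha> \<le> (1 + \<alpha>)\<^sup>2"
proof -
  show "1 \<le> C\<^sup>2" "C \<le> C\<^sup>2" using C1 by (auto simp: power2_eq_square) (metis mult_left_mono mult.right_neutral order_trans zero_le_one)+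
  show "1 \<le> (1 + \<alpha>)\<^sup>2" "\<alpha> \<le> (1 + \<alpha>)\<^sup>2" "1 + \<alpha> \<le> (1 + \<alpha>)\<^sup>2" using \<alpha> by (auto simp: power2_eq_square algebra_simps)
qed

lemma CV_Z: "C * norm V \<le> Z"
proof -
  have "\<beta> + \<alpha> * C \<le> C * (1 + \<alpha>) * (1 + N + \<beta>)"
  proof -
    have "\<beta> + \<alpha> * C \<le> C * \<beta> + C * \<alpha> * \<beta>"
    proof -
      have "1 * \<beta> \<le> C * \<beta>" "(C * \<alpha>) * 1 \<le> (C * \<alpha>) * \<beta>"
        by (rule mult_right_mono mult_left_mono; use C1 \<beta> \<alpha> in simp)+
      then show ?thesis by (simp add: mult_ac)
    qed
    also have "\<dots> = C * (1 + \<alpha>) * \<beta>" by (simp add: algebra_simps)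
    also have "\<dots> \<le> C * (1 + \<alpha>) * (1 + N + \<beta>)" using C1 \<alpha> N0 by (intro mult_left_mono) auto
    finally show ?thesis .
  qed
  then have "C * norm V \<le> C * (C * (1 + \<alpha>) * (1 + N + \<beta>))" using norm_V C1 by (intro mult_left_mono) auto
  also have "\<dots> = C\<^sup>2 * (1 + \<alpha>) * (1 + N + \<beta>)" by (simp add: power2_eq_square)
  also have "\<dots> \<le> Z" using Z_simps C1 \<alpha> N0 \<beta> by (intro Z_ge) auto
  finally show ?thesis .
qed

lemma C2_Z: "C\<^sup>2 \<le> Z" "C \<le> Z" "1 \<le> Z" and CN_Z: "C * N \<le> Z" and aCN_Z: "\<alpha> * C * N \<le> Z"
  and aC2_Z: "\<alpha> * C\<^sup>2 \<le> Z" and aC_Z: "\<alpha> * C \<le> Z" and abC_Z: "\<alpha> * \<beta> * C \<le> Z" and N_Z: "N \<le> Z"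
  using Z_ge[of "C\<^sup>2" 1 1] Z_ge[of C 1 1] Z_ge[of 1 1 1] Z_ge[of C 1 N] Z_ge[of C \<alpha> N] Z_ge[of "C\<^sup>2" \<alpha> 1]
    Z_ge[of C \<alpha> 1] Z_ge[of C \<alpha> \<beta>] Z_ge[of 1 1 N] Z_simps C1 \<alpha> N0 \<beta>
  by (simp_all add: mult_ac)

lemma beta_v: "\<beta>\<^sup>2 / v\<^sup>2 \<le> 1"
  using \<beta> power_mono[of \<beta> v 2] by (simp add: divide_le_eq)

lemma VV: "V \<bullet> V \<ge> \<beta>\<^sup>2 - 3 * Z"
proof -
  have "V \<bullet> V = \<beta>\<^sup>2 * (k \<bullet> k) + 2 * (\<alpha> * \<beta> * (k \<bullet> rho p R)) + \<alpha>\<^sup>2 * (rho p R \<bullet> rho p R)"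
    by (simp add: V_def inner_add_left inner_add_right inner_commute power2_eq_square algebra_simps)
  moreover have "\<beta>\<^sup>2 * (k \<bullet> k) \<ge> \<beta>\<^sup>2 - 1" unfolding kk(1) using beta_v by (simp add: algebra_simps)
  moreover have "\<bar>k \<bullet> rho p R\<bar> \<le> 1 * C"
    using Cauchy_Schwarz_ineq2[of k "rho p R"] mult_mono[OF norm_k norm_rho_R] C1 by simp
  then have "\<alpha> * \<beta> * \<bar>k \<bullet> rho p R\<bar> \<le> \<alpha> * \<beta> * (1 * C)" using \<alpha> \<beta> by (intro mult_left_mono) auto
  then have "\<bar>\<alpha> * \<beta> * (k \<bullet> rho p R)\<bar> \<le> Z" using abC_Z \<alpha> \<beta> by (simp add: abs_mult)
  moreover have "\<alpha>\<^sup>2 * (rho p R \<bullet> rho p R) \<ge> 0" by simp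
  ultimately show ?thesis using C2_Z(3) by (simp only: abs_le_iff) linarith
qed

text \<open>The terms of size \<beta> v F cancel because the Laplacian of u on the graph is only F /
  v. The remainder is controlled by C, \<alpha> C and \<alpha> C^2.\<close>

lemma F_terms: "\<beta> * v * F x + \<alpha> * lr - F x * (p \<bullet> V) \<ge> - 3 * Z" "\<bar>F x * (p \<bullet> G)\<bar> \<le> Z"
proof -
  have pr: "p \<bullet> rho p h = (p \<bullet> h) / v" for h by (simp add: rho_symmetric[symmetric] rho_self v_def)
  have pp: "p \<bullet> p = v\<^sup>2 - 1" using slope_sq[of p] by (simp add: v_def)
  have "(1 / v) * (v\<^sup>2 - 1) = v - 1 / v" by (simp add: field_simps power2_eq_square)
  then have "p \<bullet> V = \<beta> * (v - 1 / v) + \<alpha> * ((p \<bullet> R) / v)"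
    unfolding V_def k_def inner_add_right inner_scaleR_right pr pp by simp
  then have "\<beta> * v * F x + \<alpha> * lr - F x * (p \<bullet> V) = F x * (\<beta> / v) + \<alpha> * lr - \<alpha> * (F x * ((p \<bullet> R) / v))"
    by (simp only: right_diff_distrib distrib_left) simp
  moreover have "\<bar>F x * (\<beta> / v)\<bar> \<le> C * 1" unfolding abs_mult
    using FC \<beta> C1 by (intro mult_mono) auto
  moreover have "\<bar>\<alpha> * lr\<bar> \<le> \<alpha> * C" using lr \<alpha> by (simp add: abs_mult mult_left_mono)
  moreover have ph: "\<bar>(p \<bullet> h) / v\<bar> \<le> norm h" for h
  proof -
    have "\<bar>p \<bullet> h\<bar> \<le> v * norm h"
      using Cauchy_Schwarz_ineq2[of p h] mult_right_mono[OF norm_le_slope[of p], of "norm h"] by (simp add: v_def)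
    then show ?thesis by (simp add: abs_divide divide_le_eq mult.commute)
  qed
  have "\<bar>\<alpha> * (F x * ((p \<bullet> R) / v))\<bar> \<le> \<alpha> * (C * C)" unfolding abs_mult
    using FC C1 order_trans[OF ph[of R] R] \<alpha> by (intro mult_mono) auto
  ultimately show "\<beta> * v * F x + \<alpha> * lr - F x * (p \<bullet> V) \<ge> - 3 * Z"
    using C2_Z(2) aC_Z aC2_Z by (simp only: abs_le_iff power2_eq_square) linarith
  have "p \<bullet> G = ((p \<bullet> Q) / v) / v" by (simp add: G_def pr)
  moreover have "\<bar>((p \<bullet> Q) / v) / v\<bar> \<le> C"
    using order_trans[OF ph[of Q] Q] by (simp add: abs_divide divide_le_eq)
  ultimately have "\<bar>F x * (p \<bullet> G)\<bar> \<le> C * C" unfolding abs_mult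
    using FC C1 by (intro mult_mono) auto
  then show "\<bar>F x * (p \<bullet> G)\<bar> \<le> Z" using C2_Z(1) by (simp add: power2_eq_square)
qed

text \<open>The z-derivative of f contributes fz (p . p + b v \<theta>) / v, nonnegative by the
  second hypothesis. For |b| \<le> q^2 < 1 that hypothesis holds as soon as v is large.\<close>

lemma dF_term:
  assumes "\<bar>b\<bar> \<le> 1" "p \<bullet> p + b * v * \<theta> \<ge> 0"
  shows "dF \<bullet> ((1 / v) *\<^sub>R p + b *\<^sub>R \<gamma> x) \<ge> - 2 * Z"
proof -
  define q where "q = (1 / v) *\<^sub>R p + b *\<^sub>R \<gamma> x"
  have "norm q \<le> norm k + norm (b *\<^sub>R \<gamma> x)" unfolding q_def k_def by (rule norm_triangle_ineq)
  then have "norm q \<le> 2" using norm_k assms(1) \<gamma> by simp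
  then have "norm fx * norm q \<le> C * 2" using fx C1 by (intro mult_mono) auto
  then have "fx \<bullet> q \<ge> - 2 * C" using Cauchy_Schwarz_ineq2[of fx q] by linarith
  moreover have "p \<bullet> q = (p \<bullet> p + b * v * \<theta>) / v" by (simp add: q_def inner_add_right \<theta>_def field_simps)
  then have "fz * (p \<bullet> q) \<ge> 0" using fz assms(2) by simp
  ultimately show ?thesis using C2_Z(2) unfolding dF_eq q_def[symmetric] by (simp add: inner_add_left)
qed

text \<open>The norm of y = B p is kept, since bounding it by N |p| would cost a factor v; the
  gradient condition bounds it later.\<close>

lemma E_term: "\<bar>b\<bar> \<le> 1 \<Longrightarrow> b * E / v \<ge> - (3 * Z + 2 * (C * norm y))"
proof -
  assume b: "\<bar>b\<bar> \<le> 1"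
  have "\<bar>E\<bar> / v \<le> C * (1 + 2 * (N + norm y))" using E by (simp add: divide_le_eq N_def mult_ac)
  moreover have "\<bar>b * E / v\<bar> \<le> 1 * (\<bar>E\<bar> / v)"
    unfolding abs_mult abs_divide times_divide_eq_right[symmetric] using b by (intro mult_mono) auto
  ultimately have "\<bar>b * E / v\<bar> \<le> C + 2 * (C * N) + 2 * (C * norm y)" by (simp add: algebra_simps)
  then have "- (b * E / v) \<le> C + 2 * (C * N) + 2 * (C * norm y)" by (rule abs_le_D2)
  then show ?thesis using C2_Z(2) CN_Z by linarith
qed

text \<open>v and \<theta> satisfy equations of the same shape, so in the equation for v + b
  \<theta> = v \<omega> the vectors y and z enter the main terms through \<omega> y + b z. The
  gradient condition replaces this vector by - Y, and N^2 is retained with coefficient one.\<close>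

lemma local_max_affine:
  assumes b: "\<bar>b\<bar> < 1"
    and mx: "\<forall>\<^sub>F w in nhds x. ln (slope (grad u w) + b * (grad u w \<bullet> \<gamma> w)) + (\<beta> * u w + \<alpha> * rt w)
       \<le> ln (slope (grad u x) + b * (grad u x \<bullet> \<gamma> x)) + (\<beta> * u x + \<alpha> * rt x)"
  defines "\<omega> \<equiv> 1 - b * s" and "Y \<equiv> (1 - b * s) *\<^sub>R V + b *\<^sub>R G"
  shows "\<omega> *\<^sub>R y + b *\<^sub>R z = - Y"
    and "N\<^sup>2 - 2 * (y \<bullet> Y) - \<omega> * (V \<bullet> V) - F x * (p \<bullet> Y) + \<omega> * (\<beta> * v * F x + \<alpha> * lr)
      + dF \<bullet> ((1 / v) *\<^sub>R p + b *\<^sub>R \<gamma> x) + b * E / v \<le> 0"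
proof -
  define w where "w = slope (grad u x) + b * (grad u x \<bullet> \<gamma> x)"
  have w: "w = v * \<omega>" by (simp add: w_def \<omega>_def p_def[symmetric] v_def[symmetric] \<theta>_def[symmetric] theta_s algebra_simps)
  have "\<bar>b * s\<bar> \<le> \<bar>b\<bar> * 1" unfolding abs_mult using abs_s by (intro mult_left_mono) auto
  then have \<omega>: "\<omega> > 0" using b unfolding \<omega>_def by (simp only: abs_le_iff) linarith
  have wp: "w > 0" using \<omega> by (simp add: w)
  define Lw where "Lw = (F x * v * (p \<bullet> y) + dF \<bullet> p + 2 * v * (y \<bullet> y) + v * (hs_norm B)\<^sup>2)
      + b * (F x * v * (sigma p (\<gamma> x) \<bullet> y) + v * (dF \<bullet> \<gamma> x) + 2 * v * (B (sigma p (\<gamma> x)) \<bullet> y) + E)"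
  define Dw where "Dw = (1 / v) *\<^sub>R H p + b *\<^sub>R (H (\<gamma> x) + Q)"
  have 1: "mc_jet p (\<lambda>w. ln (slope (grad u w) + b * (grad u w \<bullet> \<gamma> w)) + (\<beta> * u w + \<alpha> * rt w)) x
     (inverse w *\<^sub>R Dw + (\<beta> *\<^sub>R p + \<alpha> *\<^sub>R R))
     (inverse w * Lw - (inverse w)\<^sup>2 * aform p Dw Dw + (\<beta> * (v * F x) + \<alpha> * lr))"
    unfolding Dw_def Lw_def w_def
    by (intro mc_jet_add mc_jet_ln mc_jet_cmult mc_jet_slope jet_theta jet_rt mc_jet_u) (use wp w_def in simp)
  have D: "inverse w *\<^sub>R Dw + (\<beta> *\<^sub>R p + \<alpha> *\<^sub>R R) = 0" by (rule mc_jet_local_max(1)[OF 1 mx])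
  have L: "inverse w * Lw - (inverse w)\<^sup>2 * aform p Dw Dw + (\<beta> * (v * F x) + \<alpha> * lr) \<le> 0"
    by (rule mc_jet_local_max(2)[OF 1 mx])
  have rD: "rho p Dw = v *\<^sub>R (\<omega> *\<^sub>R y + b *\<^sub>R z + b *\<^sub>R G)"
    unfolding Dw_def linear_add[OF linear_rho] linear_scale[OF linear_rho] rho_H_p
    unfolding rho_H B_sigma_gamma G_def \<omega>_def
    by (simp add: power2_eq_square scaleR_add_right scaleR_diff_right scaleR_diff_left mult_ac)
  have "rho p (inverse w *\<^sub>R Dw + (\<beta> *\<^sub>R p + \<alpha> *\<^sub>R R)) = 0" unfolding D by (rule linear_0[OF linear_rho])
  then have iV: "inverse w *\<^sub>R rho p Dw = - V"
    unfolding linear_add[OF linear_rho, of p "inverse w *\<^sub>R Dw"] linear_scale[OF linear_rho] rho_V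
    by (simp add: eq_neg_iff_add_eq_0)
  then have "w *\<^sub>R (inverse w *\<^sub>R rho p Dw) = w *\<^sub>R (- V)" by simp
  then have "rho p Dw = - (w *\<^sub>R V)" using wp by simp
  then have "v *\<^sub>R (\<omega> *\<^sub>R y + b *\<^sub>R z + b *\<^sub>R G) = v *\<^sub>R (- (\<omega> *\<^sub>R V))" unfolding rD w by simp
  then have "\<omega> *\<^sub>R y + b *\<^sub>R z + b *\<^sub>R G = - (\<omega> *\<^sub>R V)" using v_pos(2) by (simp only: scaleR_cancel_left) simp
  then show crit: "\<omega> *\<^sub>R y + b *\<^sub>R z = - Y" unfolding Y_def \<omega>_def[symmetric]
    by (simp only: eq_neg_iff_add_eq_0 add_ac)
  have a: "(inverse w)\<^sup>2 * aform p Dw Dw = V \<bullet> V"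
  proof -
    have "(inverse w)\<^sup>2 * aform p Dw Dw = (inverse w *\<^sub>R rho p Dw) \<bullet> (inverse w *\<^sub>R rho p Dw)"
      by (simp add: aform_rho power2_eq_square)
    then show ?thesis unfolding iV by simp
  qed
  have py: "\<omega> * (p \<bullet> y) + b * (g \<bullet> y) = - (p \<bullet> Y)"
  proof -
    have "g \<bullet> y = p \<bullet> z" unfolding y_def z_def by (metis B_symmetric inner_commute)
    then have "\<omega> * (p \<bullet> y) + b * (g \<bullet> y) = p \<bullet> (\<omega> *\<^sub>R y + b *\<^sub>R z)" by (simp add: inner_add_right)
    then show ?thesis unfolding crit by simp
  qed
  have yY: "\<omega> * (y \<bullet> y) + b * (z \<bullet> y) = - (y \<bullet> Y)"
  proof -
    have "\<omega> * (y \<bullet> y) + b * (z \<bullet> y) = y \<bullet> (\<omega> *\<^sub>R y + b *\<^sub>R z)" by (simp add: inner_add_right inner_commute)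
    then show ?thesis unfolding crit by simp
  qed
  have "Lw = v * (F x * (\<omega> * (p \<bullet> y) + b * (g \<bullet> y)) + dF \<bullet> ((1 / v) *\<^sub>R p + b *\<^sub>R \<gamma> x)
      + 2 * (\<omega> * (y \<bullet> y) + b * (z \<bullet> y)) + N\<^sup>2 + b * E / v)"
    unfolding Lw_def B_sigma_gamma unfolding sigma_gamma N_def \<omega>_def
    by (simp add: inner_diff_left inner_add_right algebra_simps)
  then have "inverse w * Lw = inverse \<omega> * (F x * (\<omega> * (p \<bullet> y) + b * (g \<bullet> y)) + dF \<bullet> ((1 / v) *\<^sub>R p + b *\<^sub>R \<gamma> x)
      + 2 * (\<omega> * (y \<bullet> y) + b * (z \<bullet> y)) + N\<^sup>2 + b * E / v)"
    unfolding w by simp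
  then have "\<omega> * (inverse w * Lw) = F x * (\<omega> * (p \<bullet> y) + b * (g \<bullet> y)) + dF \<bullet> ((1 / v) *\<^sub>R p + b *\<^sub>R \<gamma> x)
      + 2 * (\<omega> * (y \<bullet> y) + b * (z \<bullet> y)) + N\<^sup>2 + b * E / v"
    using \<omega> by simp
  moreover have "\<omega> * (inverse w * Lw - V \<bullet> V + (\<beta> * (v * F x) + \<alpha> * lr)) \<le> 0"
    using L \<omega> unfolding a by (simp add: mult_le_0_iff)
  then have "\<omega> * (inverse w * Lw) - \<omega> * (V \<bullet> V) + \<omega> * (\<beta> * v * F x + \<alpha> * lr) \<le> 0"
    by (simp only: distrib_left right_diff_distrib mult.assoc)
  ultimately show "N\<^sup>2 - 2 * (y \<bullet> Y) - \<omega> * (V \<bullet> V) - F x * (p \<bullet> Y) + \<omega> * (\<beta> * v * F x + \<alpha> * lr)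
      + dF \<bullet> ((1 / v) *\<^sub>R p + b *\<^sub>R \<gamma> x) + b * E / v \<le> 0"
    unfolding py yY by simp
qed

text \<open>To first order sqrt (v^2 - \<theta>^2) behaves like v + s \<theta>, so the gradient
  condition is the affine one with b = s. In second order the square of z - s y + G, the gradient of
  \<theta> divided by v, enters with a minus sign; this is the source of the degeneracy.\<close>

lemma local_max_tangential:
  assumes s1: "\<bar>s\<bar> < 1"
    and mx: "\<forall>\<^sub>F w in nhds x. ln ((slope (grad u w))\<^sup>2 - (grad u w \<bullet> \<gamma> w)\<^sup>2) / 2 + (\<beta> * u w + \<alpha> * rt w)
       \<le> ln ((slope (grad u x))\<^sup>2 - (grad u x \<bullet> \<gamma> x)\<^sup>2) / 2 + (\<beta> * u x + \<alpha> * rt x)"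
  defines "\<tau> \<equiv> 1 - s\<^sup>2" and "Y \<equiv> (1 - s\<^sup>2) *\<^sub>R V + s *\<^sub>R G"
  shows "\<tau> *\<^sub>R y + s *\<^sub>R z = - Y"
    and "N\<^sup>2 + 3 * (y \<bullet> y) + 2 * s * (y \<bullet> (z - s *\<^sub>R y)) - (z - s *\<^sub>R y + G) \<bullet> (z - s *\<^sub>R y + G)
      - 2 * \<tau> * (V \<bullet> V) - F x * (p \<bullet> Y) + \<tau> * (\<beta> * v * F x + \<alpha> * lr)
      + dF \<bullet> ((1 / v) *\<^sub>R p + s *\<^sub>R \<gamma> x) + s * E / v \<le> 0"
proof -
  define m where "m = (slope (grad u x))\<^sup>2 - (grad u x \<bullet> \<gamma> x)\<^sup>2"
  have m: "m = v\<^sup>2 * \<tau>"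
    by (simp add: m_def \<tau>_def p_def[symmetric] v_def[symmetric] \<theta>_def[symmetric] theta_s power_mult_distrib algebra_simps)
  have \<tau>: "\<tau> > 0" using s1 unfolding \<tau>_def by (simp add: abs_square_less_1)
  have mp: "m > 0" using \<tau> by (simp add: m)
  define Lt where "Lt = F x * v * (sigma p (\<gamma> x) \<bullet> y) + v * (dF \<bullet> \<gamma> x) + 2 * v * (B (sigma p (\<gamma> x)) \<bullet> y) + E"
  define Dt where "Dt = H (\<gamma> x) + Q"
  define Lm where "Lm = 2 * (F x * v\<^sup>2 * (p \<bullet> y) + v * (dF \<bullet> p) + 3 * v\<^sup>2 * (y \<bullet> y) + v\<^sup>2 * (hs_norm B)\<^sup>2)
      + (- 1) * (\<theta> * Lt + \<theta> * Lt + 2 * aform p Dt Dt)"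
  define Dm where "Dm = 2 *\<^sub>R H p + (- 1) *\<^sub>R (\<theta> *\<^sub>R Dt + \<theta> *\<^sub>R Dt)"
  have jm: "mc_jet p (\<lambda>w. 2 * ((slope (grad u w))\<^sup>2 / 2) + (- 1) * ((grad u w \<bullet> \<gamma> w) * (grad u w \<bullet> \<gamma> w))) x Dm Lm"
    unfolding Dm_def Lm_def Dt_def Lt_def \<theta>_def unfolding p_def
    by (intro mc_jet_add mc_jet_cmult mc_jet_mult mc_jet_half_slope_sq[unfolded p_def] jet_theta[unfolded p_def])
  have "(\<lambda>w. 2 * ((slope (grad u w))\<^sup>2 / 2) + (- 1) * ((grad u w \<bullet> \<gamma> w) * (grad u w \<bullet> \<gamma> w))) =
      (\<lambda>w. (slope (grad u w))\<^sup>2 - (grad u w \<bullet> \<gamma> w)\<^sup>2)"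
    by (simp add: power2_eq_square)
  then have jm': "mc_jet p (\<lambda>w. (slope (grad u w))\<^sup>2 - (grad u w \<bullet> \<gamma> w)\<^sup>2) x Dm Lm" using jm by simp
  have 1: "mc_jet p (\<lambda>w. (1/2) * ln ((slope (grad u w))\<^sup>2 - (grad u w \<bullet> \<gamma> w)\<^sup>2) + (\<beta> * u w + \<alpha> * rt w)) x
     ((1/2) *\<^sub>R (inverse m *\<^sub>R Dm) + (\<beta> *\<^sub>R p + \<alpha> *\<^sub>R R))
     ((1/2) * (inverse m * Lm - (inverse m)\<^sup>2 * aform p Dm Dm) + (\<beta> * (v * F x) + \<alpha> * lr))"
    unfolding m_def
    by (intro mc_jet_add mc_jet_ln mc_jet_cmult jm' jet_rt mc_jet_u) (use mp m_def in simp)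
  have mx': "\<forall>\<^sub>F w in nhds x. (1/2) * ln ((slope (grad u w))\<^sup>2 - (grad u w \<bullet> \<gamma> w)\<^sup>2) + (\<beta> * u w + \<alpha> * rt w)
       \<le> (1/2) * ln ((slope (grad u x))\<^sup>2 - (grad u x \<bullet> \<gamma> x)\<^sup>2) + (\<beta> * u x + \<alpha> * rt x)"
    using mx by simp
  have D: "(1/2) *\<^sub>R (inverse m *\<^sub>R Dm) + (\<beta> *\<^sub>R p + \<alpha> *\<^sub>R R) = 0" by (rule mc_jet_local_max(1)[OF 1 mx'])
  have L: "(1/2) * (inverse m * Lm - (inverse m)\<^sup>2 * aform p Dm Dm) + (\<beta> * (v * F x) + \<alpha> * lr) \<le> 0"
    by (rule mc_jet_local_max(2)[OF 1 mx'])
  have rt: "rho p Dt = v *\<^sub>R (z - s *\<^sub>R y + G)"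
    unfolding Dt_def linear_add[OF linear_rho] rho_H B_sigma_gamma G_def by (simp add: scaleR_add_right)
  have "rho p Dm = 2 *\<^sub>R (v\<^sup>2 *\<^sub>R y) + (2 * s * v) *\<^sub>R (v *\<^sub>R (z - s *\<^sub>R y + G))"
    unfolding Dm_def linear_add[OF linear_rho] linear_scale[OF linear_rho] rho_H_p rt theta_s
    by (simp only: scaleR_left_distrib[symmetric] scaleR_scaleR) simp
  also have "\<dots> = (2 * v\<^sup>2) *\<^sub>R (\<tau> *\<^sub>R y + s *\<^sub>R z + s *\<^sub>R G)"
  proof -
    have "\<tau> *\<^sub>R y + s *\<^sub>R z + s *\<^sub>R G = y + s *\<^sub>R (z - s *\<^sub>R y + G)"
      unfolding \<tau>_def by (simp add: algebra_simps power2_eq_square)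
    then show ?thesis by (simp add: scaleR_add_right power2_eq_square mult_ac)
  qed
  finally have rD: "rho p Dm = (2 * v\<^sup>2) *\<^sub>R (\<tau> *\<^sub>R y + s *\<^sub>R z + s *\<^sub>R G)" .
  have "rho p ((1/2) *\<^sub>R (inverse m *\<^sub>R Dm) + (\<beta> *\<^sub>R p + \<alpha> *\<^sub>R R)) = 0" unfolding D by (rule linear_0[OF linear_rho])
  then have iV: "(1/2) *\<^sub>R (inverse m *\<^sub>R rho p Dm) = - V"
    unfolding linear_add[OF linear_rho, of p "(1/2) *\<^sub>R (inverse m *\<^sub>R Dm)"] linear_scale[OF linear_rho] rho_V
    by (simp add: eq_neg_iff_add_eq_0)
  then have "(2 * m) *\<^sub>R ((1/2) *\<^sub>R (inverse m *\<^sub>R rho p Dm)) = (2 * m) *\<^sub>R (- V)" by (simp only:)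
  then have "rho p Dm = (2 * m) *\<^sub>R (- V)" using mp by simp
  then have "(2 * v\<^sup>2) *\<^sub>R (\<tau> *\<^sub>R y + s *\<^sub>R z + s *\<^sub>R G) = (2 * v\<^sup>2) *\<^sub>R (- (\<tau> *\<^sub>R V))" unfolding rD m by simp
  then have "\<tau> *\<^sub>R y + s *\<^sub>R z + s *\<^sub>R G = - (\<tau> *\<^sub>R V)" using v_pos(2) by (simp only: scaleR_cancel_left) simp
  then show crit: "\<tau> *\<^sub>R y + s *\<^sub>R z = - Y" unfolding Y_def \<tau>_def[symmetric]
    by (simp only: eq_neg_iff_add_eq_0 add_ac)
  have a: "(inverse m)\<^sup>2 * aform p Dm Dm = 4 * (V \<bullet> V)"
  proof -
    have "(inverse m)\<^sup>2 * aform p Dm Dm = 4 * (((1/2) *\<^sub>R (inverse m *\<^sub>R rho p Dm)) \<bullet> ((1/2) *\<^sub>R (inverse m *\<^sub>R rho p Dm)))"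
      by (simp add: aform_rho power2_eq_square)
    then show ?thesis unfolding iV by simp
  qed
  have py: "\<tau> * (p \<bullet> y) + s * (g \<bullet> y) = - (p \<bullet> Y)"
  proof -
    have "g \<bullet> y = p \<bullet> z" unfolding y_def z_def by (metis B_symmetric inner_commute)
    then have "\<tau> * (p \<bullet> y) + s * (g \<bullet> y) = p \<bullet> (\<tau> *\<^sub>R y + s *\<^sub>R z)" by (simp add: inner_add_right)
    then show ?thesis unfolding crit by simp
  qed
  define X where "X = F x * (\<tau> * (p \<bullet> y) + s * (g \<bullet> y)) + dF \<bullet> ((1 / v) *\<^sub>R p + s *\<^sub>R \<gamma> x)
      + 3 * (y \<bullet> y) + N\<^sup>2 + 2 * s * (y \<bullet> (z - s *\<^sub>R y)) + s * E / v - (z - s *\<^sub>R y + G) \<bullet> (z - s *\<^sub>R y + G)"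
  have at: "aform p Dt Dt = v\<^sup>2 * ((z - s *\<^sub>R y + G) \<bullet> (z - s *\<^sub>R y + G))"
    unfolding aform_rho rt by (simp add: power2_eq_square)
  have "Lm = (2 * v\<^sup>2) * X"
    unfolding Lm_def at Lt_def B_sigma_gamma X_def unfolding sigma_gamma N_def theta_s \<tau>_def inner_commute[of y "z - s *\<^sub>R y"]
    by (simp add: inner_diff_left inner_add_right power2_eq_square algebra_simps)
  then have "\<tau> * ((1/2) * (inverse m * Lm)) = X"
    unfolding m using \<tau> by (simp add: field_simps)
  moreover have "\<tau> * ((1/2) * (inverse m * Lm - 4 * (V \<bullet> V)) + (\<beta> * (v * F x) + \<alpha> * lr)) \<le> 0"
    using L \<tau> unfolding a by (simp add: mult_le_0_iff)
  then have "\<tau> * ((1/2) * (inverse m * Lm)) - 2 * \<tau> * (V \<bullet> V) + \<tau> * (\<beta> * v * F x + \<alpha> * lr) \<le> 0"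
    by (simp add: algebra_simps)
  ultimately show "N\<^sup>2 + 3 * (y \<bullet> y) + 2 * s * (y \<bullet> (z - s *\<^sub>R y)) - (z - s *\<^sub>R y + G) \<bullet> (z - s *\<^sub>R y + G)
      - 2 * \<tau> * (V \<bullet> V) - F x * (p \<bullet> Y) + \<tau> * (\<beta> * v * F x + \<alpha> * lr)
      + dF \<bullet> ((1 / v) *\<^sub>R p + s *\<^sub>R \<gamma> x) + s * E / v \<le> 0"
    unfolding X_def py by linarith
qed

end

section \<open>Coercivity in N and \<beta> at an interior maximum\<close>

lemma two_abs_le:
  fixes t :: real
  assumes "t\<^sup>2 \<le> a * c" "0 \<le> a" "0 \<le> c" "0 < q"
  shows "2 * \<bar>t\<bar> \<le> q * a + c / q"
proof -
  have "4 * (a * c) \<le> (q * a + c / q)\<^sup>2"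
  proof -
    have "(q * a + c / q)\<^sup>2 - 4 * (a * c) = (q * a - c / q)\<^sup>2"
      using assms(4) by (simp add: power2_eq_square algebra_simps)
    then show ?thesis using zero_le_power2[of "q * a - c / q"] by linarith
  qed
  then have "(2 * \<bar>t\<bar>)\<^sup>2 \<le> (q * a + c / q)\<^sup>2" using assms(1) by (simp add: power_mult_distrib)
  then show ?thesis by (rule power2_le_imp_le) (use assms in auto)
qed

context mc_test
begin

lemma Z0: "Z \<ge> 0" using C2_Z(3) by simp

lemma abs_VG: "\<bar>V \<bullet> G\<bar> \<le> Z"
  using Cauchy_Schwarz_ineq2[of V G] mult_left_mono[OF norm_G, of "norm V"] CV_Z by (simp add: mult.commute)

lemma abs_zG: "\<bar>z \<bullet> G\<bar> \<le> Z"
  using Cauchy_Schwarz_ineq2[of z G] mult_mono[OF norm_z norm_G N0] CN_Z by (simp add: mult.commute)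

lemma GG_le: "G \<bullet> G \<le> Z"
  using mult_mono[OF norm_G norm_G] C1 C2_Z(1) by (simp add: dot_square_norm power2_eq_square)

text \<open>The gradient condition expresses \<omega> y by V, G and z, whose bounds contain no
  factor v.\<close>

lemma C_norm_y:
  assumes "\<omega> *\<^sub>R y + b *\<^sub>R z = - Y" "Y = \<omega> *\<^sub>R V + b *\<^sub>R G" "\<epsilon> \<le> \<omega>" "0 < \<epsilon>" "\<omega> \<le> 2" "\<bar>b\<bar> \<le> 1"
  shows "C * norm y \<le> 4 * (Z / \<epsilon>)"
proof -
  have bb: "\<bar>b\<bar> * norm h \<le> norm h" for h :: 'a using mult_right_mono[OF assms(6), of "norm h"] by simp
  have "\<omega> *\<^sub>R y = - (\<omega> *\<^sub>R V + b *\<^sub>R G + b *\<^sub>R z)"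
    using assms(1) unfolding assms(2) by (simp only: eq_neg_iff_add_eq_0 add_ac)
  then have "\<omega> * norm y = norm (\<omega> *\<^sub>R V + b *\<^sub>R G + b *\<^sub>R z)" using assms(3,4) by (metis abs_of_pos less_le_trans norm_minus_cancel norm_scaleR)
  also have "\<dots> \<le> norm (\<omega> *\<^sub>R V) + norm (b *\<^sub>R G) + norm (b *\<^sub>R z)"
    using norm_triangle_ineq[of "\<omega> *\<^sub>R V + b *\<^sub>R G" "b *\<^sub>R z"] norm_triangle_ineq[of "\<omega> *\<^sub>R V" "b *\<^sub>R G"] by linarith
  also have "\<dots> \<le> 2 * norm V + C + N"
    using bb[of G] bb[of z] norm_G norm_z mult_right_mono[OF assms(5), of "norm V"] assms(3,4) by simp
  finally have "\<epsilon> * norm y \<le> 2 * norm V + C + N"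
    using mult_right_mono[OF assms(3), of "norm y"] by simp
  then have "C * (\<epsilon> * norm y) \<le> C * (2 * norm V + C + N)" using C1 by (intro mult_left_mono) auto
  also have "\<dots> = 2 * (C * norm V) + C\<^sup>2 + C * N" by (simp add: power2_eq_square algebra_simps)
  also have "\<dots> \<le> 4 * Z" using CV_Z C2_Z(1) CN_Z by linarith
  finally show ?thesis using assms(4) by (simp add: pos_le_divide_eq mult_ac)
qed

text \<open>Once y is eliminated, the form is N^2 + \<omega> |V|^2 + 2 b (z . V) with V close to
  \<beta> k. As z = B g, the cross term is essentially the entry of B between g and k; the bound for
  symmetric maps absorbs it with the factor q and leaves the share 1 - q of both squares.\<close>

lemma affine_estimate:
  assumes q: "0 < q" "q < 1" and b: "\<bar>b\<bar> = q\<^sup>2" and \<epsilon>: "\<epsilon> = 1 - q\<^sup>2"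
    and pp: "p \<bullet> p + b * v * \<theta> \<ge> 0"
    and mx: "\<forall>\<^sub>F w in nhds x. ln (slope (grad u w) + b * (grad u w \<bullet> \<gamma> w)) + (\<beta> * u w + \<alpha> * rt w)
       \<le> ln (slope (grad u x) + b * (grad u x \<bullet> \<gamma> x)) + (\<beta> * u x + \<alpha> * rt x)"
  shows "(1 - q) * \<epsilon> * (N\<^sup>2 + \<beta>\<^sup>2) \<le> 25 * Z + 10 * (Z / \<epsilon>)"
proof -
  have q2: "q\<^sup>2 < 1" using q by (simp add: abs_square_less_1)
  have b1: "\<bar>b\<bar> < 1" and \<epsilon>0: "\<epsilon> > 0" using b q2 \<epsilon> by auto
  define \<omega> where "\<omega> = 1 - b * s"
  define Y where "Y = \<omega> *\<^sub>R V + b *\<^sub>R G"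
  note crit = local_max_affine(1)[OF b1 mx, folded \<omega>_def, folded Y_def]
  note ineq = local_max_affine(2)[OF b1 mx, folded \<omega>_def, folded Y_def]
  have bs: "\<bar>b * s\<bar> \<le> q\<^sup>2" unfolding abs_mult b using abs_s mult_left_mono[of "\<bar>s\<bar>" 1 "q\<^sup>2"] by simp
  then have \<omega>: "\<epsilon> \<le> \<omega>" "\<omega> \<le> 2" using q2 unfolding \<omega>_def \<epsilon> by linarith+
  then have \<omega>0: "\<omega> > 0" using \<epsilon>0 by linarith
  have Cy: "C * norm y \<le> 4 * (Z / \<epsilon>)"
    by (rule C_norm_y[OF crit Y_def \<omega>(1) \<epsilon>0 \<omega>(2)]) (use b1 in simp)
  \<comment> \<open>Multiplication by \<omega> allows \<omega> y to be replaced by - Y - b z. The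
    term 2 Y . Y then turns the coefficient of |V|^2 from - \<omega> into + \<omega>.\<close>
  have T1: "- 2 * (y \<bullet> Y) - \<omega> * (V \<bullet> V) \<ge> \<omega> * (V \<bullet> V) + 2 * (b * (z \<bullet> V)) - 4 * Z - 2 * (Z / \<epsilon>)"
  proof -
    have wy: "\<omega> *\<^sub>R y = - Y - b *\<^sub>R z" using crit by (simp add: algebra_simps eq_diff_eq)
    have "\<omega> * (- 2 * (y \<bullet> Y) - \<omega> * (V \<bullet> V)) = - 2 * ((\<omega> *\<^sub>R y) \<bullet> Y) - \<omega>\<^sup>2 * (V \<bullet> V)"
      by (simp add: power2_eq_square algebra_simps)
    also have "\<dots> = \<omega> * (\<omega> * (V \<bullet> V) + 2 * (b * (z \<bullet> V)) + 4 * (b * (V \<bullet> G))) + 2 * (b\<^sup>2 * (G \<bullet> G)) + 2 * (b\<^sup>2 * (z \<bullet> G))"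
      unfolding wy Y_def by (simp add: inner_add_left inner_add_right inner_diff_left inner_commute power2_eq_square algebra_simps)
    finally have "- 2 * (y \<bullet> Y) - \<omega> * (V \<bullet> V) = \<omega> * (V \<bullet> V) + 2 * (b * (z \<bullet> V)) + 4 * (b * (V \<bullet> G)) + (2 * (b\<^sup>2 * (G \<bullet> G)) + 2 * (b\<^sup>2 * (z \<bullet> G))) / \<omega>"
      using \<omega>0 by (simp add: field_simps)
    moreover have "\<bar>b * (V \<bullet> G)\<bar> \<le> 1 * Z" unfolding abs_mult using b1 abs_VG by (intro mult_mono) auto
    moreover have "(2 * (b\<^sup>2 * (G \<bullet> G)) + 2 * (b\<^sup>2 * (z \<bullet> G))) / \<omega> \<ge> - 2 * (Z / \<epsilon>)"
    proof -
      have "\<bar>b\<^sup>2 * (z \<bullet> G)\<bar> \<le> 1 * Z" unfolding abs_mult using b1 abs_zG abs_square_less_1[of b] by (intro mult_mono) auto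
      moreover have "b\<^sup>2 * (G \<bullet> G) \<ge> 0" by simp
      ultimately have "2 * (b\<^sup>2 * (G \<bullet> G)) + 2 * (b\<^sup>2 * (z \<bullet> G)) \<ge> - (2 * Z)" by linarith
      then have "(2 * (b\<^sup>2 * (G \<bullet> G)) + 2 * (b\<^sup>2 * (z \<bullet> G))) / \<omega> \<ge> - (2 * Z) / \<omega>" using \<omega>0 by (intro divide_right_mono) auto
      moreover have "2 * Z / \<omega> \<le> 2 * Z / \<epsilon>" using \<omega> \<omega>0 \<epsilon>0 Z0 by (intro divide_left_mono) auto
      ultimately show ?thesis by simp
    qed
    ultimately show ?thesis by linarith
  qed
  have T2: "- F x * (p \<bullet> Y) + \<omega> * (\<beta> * v * F x + \<alpha> * lr) \<ge> - 7 * Z"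
  proof -
    have "- F x * (p \<bullet> Y) + \<omega> * (\<beta> * v * F x + \<alpha> * lr) = \<omega> * (\<beta> * v * F x + \<alpha> * lr - F x * (p \<bullet> V)) - b * (F x * (p \<bullet> G))"
      unfolding Y_def by (simp add: inner_add_right algebra_simps)
    moreover have "\<omega> * (\<beta> * v * F x + \<alpha> * lr - F x * (p \<bullet> V)) \<ge> \<omega> * (- 3 * Z)"
      using F_terms(1) \<omega>0 by (intro mult_left_mono) auto
    moreover have "\<omega> * (3 * Z) \<le> 2 * (3 * Z)" using \<omega> Z0 by (intro mult_right_mono) auto
    moreover have "\<bar>b * (F x * (p \<bullet> G))\<bar> \<le> 1 * Z" unfolding abs_mult[of b] using b1 F_terms(2) by (intro mult_mono) auto
    ultimately show ?thesis by linarith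
  qed
  have T3: "dF \<bullet> ((1 / v) *\<^sub>R p + b *\<^sub>R \<gamma> x) \<ge> - 2 * Z" using dF_term[of b] pp b1 by simp
  have T4: "b * E / v \<ge> - (3 * Z + 2 * (C * norm y))" using E_term[of b] b1 by simp
  have A: "N\<^sup>2 + \<omega> * (V \<bullet> V) + 2 * (b * (z \<bullet> V)) \<le> 16 * Z + 10 * (Z / \<epsilon>)"
    using ineq T1 T2 T3 T4 Cy by linarith
  have zV: "b * (z \<bullet> V) \<ge> b * (\<beta> * (z \<bullet> k)) - Z"
  proof -
    have "z \<bullet> V = \<beta> * (z \<bullet> k) + \<alpha> * (z \<bullet> rho p R)" by (simp add: V_def inner_add_right)
    moreover have "\<bar>\<alpha> * (z \<bullet> rho p R)\<bar> \<le> \<alpha> * (N * C)"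
      unfolding abs_mult using \<alpha> order_trans[OF Cauchy_Schwarz_ineq2 mult_mono[OF norm_z norm_rho_R N0 norm_ge_zero]]
      by (intro mult_mono) auto
    then have "\<bar>b * (\<alpha> * (z \<bullet> rho p R))\<bar> \<le> 1 * Z"
      unfolding abs_mult[of b] using b1 aCN_Z by (intro mult_mono) (auto simp: mult_ac)
    ultimately show ?thesis by (simp only: distrib_left)
  qed
  have AM: "2 * \<bar>b * (\<beta> * (z \<bullet> k))\<bar> \<le> q * N\<^sup>2 + q * \<omega> * \<beta>\<^sup>2 + Z"
  proof -
    have "(z \<bullet> k)\<^sup>2 \<le> N\<^sup>2 * ((g \<bullet> g) * (k \<bullet> k) + (g \<bullet> k)\<^sup>2) / 2"
      unfolding z_def N_def by (rule selfadjoint_inner_bound[OF linear_B B_symmetric])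
    also have "\<dots> \<le> N\<^sup>2 * ((1 - s\<^sup>2) * 1 + 1 / v\<^sup>2) / 2"
    proof -
      have "(g \<bullet> g) * (k \<bullet> k) \<le> (1 - s\<^sup>2) * 1"
        unfolding gg using kk(2) abs_s by (intro mult_left_mono) (auto simp: abs_square_le_1)
      moreover have "(g \<bullet> k)\<^sup>2 \<le> 1 / v\<^sup>2"
        unfolding gk power_divide using abs_s by (intro divide_right_mono) (auto simp: abs_square_le_1)
      ultimately show ?thesis by (intro divide_right_mono mult_left_mono) auto
    qed
    finally have zk: "(z \<bullet> k)\<^sup>2 \<le> N\<^sup>2 * ((1 - s\<^sup>2) + 1 / v\<^sup>2) / 2" by simp
    \<comment> \<open>With t = |b| and r = |s| this comes down to t (1 + 2 r - r^2) \<le> 2, a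
      consequence of (1 - r)^2 \<ge> 0. Without the one half on the left the inequality fails for t
      close to 1 and 0 < r < 1.\<close>
    have key: "b\<^sup>2 * (1 - s\<^sup>2) / 2 \<le> q\<^sup>2 * \<omega>"
    proof -
      define t r where "t = \<bar>b\<bar>" and "r = \<bar>s\<bar>"
      have r: "0 \<le> r" "r \<le> 1" and t: "0 \<le> t" "t \<le> 1" using abs_s b1 by (auto simp: r_def t_def)
      have "t * (1 - r\<^sup>2) / 2 \<le> 1 - t * r"
      proof -
        have "t * (1 + 2 * r - r\<^sup>2) \<le> 1 * 2"
        proof (intro mult_mono)
          have "0 \<le> (1 - r)\<^sup>2" by simp
          then show "1 + 2 * r - r\<^sup>2 \<le> 2" by (simp add: power2_eq_square algebra_simps)
          have "r * r \<le> 1 * 1" using r by (intro mult_mono) auto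
          then show "0 \<le> 1 + 2 * r - r\<^sup>2" using r(1) unfolding power2_eq_square by linarith
        qed (use t in auto)
        moreover have "t * (1 + 2 * r - r\<^sup>2) = t + 2 * (t * r) - t * r\<^sup>2" by (simp add: algebra_simps)
        ultimately show ?thesis unfolding right_diff_distrib by simp
      qed
      then have "t * (t * (1 - r\<^sup>2) / 2) \<le> t * (1 - t * r)" using t by (intro mult_left_mono) auto
      moreover have "1 - t * r \<le> \<omega>" unfolding \<omega>_def t_def r_def abs_mult[symmetric] by simp
      then have "t * (1 - t * r) \<le> t * \<omega>" using t by (intro mult_left_mono) auto
      moreover have "b\<^sup>2 * (1 - s\<^sup>2) / 2 = t * (t * (1 - r\<^sup>2) / 2)" by (simp add: t_def r_def power2_eq_square)
      ultimately show ?thesis using b by (simp add: t_def)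
    qed
    have "b\<^sup>2 * \<beta>\<^sup>2 * (z \<bullet> k)\<^sup>2 \<le> b\<^sup>2 * \<beta>\<^sup>2 * (N\<^sup>2 * ((1 - s\<^sup>2) + 1 / v\<^sup>2) / 2)"
      using zk by (intro mult_left_mono) auto
    also have "\<dots> = N\<^sup>2 * (\<beta>\<^sup>2 * (b\<^sup>2 * (1 - s\<^sup>2) / 2) + b\<^sup>2 * (\<beta>\<^sup>2 / v\<^sup>2) / 2)"
      by (simp add: field_simps)
    also have "\<dots> \<le> N\<^sup>2 * (\<beta>\<^sup>2 * (q\<^sup>2 * \<omega>) + q\<^sup>2 * 1 / 2)"
    proof -
      have "b\<^sup>2 = q\<^sup>2 * q\<^sup>2" using b by (metis power2_abs power2_eq_square)
      moreover have "q\<^sup>2 * q\<^sup>2 \<le> 1 * q\<^sup>2" using q2 by (intro mult_right_mono) auto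
      ultimately have "b\<^sup>2 \<le> q\<^sup>2" by simp
      then have "b\<^sup>2 * (\<beta>\<^sup>2 / v\<^sup>2) \<le> q\<^sup>2 * 1" using beta_v by (intro mult_mono) auto
      then show ?thesis using key by (intro mult_left_mono add_mono divide_right_mono) auto
    qed
    finally have "(b * (\<beta> * (z \<bullet> k)))\<^sup>2 \<le> N\<^sup>2 * (\<beta>\<^sup>2 * (q\<^sup>2 * \<omega>) + q\<^sup>2 * 1 / 2)"
      by (simp add: power_mult_distrib mult_ac)
    \<comment> \<open>The weight q on N^2 is balanced by 1 / q on the other factor, which turns q^2
      \<omega> into q \<omega>.\<close>
    from two_abs_le[OF this _ _ q(1)]
    have "2 * \<bar>b * (\<beta> * (z \<bullet> k))\<bar> \<le> q * N\<^sup>2 + (\<beta>\<^sup>2 * (q\<^sup>2 * \<omega>) + q\<^sup>2 * 1 / 2) / q"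
      using \<omega>0 by simp
    moreover have "(\<beta>\<^sup>2 * (q\<^sup>2 * \<omega>) + q\<^sup>2 * 1 / 2) / q = q * \<omega> * \<beta>\<^sup>2 + q / 2"
      using q(1) by (simp add: field_simps power2_eq_square)
    moreover have "q / 2 \<le> Z" using q(2) C2_Z(3) by simp
    ultimately show ?thesis by linarith
  qed
  have "\<omega> * (V \<bullet> V) \<ge> \<omega> * (\<beta>\<^sup>2 - 3 * Z)" using VV \<omega>0 by (intro mult_left_mono) auto
  moreover have "\<omega> * (3 * Z) \<le> 2 * (3 * Z)" using \<omega> Z0 by (intro mult_right_mono) auto
  ultimately have "\<omega> * (V \<bullet> V) \<ge> \<omega> * \<beta>\<^sup>2 - 6 * Z" by (simp only: right_diff_distrib)
  moreover have "b * (\<beta> * (z \<bullet> k)) \<ge> - \<bar>b * (\<beta> * (z \<bullet> k))\<bar>" by simp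
  ultimately have "(1 - q) * N\<^sup>2 + (1 - q) * \<omega> * \<beta>\<^sup>2 \<le> 25 * Z + 10 * (Z / \<epsilon>)"
    using A zV AM by (simp only: left_diff_distrib mult_1_left mult.assoc)
  moreover have "(1 - q) * \<epsilon> * N\<^sup>2 \<le> (1 - q) * 1 * N\<^sup>2"
    using q \<epsilon> by (intro mult_right_mono mult_left_mono) auto
  moreover have "(1 - q) * \<epsilon> * \<beta>\<^sup>2 \<le> (1 - q) * \<omega> * \<beta>\<^sup>2"
    using q \<omega> by (intro mult_right_mono mult_left_mono) auto
  ultimately show ?thesis by (simp only: distrib_left mult_1_right)
qed

text \<open>Since z = B g and |g|^2 = \<tau>, the difference N^2 - |z|^2 / \<tau> is |B|^2 - |B h|^2
  for the unit vector h along g, and it misses the entry B h . h. In V . z that entry is multiplied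
  by g . V up to a factor, and g . V is bounded independently of \<beta>, because g . k = - s / v
  and \<beta> \<le> v. So the missing entry produces only an error of size Z.\<close>

lemma tangential_estimate:
  assumes q: "0 < q" "q < 1" and s: "\<bar>s\<bar> \<le> q\<^sup>2" and \<epsilon>: "\<epsilon> = 1 - q\<^sup>2"
    and pp: "p \<bullet> p + s * v * \<theta> \<ge> 0"
    and mx: "\<forall>\<^sub>F w in nhds x. ln ((slope (grad u w))\<^sup>2 - (grad u w \<bullet> \<gamma> w)\<^sup>2) / 2 + (\<beta> * u w + \<alpha> * rt w)
       \<le> ln ((slope (grad u x))\<^sup>2 - (grad u x \<bullet> \<gamma> x)\<^sup>2) / 2 + (\<beta> * u x + \<alpha> * rt x)"
  shows "\<epsilon> * (N\<^sup>2 / (2 + 2 * DIM('a)) + \<epsilon> * \<beta>\<^sup>2) \<le> 27 * Z + 18 * (Z / \<epsilon>)"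
proof -
  have q2: "q\<^sup>2 < 1" using q by (simp add: abs_square_less_1)
  have s1: "\<bar>s\<bar> < 1" and \<epsilon>0: "\<epsilon> > 0" using s q2 \<epsilon> by auto
  define \<tau> where "\<tau> = 1 - s\<^sup>2"
  define Y where "Y = \<tau> *\<^sub>R V + s *\<^sub>R G"
  note crit = local_max_tangential(1)[OF s1 mx, folded \<tau>_def, folded Y_def]
  note ineq = local_max_tangential(2)[OF s1 mx, folded \<tau>_def, folded Y_def]
  have s2: "s\<^sup>2 \<le> \<bar>s\<bar>" "s\<^sup>2 \<le> 1"
  proof -
    have "\<bar>s\<bar> * \<bar>s\<bar> \<le> \<bar>s\<bar> * 1" using s1 by (intro mult_left_mono) auto
    then show "s\<^sup>2 \<le> \<bar>s\<bar>" by (simp add: power2_eq_square)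
    then show "s\<^sup>2 \<le> 1" using s1 by linarith
  qed
  have \<tau>: "\<epsilon> \<le> \<tau>" "\<tau> \<le> 1" using s2 s unfolding \<tau>_def \<epsilon> by auto
  then have \<tau>0: "\<tau> > 0" using \<epsilon>0 by linarith
  have Cy: "C * norm y \<le> 4 * (Z / \<epsilon>)"
    by (rule C_norm_y[OF crit Y_def \<tau>(1) \<epsilon>0]) (use s1 \<tau> in simp_all)
  \<comment> \<open>The same elimination of y as in the affine case. The coefficient of |z|^2
    becomes - s^2 / \<tau> - 1 = - 1 / \<tau>.\<close>
  have T1: "3 * (y \<bullet> y) + 2 * s * (y \<bullet> (z - s *\<^sub>R y)) - (z - s *\<^sub>R y + G) \<bullet> (z - s *\<^sub>R y + G) - 2 * \<tau> * (V \<bullet> V)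
     \<ge> \<tau> * (V \<bullet> V) + 2 * (s * (V \<bullet> z)) - (z \<bullet> z) / \<tau> - (9 * Z + 10 * (Z / \<epsilon>))"
  proof -
    have ty: "\<tau> *\<^sub>R y = - Y - s *\<^sub>R z" using crit by (simp add: algebra_simps eq_diff_eq)
    have "\<tau> * (3 * \<tau> * (y \<bullet> y) + 4 * s * (y \<bullet> z)) = 3 * ((\<tau> *\<^sub>R y) \<bullet> (\<tau> *\<^sub>R y)) + 4 * s * ((\<tau> *\<^sub>R y) \<bullet> z)"
      by (simp add: algebra_simps)
    also have "\<dots> = 3 * (Y \<bullet> Y) + 2 * s * (Y \<bullet> z) - s\<^sup>2 * (z \<bullet> z)"
      unfolding ty by (simp add: inner_diff_left inner_diff_right inner_commute power2_eq_square algebra_simps)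
    also have "\<dots> = \<tau> * (3 * \<tau> * (V \<bullet> V) + 6 * (s * (V \<bullet> G)) + 2 * (s * (V \<bullet> z))) + (3 * (s\<^sup>2 * (G \<bullet> G)) + 2 * (s\<^sup>2 * (z \<bullet> G))) - s\<^sup>2 * (z \<bullet> z)"
      unfolding Y_def by (simp add: inner_add_left inner_add_right inner_commute power2_eq_square algebra_simps)
    finally have "\<tau> * (3 * \<tau> * (y \<bullet> y) + 4 * s * (y \<bullet> z)) = \<tau> * (3 * \<tau> * (V \<bullet> V) + 6 * (s * (V \<bullet> G)) + 2 * (s * (V \<bullet> z))) + (3 * (s\<^sup>2 * (G \<bullet> G)) + 2 * (s\<^sup>2 * (z \<bullet> G))) - s\<^sup>2 * (z \<bullet> z)" .
    moreover have "a = c + d / \<tau> - e / \<tau>" if "\<tau> * a = \<tau> * c + d - e" for a c d e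
    proof -
      have "a = (\<tau> * c + d - e) / \<tau>" unfolding that[symmetric] using \<tau>0 by simp
      then show ?thesis using \<tau>0 by (simp add: add_divide_distrib diff_divide_distrib)
    qed
    ultimately have "3 * \<tau> * (y \<bullet> y) + 4 * s * (y \<bullet> z) = 3 * \<tau> * (V \<bullet> V) + 6 * (s * (V \<bullet> G)) + 2 * (s * (V \<bullet> z))
        + (3 * (s\<^sup>2 * (G \<bullet> G)) + 2 * (s\<^sup>2 * (z \<bullet> G))) / \<tau> - s\<^sup>2 * (z \<bullet> z) / \<tau>"
      by blast
    moreover have "s\<^sup>2 * (z \<bullet> z) / \<tau> = (z \<bullet> z) / \<tau> - z \<bullet> z"
      using \<tau>0 unfolding \<tau>_def by (simp add: field_simps)
    moreover have "3 * (y \<bullet> y) + 2 * s * (y \<bullet> (z - s *\<^sub>R y)) - (z - s *\<^sub>R y + G) \<bullet> (z - s *\<^sub>R y + G)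
       = (3 * \<tau> * (y \<bullet> y) + 4 * s * (y \<bullet> z)) - z \<bullet> z - 2 * (z \<bullet> G) + 2 * (s * (y \<bullet> G)) - G \<bullet> G"
      unfolding \<tau>_def by (simp add: inner_add_left inner_add_right inner_diff_left inner_diff_right inner_commute power2_eq_square algebra_simps)
    moreover have "\<bar>s * (V \<bullet> G)\<bar> \<le> 1 * Z" unfolding abs_mult using s1 abs_VG by (intro mult_mono) auto
    moreover have "\<bar>s * (y \<bullet> G)\<bar> \<le> 1 * (4 * (Z / \<epsilon>))" unfolding abs_mult
    proof (intro mult_mono)
      show "\<bar>y \<bullet> G\<bar> \<le> 4 * (Z / \<epsilon>)"
        using Cauchy_Schwarz_ineq2[of y G] mult_left_mono[OF norm_G, of "norm y"] Cy by (simp add: mult.commute)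
    qed (use s1 in auto)
    moreover have "(3 * (s\<^sup>2 * (G \<bullet> G)) + 2 * (s\<^sup>2 * (z \<bullet> G))) / \<tau> \<ge> - 2 * (Z / \<epsilon>)"
    proof -
      have "\<bar>s\<^sup>2 * (z \<bullet> G)\<bar> \<le> 1 * Z" unfolding abs_mult using s2 abs_zG by (intro mult_mono) auto
      moreover have "s\<^sup>2 * (G \<bullet> G) \<ge> 0" by simp
      ultimately have "3 * (s\<^sup>2 * (G \<bullet> G)) + 2 * (s\<^sup>2 * (z \<bullet> G)) \<ge> - (2 * Z)" by linarith
      then have "(3 * (s\<^sup>2 * (G \<bullet> G)) + 2 * (s\<^sup>2 * (z \<bullet> G))) / \<tau> \<ge> - (2 * Z) / \<tau>" using \<tau>0 by (intro divide_right_mono) auto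
      moreover have "2 * Z / \<tau> \<le> 2 * Z / \<epsilon>" using \<tau> \<tau>0 \<epsilon>0 Z0 by (intro divide_left_mono) auto
      ultimately show ?thesis by simp
    qed
    ultimately show ?thesis using abs_zG GG_le by linarith
  qed
  have T2: "- F x * (p \<bullet> Y) + \<tau> * (\<beta> * v * F x + \<alpha> * lr) \<ge> - 4 * Z"
  proof -
    have "- F x * (p \<bullet> Y) + \<tau> * (\<beta> * v * F x + \<alpha> * lr) = \<tau> * (\<beta> * v * F x + \<alpha> * lr - F x * (p \<bullet> V)) - s * (F x * (p \<bullet> G))"
      unfolding Y_def by (simp add: inner_add_right algebra_simps)
    moreover have "\<tau> * (\<beta> * v * F x + \<alpha> * lr - F x * (p \<bullet> V)) \<ge> \<tau> * (- 3 * Z)"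
      using F_terms(1) \<tau>0 by (intro mult_left_mono) auto
    moreover have "\<tau> * (3 * Z) \<le> 1 * (3 * Z)" using \<tau> Z0 by (intro mult_right_mono) auto
    moreover have "\<bar>s * (F x * (p \<bullet> G))\<bar> \<le> 1 * Z" unfolding abs_mult[of s] using s1 F_terms(2) by (intro mult_mono) auto
    ultimately show ?thesis by linarith
  qed
  have T3: "dF \<bullet> ((1 / v) *\<^sub>R p + s *\<^sub>R \<gamma> x) \<ge> - 2 * Z" using dF_term[of s] pp s1 by simp
  have T4: "s * E / v \<ge> - (3 * Z + 2 * (C * norm y))" using E_term[of s] s1 by simp
  have A: "N\<^sup>2 - (z \<bullet> z) / \<tau> + \<tau> * (V \<bullet> V) + 2 * (s * (V \<bullet> z)) \<le> 18 * Z + 18 * (Z / \<epsilon>)"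
    using ineq T1 T2 T3 T4 Cy by linarith
  define h where "h = (1 / sqrt \<tau>) *\<^sub>R g"
  define M where "M = N\<^sup>2 - B h \<bullet> B h"
  have hh: "h \<bullet> h = 1" using \<tau>0 by (simp add: h_def gg \<tau>_def[symmetric])
  have Bh: "B h = (1 / sqrt \<tau>) *\<^sub>R z" by (simp add: h_def linear_scale[OF linear_B] z_def)
  have Mz: "M = N\<^sup>2 - (z \<bullet> z) / \<tau>" using \<tau>0 by (simp add: M_def Bh)
  note ub = selfadjoint_unit_bounds[OF linear_B B_symmetric hh M_def[unfolded N_def]]
  have M0: "M \<ge> 0" by (rule ub(1))
  have NM: "N\<^sup>2 \<le> 2 * Z + (2 + 2 * DIM('a)) * M"
  proof -
    have "(F x)\<^sup>2 \<le> C\<^sup>2" using FC power_mono[of "\<bar>F x\<bar>" C 2] by simp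
    then show ?thesis using ub(2) C2_Z(1) unfolding trace_B N_def by linarith
  qed
  have Vz: "\<bar>V \<bullet> z\<bar> \<le> sqrt \<tau> * (sqrt M * norm V) + 2 * Z"
  proof -
    have "V \<bullet> z = sqrt \<tau> * (B h \<bullet> V)" using \<tau>0 by (simp add: Bh inner_commute)
    then have "\<bar>V \<bullet> z\<bar> = sqrt \<tau> * \<bar>B h \<bullet> V\<bar>" using \<tau>0 by (simp add: abs_mult)
    also have "\<dots> \<le> sqrt \<tau> * (sqrt M * norm V + N * \<bar>h \<bullet> V\<bar>)"
      using ub(3)[of V] \<tau>0 unfolding N_def by (intro mult_left_mono) auto
    also have "\<dots> = sqrt \<tau> * (sqrt M * norm V) + N * \<bar>g \<bullet> V\<bar>"
      using \<tau>0 by (simp add: h_def abs_mult distrib_left)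
    finally have 1: "\<bar>V \<bullet> z\<bar> \<le> sqrt \<tau> * (sqrt M * norm V) + N * \<bar>g \<bullet> V\<bar>" .
    have "g \<bullet> V = \<beta> * (- s / v) + \<alpha> * (g \<bullet> rho p R)" by (simp add: V_def inner_add_right gk)
    moreover have "\<bar>\<beta> * (- s / v)\<bar> \<le> 1"
    proof -
      have "\<bar>\<beta> * (- s / v)\<bar> = (\<beta> / v) * \<bar>s\<bar>" using \<beta> by (simp add: abs_mult)
      also have "\<dots> \<le> 1 * 1" using \<beta> s1 by (intro mult_mono) auto
      finally show ?thesis by simp
    qed
    moreover have "\<bar>g \<bullet> rho p R\<bar> \<le> 1 * C"
      by (rule order_trans[OF Cauchy_Schwarz_ineq2 mult_mono[OF norm_g norm_rho_R]]) auto
    then have "\<bar>\<alpha> * (g \<bullet> rho p R)\<bar> \<le> \<alpha> * C" using \<alpha> by (simp add: abs_mult mult_left_mono)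
    ultimately have "\<bar>g \<bullet> V\<bar> \<le> 1 + \<alpha> * C" by linarith
    then have "N * \<bar>g \<bullet> V\<bar> \<le> N * (1 + \<alpha> * C)" using N0 by (rule mult_left_mono)
    also have "\<dots> = N + \<alpha> * C * N" by (simp add: algebra_simps)
    finally show ?thesis using 1 N_Z aCN_Z by linarith
  qed
  \<comment> \<open>Without the factor s the cross term could just be absorbed completely; |s| \<le>
    q^2 leaves the share \<epsilon> = 1 - q^2 of the form.\<close>
  have "2 * (sqrt \<tau> * (sqrt M * norm V)) \<le> M + \<tau> * (V \<bullet> V)"
  proof -
    have "0 \<le> (sqrt M - sqrt \<tau> * norm V)\<^sup>2" by simp
    then show ?thesis using M0 \<tau>0 by (simp add: power2_diff power_mult_distrib power2_norm_eq_inner mult_ac)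
  qed
  then have "2 * \<bar>V \<bullet> z\<bar> \<le> M + \<tau> * (V \<bullet> V) + 4 * Z" using Vz by linarith
  then have "\<bar>s\<bar> * (2 * \<bar>V \<bullet> z\<bar>) \<le> \<bar>s\<bar> * (M + \<tau> * (V \<bullet> V) + 4 * Z)" by (intro mult_left_mono) auto
  also have "\<dots> \<le> q\<^sup>2 * (M + \<tau> * (V \<bullet> V)) + 4 * Z"
  proof -
    have "\<bar>s\<bar> * (M + \<tau> * (V \<bullet> V)) \<le> q\<^sup>2 * (M + \<tau> * (V \<bullet> V))" using s M0 \<tau>0 by (intro mult_right_mono) auto
    moreover have "\<bar>s\<bar> * (4 * Z) \<le> 1 * (4 * Z)" using s1 Z0 by (intro mult_right_mono) auto
    ultimately show ?thesis by (simp only: distrib_left)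
  qed
  finally have "2 * \<bar>s * (V \<bullet> z)\<bar> \<le> q\<^sup>2 * (M + \<tau> * (V \<bullet> V)) + 4 * Z" by (simp add: abs_mult mult_ac)
  moreover have "- \<bar>s * (V \<bullet> z)\<bar> \<le> s * (V \<bullet> z)" by simp
  ultimately have "(M + \<tau> * (V \<bullet> V)) - q\<^sup>2 * (M + \<tau> * (V \<bullet> V)) \<le> 22 * Z + 18 * (Z / \<epsilon>)"
    using A unfolding Mz[symmetric] by linarith
  then have e1: "\<epsilon> * (M + \<tau> * (V \<bullet> V)) \<le> 22 * Z + 18 * (Z / \<epsilon>)" unfolding \<epsilon> by (simp only: left_diff_distrib mult_1_left)
  have "\<epsilon> * \<beta>\<^sup>2 - 3 * Z \<le> \<epsilon> * (V \<bullet> V)"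
  proof -
    have "\<epsilon> * (\<beta>\<^sup>2 - 3 * Z) \<le> \<epsilon> * (V \<bullet> V)" using VV \<epsilon>0 by (intro mult_left_mono) auto
    moreover have "\<epsilon> * (3 * Z) \<le> 1 * (3 * Z)" using \<epsilon> Z0 by (intro mult_right_mono) auto
    ultimately show ?thesis by (simp only: right_diff_distrib)
  qed
  also have "\<dots> \<le> \<tau> * (V \<bullet> V)" using \<tau> by (intro mult_right_mono) auto
  finally have e2: "\<epsilon> * \<beta>\<^sup>2 - 3 * Z \<le> \<tau> * (V \<bullet> V)" .
  have e3: "N\<^sup>2 / (2 + 2 * DIM('a)) \<le> Z + M"
  proof -
    have "N\<^sup>2 \<le> (2 + 2 * DIM('a)) * (Z + M)"
    proof -
      have "2 * Z \<le> (2 + 2 * DIM('a)) * Z" using Z0 by (intro mult_right_mono) auto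
      then show ?thesis using NM by (simp only: distrib_left)
    qed
    then show ?thesis by (simp add: pos_divide_le_eq mult.commute)
  qed
  have "\<epsilon> * (N\<^sup>2 / (2 + 2 * DIM('a)) + \<epsilon> * \<beta>\<^sup>2) \<le> \<epsilon> * ((M + \<tau> * (V \<bullet> V)) + 4 * Z)"
    using e2 e3 \<epsilon>0 by (intro mult_left_mono) auto
  also have "\<dots> \<le> \<epsilon> * (M + \<tau> * (V \<bullet> V)) + 1 * (4 * Z)"
    unfolding distrib_left using \<epsilon> Z0 by (intro add_mono order_refl mult_right_mono) auto
  finally show ?thesis using e1 Z0 by linarith
qed

text \<open>Both estimates give c (N^2 + \<beta>^2) \<le> \<kappa> Z with a common constant c. As Z
  is linear in N and \<beta>, this reads N^2 + \<beta>^2 \<le> M (1 + N + \<beta>) with M free of N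
  and \<beta>, and the quadratic left side bounds \<beta>.\<close>

lemma beta_bounded:
  assumes q: "0 < q" "q < 1"
    and c: "c = (1 - q) * (1 - q\<^sup>2)\<^sup>2 / (2 + 2 * DIM('a))"
    and M: "M = (27 + 18 / (1 - q\<^sup>2)) * (C\<^sup>2 * (1 + \<alpha>)\<^sup>2) / c"
    and cases: "(\<exists>b. \<bar>b\<bar> = q\<^sup>2 \<and> p \<bullet> p + b * v * \<theta> \<ge> 0 \<and>
      (\<forall>\<^sub>F w in nhds x. ln (slope (grad u w) + b * (grad u w \<bullet> \<gamma> w)) + (\<beta> * u w + \<alpha> * rt w)
       \<le> ln (slope (grad u x) + b * (grad u x \<bullet> \<gamma> x)) + (\<beta> * u x + \<alpha> * rt x))) \<or>
      (\<bar>s\<bar> \<le> q\<^sup>2 \<and> p \<bullet> p + s * v * \<theta> \<ge> 0 \<and>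
      (\<forall>\<^sub>F w in nhds x. ln ((slope (grad u w))\<^sup>2 - (grad u w \<bullet> \<gamma> w)\<^sup>2) / 2 + (\<beta> * u w + \<alpha> * rt w)
       \<le> ln ((slope (grad u x))\<^sup>2 - (grad u x \<bullet> \<gamma> x)\<^sup>2) / 2 + (\<beta> * u x + \<alpha> * rt x)))"
  shows "\<beta> < 2 * M + 2"
proof -
  define \<epsilon> where "\<epsilon> = 1 - q\<^sup>2"
  define n where "n = real (2 + 2 * DIM('a))"
  define \<kappa> where "\<kappa> = 27 + 18 / \<epsilon>"
  have \<epsilon>: "0 < \<epsilon>" "\<epsilon> \<le> 1" using q by (auto simp: \<epsilon>_def abs_square_less_1)
  have n: "n \<ge> 1" by (simp add: n_def)
  have cn: "c = (1 - q) * \<epsilon>\<^sup>2 / n" by (simp add: c \<epsilon>_def n_def)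
  then have c0: "c > 0" using q \<epsilon> n by simp
  have S: "N\<^sup>2 + \<beta>\<^sup>2 \<ge> 0" by simp
  have "c * (N\<^sup>2 + \<beta>\<^sup>2) \<le> \<kappa> * Z"
    using cases
  proof (elim disjE exE conjE)
    fix b assume b: "\<bar>b\<bar> = q\<^sup>2" "p \<bullet> p + b * v * \<theta> \<ge> 0"
      and mx: "\<forall>\<^sub>F w in nhds x. ln (slope (grad u w) + b * (grad u w \<bullet> \<gamma> w)) + (\<beta> * u w + \<alpha> * rt w)
       \<le> ln (slope (grad u x) + b * (grad u x \<bullet> \<gamma> x)) + (\<beta> * u x + \<alpha> * rt x)"
    have "c \<le> (1 - q) * \<epsilon>"
    proof -
      have "(1 - q) * \<epsilon>\<^sup>2 / n \<le> (1 - q) * \<epsilon>\<^sup>2 / 1" using n q by (intro divide_left_mono) auto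
      also have "\<dots> \<le> (1 - q) * \<epsilon>" using \<epsilon> q by (simp add: power2_eq_square mult_left_le)
      finally show ?thesis by (simp add: cn)
    qed
    then have "c * (N\<^sup>2 + \<beta>\<^sup>2) \<le> (1 - q) * \<epsilon> * (N\<^sup>2 + \<beta>\<^sup>2)" using S by (rule mult_right_mono)
    also have "\<dots> \<le> 25 * Z + 10 * (Z / \<epsilon>)" by (rule affine_estimate[OF q b(1) \<epsilon>_def b(2) mx])
    also have "\<dots> \<le> 27 * Z + 18 * (Z / \<epsilon>)"
    proof -
      have "Z / \<epsilon> \<ge> 0" using Z0 \<epsilon> by simp
      then show ?thesis using Z0 by linarith
    qed
    also have "\<dots> = \<kappa> * Z" by (simp add: \<kappa>_def algebra_simps)
    finally show ?thesis .
  next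
    assume s: "\<bar>s\<bar> \<le> q\<^sup>2" "p \<bullet> p + s * v * \<theta> \<ge> 0"
      and mx: "\<forall>\<^sub>F w in nhds x. ln ((slope (grad u w))\<^sup>2 - (grad u w \<bullet> \<gamma> w)\<^sup>2) / 2 + (\<beta> * u w + \<alpha> * rt w)
       \<le> ln ((slope (grad u x))\<^sup>2 - (grad u x \<bullet> \<gamma> x)\<^sup>2) / 2 + (\<beta> * u x + \<alpha> * rt x)"
    have "c \<le> 1 * \<epsilon>\<^sup>2 / n" unfolding cn using q n by (intro divide_right_mono mult_right_mono) auto
    then have "c * (N\<^sup>2 + \<beta>\<^sup>2) \<le> 1 * \<epsilon>\<^sup>2 / n * (N\<^sup>2 + \<beta>\<^sup>2)" using S by (rule mult_right_mono)
    also have "\<dots> = \<epsilon> * (\<epsilon> * (N\<^sup>2 / n) + \<epsilon> * \<beta>\<^sup>2 / n)" by (simp add: power2_eq_square add_divide_distrib algebra_simps)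
    also have "\<dots> \<le> \<epsilon> * (1 * (N\<^sup>2 / n) + \<epsilon> * \<beta>\<^sup>2 / 1)"
      using \<epsilon> n by (intro mult_left_mono add_mono mult_right_mono divide_left_mono) auto
    also have "\<dots> = \<epsilon> * (N\<^sup>2 / (2 + 2 * DIM('a)) + \<epsilon> * \<beta>\<^sup>2)" by (simp add: n_def)
    also have "\<dots> \<le> 27 * Z + 18 * (Z / \<epsilon>)" by (rule tangential_estimate[OF q s(1) \<epsilon>_def s(2) mx])
    also have "\<dots> = \<kappa> * Z" by (simp add: \<kappa>_def algebra_simps)
    finally show ?thesis .
  qed
  then have "N\<^sup>2 + \<beta>\<^sup>2 \<le> \<kappa> * Z / c" using c0 by (simp add: pos_le_divide_eq mult.commute)
  also have "\<dots> = M * (1 + N + \<beta>)" by (simp add: M Z_def \<kappa>_def \<epsilon>_def)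
  finally have le: "N\<^sup>2 + \<beta>\<^sup>2 \<le> M * (1 + N + \<beta>)" .
  have M0: "M \<ge> 0" unfolding M using c0 \<epsilon> by (simp add: \<epsilon>_def)
  show ?thesis
  proof (rule ccontr)
    assume "\<not> \<beta> < 2 * M + 2"
    then have b: "\<beta> \<ge> 2 * M + 2" by simp
    then have "\<beta> * (\<beta> - M) \<ge> (2 * M + 2) * (M + 2)" using M0 by (intro mult_mono) auto
    moreover have "0 \<le> (N - M / 2)\<^sup>2" by simp
    then have "N\<^sup>2 - M * N + M\<^sup>2 / 4 \<ge> 0" by (simp add: power2_eq_square algebra_simps)
    moreover have "(2 * M + 2) * (M + 2) = 2 * M\<^sup>2 + 6 * M + 4" by (simp add: power2_eq_square algebra_simps)
    moreover have "\<beta> * (\<beta> - M) = \<beta>\<^sup>2 - M * \<beta>" by (simp add: power2_eq_square algebra_simps)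
    moreover have "M * (1 + N + \<beta>) = M + M * N + M * \<beta>" by (simp add: algebra_simps)
    ultimately show False using le M0 zero_le_power2[of M] by linarith
  qed
qed

end

section \<open>A defining function of the domain\<close>

lemma isCont_eventually_in_open:
  assumes "isCont c a" "open T" "c a \<in> T"
  shows "\<forall>\<^sub>F t in nhds a. c t \<in> T"
  using topological_tendstoD[OF assms(1)[unfolded isCont_def] assms(2,3)] assms(3)
  by (simp add: eventually_nhds_conv_at)

text \<open>h is the height above the boundary graph. It is defined on the whole space and grows
  with unit speed along e, so any point can be moved to a prescribed level of h by a shift along
  e.\<close>

locale boundary_chart =
  fixes \<Omega> :: "'a::euclidean_space set" and x\<^sub>0 e :: 'a and r :: real and h :: "'a \<Rightarrow> real"
  assumes r: "r > 0" and e: "norm e = 1" and h: "Ck_on 1 UNIV h"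
    and h_shift: "\<And>x t. h (x + t *\<^sub>R e) = h x + t"
    and chart: "\<Omega> \<inter> ball x\<^sub>0 r = {x \<in> ball x\<^sub>0 r. h x > 0}"
    and op: "open \<Omega>"
begin

lemma h_GDERIV: "GDERIV h x :> grad h x"
  using Ck_on_GDERIV[of 0 UNIV h x] h by simp

lemma h_line: "((\<lambda>t. h (x + t *\<^sub>R w)) has_real_derivative grad h (x + t *\<^sub>R w) \<bullet> w) (at t)"
  by (rule GDERIV_line[OF h_GDERIV])

lemma grad_h_e: "grad h x \<bullet> e = 1"
proof -
  have "((\<lambda>t. h x + t) has_real_derivative grad h x \<bullet> e) (at 0)"
    using h_line[of x e 0] unfolding h_shift by simp
  moreover have "((\<lambda>t. h x + t) has_real_derivative 1) (at 0)" by (auto intro!: derivative_eq_intros)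
  ultimately show ?thesis by (rule DERIV_unique)
qed

lemma grad_h_nz: "grad h x \<noteq> 0"
  using grad_h_e[of x] by auto

lemma h_cont: "continuous_on UNIV h" by (rule Ck_on_imp_continuous[OF h])

lemma in_\<Omega>: "x \<in> ball x\<^sub>0 r \<Longrightarrow> x \<in> \<Omega> \<longleftrightarrow> h x > 0"
  using chart by blast

lemma frontier_h_zero:
  assumes "x \<in> frontier \<Omega>" "x \<in> ball x\<^sub>0 r" shows "h x = 0"
proof -
  have "\<not> h x > 0" using assms in_\<Omega> op by (auto simp: frontier_def interior_open)
  moreover have "\<not> h x < 0"
  proof
    assume "h x < 0"
    then have "open ({y. h y < 0} \<inter> ball x\<^sub>0 r)" "x \<in> {y. h y < 0} \<inter> ball x\<^sub>0 r"
      using assms(2) open_Collect_less[OF h_cont continuous_on_const, of 0] by auto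
    moreover have "x \<in> closure \<Omega>" using assms(1) by (simp add: frontier_def)
    ultimately have "\<Omega> \<inter> ({y. h y < 0} \<inter> ball x\<^sub>0 r) \<noteq> {}"
      using open_Int_closure_eq_empty[of "{y. h y < 0} \<inter> ball x\<^sub>0 r" \<Omega>] by blast
    then show False using in_\<Omega> by fastforce
  qed
  ultimately show ?thesis by simp
qed

lemma h_zero_frontier:
  assumes "h x = 0" "x \<in> ball x\<^sub>0 r" shows "x \<in> frontier \<Omega>"
proof -
  have "x \<notin> \<Omega>" using assms in_\<Omega> by simp
  moreover have "x \<in> closure \<Omega>"
    unfolding closure_approachable
  proof (intro allI impI)
    fix d :: real assume d: "d > 0"
    obtain d' where d': "d' > 0" "ball x d' \<subseteq> ball x\<^sub>0 r" using assms(2) openE open_ball by blast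
    define t where "t = min d d' / 2"
    have t: "0 < t" "t < d" "t < d'" using d d' by (auto simp: t_def)
    have "x + t *\<^sub>R e \<in> ball x d'" using t e by (simp add: dist_norm)
    then have "x + t *\<^sub>R e \<in> \<Omega>" using d'(2) in_\<Omega> h_shift assms(1) t(1) by auto
    moreover have "dist (x + t *\<^sub>R e) x < d" using t e by (simp add: dist_norm)
    ultimately show "\<exists>y\<in>\<Omega>. dist y x < d" by blast
  qed
  ultimately show ?thesis using op by (simp add: frontier_def interior_open)
qed

lemma eventually_inside:
  assumes "x \<in> frontier \<Omega>" "x \<in> ball x\<^sub>0 r" "grad h x \<bullet> w > 0"
  shows "\<exists>\<epsilon>>0. \<forall>t. 0 < t \<and> t < \<epsilon> \<longrightarrow> x + t *\<^sub>R w \<in> \<Omega>"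
proof -
  have "((\<lambda>t. h (x + t *\<^sub>R w)) has_real_derivative grad h x \<bullet> w) (at 0)" using h_line[of x w 0] by simp
  from DERIV_pos_inc_right[OF this assms(3)] obtain d where d: "d > 0" "\<And>t. 0 < t \<Longrightarrow> t < d \<Longrightarrow> h x < h (x + t *\<^sub>R w)"
    by auto
  obtain d' where d': "d' > 0" "ball x d' \<subseteq> ball x\<^sub>0 r" using assms(2) openE open_ball by blast
  have w: "norm w > 0" using assms(3) by auto
  show ?thesis
  proof (intro exI[of _ "min d (d' / norm w)"] conjI allI impI)
    show "0 < min d (d' / norm w)" using d(1) d'(1) w by simp
    fix t assume t: "0 < t \<and> t < min d (d' / norm w)"
    then have "x + t *\<^sub>R w \<in> ball x d'" using w by (simp add: dist_norm pos_less_divide_eq)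
    then show "x + t *\<^sub>R w \<in> \<Omega>" using d'(2) in_\<Omega> d(2)[of t] t frontier_h_zero[OF assms(1,2)] by auto
  qed
qed

text \<open>The line x + t w is corrected along e so as to stay on the level h = \<epsilon>. If w is
  orthogonal to the gradient of h at x, the velocity at t = 0 is w.\<close>

lemma tangent_curve_derivative:
  "((\<lambda>t. x + t *\<^sub>R w + (\<epsilon> - h (x + t *\<^sub>R w)) *\<^sub>R e) has_vector_derivative (w - (grad h (x + t *\<^sub>R w) \<bullet> w) *\<^sub>R e)) (at t)"
  using h_line[of x w t] by (auto intro!: derivative_eq_intros simp: has_real_derivative_iff_has_vector_derivative)

lemma h_tangent_curve: "h (x + t *\<^sub>R w + (\<epsilon> - h (x + t *\<^sub>R w)) *\<^sub>R e) = \<epsilon>"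
  unfolding h_shift by simp

lemma inward_unit_normal_orthogonal:
  assumes x: "x \<in> frontier \<Omega>" "x \<in> ball x\<^sub>0 r" and \<nu>: "inward_unit_normal \<Omega> x \<nu>" and w: "grad h x \<bullet> w = 0"
  shows "w \<bullet> \<nu> = 0"
proof -
  define c where "c t = x + t *\<^sub>R w + (0 - h (x + t *\<^sub>R w)) *\<^sub>R e" for t
  have hx: "h x = 0" by (rule frontier_h_zero[OF x])
  have c0: "c 0 = x" by (simp add: c_def hx)
  have dc: "(c has_vector_derivative w) (at 0)"
    using tangent_curve_derivative[of x w 0 0] w unfolding c_def[abs_def] by simp
  have "isCont c 0" using dc has_vector_derivative_continuous by blast
  then have "\<forall>\<^sub>F t in nhds 0. c t \<in> ball x\<^sub>0 r"
    by (rule isCont_eventually_in_open) (use x c0 in auto)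
  then obtain d where d: "d > 0" "\<And>t. dist t 0 < d \<Longrightarrow> c t \<in> ball x\<^sub>0 r"
    unfolding eventually_nhds_metric by blast
  \<comment> \<open>The definition of the normal asks for curves that stay in the boundary for all
    times; freezing the curve at x outside a short interval does not change its velocity at
    0.\<close>
  define c' where "c' t = (if \<bar>t\<bar> < d then c t else x)" for t
  have "c' t \<in> frontier \<Omega>" for t
  proof -
    have "h (c t) = 0" unfolding c_def by (rule h_tangent_curve)
    then show ?thesis using d(2)[of t] x(1) h_zero_frontier[of "c t"] by (auto simp: c'_def)
  qed
  moreover have "c' 0 = x" using d(1) by (simp add: c'_def c0)
  moreover have "(c' has_vector_derivative w) (at 0)"
    by (rule has_vector_derivative_transform_within_open[OF dc, of "{-d<..<d}"]) (use d(1) in \<open>auto simp: c'_def abs_less_iff\<close>)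
  ultimately show ?thesis using \<nu> unfolding inward_unit_normal_def by blast
qed

lemma inward_unit_normal_unique:
  assumes x: "x \<in> frontier \<Omega>" "x \<in> ball x\<^sub>0 r" and \<nu>: "inward_unit_normal \<Omega> x \<nu>"
  shows "grad h x = norm (grad h x) *\<^sub>R \<nu>"
proof -
  define g where "g = grad h x"
  have g: "g \<noteq> 0" by (simp add: g_def grad_h_nz)
  have nu: "norm \<nu> = 1" using \<nu> by (simp add: inward_unit_normal_def)
  \<comment> \<open>The part of \<nu> orthogonal to the gradient is itself a tangent direction,
    hence orthogonal to \<nu>, hence zero.\<close>
  define w where "w = \<nu> - ((g \<bullet> \<nu>) / (g \<bullet> g)) *\<^sub>R g"
  have gw: "g \<bullet> w = 0" using g by (simp add: w_def inner_diff_right)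
  then have "w \<bullet> \<nu> = 0" using inward_unit_normal_orthogonal[OF x \<nu>] by (simp add: g_def)
  then have "w \<bullet> w = 0" using gw by (simp add: w_def inner_diff_right inner_diff_left inner_commute)
  then have \<nu>g: "\<nu> = ((g \<bullet> \<nu>) / (g \<bullet> g)) *\<^sub>R g" by (simp add: w_def)
  define a where "a = (g \<bullet> \<nu>) / (g \<bullet> g)"
  have "\<not> a < 0"
  proof
    assume a: "a < 0"
    have "grad h x \<bullet> (- \<nu>) > 0" using a g unfolding g_def[symmetric] by (subst \<nu>g) (simp add: a_def[symmetric] mult_neg_pos)
    have "((\<lambda>t. h (x + t *\<^sub>R \<nu>)) has_real_derivative grad h x \<bullet> \<nu>) (at 0)" using h_line[of x \<nu> 0] by simp
    moreover have "grad h x \<bullet> \<nu> < 0" using \<open>grad h x \<bullet> (- \<nu>) > 0\<close> by simp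
    ultimately obtain d where d: "d > 0" "\<And>t. 0 < t \<Longrightarrow> t < d \<Longrightarrow> h (x + t *\<^sub>R \<nu>) < h x"
      using DERIV_neg_dec_right[of "\<lambda>t. h (x + t *\<^sub>R \<nu>)" _ 0] by auto
    obtain d' where d': "d' > 0" "ball x d' \<subseteq> ball x\<^sub>0 r" using x(2) openE open_ball by blast
    obtain \<epsilon> where \<epsilon>: "\<epsilon> > 0" "\<And>t. 0 < t \<and> t < \<epsilon> \<Longrightarrow> x + t *\<^sub>R \<nu> \<in> \<Omega>"
      using \<nu> unfolding inward_unit_normal_def by blast
    define t where "t = min d (min d' \<epsilon>) / 2"
    have t: "0 < t" "t < d" "t < d'" "t < \<epsilon>" using d d' \<epsilon> by (auto simp: t_def)
    have "x + t *\<^sub>R \<nu> \<in> ball x d'" using t nu by (simp add: dist_norm)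
    then show False using d'(2) in_\<Omega> \<epsilon>(2)[of t] d(2)[of t] t frontier_h_zero[OF x] by force
  qed
  moreover have "a \<noteq> 0" using \<nu>g nu by (auto simp: a_def)
  ultimately have a: "a > 0" by simp
  have "norm \<nu> = \<bar>a\<bar> * norm g" using arg_cong[OF \<nu>g, of norm] by (simp add: a_def)
  then have "a * norm g = 1" using nu a by simp
  then have "norm g *\<^sub>R \<nu> = g" by (subst \<nu>g) (simp add: a_def[symmetric] mult.commute)
  then show ?thesis by (simp add: g_def)
qed

lemma inward_unit_normal_exists:
  assumes x: "x \<in> frontier \<Omega>" "x \<in> ball x\<^sub>0 r"
  shows "inward_unit_normal \<Omega> x (grad h x /\<^sub>R norm (grad h x))"
  unfolding inward_unit_normal_def
proof (intro conjI allI impI)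
  have g: "grad h x \<noteq> 0" by (rule grad_h_nz)
  then show "norm (grad h x /\<^sub>R norm (grad h x)) = 1" by simp
  show "\<exists>\<epsilon>>0. \<forall>t. 0 < t \<and> t < \<epsilon> \<longrightarrow> x + t *\<^sub>R (grad h x /\<^sub>R norm (grad h x)) \<in> \<Omega>"
    by (rule eventually_inside[OF x]) (use g in simp)
  fix c w assume c: "c 0 = x \<and> (\<forall>t::real. c t \<in> frontier \<Omega>) \<and> (c has_vector_derivative w) (at 0)"
  then have "isCont c 0" using has_vector_derivative_continuous by blast
  then have ev: "\<forall>\<^sub>F t in nhds 0. c t \<in> ball x\<^sub>0 r"
    by (rule isCont_eventually_in_open) (use c x in auto)
  have "((\<lambda>t. h (c t)) has_derivative (\<lambda>s. (s *\<^sub>R w) \<bullet> grad h x)) (at 0)"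
    using c h_GDERIV[of x] has_derivative_compose[of c "\<lambda>s. s *\<^sub>R w" 0 UNIV h "\<lambda>k. k \<bullet> grad h x"]
    by (simp add: gderiv_def has_vector_derivative_def)
  moreover have "((\<lambda>t. h (c t)) has_derivative (\<lambda>s. 0)) (at 0)"
  proof -
    have "\<forall>\<^sub>F t in nhds 0. h (c t) = 0" using ev by eventually_elim (use c frontier_h_zero in blast)
    then obtain d where d: "d > 0" "\<And>t. dist t 0 < d \<Longrightarrow> h (c t) = 0" unfolding eventually_nhds_metric by blast
    have "((\<lambda>t. 0::real) has_derivative (\<lambda>s. 0)) (at (0::real))" by simp
    then show ?thesis
      by (rule has_derivative_transform_within_open[OF _ open_ball[of 0 d]]) (use d in \<open>auto simp: dist_commute\<close>)
  qed
  ultimately have "(\<lambda>s. (s *\<^sub>R w) \<bullet> grad h x) = (\<lambda>s. 0)" by (rule has_derivative_unique)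
  from fun_cong[OF this, of 1] show "w \<bullet> (grad h x /\<^sub>R norm (grad h x)) = 0" by simp
qed

text \<open>As \<open>g\<close> need not be differentiable on the boundary itself, the boundary curve is first pushed
  into the domain.\<close>

lemma tangential_derivative_zero:
  assumes x: "x \<in> frontier \<Omega>" "x \<in> ball x\<^sub>0 r" and U: "open U" "x \<in> U"
    and g: "continuous_on (closure \<Omega> \<inter> U) g" "\<And>y. y \<in> \<Omega> \<inter> U \<Longrightarrow> GDERIV g y :> G y"
    and G: "continuous_on (closure \<Omega> \<inter> U) G"
    and g0: "\<And>y. y \<in> frontier \<Omega> \<inter> U \<Longrightarrow> g y = 0" and w: "grad h x \<bullet> w = 0"
  shows "G x \<bullet> w = 0"
proof (rule ccontr)
  assume nz: "G x \<bullet> w \<noteq> 0"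
  have xc: "x \<in> closure \<Omega> \<inter> U" using x U by (simp add: frontier_def)
  define c where "c q = x + snd q *\<^sub>R w + (fst q - h (x + snd q *\<^sub>R w)) *\<^sub>R e" for q :: "real \<times> real"
  define w' where "w' t = w - (grad h (x + t *\<^sub>R w) \<bullet> w) *\<^sub>R e" for t :: real
  have hx: "h x = 0" by (rule frontier_h_zero[OF x])
  have c0: "c (0, 0) = x" by (simp add: c_def hx)
  have w0: "w' 0 = w" by (simp add: w'_def w)
  have cc: "continuous_on UNIV c" unfolding c_def
    by (intro continuous_intros continuous_on_compose2[OF h_cont]) auto
  have cw: "continuous_on UNIV w'" unfolding w'_def
    by (intro continuous_intros continuous_on_compose2[OF continuous_on_grad[OF h]]) auto
  obtain d1 where d1: "d1 > 0" "\<And>y. y \<in> closure \<Omega> \<inter> U \<Longrightarrow> dist y x < d1 \<Longrightarrow> dist (G y) (G x) < \<bar>G x \<bullet> w\<bar> / (4 * (norm w + 1))"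
  proof -
    have "0 < \<bar>G x \<bullet> w\<bar> / (4 * (norm w + 1))" using nz by (simp add: add_nonneg_pos)
    then show ?thesis using G xc that unfolding continuous_on_iff by blast
  qed
  obtain d2 where d2: "d2 > 0" "\<And>t. dist t 0 < d2 \<Longrightarrow> dist (w' t) (w' 0) < min 1 (\<bar>G x \<bullet> w\<bar> / (4 * (norm (G x) + 1)))"
  proof -
    have "0 < min 1 (\<bar>G x \<bullet> w\<bar> / (4 * (norm (G x) + 1)))" using nz by (simp add: add_nonneg_pos)
    then show ?thesis using cw that unfolding continuous_on_iff by blast
  qed
  have "isCont c (0, 0)" using cc by (simp add: continuous_on_eq_continuous_at)
  moreover have "open (ball x\<^sub>0 r \<inter> U \<inter> ball x d1)" "x \<in> ball x\<^sub>0 r \<inter> U \<inter> ball x d1" using x U d1(1) by auto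
  ultimately have "\<forall>\<^sub>F q in nhds (0, 0). c q \<in> ball x\<^sub>0 r \<inter> U \<inter> ball x d1"
    unfolding c0[symmetric] by (rule isCont_eventually_in_open)
  then obtain d3 where d3: "d3 > 0" "\<And>q. dist q (0, 0) < d3 \<Longrightarrow> c q \<in> ball x\<^sub>0 r \<inter> U \<inter> ball x d1"
    unfolding eventually_nhds_metric by blast
  define T where "T = min d2 d3 / 3"
  have T: "T > 0" "T < d2" "2 * T < d3" using d2(1) d3(1) by (auto simp: T_def min_def)
  have cin: "c (\<epsilon>, t) \<in> ball x\<^sub>0 r \<inter> U \<inter> ball x d1" if "\<bar>\<epsilon>\<bar> \<le> T" "\<bar>t\<bar> \<le> T" for \<epsilon> t
  proof (rule d3(2))
    have "dist (\<epsilon>, t) (0, 0) \<le> \<bar>\<epsilon>\<bar> + \<bar>t\<bar>"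
      using norm_Pair_le[of \<epsilon> t] by (simp add: dist_norm zero_prod_def[symmetric])
    then show "dist (\<epsilon>, t) (0, 0) < d3" using that T by linarith
  qed
  have hc: "h (c (\<epsilon>, t)) = \<epsilon>" for \<epsilon> t unfolding c_def fst_conv snd_conv by (rule h_tangent_curve)
  \<comment> \<open>On a level \<epsilon> > 0 the curve runs inside \<Omega>, where g is
    differentiable. The mean value theorem bounds the increment of g from below independently of
    \<epsilon>, whereas both end values tend to 0 with \<epsilon>.\<close>
  have big: "\<bar>g (c (\<epsilon>, T)) - g (c (\<epsilon>, 0))\<bar> \<ge> T * (\<bar>G x \<bullet> w\<bar> / 2)" if \<epsilon>: "0 < \<epsilon>" "\<epsilon> \<le> T" for \<epsilon>
  proof -
    have in\<Omega>: "c (\<epsilon>, t) \<in> \<Omega> \<inter> U" if "0 \<le> t" "t \<le> T" for t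
      using cin[of \<epsilon> t] that \<epsilon> in_\<Omega>[of "c (\<epsilon>, t)"] hc by auto
    have der: "((\<lambda>t. g (c (\<epsilon>, t))) has_real_derivative G (c (\<epsilon>, t)) \<bullet> w' t) (at t)" if "0 \<le> t" "t \<le> T" for t
    proof -
      have "((\<lambda>t. c (\<epsilon>, t)) has_derivative (\<lambda>s. s *\<^sub>R w' t)) (at t)"
        using tangent_curve_derivative[of x w \<epsilon> t] unfolding c_def w'_def by (simp add: has_vector_derivative_def)
      from has_derivative_compose[OF this g(2)[OF in\<Omega>[OF that], unfolded gderiv_def]]
      show ?thesis by (simp add: has_field_derivative_def mult_commute_abs inner_commute mult.commute)
    qed
    have "\<exists>t>0. t < T \<and> g (c (\<epsilon>, T)) - g (c (\<epsilon>, 0)) = (T - 0) * (G (c (\<epsilon>, t)) \<bullet> w' t)"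
      by (rule MVT2) (use T der in auto)
    then obtain t where t: "0 < t" "t < T" and eq: "g (c (\<epsilon>, T)) - g (c (\<epsilon>, 0)) = T * (G (c (\<epsilon>, t)) \<bullet> w' t)" by auto
    define D W where "D = G (c (\<epsilon>, t)) - G x" and "W = w' t - w"
    have nD: "norm D < \<bar>G x \<bullet> w\<bar> / (4 * (norm w + 1))"
      using d1(2)[of "c (\<epsilon>, t)"] in\<Omega>[of t] cin[of \<epsilon> t] t \<epsilon> closure_subset[of \<Omega>]
      by (auto simp: D_def dist_norm norm_minus_commute)
    have nW: "norm W < min 1 (\<bar>G x \<bullet> w\<bar> / (4 * (norm (G x) + 1)))"
      using d2(2)[of t] t T by (simp add: W_def w0 dist_norm)
    have "\<bar>D \<bullet> w' t\<bar> \<le> \<bar>G x \<bullet> w\<bar> / 4"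
    proof -
      have "norm (w' t) \<le> norm w + 1" using nW norm_triangle_ineq[of w W] by (simp add: W_def)
      then have "norm D * norm (w' t) \<le> \<bar>G x \<bullet> w\<bar> / (4 * (norm w + 1)) * (norm w + 1)"
        using nD by (intro mult_mono) auto
      also have "\<dots> = \<bar>G x \<bullet> w\<bar> / 4"
      proof -
        have num: "a / (4 * n) * n = a / 4" if "n > 0" for a n :: real using that by simp
        show ?thesis by (rule num) (simp add: add_nonneg_pos)
      qed
      finally show ?thesis using Cauchy_Schwarz_ineq2[of D "w' t"] by linarith
    qed
    moreover have "\<bar>G x \<bullet> W\<bar> \<le> \<bar>G x \<bullet> w\<bar> / 4"
    proof -
      have p1: "0 < norm (G x) + 1" by (simp add: add_nonneg_pos)
      have "norm (G x) * norm W \<le> (norm (G x) + 1) * (\<bar>G x \<bullet> w\<bar> / (4 * (norm (G x) + 1)))"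
        using nW by (intro mult_mono) auto
      also have "\<dots> = \<bar>G x \<bullet> w\<bar> / 4"
      proof -
        have num: "n * (a / (4 * n)) = a / 4" if "n > 0" for a n :: real using that by simp
        show ?thesis by (rule num[OF p1])
      qed
      finally show ?thesis using Cauchy_Schwarz_ineq2[of "G x" W] by linarith
    qed
    moreover have "G (c (\<epsilon>, t)) \<bullet> w' t = G x \<bullet> w + G x \<bullet> W + D \<bullet> w' t"
      by (simp add: D_def W_def inner_diff_left inner_diff_right)
    ultimately have "\<bar>G (c (\<epsilon>, t)) \<bullet> w' t\<bar> \<ge> \<bar>G x \<bullet> w\<bar> / 2" by linarith
    then show ?thesis unfolding eq using T(1) by (simp add: abs_mult)
  qed
  have lim: "((\<lambda>\<epsilon>. g (c (\<epsilon>, t))) \<longlongrightarrow> 0) (at_right 0)" if t: "0 \<le> t" "t \<le> T" for t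
  proof -
    have f0: "c (0, t) \<in> frontier \<Omega> \<inter> U" using cin[of 0 t] t T h_zero_frontier[of "c (0, t)"] hc by auto
    have "continuous_on {0..T} (\<lambda>\<epsilon>. c (\<epsilon>, t))"
      by (rule continuous_on_compose2[OF cc]) (auto intro!: continuous_intros)
    then have "continuous_on {0..T} (\<lambda>\<epsilon>. g (c (\<epsilon>, t)))"
    proof (rule continuous_on_compose2[OF g(1)], intro subsetI)
      fix y assume "y \<in> (\<lambda>\<epsilon>. c (\<epsilon>, t)) ` {0..T}"
      then obtain \<epsilon> where \<epsilon>: "0 \<le> \<epsilon>" "\<epsilon> \<le> T" "y = c (\<epsilon>, t)" by auto
      have "y \<in> closure \<Omega>"
      proof (cases "\<epsilon> = 0")
        case True then show ?thesis using f0 \<epsilon> by (simp add: frontier_def)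
      next
        case False
        then have "y \<in> \<Omega>" using cin[of \<epsilon> t] t \<epsilon> in_\<Omega>[of y] hc[of \<epsilon> t] by auto
        then show ?thesis using closure_subset by blast
      qed
      then show "y \<in> closure \<Omega> \<inter> U" using cin[of \<epsilon> t] t \<epsilon> by auto
    qed
    then have "((\<lambda>\<epsilon>. g (c (\<epsilon>, t))) \<longlongrightarrow> g (c (0, t))) (at 0 within {0..T})"
      using T by (simp add: continuous_on_def)
    moreover have "at 0 within {0..T} = at_right (0::real)" using T(1) by (rule at_within_Icc_at_right)
    ultimately show ?thesis using g0[OF f0] by simp
  qed
  have "((\<lambda>\<epsilon>. \<bar>g (c (\<epsilon>, T)) - g (c (\<epsilon>, 0))\<bar>) \<longlongrightarrow> \<bar>0 - 0\<bar>) (at_right 0)"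
    by (intro tendsto_intros lim) (use T in auto)
  moreover have "\<forall>\<^sub>F \<epsilon> in at_right 0. T * (\<bar>G x \<bullet> w\<bar> / 2) \<le> \<bar>g (c (\<epsilon>, T)) - g (c (\<epsilon>, 0))\<bar>"
    unfolding eventually_at_right_field using T(1) big by (intro exI[of _ T]) auto
  ultimately have "T * (\<bar>G x \<bullet> w\<bar> / 2) \<le> \<bar>0 - 0\<bar>"
    by (intro tendsto_lowerbound[where F="at_right 0"]) auto
  then show False using T(1) nz by (simp add: mult_le_0_iff)
qed

text \<open>First order condition at a boundary maximum, for every transversal inward direction and
  not just the normal one. On the ray along w the function is continuous up to the end point and
  differentiable beyond it; if G x . w were positive, continuity of G would make g strictly
  increasing there.\<close>

lemma inward_derivative_nonpos:
  assumes x: "x \<in> frontier \<Omega>" "x \<in> ball x\<^sub>0 r" and U: "open U" "x \<in> U"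
    and g: "continuous_on (closure \<Omega> \<inter> U) g" "\<And>y. y \<in> \<Omega> \<inter> U \<Longrightarrow> GDERIV g y :> G y"
    and G: "continuous_on (closure \<Omega> \<inter> U) G"
    and mx: "\<And>y. y \<in> \<Omega> \<inter> U \<Longrightarrow> g y \<le> g x" and w: "grad h x \<bullet> w > 0"
  shows "G x \<bullet> w \<le> 0"
proof (rule ccontr)
  assume "\<not> G x \<bullet> w \<le> 0"
  then have pos: "G x \<bullet> w > 0" by simp
  have xc: "x \<in> closure \<Omega> \<inter> U" using x U by (simp add: frontier_def)
  obtain \<epsilon> where \<epsilon>: "\<epsilon> > 0" "\<And>t. 0 < t \<and> t < \<epsilon> \<Longrightarrow> x + t *\<^sub>R w \<in> \<Omega>"
    using eventually_inside[OF x w] by blast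
  define c where "c t = x + t *\<^sub>R w" for t
  have cc: "continuous_on UNIV c" unfolding c_def by (intro continuous_intros)
  have "isCont c 0" using cc by (simp add: continuous_on_eq_continuous_at)
  then have "\<forall>\<^sub>F t in nhds 0. c t \<in> U"
    by (rule isCont_eventually_in_open) (use U in \<open>auto simp: c_def\<close>)
  then obtain d where d: "d > 0" "\<And>t. dist t 0 < d \<Longrightarrow> c t \<in> U" unfolding eventually_nhds_metric by blast
  define T where "T = min \<epsilon> d / 2"
  have T: "0 < T" "T < \<epsilon>" "T < d" using \<epsilon>(1) d(1) by (auto simp: T_def)
  have cin: "c t \<in> \<Omega> \<inter> U" if "0 < t" "t \<le> T" for t
    using \<epsilon>(2)[of t] d(2)[of t] that T by (auto simp: c_def)
  have c0: "c 0 = x" by (simp add: c_def)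
  have cK: "c ` {0..T} \<subseteq> closure \<Omega> \<inter> U"
  proof
    fix y assume "y \<in> c ` {0..T}"
    then obtain t where t: "0 \<le> t" "t \<le> T" "y = c t" by auto
    then show "y \<in> closure \<Omega> \<inter> U" using cin[of t] xc c0 closure_subset[of \<Omega>] by (cases "t = 0") auto
  qed
  have cG: "continuous_on {0..T} (\<lambda>t. G (c t) \<bullet> w)"
    by (intro continuous_intros continuous_on_compose2[OF G _ cK] continuous_on_subset[OF cc]) auto
  have cg: "continuous_on {0..T} (\<lambda>t. g (c t))"
    by (intro continuous_on_compose2[OF g(1) _ cK] continuous_on_subset[OF cc]) auto
  have "\<exists>s>0. \<forall>t\<in>{0..T}. dist t 0 < s \<longrightarrow> dist (G (c t) \<bullet> w) (G (c 0) \<bullet> w) < G x \<bullet> w"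
    using cG pos T(1) unfolding continuous_on_iff by (metis atLeastAtMost_iff less_eq_real_def)
  then obtain s where s: "s > 0" "\<And>t. t \<in> {0..T} \<Longrightarrow> dist t 0 < s \<Longrightarrow> dist (G (c t) \<bullet> w) (G (c 0) \<bullet> w) < G x \<bullet> w"
    by blast
  define T' where "T' = min T s / 2"
  have T': "0 < T'" "T' < T" "T' < s" using T(1) s(1) by (auto simp: T'_def)
  have pos': "G (c t) \<bullet> w > 0" if "0 \<le> t" "t \<le> T'" for t
    using s(2)[of t] that T' unfolding c0 by (auto simp: dist_real_def)
  have der: "((\<lambda>t. g (c t)) has_real_derivative G (c t) \<bullet> w) (at t)" if "0 < t" "t \<le> T" for t
    using GDERIV_line[of g x t w "G (c t)"] g(2)[OF cin[OF that]] by (simp add: c_def)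
  have "g (c 0) < g (c T')"
  proof (rule DERIV_pos_imp_increasing_open[OF T'(1)])
    show "\<exists>y. ((\<lambda>t. g (c t)) has_real_derivative y) (at t) \<and> 0 < y" if "0 < t" "t < T'" for t
      using der[of t] pos'[of t] that T' by auto
    show "continuous_on {0..T'} (\<lambda>t. g (c t))" by (rule continuous_on_subset[OF cg]) (use T' in auto)
  qed
  then show False using mx[OF cin[of T']] T' T c0 by simp
qed

end

definition local_height :: "'a::euclidean_space \<Rightarrow> ('a \<Rightarrow> real) \<Rightarrow> 'a \<Rightarrow> real" where
  "local_height e \<phi> x = x \<bullet> e - \<phi> (x - (x \<bullet> e) *\<^sub>R e)"

lemma Ck_on_local_height:
  assumes "Ck_on k UNIV \<phi>"
  shows "Ck_on k UNIV (local_height e \<phi>)"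
  unfolding local_height_def[abs_def]
proof (intro Ck_on_diff Ck_on_inner Ck_on_compose_linear[where P="\<lambda>x. x - (x \<bullet> e) *\<^sub>R e"] assms)
  show "linear (\<lambda>x. x - (x \<bullet> e) *\<^sub>R e)"
    by (rule linearI) (simp_all add: inner_add_left algebra_simps)
qed (auto simp: inner_diff_left inner_diff_right inner_commute)

lemma Ck_boundary_chart:
  assumes "open \<Omega>" "Ck_boundary k \<Omega>" "1 \<le> k" "x\<^sub>0 \<in> frontier \<Omega>"
  obtains r e h where "boundary_chart \<Omega> x\<^sub>0 e r h" "Ck_on k UNIV h"
proof -
  obtain r e \<phi> where r: "r > 0" and e: "norm e = 1" and \<phi>: "Ck_on k UNIV \<phi>"
    and ch: "\<Omega> \<inter> ball x\<^sub>0 r = {x \<in> ball x\<^sub>0 r. x \<bullet> e > \<phi> (x - (x \<bullet> e) *\<^sub>R e)}"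
    using assms(2,4) unfolding Ck_boundary_def by blast
  have ee: "e \<bullet> e = 1" using e by (simp add: norm_eq_1)
  have C: "Ck_on k UNIV (local_height e \<phi>)" by (rule Ck_on_local_height[OF \<phi>])
  have "boundary_chart \<Omega> x\<^sub>0 e r (local_height e \<phi>)"
  proof
    show "Ck_on 1 UNIV (local_height e \<phi>)" using C assms(3) by (rule Ck_on_mono)
    fix x t
    have "x + t *\<^sub>R e - ((x + t *\<^sub>R e) \<bullet> e) *\<^sub>R e = x - (x \<bullet> e) *\<^sub>R e"
      by (simp add: inner_add_left ee algebra_simps)
    then show "local_height e \<phi> (x + t *\<^sub>R e) = local_height e \<phi> x + t"
      unfolding local_height_def by (simp only:) (simp add: inner_add_left ee)
  qed (use r e ch assms(1) in \<open>auto simp: local_height_def\<close>)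
  then show thesis using C that by blast
qed

lemma frontier_nonempty_bounded:
  fixes \<Omega> :: "'a::euclidean_space set"
  assumes "open \<Omega>" "bounded \<Omega>" "\<Omega> \<noteq> {}"
  shows "frontier \<Omega> \<noteq> {}" "compact (frontier \<Omega>)"
  using assms frontier_eq_empty[of \<Omega>] by (auto simp: compact_frontier_bounded not_bounded_UNIV)

text \<open>Weighting the local defining functions by bump functions gives a global one. The bumps
  need not sum to one: on the boundary only the sign and direction of the gradient matter.\<close>

lemma global_defining_function:
  fixes \<Omega> :: "'a::euclidean_space set"
  assumes "open \<Omega>" "bounded \<Omega>" "\<Omega> \<noteq> {}" "Ck_boundary 3 \<Omega>"
  obtains rt where "Ck_on 3 UNIV rt" "\<And>x. x \<in> frontier \<Omega> \<Longrightarrow> grad rt x \<noteq> 0"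
    "\<And>x \<nu>. x \<in> frontier \<Omega> \<Longrightarrow> inward_unit_normal \<Omega> x \<nu> \<Longrightarrow> grad rt x = norm (grad rt x) *\<^sub>R \<nu>"
proof -
  have "\<forall>a\<in>frontier \<Omega>. \<exists>r e h. boundary_chart \<Omega> a e r h \<and> Ck_on 3 UNIV h"
    using Ck_boundary_chart[OF assms(1,4)] by (metis one_le_numeral)
  then obtain R e h where ch: "\<And>a. a \<in> frontier \<Omega> \<Longrightarrow> boundary_chart \<Omega> a (e a) (R a) (h a)"
    and C3: "\<And>a. a \<in> frontier \<Omega> \<Longrightarrow> Ck_on 3 UNIV (h a)" by metis
  have Rp: "a \<in> frontier \<Omega> \<Longrightarrow> R a > 0" for a using ch[of a] by (simp add: boundary_chart_def)
  have "frontier \<Omega> \<subseteq> (\<Union>a\<in>frontier \<Omega>. ball a (R a))" using Rp by force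
  then obtain A where A: "A \<subseteq> frontier \<Omega>" "finite A" "frontier \<Omega> \<subseteq> (\<Union>a\<in>A. ball a (R a))"
    using compactE_image[OF frontier_nonempty_bounded(2)[OF assms(1-3)], of "frontier \<Omega>" "\<lambda>a. ball a (R a)"] by auto
  define b where "b a x = (R a)\<^sup>2 - (x - a) \<bullet> (x - a)" for a x
  \<comment> \<open>Positive exactly on the ball of radius R a. The fourth power makes it of class
    C^3 and makes its gradient vanish outside the ball.\<close>
  define X where "X a x = (max 0 (b a x)) ^ Suc 3" for a x
  have sq: "(x - a) \<bullet> (x - a) = (\<Sum>c\<in>Basis. (x \<bullet> c - a \<bullet> c) * (x \<bullet> c - a \<bullet> c))" for x a :: 'a
    by (subst euclidean_inner) (simp add: inner_diff_left)
  have bC: "Ck_on 3 UNIV (b a)" for a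
    unfolding b_def[abs_def] sq by (intro Ck_on_diff Ck_on_sum Ck_on_mult Ck_on_inner Ck_on_const open_UNIV)
  have XC: "Ck_on 3 UNIV (X a)" for a
    unfolding X_def[abs_def] by (rule Ck_on_max0_power[OF open_UNIV bC])
  define rt where "rt x = (\<Sum>a\<in>A. X a x * h a x)" for x
  have rC: "Ck_on 3 UNIV rt"
    unfolding rt_def[abs_def] using A(1) C3 by (intro Ck_on_sum Ck_on_mult XC open_UNIV) auto
  have Xpos: "X a x > 0" if "x \<in> ball a (R a)" for a x
  proof -
    have "norm (x - a) < R a" using that by (simp add: dist_norm norm_minus_commute)
    then have "(norm (x - a))\<^sup>2 < (R a)\<^sup>2" by (intro power_strict_mono) auto
    then show ?thesis by (simp add: X_def b_def power2_norm_eq_inner)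
  qed
  have Xz: "X a x = 0" "grad (X a) x = 0" if "x \<notin> ball a (R a)" "a \<in> frontier \<Omega>" for a x
  proof -
    have "R a \<le> norm (x - a)" using that by (simp add: dist_norm norm_minus_commute)
    then have "(R a)\<^sup>2 \<le> (norm (x - a))\<^sup>2" using Rp[OF that(2)] by (intro power_mono) auto
    then have b: "b a x \<le> 0" by (simp add: b_def power2_norm_eq_inner)
    then show "X a x = 0" by (simp add: X_def max_def)
    have gb: "GDERIV (b a) x :> grad (b a) x" using Ck_on_GDERIV[of 2 UNIV "b a" x] bC by (simp add: numeral_3_eq_3 numeral_2_eq_2)
    have Xe: "X a = (\<lambda>x. (max 0 (b a x)) ^ Suc (Suc 2))"
      unfolding X_def by (simp only: numeral_3_eq_3 numeral_2_eq_2)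
    have "max 0 (b a x) = 0" using b by simp
    with GDERIV_DERIV_compose[OF gb DERIV_max0_power[of 2]]
    have "GDERIV (X a) x :> 0" unfolding Xe by simp
    then show "grad (X a) x = 0" by (rule GDERIV_imp_grad_eq)
  qed
  \<comment> \<open>Inside the ball around a the factor h a vanishes on the boundary, outside it the
    gradient of X a vanishes; derivatives of the bumps never contribute.\<close>
  have gr: "grad rt x = (\<Sum>a\<in>{a \<in> A. x \<in> ball a (R a)}. X a x *\<^sub>R grad (h a) x)" if x: "x \<in> frontier \<Omega>" for x
  proof -
    have "GDERIV rt x :> (\<Sum>a\<in>A. X a x *\<^sub>R grad (h a) x + h a x *\<^sub>R grad (X a) x)"
      unfolding rt_def
    proof (intro GDERIV_sum GDERIV_mult)
      fix a assume "a \<in> A"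
      then have "Ck_on (Suc 2) UNIV (h a)" using C3 A(1) by (auto simp: numeral_3_eq_3 numeral_2_eq_2)
      then show "GDERIV (h a) x :> grad (h a) x" by (rule Ck_on_GDERIV) simp
      have "Ck_on (Suc 2) UNIV (X a)" using XC by (simp add: numeral_3_eq_3 numeral_2_eq_2)
      then show "GDERIV (X a) x :> grad (X a) x" by (rule Ck_on_GDERIV) simp
    qed
    then have "grad rt x = (\<Sum>a\<in>A. X a x *\<^sub>R grad (h a) x + h a x *\<^sub>R grad (X a) x)" by (rule GDERIV_imp_grad_eq)
    also have "\<dots> = (\<Sum>a\<in>A. if x \<in> ball a (R a) then X a x *\<^sub>R grad (h a) x else 0)"
    proof (intro sum.cong refl)
      fix a assume a: "a \<in> A"
      then have af: "a \<in> frontier \<Omega>" using A(1) by auto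
      show "X a x *\<^sub>R grad (h a) x + h a x *\<^sub>R grad (X a) x = (if x \<in> ball a (R a) then X a x *\<^sub>R grad (h a) x else 0)"
        using Xz[OF _ af, of x] boundary_chart.frontier_h_zero[OF ch[OF af] x] by auto
    qed
    also have "\<dots> = (\<Sum>a\<in>{a \<in> A. x \<in> ball a (R a)}. X a x *\<^sub>R grad (h a) x)"
      by (rule sum.inter_filter[symmetric, OF A(2)])
    finally show ?thesis .
  qed
  have dir: "\<exists>c>0. grad rt x = c *\<^sub>R \<nu>" if x: "x \<in> frontier \<Omega>" and \<nu>: "inward_unit_normal \<Omega> x \<nu>" for x \<nu>
  proof (intro exI conjI)
    define S where "S = {a \<in> A. x \<in> ball a (R a)}"
    have S: "finite S" "S \<noteq> {}" using A(2) subsetD[OF A(3) x] by (auto simp: S_def)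
    have gh: "grad (h a) x = norm (grad (h a) x) *\<^sub>R \<nu>" "norm (grad (h a) x) > 0" if "a \<in> S" for a
      using boundary_chart.inward_unit_normal_unique[OF ch x _ \<nu>, of a] boundary_chart.grad_h_nz[OF ch, of a x] that A(1)
      by (auto simp: S_def)
    have "grad rt x = (\<Sum>a\<in>S. (X a x * norm (grad (h a) x)) *\<^sub>R \<nu>)"
      unfolding gr[OF x] S_def[symmetric] by (intro sum.cong refl) (metis gh(1) scaleR_scaleR)
    then show "grad rt x = (\<Sum>a\<in>S. X a x * norm (grad (h a) x)) *\<^sub>R \<nu>" by (simp add: scaleR_sum_left)
    show "(\<Sum>a\<in>S. X a x * norm (grad (h a) x)) > 0"
      by (intro sum_pos S mult_pos_pos gh(2) Xpos) (auto simp: S_def)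
  qed
  show thesis
  proof
    show "Ck_on 3 UNIV rt" by (rule rC)
    show "grad rt x = norm (grad rt x) *\<^sub>R \<nu>" if x: "x \<in> frontier \<Omega>" and \<nu>: "inward_unit_normal \<Omega> x \<nu>" for x \<nu>
    proof -
      obtain c where c: "c > 0" "grad rt x = c *\<^sub>R \<nu>" using dir[OF x \<nu>] by blast
      have "norm \<nu> = 1" using \<nu> by (simp add: inward_unit_normal_def)
      then show ?thesis using c by simp
    qed
    show "grad rt x \<noteq> 0" if x: "x \<in> frontier \<Omega>" for x
    proof -
      obtain a where a: "a \<in> A" "x \<in> ball a (R a)" using A(3) x by blast
      then have af: "a \<in> frontier \<Omega>" using A(1) by auto
      note n = boundary_chart.inward_unit_normal_exists[OF ch[OF af] x a(2)]
      obtain c where "c > 0" "grad rt x = c *\<^sub>R (grad (h a) x /\<^sub>R norm (grad (h a) x))" using dir[OF x n] by blast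
      then show ?thesis using boundary_chart.grad_h_nz[OF ch[OF af], of x] by simp
    qed
  qed
qed

section \<open>The collar of the boundary and its uniform bounds\<close>

lemma mc_jet_bounded:
  fixes f :: "'a::euclidean_space \<Rightarrow> real"
  assumes "open S" "Ck_on 2 S f" "compact K" "K \<subseteq> S"
  obtains C where "\<And>x p. x \<in> K \<Longrightarrow> \<exists>l. mc_jet p f x (grad f x) l \<and> norm (grad f x) \<le> C \<and> \<bar>l\<bar> \<le> C"
proof -
  have C1: "Ck_on 1 S f" using assms(2) by (rule Ck_on_mono) simp
  define n where "n x = norm (grad f x) + (DIM('a) + 1) * hs_norm (hess f x)" for x
  have cp: "continuous_on S (grad (partial_deriv c f))" if "c \<in> Basis" for c
  proof -
    have "Ck_on 1 S (partial_deriv c f)" using Ck_on_partial[of 1 S f c] assms(2) that by (simp add: numeral_2_eq_2)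
    then show ?thesis by (rule continuous_on_grad)
  qed
  have "continuous_on S n"
    unfolding n_def hs_norm_def hess_def
    by (intro continuous_intros continuous_on_grad[OF C1] cp)
  then have "continuous_on K n" using assms(4) by (rule continuous_on_subset)
  then have "bounded (n ` K)" using assms(3) by (intro compact_imp_bounded compact_continuous_image)
  then obtain C where C: "\<And>x. x \<in> K \<Longrightarrow> \<bar>n x\<bar> \<le> C" unfolding bounded_iff by auto
  \<comment> \<open>Uniform in p, since \<open>rho p\<close> does not increase norms. This matters
    because p will be the gradient of u, which is not yet bounded.\<close>
  have b: "\<bar>mc_trace p (hess f x)\<bar> \<le> (DIM('a) + 1) * hs_norm (hess f x)" for p x
  proof -
    let ?X = "hess f x"
    have "\<bar>?X h \<bullet> h\<bar> \<le> hs_norm ?X * (norm h * norm h)" for h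
      using order_trans[OF Cauchy_Schwarz_ineq2 mult_right_mono[OF norm_le_hs_norm[OF linear_hess] norm_ge_zero], of f x h h]
      by (simp add: mult.assoc)
    note q = this
    have "\<bar>\<Sum>e\<in>Basis. ?X (rho p e) \<bullet> rho p e\<bar> \<le> (\<Sum>e\<in>(Basis::'a set). hs_norm ?X * (1 * 1))"
    proof (rule order_trans[OF sum_abs sum_mono])
      fix e :: 'a assume "e \<in> Basis"
      then have "norm (rho p e) \<le> 1" using norm_rho_le[of p e] by simp
      then have "norm (rho p e) * norm (rho p e) \<le> 1 * 1" by (intro mult_mono) auto
      then have "hs_norm ?X * (norm (rho p e) * norm (rho p e)) \<le> hs_norm ?X * (1 * 1)"
        by (rule mult_left_mono) (rule hs_norm_nonneg)
      then show "\<bar>?X (rho p e) \<bullet> rho p e\<bar> \<le> hs_norm ?X * (1 * 1)" using q[of "rho p e"] by linarith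
    qed
    also have "\<dots> \<le> (DIM('a) + 1) * hs_norm ?X" using hs_norm_nonneg[of ?X] by (simp add: algebra_simps)
    finally show ?thesis unfolding mc_trace_rho[OF linear_hess] .
  qed
  show thesis
  proof
    fix x p assume x: "x \<in> K"
    have "mc_jet p f x (grad f x) (mc_trace p (hess f x))"
      unfolding mc_jet_def using Ck_on_jet2[OF assms(1,2)] x assms(4) by blast
    moreover have "norm (grad f x) \<le> C" "\<bar>mc_trace p (hess f x)\<bar> \<le> C"
    proof -
      have "0 \<le> (DIM('a) + 1) * hs_norm (hess f x)" by (intro mult_nonneg_nonneg hs_norm_nonneg) simp
      moreover have "n x \<le> C" using C[OF x] by simp
      ultimately show "norm (grad f x) \<le> C" "\<bar>mc_trace p (hess f x)\<bar> \<le> C"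
        using b[of p x] norm_ge_zero[of "grad f x"] unfolding n_def by linarith+
    qed
    ultimately show "\<exists>l. mc_jet p f x (grad f x) l \<and> norm (grad f x) \<le> C \<and> \<bar>l\<bar> \<le> C" by blast
  qed
qed

text \<open>\<open>\<gamma>\<close> extends the inward unit normal to a neighbourhood \<open>U\<close> of the boundary, and \<open>rt\<close> plays the role
  of the distance function.\<close>

locale domain_data =
  fixes \<Omega> U :: "'a::euclidean_space set" and rt :: "'a \<Rightarrow> real" and \<gamma> :: "'a \<Rightarrow> 'a" and \<mu> C c\<^sub>0 :: real
  assumes op: "open \<Omega>" and bdd: "bounded \<Omega>" and ne: "\<Omega> \<noteq> {}" and bd: "Ck_boundary 3 \<Omega>"
    and U: "open U" and \<mu>: "\<mu> > 0" and KU: "{x. infdist x (frontier \<Omega>) \<le> \<mu>} \<subseteq> U"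
    and rt: "Ck_on 2 UNIV rt" and \<gamma>C: "\<And>b. b \<in> Basis \<Longrightarrow> Ck_on 2 U (\<lambda>x. \<gamma> x \<bullet> b)"
    and \<gamma>1: "\<And>x. x \<in> U \<Longrightarrow> norm (\<gamma> x) = 1" and C: "C \<ge> 1" and c0: "c\<^sub>0 > 0"
    and rt_bound: "\<And>x. infdist x (frontier \<Omega>) \<le> \<mu> \<Longrightarrow> \<bar>rt x\<bar> \<le> C"
    and rt_jet: "\<And>x p. infdist x (frontier \<Omega>) \<le> \<mu> \<Longrightarrow>
      \<exists>l. mc_jet p rt x (grad rt x) l \<and> norm (grad rt x) \<le> C \<and> \<bar>l\<bar> \<le> C"
    and \<gamma>_jet: "\<And>x p b. infdist x (frontier \<Omega>) \<le> \<mu> \<Longrightarrow> b \<in> Basis \<Longrightarrow>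
      \<exists>l. mc_jet p (\<lambda>z. \<gamma> z \<bullet> b) x (grad (\<lambda>z. \<gamma> z \<bullet> b) x) l \<and> norm (grad (\<lambda>z. \<gamma> z \<bullet> b) x) \<le> C \<and> \<bar>l\<bar> \<le> C"
    and grad_rt: "\<And>x. x \<in> frontier \<Omega> \<Longrightarrow> \<exists>c\<ge>c\<^sub>0. grad rt x = c *\<^sub>R \<gamma> x"
    and normal: "\<And>x \<nu>. x \<in> frontier \<Omega> \<Longrightarrow> inward_unit_normal \<Omega> x \<nu> \<Longrightarrow> \<nu> = \<gamma> x"

text \<open>\<gamma> is the normalised gradient of rt; one derivative is lost, so the C^3 boundary
  yields the C^2 field that the maximum principle differentiates twice. Compactness of the boundary
  provides the width \<mu> of a collar on which the gradient does not vanish, the bound C, and the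
  minimum c_0 of its length on the boundary.\<close>

lemma domain_data_exists:
  fixes \<Omega> :: "'a::euclidean_space set"
  assumes "open \<Omega>" "bounded \<Omega>" "\<Omega> \<noteq> {}" "Ck_boundary 3 \<Omega>"
  obtains U rt \<gamma> \<mu> C c\<^sub>0 where "domain_data \<Omega> U rt \<gamma> \<mu> C c\<^sub>0"
proof -
  obtain rt where rC: "Ck_on 3 UNIV rt" and nz: "\<And>x. x \<in> frontier \<Omega> \<Longrightarrow> grad rt x \<noteq> 0"
    and dir: "\<And>x \<nu>. x \<in> frontier \<Omega> \<Longrightarrow> inward_unit_normal \<Omega> x \<nu> \<Longrightarrow> grad rt x = norm (grad rt x) *\<^sub>R \<nu>"
    using global_defining_function[OF assms] by blast
  have fr: "frontier \<Omega> \<noteq> {}" "compact (frontier \<Omega>)" by (rule frontier_nonempty_bounded[OF assms(1-3)])+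
  have r2: "Ck_on 2 UNIV rt" using rC by (rule Ck_on_mono) simp
  have r1: "Ck_on 1 UNIV rt" using rC by (rule Ck_on_mono) simp
  have cg: "continuous_on UNIV (grad rt)" by (rule continuous_on_grad[OF r1])
  define U where "U = {x. norm (grad rt x) > 0}"
  have oU: "open U" unfolding U_def by (intro open_Collect_less continuous_intros cg)
  have fU: "frontier \<Omega> \<subseteq> U" using nz by (auto simp: U_def)
  obtain \<mu> where \<mu>: "\<mu> > 0" "{x. infdist x (frontier \<Omega>) \<le> \<mu>} \<subseteq> U"
    using compact_in_open_separated[OF fr oU fU] .
  define K where "K = {x. infdist x (frontier \<Omega>) \<le> \<mu>}"
  have cK: "compact K" unfolding K_def by (rule compact_infdist_le[OF fr \<mu>(1)])
  define \<gamma> where "\<gamma> x = inverse (norm (grad rt x)) *\<^sub>R grad rt x" for x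
  have \<gamma>C: "Ck_on 2 U (\<lambda>x. \<gamma> x \<bullet> b)" if b: "b \<in> Basis" for b
  proof -
    have pc: "Ck_on 2 U (\<lambda>x. grad rt x \<bullet> c)" if "c \<in> Basis" for c
    proof -
      have "Ck_on 2 UNIV (\<lambda>x. grad rt x \<bullet> c)"
        by (rule Ck_on_grad_inner[OF _ that open_UNIV]) (use rC in \<open>simp add: numeral_3_eq_3 numeral_2_eq_2\<close>)
      then show ?thesis by (rule Ck_on_subset) simp
    qed
    have ns: "norm (grad rt x) = sqrt (\<Sum>c\<in>Basis. (grad rt x \<bullet> c) * (grad rt x \<bullet> c))" for x
      by (simp add: norm_eq_sqrt_inner euclidean_inner[of "grad rt x" "grad rt x"])
    have "Ck_on 2 U (\<lambda>x. inverse (sqrt (\<Sum>c\<in>Basis. (grad rt x \<bullet> c) * (grad rt x \<bullet> c))) * (grad rt x \<bullet> b))"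
    proof (intro Ck_on_mult Ck_on_inverse Ck_on_sqrt Ck_on_sum pc oU b)
      fix x assume "x \<in> U"
      then have "0 < norm (grad rt x)" by (simp add: U_def)
      then have "0 < sqrt (\<Sum>c\<in>Basis. (grad rt x \<bullet> c) * (grad rt x \<bullet> c))" by (simp only: ns)
      then show "0 < (\<Sum>c\<in>Basis. (grad rt x \<bullet> c) * (grad rt x \<bullet> c))"
        and "sqrt (\<Sum>c\<in>Basis. (grad rt x \<bullet> c) * (grad rt x \<bullet> c)) \<noteq> 0" by (simp_all only: real_sqrt_gt_0_iff) auto
    qed auto
    then show ?thesis by (simp only: \<gamma>_def inner_scaleR_left ns[symmetric])
  qed
  have KU: "K \<subseteq> U" using \<mu>(2) by (simp add: K_def)
  have "bounded (rt ` K)"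
    by (intro compact_imp_bounded compact_continuous_image cK continuous_on_subset[OF Ck_on_imp_continuous[OF rC]]) simp
  then obtain Ca where Ca: "\<And>x. x \<in> K \<Longrightarrow> \<bar>rt x\<bar> \<le> Ca" unfolding bounded_iff by auto
  obtain Cb where Cb: "\<And>x p. x \<in> K \<Longrightarrow> \<exists>l. mc_jet p rt x (grad rt x) l \<and> norm (grad rt x) \<le> Cb \<and> \<bar>l\<bar> \<le> Cb"
    using mc_jet_bounded[OF open_UNIV r2 cK] by auto
  have "\<forall>b\<in>Basis. \<exists>C. \<forall>x p. x \<in> K \<longrightarrow> (\<exists>l. mc_jet p (\<lambda>z. \<gamma> z \<bullet> b) x (grad (\<lambda>z. \<gamma> z \<bullet> b) x) l
       \<and> norm (grad (\<lambda>z. \<gamma> z \<bullet> b) x) \<le> C \<and> \<bar>l\<bar> \<le> C)"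
    using mc_jet_bounded[OF oU \<gamma>C cK KU] by metis
  then obtain Cc where Cc: "\<And>b x p. b \<in> Basis \<Longrightarrow> x \<in> K \<Longrightarrow> \<exists>l. mc_jet p (\<lambda>z. \<gamma> z \<bullet> b) x (grad (\<lambda>z. \<gamma> z \<bullet> b) x) l
       \<and> norm (grad (\<lambda>z. \<gamma> z \<bullet> b) x) \<le> Cc b \<and> \<bar>l\<bar> \<le> Cc b" by metis
  define C where "C = 1 + \<bar>Ca\<bar> + \<bar>Cb\<bar> + (\<Sum>b\<in>Basis. \<bar>Cc b\<bar>)"
  have CC: "C \<ge> 1" "Ca \<le> C" "Cb \<le> C" using sum_nonneg[of Basis "\<lambda>b. \<bar>Cc b\<bar>"] unfolding C_def by (simp, linarith, linarith)
  have Ccb: "Cc b \<le> C" if "b \<in> Basis" for b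
    using member_le_sum[OF that, of "\<lambda>b. \<bar>Cc b\<bar>"] by (auto simp: C_def)
  have "continuous_on (frontier \<Omega>) (\<lambda>x. norm (grad rt x))"
    by (intro continuous_intros continuous_on_subset[OF cg]) simp
  then obtain x0 where x0: "x0 \<in> frontier \<Omega>" "\<And>x. x \<in> frontier \<Omega> \<Longrightarrow> norm (grad rt x0) \<le> norm (grad rt x)"
    using continuous_attains_inf[OF fr(2,1)] by blast
  have "domain_data \<Omega> U rt \<gamma> \<mu> C (norm (grad rt x0))"
  proof
    show "norm (\<gamma> x) = 1" if "x \<in> U" for x using that by (simp add: \<gamma>_def U_def)
    show "0 < norm (grad rt x0)" using nz[OF x0(1)] by simp
    show "\<bar>rt x\<bar> \<le> C" if "infdist x (frontier \<Omega>) \<le> \<mu>" for x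
      using Ca[of x] that CC by (simp add: K_def)
    show "\<exists>l. mc_jet p rt x (grad rt x) l \<and> norm (grad rt x) \<le> C \<and> \<bar>l\<bar> \<le> C" if "infdist x (frontier \<Omega>) \<le> \<mu>" for x p
      using Cb[of x p] that CC unfolding K_def by force
    show "\<exists>l. mc_jet p (\<lambda>z. \<gamma> z \<bullet> b) x (grad (\<lambda>z. \<gamma> z \<bullet> b) x) l \<and> norm (grad (\<lambda>z. \<gamma> z \<bullet> b) x) \<le> C \<and> \<bar>l\<bar> \<le> C"
      if "infdist x (frontier \<Omega>) \<le> \<mu>" "b \<in> Basis" for x p b
      using Cc[OF that(2), of x p] that(1) Ccb[OF that(2)] unfolding K_def by force
    show "\<exists>c\<ge>norm (grad rt x0). grad rt x = c *\<^sub>R \<gamma> x" if "x \<in> frontier \<Omega>" for x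
      using x0(2)[OF that] nz[OF that] by (intro exI[of _ "norm (grad rt x)"]) (simp add: \<gamma>_def)
    show "\<nu> = \<gamma> x" if "x \<in> frontier \<Omega>" "inward_unit_normal \<Omega> x \<nu>" for x \<nu>
    proof -
      have "\<gamma> x = inverse (norm (grad rt x)) *\<^sub>R (norm (grad rt x) *\<^sub>R \<nu>)"
        using dir[OF that] by (simp add: \<gamma>_def)
      then show ?thesis using nz[OF that(1)] by simp
    qed
  qed (use assms oU \<mu> r2 \<gamma>C CC in auto)
  then show thesis by (rule that)
qed

section \<open>The gradient estimate near the boundary\<close>

text \<open>On \<open>|s| \<le> q\<^sup>2\<close> this is \<open>sqrt (1 - s\<^sup>2)\<close>, and it continues along the tangents. With
  \<open>s = \<theta> / v\<close> the product \<open>v * envelope q s\<close> is the length of the tangential part of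
  \<open>(Du, -1)\<close> where the normal is far from \<open>\<gamma>\<close>, and affine in \<open>(v, \<theta>)\<close> elsewhere.\<close>

definition envelope :: "real \<Rightarrow> real \<Rightarrow> real" where
  "envelope q s = (1 - min \<bar>s\<bar> (q\<^sup>2) * \<bar>s\<bar>) / sqrt (1 - (min \<bar>s\<bar> (q\<^sup>2))\<^sup>2)"

lemma envelope_inner: "\<bar>s\<bar> \<le> q\<^sup>2 \<Longrightarrow> \<bar>s\<bar> < 1 \<Longrightarrow> envelope q s = sqrt (1 - s\<^sup>2)"
proof -
  assume s: "\<bar>s\<bar> \<le> q\<^sup>2" "\<bar>s\<bar> < 1"
  then have "1 - s\<^sup>2 > 0" by (simp add: abs_square_less_1)
  moreover have "\<bar>s\<bar> * \<bar>s\<bar> = s\<^sup>2" by (simp add: power2_eq_square)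
  ultimately show ?thesis using s by (simp add: envelope_def min_def real_div_sqrt)
qed

lemma envelope_outer: "q\<^sup>2 \<le> \<bar>s\<bar> \<Longrightarrow> envelope q s = (1 - q\<^sup>2 * \<bar>s\<bar>) / sqrt (1 - (q\<^sup>2)\<^sup>2)"
  by (simp add: envelope_def min_def)

text \<open>With t the truncation of |s| one has (1 - t |s|)^2 - (1 - t^2) (1 - s^2) = (t - |s|)^2:
  the tangents of a concave function lie above it. The lower bound 1 - q^2 is what sqrt (1 - s^2)
  lacks near |s| = 1; through it the test function controls v.\<close>

lemma envelope_bounds:
  assumes q: "0 < q" "q < 1" and s: "\<bar>s\<bar> \<le> 1"
  shows "envelope q s \<ge> 1 - q\<^sup>2" "envelope q s \<le> 1 / sqrt (1 - (q\<^sup>2)\<^sup>2)" "sqrt (1 - s\<^sup>2) \<le> envelope q s"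
proof -
  define t where "t = min \<bar>s\<bar> (q\<^sup>2)"
  have q2: "q\<^sup>2 < 1" using q by (simp add: abs_square_less_1)
  have q4: "(q\<^sup>2)\<^sup>2 < 1" using q2 by (subst abs_square_less_1) simp
  note q2 = q2 q4
  have t: "0 \<le> t" "t \<le> q\<^sup>2" "t < 1" using q2 by (auto simp: t_def)
  have tt: "t\<^sup>2 \<le> (q\<^sup>2)\<^sup>2" using t by (intro power_mono) auto
  then have r: "0 < 1 - (q\<^sup>2)\<^sup>2" "1 - (q\<^sup>2)\<^sup>2 \<le> 1 - t\<^sup>2" "0 < 1 - t\<^sup>2" using q2 by auto
  have "t * \<bar>s\<bar> \<le> q\<^sup>2 * 1" using t s by (intro mult_mono) auto
  then have n: "1 - q\<^sup>2 \<le> 1 - t * \<bar>s\<bar>" "0 < 1 - t * \<bar>s\<bar>" using q2 by auto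
  have sr: "0 < sqrt (1 - t\<^sup>2)" "sqrt (1 - t\<^sup>2) \<le> 1" using r by auto
  have e: "envelope q s = (1 - t * \<bar>s\<bar>) / sqrt (1 - t\<^sup>2)" by (simp add: envelope_def t_def)
  have "(1 - t * \<bar>s\<bar>) / 1 \<le> (1 - t * \<bar>s\<bar>) / sqrt (1 - t\<^sup>2)" using n sr by (intro divide_left_mono) auto
  then show "envelope q s \<ge> 1 - q\<^sup>2" using n e by simp
  have "0 \<le> t * \<bar>s\<bar>" using t by simp
  then have "(1 - t * \<bar>s\<bar>) / sqrt (1 - t\<^sup>2) \<le> 1 / sqrt (1 - (q\<^sup>2)\<^sup>2)"
    using r n by (intro frac_le) auto
  then show "envelope q s \<le> 1 / sqrt (1 - (q\<^sup>2)\<^sup>2)" using e by simp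
  have "(1 - t\<^sup>2) * (1 - s\<^sup>2) \<le> (1 - t * \<bar>s\<bar>)\<^sup>2"
  proof -
    have "(1 - t * \<bar>s\<bar>)\<^sup>2 - (1 - t\<^sup>2) * (1 - s\<^sup>2) = (t - \<bar>s\<bar>)\<^sup>2" by (simp add: power2_eq_square algebra_simps)
    then show ?thesis by (metis diff_ge_0_iff_ge zero_le_power2)
  qed
  then have "sqrt ((1 - t\<^sup>2) * (1 - s\<^sup>2)) \<le> 1 - t * \<bar>s\<bar>" using n by (intro real_le_lsqrt) auto
  then have "sqrt (1 - s\<^sup>2) * sqrt (1 - t\<^sup>2) \<le> 1 - t * \<bar>s\<bar>" by (simp add: real_sqrt_mult mult.commute)
  then show "sqrt (1 - s\<^sup>2) \<le> envelope q s" unfolding e using sr by (simp add: pos_le_divide_eq)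
qed

lemma continuous_on_envelope:
  assumes "0 < q" "q < 1"
  shows "continuous_on UNIV (envelope q)"
proof -
  have "sqrt (1 - (min \<bar>s\<bar> (q\<^sup>2))\<^sup>2) \<noteq> 0" for s
  proof -
    have q2: "q\<^sup>2 < 1" using assms by (auto simp: abs_square_less_1)
    then have "\<bar>min \<bar>s\<bar> (q\<^sup>2)\<bar> < 1" by (auto simp: min_def)
    then have "(min \<bar>s\<bar> (q\<^sup>2))\<^sup>2 < 1" by (simp only: abs_square_less_1)
    then show ?thesis by simp
  qed
  then show ?thesis unfolding envelope_def[abs_def] by (intro continuous_intros) auto
qed

section \<open>The test function in its two regimes\<close>

definition test_fun :: "real \<Rightarrow> ('a::euclidean_space \<Rightarrow> 'a) \<Rightarrow> ('a \<Rightarrow> 'a) \<Rightarrow> ('a \<Rightarrow> real) \<Rightarrow> 'a \<Rightarrow> real" where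
  "test_fun q P \<gamma> \<Psi> y = ln (slope (P y) * envelope q ((P y \<bullet> \<gamma> y) / slope (P y))) + \<Psi> y"

lemma inner_less_slope:
  assumes "norm g = 1" shows "\<bar>(p \<bullet> g) / slope p\<bar> < 1" "(p \<bullet> g)\<^sup>2 < (slope p)\<^sup>2"
proof -
  have "\<bar>p \<bullet> g\<bar> \<le> norm p" using Cauchy_Schwarz_ineq2[of p g] assms by simp
  also have "norm p < slope p" unfolding norm_eq_sqrt_inner slope_def by simp
  finally have a: "\<bar>p \<bullet> g\<bar> < slope p" .
  then show "\<bar>(p \<bullet> g) / slope p\<bar> < 1" by (simp add: abs_divide abs_of_pos)
  show "(p \<bullet> g)\<^sup>2 < (slope p)\<^sup>2" using a by (metis abs_ge_zero power2_abs power_strict_mono pos2)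
qed

lemma ln_tangential:
  assumes "norm g = 1"
  shows "ln ((slope p)\<^sup>2 - (p \<bullet> g)\<^sup>2) / 2 = ln (slope p * sqrt (1 - ((p \<bullet> g) / slope p)\<^sup>2))"
proof -
  have "(slope p)\<^sup>2 - (p \<bullet> g)\<^sup>2 = (slope p)\<^sup>2 * (1 - ((p \<bullet> g) / slope p)\<^sup>2)"
    by (simp add: power_divide right_diff_distrib)
  then have "sqrt ((slope p)\<^sup>2 - (p \<bullet> g)\<^sup>2) = slope p * sqrt (1 - ((p \<bullet> g) / slope p)\<^sup>2)"
    by (simp add: real_sqrt_mult abs_of_pos)
  moreover have "ln (sqrt ((slope p)\<^sup>2 - (p \<bullet> g)\<^sup>2)) = ln ((slope p)\<^sup>2 - (p \<bullet> g)\<^sup>2) / 2"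
    using inner_less_slope(2)[OF assms, of p] by (intro ln_sqrt) simp
  ultimately show ?thesis by simp
qed

text \<open>Contact from below where |s| \<le> q^2, which transfers a maximum of the test function
  to the smooth tangential function.\<close>

lemma tangential_le_test_fun:
  assumes q: "0 < q" "q < 1" and g: "norm (\<gamma> y) = 1"
  shows "ln ((slope (P y))\<^sup>2 - (P y \<bullet> \<gamma> y)\<^sup>2) / 2 + \<Psi> y \<le> test_fun q P \<gamma> \<Psi> y"
    and "\<bar>(P y \<bullet> \<gamma> y) / slope (P y)\<bar> \<le> q\<^sup>2 \<Longrightarrow> ln ((slope (P y))\<^sup>2 - (P y \<bullet> \<gamma> y)\<^sup>2) / 2 + \<Psi> y = test_fun q P \<gamma> \<Psi> y"
proof -
  define s where "s = (P y \<bullet> \<gamma> y) / slope (P y)"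
  have s: "\<bar>s\<bar> < 1" unfolding s_def by (rule inner_less_slope(1)[OF g])
  then have "0 < slope (P y) * sqrt (1 - s\<^sup>2)" by (simp add: abs_square_less_1)
  moreover have "slope (P y) * sqrt (1 - s\<^sup>2) \<le> slope (P y) * envelope q s"
    using envelope_bounds(3)[OF q] s by (intro mult_left_mono) (auto simp: less_imp_le)
  ultimately show "ln ((slope (P y))\<^sup>2 - (P y \<bullet> \<gamma> y)\<^sup>2) / 2 + \<Psi> y \<le> test_fun q P \<gamma> \<Psi> y"
    unfolding ln_tangential[OF g] test_fun_def s_def[symmetric] by (simp only: ln_mono add_right_mono)
  show "ln ((slope (P y))\<^sup>2 - (P y \<bullet> \<gamma> y)\<^sup>2) / 2 + \<Psi> y = test_fun q P \<gamma> \<Psi> y" if "\<bar>(P y \<bullet> \<gamma> y) / slope (P y)\<bar> \<le> q\<^sup>2"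
    unfolding ln_tangential[OF g] test_fun_def using envelope_inner[of s q] s that by (simp add: s_def)
qed

text \<open>\<sigma> is the sign of \<theta>, locally constant where \<theta> does not vanish, so
  the absolute value becomes linear. The last logarithm is a constant and drops out of
  comparisons.\<close>

lemma test_fun_affine:
  assumes q: "0 < q" "q < 1" and g: "norm (\<gamma> y) = 1" and s: "q\<^sup>2 \<le> \<bar>(P y \<bullet> \<gamma> y) / slope (P y)\<bar>"
    and \<sigma>: "\<bar>P y \<bullet> \<gamma> y\<bar> = \<sigma> * (P y \<bullet> \<gamma> y)"
  shows "test_fun q P \<gamma> \<Psi> y = ln (slope (P y) + (- q\<^sup>2 * \<sigma>) * (P y \<bullet> \<gamma> y)) + \<Psi> y - ln (sqrt (1 - (q\<^sup>2)\<^sup>2))"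
proof -
  define v \<theta> where "v = slope (P y)" and "\<theta> = P y \<bullet> \<gamma> y"
  have v: "v > 0" by (simp add: v_def)
  have q2: "q\<^sup>2 < 1" using q by (simp add: abs_square_less_1)
  have q4: "(q\<^sup>2)\<^sup>2 < 1" using q2 by (subst abs_square_less_1) simp
  note q2 = q2 q4
  have "\<bar>\<theta> / v\<bar> < 1" unfolding \<theta>_def v_def by (rule inner_less_slope(1)[OF g])
  then have "\<bar>\<theta>\<bar> < v" using v by (simp add: abs_divide)
  then have "q\<^sup>2 * \<bar>\<theta>\<bar> \<le> 1 * \<bar>\<theta>\<bar>" using q2 by (intro mult_right_mono) auto
  then have pos: "v - q\<^sup>2 * \<bar>\<theta>\<bar> > 0" using \<open>\<bar>\<theta>\<bar> < v\<close> by simp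
  have "v * envelope q (\<theta> / v) = (v - q\<^sup>2 * \<bar>\<theta>\<bar>) / sqrt (1 - (q\<^sup>2)\<^sup>2)"
    using envelope_outer[of q "\<theta> / v"] s v unfolding v_def[symmetric] \<theta>_def[symmetric]
    by (simp add: abs_divide right_diff_distrib)
  then have "ln (v * envelope q (\<theta> / v)) = ln (v - q\<^sup>2 * \<bar>\<theta>\<bar>) - ln (sqrt (1 - (q\<^sup>2)\<^sup>2))"
    using pos q2 by (simp add: ln_div)
  moreover have "v - q\<^sup>2 * \<bar>\<theta>\<bar> = v + (- q\<^sup>2 * \<sigma>) * \<theta>" using \<sigma> unfolding \<theta>_def by simp
  ultimately show ?thesis unfolding test_fun_def v_def[symmetric] \<theta>_def[symmetric] by simp
qed

context domain_data
begin

text \<open>D serves as the common constant: the dimension enters through the sums over coordinates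
  in the jet of \<theta>, and L_1 through f. The requirement v \<ge> 1 / (1 - q^2) ensures p . p + b
  v \<theta> \<ge> 0 for |b| \<le> q^2, and v \<ge> \<beta> keeps the errors of lower order; the
  value of \<beta> then exceeds what the estimates allow.\<close>

lemma interior_max_contradiction:
  assumes sol: "mc_solution \<Omega> M\<^sub>0 L\<^sub>1 f u" and x: "x \<in> \<Omega>" "infdist x (frontier \<Omega>) \<le> \<mu>" and L1: "L\<^sub>1 \<ge> 0"
    and q: "0 < q" "q < 1" and \<alpha>: "\<alpha> \<ge> 0"
    and D: "D = DIM('a) * C + L\<^sub>1"
    and c: "c = (1 - q) * (1 - q\<^sup>2)\<^sup>2 / (2 + 2 * DIM('a))"
    and M: "M = (27 + 18 / (1 - q\<^sup>2)) * (D\<^sup>2 * (1 + \<alpha>)\<^sup>2) / c"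
    and \<beta>: "\<beta> = 2 * M + 2"
    and v: "\<beta> \<le> slope (grad u x)" "1 / (1 - q\<^sup>2) \<le> slope (grad u x)"
    and mx: "\<forall>\<^sub>F y in nhds x. test_fun q (grad u) \<gamma> (\<lambda>y. \<beta> * u y + \<alpha> * rt y) y
       \<le> test_fun q (grad u) \<gamma> (\<lambda>y. \<beta> * u y + \<alpha> * rt y) x"
  shows False
proof -
  have q2: "q\<^sup>2 < 1" using q by (auto simp: abs_square_less_1)
  have xU: "x \<in> U" using x(2) KU by auto
  have D1: "D \<ge> C" "D \<ge> L\<^sub>1" "D \<ge> 1" "DIM('a) * C \<le> D"
  proof -
    have "1 * C \<le> DIM('a) * C" using C by (intro mult_right_mono) auto
    then show "D \<ge> C" "D \<ge> L\<^sub>1" "D \<ge> 1" "DIM('a) * C \<le> D" using L1 C unfolding D by linarith+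
  qed
  have c0': "c > 0" unfolding c using q q2 by (intro divide_pos_pos mult_pos_pos) auto
  have M0: "M \<ge> 0" unfolding M using c0' q2 by simp
  then have "slope (grad u x) \<ge> 2" using v(1) \<beta> by linarith
  then have "grad u x \<noteq> 0" by (auto simp: slope_def)
  then obtain fx fz where g: "mc_graph \<Omega> u (\<lambda>y. f (y, u y)) x (fx + fz *\<^sub>R grad u x)"
    and fz: "fz \<ge> 0" and fx: "norm fx \<le> L\<^sub>1" and fb: "\<bar>f (x, u x)\<bar> \<le> L\<^sub>1"
    using mc_solution_graph[OF sol x(1)] by metis
  interpret g: mc_graph \<Omega> u "\<lambda>y. f (y, u y)" x "fx + fz *\<^sub>R grad u x" by (rule g)
  have gp: "g.p = grad u x" "g.v = slope (grad u x)" by (simp_all add: g.p_def g.v_def)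
  have "\<forall>b\<in>Basis. \<exists>l. mc_jet g.p (\<lambda>z. \<gamma> z \<bullet> b) x (grad (\<lambda>z. \<gamma> z \<bullet> b) x) l
      \<and> norm (grad (\<lambda>z. \<gamma> z \<bullet> b) x) \<le> C \<and> \<bar>l\<bar> \<le> C" using \<gamma>_jet[OF x(2)] by blast
  then obtain lb where lb: "\<And>b. b \<in> Basis \<Longrightarrow> mc_jet g.p (\<lambda>z. \<gamma> z \<bullet> b) x (grad (\<lambda>z. \<gamma> z \<bullet> b) x) (lb b)"
    "\<And>b. b \<in> Basis \<Longrightarrow> norm (grad (\<lambda>z. \<gamma> z \<bullet> b) x) \<le> C" "\<And>b. b \<in> Basis \<Longrightarrow> \<bar>lb b\<bar> \<le> C" by metis
  obtain Q E where jt: "mc_jet g.p (\<lambda>z. grad u z \<bullet> \<gamma> z) x (g.H (\<gamma> x) + Q)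
       (f (x, u x) * g.v * (sigma g.p (\<gamma> x) \<bullet> g.y) + g.v * ((fx + fz *\<^sub>R grad u x) \<bullet> \<gamma> x) + 2 * g.v * (g.B (sigma g.p (\<gamma> x)) \<bullet> g.y) + E)"
    and Q: "norm Q \<le> DIM('a) * C * g.v" and E: "\<bar>E\<bar> \<le> DIM('a) * C * g.v * (1 + 2 * (hs_norm g.B + norm g.y))"
    using g.mc_jet_normal_component[OF lb] by blast
  obtain lr where jr: "mc_jet g.p rt x (grad rt x) lr" "norm (grad rt x) \<le> C" "\<bar>lr\<bar> \<le> C"
    using rt_jet[OF x(2)] by blast
  interpret t: mc_test \<Omega> u "\<lambda>y. f (y, u y)" x "fx + fz *\<^sub>R grad u x" \<gamma> Q "grad rt x" fx E lr \<alpha> \<beta> D fz rt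
  proof
    show "norm Q \<le> D * g.v" by (rule order_trans[OF Q mult_right_mono[OF D1(4)]]) simp
    have "DIM('a) * C * (g.v * (1 + 2 * (hs_norm g.B + norm g.y))) \<le> D * (g.v * (1 + 2 * (hs_norm g.B + norm g.y)))"
      using D1(4) hs_norm_nonneg[of g.B] by (intro mult_right_mono mult_nonneg_nonneg) auto
    then show "\<bar>E\<bar> \<le> D * g.v * (1 + 2 * (hs_norm g.B + norm g.y))" using E by (simp only: mult.assoc)
    show "\<beta> \<le> g.v" "1 \<le> \<beta>" using v(1) M0 \<beta> by (simp_all add: gp)
  qed (use jt jr D1 fx fz fb \<alpha> \<gamma>1[OF xU] in \<open>auto simp: gp\<close>)
  define s where "s y = (grad u y \<bullet> \<gamma> y) / slope (grad u y)" for y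
  have ts: "t.s = - s x" "t.\<theta> = grad u x \<bullet> \<gamma> x" by (simp_all add: t.s_def t.\<theta>_def s_def gp)
  have evU: "\<forall>\<^sub>F y in nhds x. y \<in> U" by (rule eventually_nhds_in_open[OF U xU])
  have pp: "g.p \<bullet> g.p + b * g.v * t.\<theta> \<ge> 0" if "\<bar>b\<bar> \<le> q\<^sup>2" for b
  proof -
    have "\<bar>t.\<theta>\<bar> \<le> g.v" using t.abs_s t.theta_s mult_right_mono[of "\<bar>t.s\<bar>" 1 g.v] by (simp add: abs_mult)
    then have "\<bar>b * (g.v * t.\<theta>)\<bar> \<le> q\<^sup>2 * (g.v * g.v)"
      unfolding abs_mult using that by (intro mult_mono) auto
    moreover have "1 \<le> (1 - q\<^sup>2) * (g.v * g.v)"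
    proof -
      have "1 \<le> (1 - q\<^sup>2) * g.v" using v(2) q2 by (simp add: gp pos_divide_le_eq mult.commute)
      also have "\<dots> \<le> (1 - q\<^sup>2) * (g.v * g.v)" using g.v_ge_1 q2 mult_left_mono[of 1 g.v g.v] by (intro mult_left_mono) auto
      finally show ?thesis .
    qed
    moreover have "g.p \<bullet> g.p = g.v * g.v - 1" using slope_sq[of g.p] by (simp add: g.v_def power2_eq_square)
    ultimately show ?thesis by (simp add: algebra_simps abs_le_iff)
  qed
  have "\<beta> < 2 * M + 2"
  proof (rule t.beta_bounded[OF q c M])
    show "(\<exists>b. \<bar>b\<bar> = q\<^sup>2 \<and> g.p \<bullet> g.p + b * g.v * t.\<theta> \<ge> 0 \<and>
      (\<forall>\<^sub>F w in nhds x. ln (slope (grad u w) + b * (grad u w \<bullet> \<gamma> w)) + (\<beta> * u w + \<alpha> * rt w)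
       \<le> ln (slope (grad u x) + b * (grad u x \<bullet> \<gamma> x)) + (\<beta> * u x + \<alpha> * rt x))) \<or>
      (\<bar>t.s\<bar> \<le> q\<^sup>2 \<and> g.p \<bullet> g.p + t.s * g.v * t.\<theta> \<ge> 0 \<and>
      (\<forall>\<^sub>F w in nhds x. ln ((slope (grad u w))\<^sup>2 - (grad u w \<bullet> \<gamma> w)\<^sup>2) / 2 + (\<beta> * u w + \<alpha> * rt w)
       \<le> ln ((slope (grad u x))\<^sup>2 - (grad u x \<bullet> \<gamma> x)\<^sup>2) / 2 + (\<beta> * u x + \<alpha> * rt x)))"
    proof (cases "\<bar>s x\<bar> \<le> q\<^sup>2")
      case True
      have "\<forall>\<^sub>F w in nhds x. ln ((slope (grad u w))\<^sup>2 - (grad u w \<bullet> \<gamma> w)\<^sup>2) / 2 + (\<beta> * u w + \<alpha> * rt w)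
       \<le> ln ((slope (grad u x))\<^sup>2 - (grad u x \<bullet> \<gamma> x)\<^sup>2) / 2 + (\<beta> * u x + \<alpha> * rt x)"
        using mx evU
      proof eventually_elim
        case (elim w)
        show ?case
          using tangential_le_test_fun(1)[where \<gamma>=\<gamma> and y=w and P="grad u" and \<Psi>="\<lambda>y. \<beta> * u y + \<alpha> * rt y", OF q \<gamma>1[OF elim(2)]]
            tangential_le_test_fun(2)[where \<gamma>=\<gamma> and y=x and P="grad u" and \<Psi>="\<lambda>y. \<beta> * u y + \<alpha> * rt y", OF q \<gamma>1[OF xU]] True elim(1)
          unfolding s_def by linarith
      qed
      then show ?thesis using True pp[of t.s] by (simp add: ts)
    next
      case False
      \<comment> \<open>Beyond the cut \<theta> does not vanish. Its sign and the inequality |s| >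
        q^2 persist near x, so only one affine branch is involved.\<close>
      define \<sigma> where "\<sigma> = sgn (grad u x \<bullet> \<gamma> x)"
      have "grad u x \<bullet> \<gamma> x \<noteq> 0" using False by (auto simp: s_def)
      then have \<sigma>: "\<bar>\<sigma>\<bar> = 1" "\<sigma> * (grad u x \<bullet> \<gamma> x) > 0" by (auto simp: \<sigma>_def abs_sgn_eq sgn_if)
      have c\<theta>: "isCont (\<lambda>y. grad u y \<bullet> \<gamma> y) x" by (rule has_derivative_continuous[OF mc_jet_GDERIV[OF jt, unfolded gderiv_def]])
      have csl: "isCont (\<lambda>y. slope (grad u y)) x"
        by (rule has_derivative_continuous[OF mc_jet_GDERIV[OF g.mc_jet_slope, unfolded gderiv_def]])
      have cs: "isCont (\<lambda>y. \<bar>s y\<bar>) x" unfolding s_def by (intro continuous_intros c\<theta> csl) simp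
      have ev1: "\<forall>\<^sub>F y in nhds x. \<bar>s y\<bar> \<in> {q\<^sup>2<..}"
        by (rule isCont_eventually_in_open[OF cs]) (use False in auto)
      have "isCont (\<lambda>y. \<sigma> * (grad u y \<bullet> \<gamma> y)) x" by (intro continuous_intros c\<theta>)
      then have ev2: "\<forall>\<^sub>F y in nhds x. \<sigma> * (grad u y \<bullet> \<gamma> y) \<in> {0<..}"
        by (rule isCont_eventually_in_open) (use \<sigma> in auto)
      have abs\<sigma>: "\<bar>grad u y \<bullet> \<gamma> y\<bar> = \<sigma> * (grad u y \<bullet> \<gamma> y)" if "\<sigma> * (grad u y \<bullet> \<gamma> y) > 0" for y
        using that \<sigma>(1) by (metis abs_mult abs_of_pos mult_1)
      define b where "b = - q\<^sup>2 * \<sigma>"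
      have b: "\<bar>b\<bar> = q\<^sup>2" using \<sigma>(1) by (simp add: b_def abs_mult)
      have "\<forall>\<^sub>F w in nhds x. ln (slope (grad u w) + b * (grad u w \<bullet> \<gamma> w)) + (\<beta> * u w + \<alpha> * rt w)
       \<le> ln (slope (grad u x) + b * (grad u x \<bullet> \<gamma> x)) + (\<beta> * u x + \<alpha> * rt x)"
        using mx evU ev1 ev2
      proof eventually_elim
        case (elim w)
        have "test_fun q (grad u) \<gamma> (\<lambda>y. \<beta> * u y + \<alpha> * rt y) w = ln (slope (grad u w) + b * (grad u w \<bullet> \<gamma> w)) + (\<beta> * u w + \<alpha> * rt w) - ln (sqrt (1 - (q\<^sup>2)\<^sup>2))"
          unfolding b_def by (rule test_fun_affine[where \<gamma>=\<gamma> and y=w, OF q \<gamma>1[OF elim(2)]]) (use elim abs\<sigma> in \<open>auto simp: s_def\<close>)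
        moreover have "test_fun q (grad u) \<gamma> (\<lambda>y. \<beta> * u y + \<alpha> * rt y) x = ln (slope (grad u x) + b * (grad u x \<bullet> \<gamma> x)) + (\<beta> * u x + \<alpha> * rt x) - ln (sqrt (1 - (q\<^sup>2)\<^sup>2))"
          unfolding b_def by (rule test_fun_affine[where \<gamma>=\<gamma> and y=x, OF q \<gamma>1[OF xU]]) (use False \<sigma>(2) abs\<sigma> in \<open>auto simp: s_def\<close>)
        ultimately show ?case using elim(1) by linarith
      qed
      then show ?thesis using b pp[of b] by auto
    qed
  qed
  then show False using \<beta> by simp
qed

end

text \<open>At boundary points \<open>P\<close> and \<open>HB\<close> are the continuous extensions of the gradient of \<open>u\<close> and of the
  gradients of its partial derivatives.\<close>

locale capillary_solution = domain_data \<Omega> U rt \<gamma> \<mu> C c\<^sub>0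
  for \<Omega> U :: "'a::euclidean_space set" and rt :: "'a \<Rightarrow> real" and \<gamma> :: "'a \<Rightarrow> 'a" and \<mu> C c\<^sub>0 :: real +
  fixes M\<^sub>0 L\<^sub>1 L\<^sub>2 b\<^sub>0 :: real and f :: "'a \<times> real \<Rightarrow> real" and \<psi> u :: "'a \<Rightarrow> real" and P D\<psi> :: "'a \<Rightarrow> 'a" and HB :: "'a \<Rightarrow> 'a \<Rightarrow> 'a"
  assumes sol: "mc_solution \<Omega> M\<^sub>0 L\<^sub>1 f u" and L1: "L\<^sub>1 \<ge> 0"
    and ucont: "continuous_on (closure \<Omega>) u" and uM: "\<And>x. x \<in> closure \<Omega> \<Longrightarrow> \<bar>u x\<bar> \<le> M\<^sub>0"
    and Pcont: "continuous_on (closure \<Omega>) P" and P: "\<And>x. x \<in> \<Omega> \<Longrightarrow> P x = grad u x"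
    and HBcont: "\<And>b. b \<in> Basis \<Longrightarrow> continuous_on (closure \<Omega>) (HB b)"
    and HB: "\<And>b x. b \<in> Basis \<Longrightarrow> x \<in> \<Omega> \<Longrightarrow> HB b x = grad (partial_deriv b u) x"
    and \<psi>cont: "continuous_on (closure \<Omega>) \<psi>" and D\<psi>cont: "continuous_on (closure \<Omega>) D\<psi>"
    and \<psi>: "\<And>x. x \<in> \<Omega> \<Longrightarrow> GDERIV \<psi> x :> D\<psi> x"
    and \<psi>b: "\<And>x. x \<in> frontier \<Omega> \<Longrightarrow> \<bar>\<psi> x\<bar> \<le> b\<^sub>0" and D\<psi>b: "\<And>x. x \<in> frontier \<Omega> \<Longrightarrow> norm (D\<psi> x) \<le> L\<^sub>2"
    and b0: "0 < b\<^sub>0" "b\<^sub>0 < 1" and L2: "L\<^sub>2 \<ge> 0"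
    and bc: "\<And>x. x \<in> frontier \<Omega> \<Longrightarrow> P x \<bullet> \<gamma> x + \<psi> x * slope (P x) = 0"
begin

section \<open>First and second derivatives of u up to the boundary\<close>

lemma C2u: "Ck_on 2 \<Omega> u" using sol Ck_on_mono[of 3 \<Omega> u 2] by (simp add: mc_solution_def)

lemma P_GDERIV: "y \<in> \<Omega> \<Longrightarrow> b \<in> Basis \<Longrightarrow> GDERIV (\<lambda>y. P y \<bullet> b) y :> HB b y"
proof -
  assume y: "y \<in> \<Omega>" and b: "b \<in> Basis"
  have "GDERIV (partial_deriv b u) y :> HB b y"
    using GDERIV_grad[OF partial_differentiable[OF C2u y b]] HB[OF b y] by simp
  then show ?thesis
  proof (rule GDERIV_cong_open[OF op y, rotated])
    show "partial_deriv b u z = P z \<bullet> b" if "z \<in> \<Omega>" for z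
      using P[OF that] partial_deriv_eq_grad[OF b, of u z] by simp
  qed
qed

lemma \<gamma>_GDERIV: "y \<in> U \<Longrightarrow> b \<in> Basis \<Longrightarrow> GDERIV (\<lambda>y. \<gamma> y \<bullet> b) y :> grad (\<lambda>z. \<gamma> z \<bullet> b) y"
  using Ck_on_GDERIV[of 1 U "\<lambda>y. \<gamma> y \<bullet> b" y] \<gamma>C by (simp add: numeral_2_eq_2)

text \<open>An identity between continuous functions on the closure that holds inside \<Omega>; at
  the boundary HB is only an extension.\<close>

lemma HB_symmetric:
  assumes "x \<in> closure \<Omega>" "b \<in> Basis" "c \<in> Basis"
  shows "HB b x \<bullet> c = HB c x \<bullet> b"
proof -
  have "HB b x \<bullet> c - HB c x \<bullet> b = 0"
  proof (rule continuous_constant_on_closure[of \<Omega> "\<lambda>x. HB b x \<bullet> c - HB c x \<bullet> b"])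
    show "continuous_on (closure \<Omega>) (\<lambda>x. HB b x \<bullet> c - HB c x \<bullet> b)"
      by (intro continuous_intros HBcont assms)
    fix y assume y: "y \<in> \<Omega>"
    have "HB b y \<bullet> c = partial_deriv c (partial_deriv b u) y"
      using partial_deriv_eq_grad[OF assms(3)] HB[OF assms(2) y] by simp
    moreover have "HB c y \<bullet> b = partial_deriv b (partial_deriv c u) y"
      using partial_deriv_eq_grad[OF assms(2)] HB[OF assms(3) y] by simp
    ultimately show "HB b y \<bullet> c - HB c y \<bullet> b = 0"
      using Ck_on_partial_commute[OF op C2u y assms(2,3)] by simp
  qed (rule assms(1))
  then show ?thesis by simp
qed

text \<open>The Hessian of u as a linear map, continued to the boundary.\<close>

definition HH where "HH x k = (\<Sum>b\<in>Basis. (k \<bullet> b) *\<^sub>R HB b x)"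

lemma linear_HH: "linear (HH x)"
  unfolding HH_def by (rule linearI)
    (simp_all add: inner_add_left scaleR_add_left sum.distrib scaleR_sum_right)

lemma HH_symmetric: "x \<in> closure \<Omega> \<Longrightarrow> HH x k \<bullet> l = HH x l \<bullet> k"
proof -
  assume x: "x \<in> closure \<Omega>"
  have e: "HH x k \<bullet> l = (\<Sum>b\<in>Basis. \<Sum>c\<in>Basis. (k \<bullet> b) * (l \<bullet> c) * (HB b x \<bullet> c))" for k l
  proof -
    have "HB b x \<bullet> l = (\<Sum>c\<in>Basis. (l \<bullet> c) * (HB b x \<bullet> c))" for b
      by (subst euclidean_inner) (simp add: mult.commute)
    then show ?thesis by (simp add: HH_def inner_sum_left sum_distrib_left mult.assoc)
  qed
  have "HH x k \<bullet> l = (\<Sum>c\<in>Basis. \<Sum>b\<in>Basis. (k \<bullet> b) * (l \<bullet> c) * (HB b x \<bullet> c))"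
    unfolding e by (rule sum.swap)
  also have "\<dots> = (\<Sum>c\<in>Basis. \<Sum>b\<in>Basis. (l \<bullet> c) * (k \<bullet> b) * (HB c x \<bullet> b))"
    by (intro sum.cong refl) (simp add: HB_symmetric[OF x] mult.commute)
  also have "\<dots> = HH x l \<bullet> k" unfolding e ..
  finally show ?thesis .
qed

text \<open>The part of the gradient of \<theta> in which \<gamma> is differentiated, as in
  \<open>mc_jet_normal_component\<close> but up to the boundary.\<close>

definition Q where "Q y = (\<Sum>b\<in>Basis. (P y \<bullet> b) *\<^sub>R grad (\<lambda>z. \<gamma> z \<bullet> b) y)"

lemma theta_GDERIV: "y \<in> \<Omega> \<inter> U \<Longrightarrow> GDERIV (\<lambda>y. P y \<bullet> \<gamma> y) y :> Q y + HH y (\<gamma> y)"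
proof -
  assume y: "y \<in> \<Omega> \<inter> U"
  have "GDERIV (\<lambda>y. \<Sum>b\<in>Basis. (P y \<bullet> b) * (\<gamma> y \<bullet> b)) y :>
     (\<Sum>b\<in>Basis. (P y \<bullet> b) *\<^sub>R grad (\<lambda>z. \<gamma> z \<bullet> b) y + (\<gamma> y \<bullet> b) *\<^sub>R HB b y)"
    using y by (intro GDERIV_sum GDERIV_mult P_GDERIV \<gamma>_GDERIV) auto
  then show ?thesis by (simp add: euclidean_inner[of "P _" "\<gamma> _", symmetric] Q_def HH_def sum.distrib)
qed

lemma slope_sq_GDERIV: "y \<in> \<Omega> \<Longrightarrow> GDERIV (\<lambda>y. (slope (P y))\<^sup>2) y :> 2 *\<^sub>R HH y (P y)"
proof -
  assume y: "y \<in> \<Omega>"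
  have "GDERIV (\<lambda>y. 1 + (\<Sum>b\<in>Basis. (P y \<bullet> b) * (P y \<bullet> b))) y :>
     0 + (\<Sum>b\<in>Basis. (P y \<bullet> b) *\<^sub>R HB b y + (P y \<bullet> b) *\<^sub>R HB b y)"
    using y by (intro GDERIV_add GDERIV_const GDERIV_sum GDERIV_mult P_GDERIV) auto
  then show ?thesis by (simp only: euclidean_inner[of "P _" "P _", symmetric] slope_sq HH_def sum.distrib add_0 scaleR_2)
qed

lemma slope_GDERIV: "y \<in> \<Omega> \<Longrightarrow> GDERIV (\<lambda>y. slope (P y)) y :> (1 / slope (P y)) *\<^sub>R HH y (P y)"
proof -
  assume y: "y \<in> \<Omega>"
  have "GDERIV (\<lambda>y. sqrt ((slope (P y))\<^sup>2)) y :> (inverse (sqrt ((slope (P y))\<^sup>2)) / 2) *\<^sub>R (2 *\<^sub>R HH y (P y))"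
    by (rule GDERIV_DERIV_compose[OF slope_sq_GDERIV[OF y] DERIV_real_sqrt]) simp
  moreover have "sqrt ((slope (P y))\<^sup>2) = slope (P y)" for y by (simp add: abs_of_pos)
  ultimately show ?thesis by (simp add: inverse_eq_divide)
qed

lemma cont_\<gamma>: "continuous_on U \<gamma>"
proof -
  have "continuous_on U (\<lambda>y. \<Sum>b\<in>Basis. (\<gamma> y \<bullet> b) *\<^sub>R b)"
    by (intro continuous_intros Ck_on_imp_continuous[OF \<gamma>C])
  then show ?thesis by (simp add: euclidean_representation)
qed

lemma conts:
  "continuous_on (closure \<Omega> \<inter> U) P" "continuous_on (closure \<Omega> \<inter> U) \<gamma>"
  "continuous_on (closure \<Omega> \<inter> U) (\<lambda>y. HH y (P y))" "continuous_on (closure \<Omega> \<inter> U) (\<lambda>y. HH y (\<gamma> y))"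
  "continuous_on (closure \<Omega> \<inter> U) Q" "continuous_on (closure \<Omega> \<inter> U) (\<lambda>y. slope (P y))"
proof -
  show p: "continuous_on (closure \<Omega> \<inter> U) P" by (rule continuous_on_subset[OF Pcont]) auto
  show g: "continuous_on (closure \<Omega> \<inter> U) \<gamma>" by (rule continuous_on_subset[OF cont_\<gamma>]) auto
  have hb: "continuous_on (closure \<Omega> \<inter> U) (HB b)" if "b \<in> Basis" for b
    by (rule continuous_on_subset[OF HBcont[OF that]]) auto
  have dg: "continuous_on (closure \<Omega> \<inter> U) (grad (\<lambda>z. \<gamma> z \<bullet> b))" if "b \<in> Basis" for b
    by (rule continuous_on_subset[OF continuous_on_grad[OF Ck_on_mono[OF \<gamma>C[OF that]]]]) auto
  show "continuous_on (closure \<Omega> \<inter> U) (\<lambda>y. HH y (P y))" "continuous_on (closure \<Omega> \<inter> U) (\<lambda>y. HH y (\<gamma> y))"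
    "continuous_on (closure \<Omega> \<inter> U) Q" "continuous_on (closure \<Omega> \<inter> U) (\<lambda>y. slope (P y))"
    unfolding HH_def Q_def slope_def by (intro continuous_intros p g hb dg; assumption)+
qed

text \<open>Let q be the part of p orthogonal to \<gamma>. Then m = v^2 - \<theta>^2 = 1 + |q|^2,
  and half of its logarithm has the gradient (HH q - \<theta> Q) / m. Along the conormal \<xi> the
  term HH q . \<xi> is exactly the second order part of the boundary condition differentiated along
  q, so it reduces to first order quantities. The remaining conormal terms are bounded, except the
  one with \<alpha>.\<close>

lemma boundary_max:
  assumes x: "x \<in> frontier \<Omega>" and \<alpha>: "\<alpha> \<ge> 0" and \<beta>: "0 \<le> \<beta>" "\<beta> \<le> slope (P x)"
    and W: "open W" "x \<in> W" "W \<subseteq> U"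
    and mx: "\<And>y. y \<in> \<Omega> \<inter> W \<Longrightarrow> ln ((slope (P y))\<^sup>2 - (P y \<bullet> \<gamma> y)\<^sup>2) / 2 + (\<beta> * u y + \<alpha> * rt y)
      \<le> ln ((slope (P x))\<^sup>2 - (P x \<bullet> \<gamma> x)\<^sup>2) / 2 + (\<beta> * u x + \<alpha> * rt x)"
  shows "\<alpha> * c\<^sub>0 * (1 - b\<^sub>0) \<le> (3 * DIM('a) * C + L\<^sub>2) / (1 - b\<^sub>0) + 1"
proof -
  obtain r e h where ch: "boundary_chart \<Omega> x e r h"
    using Ck_boundary_chart[OF op bd _ x] by (metis one_le_numeral)
  interpret ch: boundary_chart \<Omega> x e r h by (rule ch)
  have xb: "x \<in> ball x r" using ch.r by simp
  have xc: "x \<in> closure \<Omega>" using x by (simp add: frontier_def)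
  have xU: "x \<in> U" using W by auto
  have inf0: "infdist x (frontier \<Omega>) \<le> \<mu>" using x \<mu> by simp
  have gh: "grad h x = norm (grad h x) *\<^sub>R \<gamma> x"
  proof -
    have "grad h x /\<^sub>R norm (grad h x) = \<gamma> x" by (rule normal[OF x ch.inward_unit_normal_exists[OF x xb]])
    then show ?thesis using ch.grad_h_nz[of x] by (metis norm_eq_zero scaleR_scaleR right_inverse scaleR_one)
  qed
  have ghp: "norm (grad h x) > 0" using ch.grad_h_nz by simp
  have sub: "closure \<Omega> \<inter> W \<subseteq> closure \<Omega> \<inter> U" using W by auto
  note cW = conts[THEN continuous_on_subset[OF _ sub]]
  have cW': "continuous_on (closure \<Omega> \<inter> W) \<psi>" "continuous_on (closure \<Omega> \<inter> W) D\<psi>" "continuous_on (closure \<Omega> \<inter> W) u"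
    "continuous_on (closure \<Omega> \<inter> W) rt" "continuous_on (closure \<Omega> \<inter> W) (grad rt)"
    using \<psi>cont D\<psi>cont ucont Ck_on_imp_continuous[OF rt] continuous_on_grad[OF Ck_on_mono[OF rt, of 1]]
    by (auto elim: continuous_on_subset)
  define p v \<theta> g where "p = P x" and "v = slope p" and "\<theta> = p \<bullet> \<gamma> x" and "g = \<gamma> x"
  define q where "q = p - \<theta> *\<^sub>R g"
  define s where "s = \<psi> x"
  have v: "v > 0" "v \<ge> 1" by (auto simp: v_def slope_ge_1)
  have g1: "norm g = 1" using \<gamma>1[OF xU] by (simp add: g_def)
  have gg: "g \<bullet> g = 1" using g1 by (simp add: norm_eq_1)
  have \<theta>: "\<theta> = - s * v" using bc[OF x] by (simp add: \<theta>_def s_def v_def p_def)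
  have s: "\<bar>s\<bar> \<le> b\<^sub>0" "\<bar>s\<bar> < 1" using \<psi>b[OF x] b0 by (auto simp: s_def)
  have s2: "1 - b\<^sub>0 \<le> 1 - s\<^sup>2" "1 - s\<^sup>2 \<le> 1"
  proof -
    have "\<bar>s\<bar> * \<bar>s\<bar> \<le> b\<^sub>0 * 1" using s b0 by (intro mult_mono) auto
    then show "1 - b\<^sub>0 \<le> 1 - s\<^sup>2" by (simp add: power2_eq_square)
  qed simp
  have sp: "1 - s\<^sup>2 > 0" using s2 b0 by linarith
  have pg: "p \<bullet> g = \<theta>" by (simp add: \<theta>_def g_def)
  have qg: "q \<bullet> g = 0" by (simp add: q_def inner_diff_left gg pg)
  have pp: "p \<bullet> p = v\<^sup>2 - 1" using slope_sq[of p] by (simp add: v_def)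
  have pq: "p \<bullet> q = v\<^sup>2 - 1 - \<theta>\<^sup>2" by (simp add: q_def inner_diff_right pg pp power2_eq_square)
  have qq: "q \<bullet> q = v\<^sup>2 - 1 - \<theta>\<^sup>2"
  proof -
    have "q \<bullet> q = p \<bullet> q - \<theta> * (g \<bullet> q)" by (subst (1) q_def) (simp add: inner_diff_left)
    then show ?thesis using pq qg by (simp add: inner_commute)
  qed
  have nq: "norm q \<le> v"
  proof -
    have "(norm q)\<^sup>2 \<le> v\<^sup>2" unfolding power2_norm_eq_inner qq using zero_le_power2[of \<theta>] by linarith
    then show ?thesis by (rule power2_le_imp_le) (use v in simp)
  qed
  \<comment> \<open>The conormal, that is, the inverse metric applied to g: with p = q + \<theta> g
    and \<theta> = - s v, the vector g - (\<theta> / v^2) p equals this combination.\<close>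
  define \<xi> where "\<xi> = (1 - s\<^sup>2) *\<^sub>R g + (s / v) *\<^sub>R q"
  have g\<xi>: "g \<bullet> \<xi> = 1 - s\<^sup>2" using qg by (simp add: \<xi>_def inner_add_right gg inner_commute)
  have n\<xi>: "norm \<xi> \<le> 2"
  proof -
    have "norm \<xi> \<le> norm ((1 - s\<^sup>2) *\<^sub>R g) + norm ((s / v) *\<^sub>R q)" unfolding \<xi>_def by (rule norm_triangle_ineq)
    also have "norm ((1 - s\<^sup>2) *\<^sub>R g) \<le> 1" using s2 sp g1 by simp
    also have "norm ((s / v) *\<^sub>R q) \<le> 1"
    proof -
      have "\<bar>s\<bar> * norm q \<le> 1 * v" using s nq by (intro mult_mono) auto
      then show ?thesis using v by (simp add: abs_divide divide_le_eq)
    qed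
    finally show ?thesis by simp
  qed
  have p\<xi>: "p \<bullet> \<xi> = - s / v"
  proof -
    have "p \<bullet> \<xi> = (1 - s\<^sup>2) * \<theta> + (s / v) * (v\<^sup>2 - 1 - \<theta>\<^sup>2)" by (simp add: \<xi>_def inner_add_right pg pq)
    also have "\<dots> = - s / v" unfolding \<theta> using v by (simp add: field_simps power2_eq_square)
    finally show ?thesis .
  qed
  have nQ: "norm (Q x) \<le> DIM('a) * C * v"
  proof -
    have "norm (Q x) \<le> (\<Sum>b\<in>(Basis::'a set). v * C)" unfolding Q_def
    proof (rule sum_norm_le)
      fix b :: 'a assume b: "b \<in> Basis"
      have "\<bar>P x \<bullet> b\<bar> \<le> v" using Basis_le_norm[OF b, of p] norm_le_slope[of p] by (simp add: v_def p_def)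
      then show "norm ((P x \<bullet> b) *\<^sub>R grad (\<lambda>z. \<gamma> z \<bullet> b) x) \<le> v * C"
        unfolding norm_scaleR using \<gamma>_jet[OF inf0 b, of 0] v by (intro mult_mono) auto
    qed
    then show ?thesis by (simp add: mult_ac)
  qed
  have T: "(Q x + HH x (\<gamma> x) + (\<psi> x *\<^sub>R ((1 / slope (P x)) *\<^sub>R HH x (P x)) + slope (P x) *\<^sub>R D\<psi> x)) \<bullet> q = 0"
  proof (rule ch.tangential_derivative_zero[OF x xb W(1,2), of "\<lambda>y. P y \<bullet> \<gamma> y + \<psi> y * slope (P y)"
        "\<lambda>y. Q y + HH y (\<gamma> y) + (\<psi> y *\<^sub>R ((1 / slope (P y)) *\<^sub>R HH y (P y)) + slope (P y) *\<^sub>R D\<psi> y)"])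
    show "continuous_on (closure \<Omega> \<inter> W) (\<lambda>y. P y \<bullet> \<gamma> y + \<psi> y * slope (P y))"
      by (intro continuous_intros cW cW')
    show "GDERIV (\<lambda>y. P y \<bullet> \<gamma> y + \<psi> y * slope (P y)) y :> Q y + HH y (\<gamma> y) + (\<psi> y *\<^sub>R ((1 / slope (P y)) *\<^sub>R HH y (P y)) + slope (P y) *\<^sub>R D\<psi> y)"
      if "y \<in> \<Omega> \<inter> W" for y
      using that W by (intro GDERIV_add GDERIV_mult theta_GDERIV \<psi> slope_GDERIV) auto
    show "continuous_on (closure \<Omega> \<inter> W) (\<lambda>y. Q y + HH y (\<gamma> y) + (\<psi> y *\<^sub>R ((1 / slope (P y)) *\<^sub>R HH y (P y)) + slope (P y) *\<^sub>R D\<psi> y))"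
      by (intro continuous_intros cW cW') simp
    show "grad h x \<bullet> q = 0" using qg by (subst gh) (simp add: g_def[symmetric] inner_commute)
  qed (use bc in auto)
  define m where "m y = (slope (P y))\<^sup>2 - (P y \<bullet> \<gamma> y)\<^sup>2" for y
  have mp: "m y > 0" if "y \<in> W" for y
    using inner_less_slope(2)[OF \<gamma>1, of y "P y"] that W by (auto simp: m_def)
  define Gm where "Gm y = 2 *\<^sub>R HH y (P y) - ((P y \<bullet> \<gamma> y) *\<^sub>R (Q y + HH y (\<gamma> y)) + (P y \<bullet> \<gamma> y) *\<^sub>R (Q y + HH y (\<gamma> y)))" for y
  have "(((1/2) *\<^sub>R (inverse (m x) *\<^sub>R Gm x)) + (\<beta> *\<^sub>R P x + \<alpha> *\<^sub>R grad rt x)) \<bullet> \<xi> \<le> 0"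
  proof (rule ch.inward_derivative_nonpos[OF x xb W(1,2), of "\<lambda>y. (1/2) * ln (m y) + (\<beta> * u y + \<alpha> * rt y)"
        "\<lambda>y. ((1/2) *\<^sub>R (inverse (m y) *\<^sub>R Gm y)) + (\<beta> *\<^sub>R P y + \<alpha> *\<^sub>R grad rt y)"])
    have mne: "\<forall>y\<in>closure \<Omega> \<inter> W. m y \<noteq> 0" using mp by force
    have cm: "continuous_on (closure \<Omega> \<inter> W) m" unfolding m_def by (intro continuous_intros cW)
    show "continuous_on (closure \<Omega> \<inter> W) (\<lambda>y. (1/2) * ln (m y) + (\<beta> * u y + \<alpha> * rt y))"
      by (intro continuous_intros cW' cm mne)
    show "continuous_on (closure \<Omega> \<inter> W) (\<lambda>y. ((1/2) *\<^sub>R (inverse (m y) *\<^sub>R Gm y)) + (\<beta> *\<^sub>R P y + \<alpha> *\<^sub>R grad rt y))"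
      unfolding Gm_def by (intro continuous_intros cW cW' cm mne)
    show "GDERIV (\<lambda>y. (1/2) * ln (m y) + (\<beta> * u y + \<alpha> * rt y)) y :> ((1/2) *\<^sub>R (inverse (m y) *\<^sub>R Gm y)) + (\<beta> *\<^sub>R P y + \<alpha> *\<^sub>R grad rt y)"
      if y: "y \<in> \<Omega> \<inter> W" for y
    proof -
      have cm: "GDERIV (\<lambda>y. c * k y) y :> c *\<^sub>R E" if "GDERIV k y :> E" for c k E
        using GDERIV_mult[OF GDERIV_const that, of c] by simp
      have "GDERIV (\<lambda>y. (slope (P y))\<^sup>2 - (P y \<bullet> \<gamma> y) * (P y \<bullet> \<gamma> y)) y :> Gm y"
        unfolding Gm_def using y W by (intro GDERIV_diff GDERIV_mult slope_sq_GDERIV theta_GDERIV) auto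
      then have "GDERIV m y :> Gm y" by (simp add: m_def[abs_def] power2_eq_square)
      from GDERIV_DERIV_compose[OF this DERIV_ln_twice(1)]
      have 1: "GDERIV (\<lambda>y. ln (m y)) y :> inverse (m y) *\<^sub>R Gm y" using mp y by auto
      have 2: "GDERIV u y :> P y" using Ck_on_GDERIV[of 1 \<Omega> u y] C2u y P by (simp add: numeral_2_eq_2)
      have 3: "GDERIV rt y :> grad rt y" using Ck_on_GDERIV[of 1 UNIV rt y] rt by (simp add: numeral_2_eq_2)
      show ?thesis by (intro GDERIV_add cm 1 2 3)
    qed
    show "(1/2) * ln (m y) + (\<beta> * u y + \<alpha> * rt y) \<le> (1/2) * ln (m x) + (\<beta> * u x + \<alpha> * rt x)" if "y \<in> \<Omega> \<inter> W" for y
      using mx[OF that] by (simp add: m_def)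
    show "grad h x \<bullet> \<xi> > 0" using ghp sp by (subst gh) (simp add: g_def[symmetric] g\<xi>)
  qed
  then have I: "(1/2) * (inverse (m x) * (Gm x \<bullet> \<xi>)) + (\<beta> * (p \<bullet> \<xi>) + \<alpha> * (grad rt x \<bullet> \<xi>)) \<le> 0"
    by (simp add: inner_add_left p_def)
  have mx': "m x = v\<^sup>2 * (1 - s\<^sup>2)"
    by (simp add: m_def p_def[symmetric] v_def[symmetric] g_def[symmetric] pg \<theta> power_mult_distrib algebra_simps)
  have hp: "HH x p = HH x q + \<theta> *\<^sub>R HH x g"
    using linear_add[OF linear_HH, of x q "\<theta> *\<^sub>R g"] linear_scale[OF linear_HH, of x \<theta> g] by (simp add: q_def)
  have Gm: "Gm x = 2 *\<^sub>R (HH x q - \<theta> *\<^sub>R Q x)"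
    unfolding Gm_def p_def[symmetric] g_def[symmetric] pg hp
    by (simp only: scaleR_2[symmetric] scaleR_diff_right[symmetric]) (simp add: scaleR_add_right)
  \<comment> \<open>Symmetry exchanges HH q . g for HH g . q; the tangentially differentiated
    boundary condition then eliminates both second order terms at once.\<close>
  have Hq\<xi>: "HH x q \<bullet> \<xi> = - (Q x \<bullet> q) - v * (D\<psi> x \<bullet> q)"
  proof -
    have sym: "HH x q \<bullet> g = HH x g \<bullet> q" by (rule HH_symmetric[OF xc])
    have "Q x \<bullet> q + HH x g \<bullet> q + (s * ((1 / v) * (HH x q \<bullet> q + \<theta> * (HH x g \<bullet> q))) + v * (D\<psi> x \<bullet> q)) = 0"
      using T unfolding p_def[symmetric] v_def[symmetric] g_def[symmetric] s_def[symmetric] hp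
      by (simp add: inner_add_left)
    moreover have "s * ((1 / v) * (\<theta> * (HH x g \<bullet> q))) = - s\<^sup>2 * (HH x g \<bullet> q)"
      unfolding \<theta> using v by (simp add: power2_eq_square)
    moreover have "HH x q \<bullet> \<xi> = (1 - s\<^sup>2) * (HH x g \<bullet> q) + (s / v) * (HH x q \<bullet> q)"
      by (simp add: \<xi>_def inner_add_right sym)
    ultimately show ?thesis by (simp add: distrib_left left_diff_distrib)
  qed
  define K where "K = 3 * DIM('a) * C + L\<^sub>2"
  have K0: "K \<ge> 0" using C L2 by (simp add: K_def)
  have lower: "HH x q \<bullet> \<xi> - \<theta> * (Q x \<bullet> \<xi>) \<ge> - (K * v\<^sup>2)"
  proof -
    have a1: "\<bar>Q x \<bullet> q\<bar> \<le> DIM('a) * C * v * v"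
      by (rule order_trans[OF Cauchy_Schwarz_ineq2 mult_mono[OF nQ nq]]) (use C v in auto)
    have a2: "\<bar>D\<psi> x \<bullet> q\<bar> \<le> L\<^sub>2 * v"
      by (rule order_trans[OF Cauchy_Schwarz_ineq2 mult_mono[OF D\<psi>b[OF x] nq]]) (use L2 in auto)
    have a3: "\<bar>Q x \<bullet> \<xi>\<bar> \<le> DIM('a) * C * v * 2"
      by (rule order_trans[OF Cauchy_Schwarz_ineq2 mult_mono[OF nQ n\<xi>]]) (use C v in auto)
    have "\<bar>\<theta>\<bar> \<le> 1 * v" unfolding \<theta> abs_mult using s v by (intro mult_mono) auto
    then have a4: "\<bar>\<theta> * (Q x \<bullet> \<xi>)\<bar> \<le> v * (DIM('a) * C * v * 2)" unfolding abs_mult using a3 v by (intro mult_mono) auto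
    have a5: "\<bar>v * (D\<psi> x \<bullet> q)\<bar> \<le> v * (L\<^sub>2 * v)" using a2 v by (simp add: abs_mult)
    have "K * v\<^sup>2 = DIM('a) * C * v * v + v * (L\<^sub>2 * v) + v * (DIM('a) * C * v * 2)"
      by (simp add: K_def power2_eq_square algebra_simps)
    then show ?thesis using a1 a4 a5 unfolding Hq\<xi> by linarith
  qed
  have t1: "(1/2) * (inverse (m x) * (Gm x \<bullet> \<xi>)) \<ge> - (K / (1 - b\<^sub>0))"
  proof -
    have "(1/2) * (inverse (m x) * (Gm x \<bullet> \<xi>)) = (HH x q \<bullet> \<xi> - \<theta> * (Q x \<bullet> \<xi>)) / m x"
    proof -
      have "(1/2) * (i * (2 * w)) = w * i" for i w :: real by simp
      then show ?thesis unfolding Gm inner_scaleR_left inner_diff_left divide_inverse .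
    qed
    moreover have "- (K * v\<^sup>2) / m x \<le> (HH x q \<bullet> \<xi> - \<theta> * (Q x \<bullet> \<xi>)) / m x"
      using lower mp[OF W(2)] by (intro divide_right_mono) auto
    moreover have "- (K * v\<^sup>2) / m x = - (K / (1 - s\<^sup>2))" unfolding mx' using v by simp
    ultimately have "(1/2) * (inverse (m x) * (Gm x \<bullet> \<xi>)) \<ge> - (K / (1 - s\<^sup>2))" by linarith
    moreover have "K / (1 - s\<^sup>2) \<le> K / (1 - b\<^sub>0)" using s2 sp b0 K0 by (intro divide_left_mono) auto
    ultimately show ?thesis by linarith
  qed
  \<comment> \<open>Here p . \<xi> = - s / v and \<beta> \<le> v, so the bound does not involve
    \<beta>.\<close>
  have t2: "\<beta> * (p \<bullet> \<xi>) \<ge> - 1"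
  proof -
    have "\<bar>\<beta> * (p \<bullet> \<xi>)\<bar> = (\<beta> / v) * \<bar>s\<bar>" unfolding p\<xi> using v \<beta> by (simp add: abs_mult abs_divide)
    also have "\<dots> \<le> 1 * 1" using \<beta> s v by (intro mult_mono) (auto simp: v_def p_def)
    finally show ?thesis by linarith
  qed
  have t3: "\<alpha> * (grad rt x \<bullet> \<xi>) \<ge> \<alpha> * c\<^sub>0 * (1 - b\<^sub>0)"
  proof -
    obtain c where c: "c \<ge> c\<^sub>0" "grad rt x = c *\<^sub>R \<gamma> x" using grad_rt[OF x] by blast
    have "c\<^sub>0 * (1 - b\<^sub>0) \<le> c * (1 - s\<^sup>2)" using c c0 s2 b0 by (intro mult_mono) auto
    then have "\<alpha> * (c\<^sub>0 * (1 - b\<^sub>0)) \<le> \<alpha> * (c * (1 - s\<^sup>2))" using \<alpha> by (rule mult_left_mono)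
    then show ?thesis using c g\<xi> by (simp add: g_def mult.assoc)
  qed
  show ?thesis using I t1 t2 t3 unfolding K_def by linarith
qed

end

context capillary_solution
begin

text \<open>The summand 2 in \<alpha> exceeds by one what a maximum on the boundary permits. A
  maximum over the closed collar with v > V is thus impossible on the boundary, in the open collar,
  and on its inner edge. Comparing any y with the maximum costs the oscillation 2 (\<beta> M_0 +
  \<alpha> C) of the added terms.\<close>

lemma near_boundary_estimate:
  assumes q: "q = sqrt ((1 + b\<^sub>0) / 2)"
    and \<alpha>: "\<alpha> = ((3 * DIM('a) * C + L\<^sub>2) / (1 - b\<^sub>0) + 2) / (c\<^sub>0 * (1 - b\<^sub>0))"
    and D: "D = DIM('a) * C + L\<^sub>1"
    and c: "c = (1 - q) * (1 - q\<^sup>2)\<^sup>2 / (2 + 2 * DIM('a))"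
    and M: "M = (27 + 18 / (1 - q\<^sup>2)) * (D\<^sup>2 * (1 + \<alpha>)\<^sup>2) / c"
    and \<beta>: "\<beta> = 2 * M + 2"
    and int: "\<And>x. cball x (\<mu> / 2) \<subseteq> \<Omega> \<Longrightarrow> slope (grad u x) \<le> Ci"
    and V: "V = max Ci (max \<beta> (1 / (1 - q\<^sup>2)))"
    and y: "y \<in> closure (near_boundary \<Omega> \<mu>)"
  shows "slope (P y) \<le> V / sqrt (1 - (q\<^sup>2)\<^sup>2) * exp (2 * (\<beta> * M\<^sub>0 + \<alpha> * C)) / (1 - q\<^sup>2)"
proof -
  have q2: "q\<^sup>2 = (1 + b\<^sub>0) / 2" using b0 by (simp add: q)
  have qq: "0 < q" "q < 1" using b0 by (auto simp: q)
  have q21: "q\<^sup>2 < 1" "b\<^sub>0 \<le> q\<^sup>2" using q2 b0 by auto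
  have q4: "(q\<^sup>2)\<^sup>2 < 1" using q21 by (subst abs_square_less_1) simp
  have \<alpha>0: "\<alpha> \<ge> 0" unfolding \<alpha> using C L2 b0 c0 by (intro divide_nonneg_nonneg add_nonneg_nonneg mult_nonneg_nonneg) auto
  have \<alpha>eq: "\<alpha> * c\<^sub>0 * (1 - b\<^sub>0) = (3 * DIM('a) * C + L\<^sub>2) / (1 - b\<^sub>0) + 2" unfolding \<alpha> using b0 c0 by simp
  have c0': "c > 0" unfolding c using qq q21 by (intro divide_pos_pos mult_pos_pos) auto
  have M0: "M \<ge> 0" unfolding M using c0' q21 by simp
  have \<beta>0: "\<beta> > 0" using M0 \<beta> by simp
  define W where "W = {y. infdist y (frontier \<Omega>) < \<mu>}"
  have W: "open W" "W \<subseteq> U" unfolding W_def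
    using KU by (auto intro!: open_Collect_less continuous_intros)
  define K where "K = closure (near_boundary \<Omega> \<mu>)"
  have "\<Omega> \<inter> W \<subseteq> near_boundary \<Omega> \<mu>" by (auto simp: near_boundary_def W_def)
  then have nbK: "\<Omega> \<inter> W \<subseteq> K" unfolding K_def using closure_subset by (rule subset_trans)
  have KO: "K \<subseteq> closure \<Omega>" unfolding K_def by (rule closure_mono) (auto simp: near_boundary_def)
  have Kinf: "infdist x (frontier \<Omega>) \<le> \<mu>" if "x \<in> K" for x
  proof -
    have "closed {x. infdist x (frontier \<Omega>) \<le> \<mu>}" by (intro closed_Collect_le continuous_intros)
    then have "K \<subseteq> {x. infdist x (frontier \<Omega>) \<le> \<mu>}" unfolding K_def by (rule closure_minimal[rotated]) (auto simp: near_boundary_def)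
    then show ?thesis using that by auto
  qed
  have KUs: "K \<subseteq> closure \<Omega> \<inter> U" using KO Kinf KU by auto
  have "bounded (near_boundary \<Omega> \<mu>)" by (rule bounded_subset[OF bdd]) (auto simp: near_boundary_def)
  then have cK: "compact K" by (simp add: K_def compact_closure)
  define \<Psi> where "\<Psi> y = \<beta> * u y + \<alpha> * rt y" for y
  define \<Phi> where "\<Phi> = test_fun q P \<gamma> \<Psi>"
  define s where "s y = (P y \<bullet> \<gamma> y) / slope (P y)" for y
  have s1: "\<bar>s x\<bar> < 1" if "x \<in> K" for x unfolding s_def by (rule inner_less_slope(1)[OF \<gamma>1]) (use that KUs in auto)
  have env: "envelope q (s x) \<ge> 1 - q\<^sup>2" "envelope q (s x) \<le> 1 / sqrt (1 - (q\<^sup>2)\<^sup>2)" "envelope q (s x) > 0" if "x \<in> K" for x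
    using envelope_bounds(1,2)[OF qq, of "s x"] s1[OF that] q21 by linarith+
  have wpos: "slope (P x) * envelope q (s x) > 0" if "x \<in> K" for x using env(3)[OF that] by simp
  have cPhi: "continuous_on K \<Phi>"
  proof -
    note cs = conts[THEN continuous_on_subset[OF _ KUs]]
    have cu: "continuous_on K u" "continuous_on K rt"
      using continuous_on_subset[OF ucont KO] continuous_on_subset[OF Ck_on_imp_continuous[OF rt]] by auto
    have cs': "continuous_on K s" unfolding s_def by (intro continuous_intros cs) simp
    have "continuous_on K (\<lambda>x. slope (P x) * envelope q (s x))"
      by (intro continuous_intros cs continuous_on_compose2[OF continuous_on_envelope[OF qq] cs']) auto
    moreover have "\<forall>x\<in>K. slope (P x) * envelope q (s x) \<noteq> 0" using wpos by force
    ultimately have "continuous_on K (\<lambda>x. ln (slope (P x) * envelope q (s x)))" by (rule continuous_on_ln)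
    then show ?thesis
      unfolding \<Phi>_def test_fun_def[abs_def] s_def[symmetric] \<Psi>_def
      by (rule continuous_on_add) (intro continuous_intros cu)
  qed
  have yK: "y \<in> K" using y by (simp add: K_def)
  obtain x where x: "x \<in> K" and xmax: "\<And>z. z \<in> K \<Longrightarrow> \<Phi> z \<le> \<Phi> x"
    using continuous_attains_sup[OF cK _ cPhi] yK by blast
  have xU: "x \<in> U" "x \<in> closure \<Omega>" using x KUs by auto
  have "slope (P x) \<le> V"
  proof (rule ccontr)
    assume "\<not> slope (P x) \<le> V"
    then have big: "\<beta> \<le> slope (P x)" "1 / (1 - q\<^sup>2) \<le> slope (P x)" "Ci < slope (P x)" by (auto simp: V)
    show False
    proof (cases "x \<in> \<Omega>")
      case True
      show False
      proof (cases "x \<in> W")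
        \<comment> \<open>At the inner edge the maximum need not be a local maximum in \<Omega>. The
          ball of radius \<mu> / 2 lies in \<Omega>, and the interior estimate applies
          instead.\<close>
        case False
        then have inf: "\<mu> \<le> infdist x (frontier \<Omega>)" by (simp add: W_def)
        have "cball x (\<mu> / 2) \<subseteq> \<Omega>"
        proof (rule ccontr)
          assume "\<not> cball x (\<mu> / 2) \<subseteq> \<Omega>"
          moreover have "x \<in> cball x (\<mu> / 2) \<inter> \<Omega>" using True \<mu> by simp
          then have "cball x (\<mu> / 2) \<inter> \<Omega> \<noteq> {}" by blast
          ultimately have "cball x (\<mu> / 2) \<inter> frontier \<Omega> \<noteq> {}"
            by (intro connected_Int_frontier) auto
          then obtain z where "dist x z \<le> \<mu> / 2" "z \<in> frontier \<Omega>" by auto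
          then show False using inf infdist_le[of z "frontier \<Omega>" x] \<mu> by linarith
        qed
        then show False using int[of x] big(3) P[OF True] by simp
      next
        case W: True
        have ev: "\<forall>\<^sub>F z in nhds x. z \<in> \<Omega> \<inter> W"
          by (rule eventually_nhds_in_open) (use op \<open>open W\<close> True W in auto)
        have eq: "test_fun q (grad u) \<gamma> (\<lambda>y. \<beta> * u y + \<alpha> * rt y) z = \<Phi> z" if "z \<in> \<Omega>" for z
          using P[OF that] by (simp add: \<Phi>_def test_fun_def \<Psi>_def)
        show False
        proof (rule interior_max_contradiction[OF sol True Kinf[OF x] L1 qq \<alpha>0 D c M \<beta>])
          show "\<beta> \<le> slope (grad u x)" "1 / (1 - q\<^sup>2) \<le> slope (grad u x)" using big P[OF True] by auto
          show "\<forall>\<^sub>F z in nhds x. test_fun q (grad u) \<gamma> (\<lambda>y. \<beta> * u y + \<alpha> * rt y) z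
             \<le> test_fun q (grad u) \<gamma> (\<lambda>y. \<beta> * u y + \<alpha> * rt y) x"
            using ev by eventually_elim (use eq True xmax nbK in auto)
        qed
      qed
    next
      case False
      then have xf: "x \<in> frontier \<Omega>" using xU op by (simp add: frontier_def interior_open)
      \<comment> \<open>By the boundary condition |s| = |\<psi>| \<le> b_0 \<le> q^2, so x belongs
        to the tangential regime.\<close>
      have sx: "\<bar>s x\<bar> \<le> q\<^sup>2"
      proof -
        have "P x \<bullet> \<gamma> x = - \<psi> x * slope (P x)" using bc[OF xf] by simp
        then have "s x = - \<psi> x" by (simp add: s_def)
        then show ?thesis using \<psi>b[OF xf] q21 by simp
      qed
      have "\<alpha> * c\<^sub>0 * (1 - b\<^sub>0) \<le> (3 * DIM('a) * C + L\<^sub>2) / (1 - b\<^sub>0) + 1"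
      proof (rule boundary_max[OF xf \<alpha>0 less_imp_le[OF \<beta>0] big(1) W(1) _ W(2)])
        show "x \<in> W" using xf \<mu> by (simp add: W_def)
        fix z assume z: "z \<in> \<Omega> \<inter> W"
        have "ln ((slope (P z))\<^sup>2 - (P z \<bullet> \<gamma> z)\<^sup>2) / 2 + \<Psi> z \<le> \<Phi> z"
          unfolding \<Phi>_def by (rule tangential_le_test_fun(1)[where \<gamma>=\<gamma> and y=z, OF qq \<gamma>1]) (use z W in auto)
        also have "\<dots> \<le> \<Phi> x" using xmax z nbK by auto
        also have "\<dots> = ln ((slope (P x))\<^sup>2 - (P x \<bullet> \<gamma> x)\<^sup>2) / 2 + \<Psi> x"
          unfolding \<Phi>_def by (rule tangential_le_test_fun(2)[where \<gamma>=\<gamma> and y=x and P=P, OF qq \<gamma>1[OF xU(1)] sx[unfolded s_def], symmetric])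
        finally show "ln ((slope (P z))\<^sup>2 - (P z \<bullet> \<gamma> z)\<^sup>2) / 2 + (\<beta> * u z + \<alpha> * rt z)
           \<le> ln ((slope (P x))\<^sup>2 - (P x \<bullet> \<gamma> x)\<^sup>2) / 2 + (\<beta> * u x + \<alpha> * rt x)" by (simp add: \<Psi>_def)
      qed
      then show False using \<alpha>eq by simp
    qed
  qed
  note xV = this
  define L where "L = \<beta> * M\<^sub>0 + \<alpha> * C"
  have \<Psi>b: "\<bar>\<Psi> z\<bar> \<le> L" if "z \<in> K" for z
  proof -
    have "\<bar>\<beta> * u z\<bar> \<le> \<beta> * M\<^sub>0" unfolding abs_mult using uM[of z] KO that \<beta>0 by (auto intro!: mult_mono)
    moreover have "\<bar>\<alpha> * rt z\<bar> \<le> \<alpha> * C" unfolding abs_mult using rt_bound[OF Kinf[OF that]] \<alpha>0 by (auto intro!: mult_mono)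
    ultimately show ?thesis unfolding \<Psi>_def L_def by linarith
  qed
  have sl: "0 \<le> slope (P z)" for z using slope_pos(1)[of "P z"] by linarith
  have "V > 0" unfolding V using \<beta>0 by linarith
  have sq: "0 < sqrt (1 - (q\<^sup>2)\<^sup>2)" using q4 by simp
  have lx: "ln (slope (P x) * envelope q (s x)) \<le> ln (V / sqrt (1 - (q\<^sup>2)\<^sup>2))"
  proof -
    have "slope (P x) * envelope q (s x) \<le> V * (1 / sqrt (1 - (q\<^sup>2)\<^sup>2))"
      using xV env[OF x] \<open>V > 0\<close> sl by (intro mult_mono) auto
    then have "slope (P x) * envelope q (s x) \<le> V / sqrt (1 - (q\<^sup>2)\<^sup>2)" by simp
    then show ?thesis using wpos[OF x] by (intro ln_mono) auto
  qed
  have "ln (slope (P y) * envelope q (s y)) + \<Psi> y \<le> ln (slope (P x) * envelope q (s x)) + \<Psi> x"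
    using xmax[OF yK] by (simp add: \<Phi>_def test_fun_def s_def)
  then have "ln (slope (P y) * envelope q (s y)) \<le> ln (V / sqrt (1 - (q\<^sup>2)\<^sup>2)) + 2 * L"
    using lx \<Psi>b[OF x] \<Psi>b[OF yK] by linarith
  then have "exp (ln (slope (P y) * envelope q (s y))) \<le> exp (ln (V / sqrt (1 - (q\<^sup>2)\<^sup>2)) + 2 * L)" by simp
  then have "slope (P y) * envelope q (s y) \<le> V / sqrt (1 - (q\<^sup>2)\<^sup>2) * exp (2 * L)"
    using wpos[OF yK] \<open>V > 0\<close> sq by (simp add: exp_add)
  moreover have "slope (P y) * (1 - q\<^sup>2) \<le> slope (P y) * envelope q (s y)"
    using env(1)[OF yK] sl by (intro mult_left_mono) auto
  ultimately have "slope (P y) * (1 - q\<^sup>2) \<le> V / sqrt (1 - (q\<^sup>2)\<^sup>2) * exp (2 * L)" by linarith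
  then show ?thesis using q21(1) unfolding L_def by (subst pos_le_divide_eq) (simp_all only: diff_gt_0_iff_gt)
qed

end

section \<open>Continuous extensions, choice of the constants and conclusion\<close>

lemma Ck_closure_grad:
  assumes "Ck_closure k S f" "set bs \<subseteq> Basis" "length bs < k"
  shows "\<exists>G. continuous_on (closure S) G \<and> (\<forall>x\<in>S. G x = grad (iter_partial bs f) x)"
proof -
  have "\<exists>g. continuous_on (closure S) g \<and> (\<forall>x\<in>S. g x = partial_deriv b (iter_partial bs f) x)" if "b \<in> Basis" for b
  proof -
    have "set (b # bs) \<subseteq> Basis \<and> length (b # bs) \<le> k" using assms that by auto
    then have "\<exists>g. continuous_on (closure S) g \<and> (\<forall>x\<in>S. g x = iter_partial (b # bs) f x)"
      using assms(1) unfolding Ck_closure_def by blast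
    then show ?thesis by (simp add: iter_partial_def)
  qed
  then obtain g where g: "\<And>b. b \<in> Basis \<Longrightarrow> continuous_on (closure S) (g b)"
    "\<And>b x. b \<in> Basis \<Longrightarrow> x \<in> S \<Longrightarrow> g b x = partial_deriv b (iter_partial bs f) x" by metis
  show ?thesis
  proof (intro exI conjI ballI)
    show "continuous_on (closure S) (\<lambda>x. \<Sum>b\<in>Basis. g b x *\<^sub>R b)" by (intro continuous_intros g)
    show "(\<Sum>b\<in>Basis. g b x *\<^sub>R b) = grad (iter_partial bs f) x" if "x \<in> S" for x
      unfolding grad_def by (intro sum.cong) (auto simp: g(2) that)
  qed
qed

lemma grad_ext_closure:
  assumes "open S" "Ck_closure k S f" "1 \<le> k"
  shows "continuous_on (closure S) (grad_ext S f)" "x \<in> S \<Longrightarrow> grad_ext S f x = grad f x"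
proof -
  obtain G where G: "continuous_on (closure S) G" "\<forall>x\<in>S. G x = grad f x"
    using Ck_closure_grad[OF assms(2), of "[]"] assms(3) by (auto simp: iter_partial_def)
  have e: "grad_ext S f x = G x" if "x \<in> closure S" for x
    by (rule grad_ext_eqI[OF G(1) _ assms(1) that]) (use G in auto)
  show "continuous_on (closure S) (grad_ext S f)" using G(1) by (rule continuous_on_eq) (simp add: e)
  show "grad_ext S f x = grad f x" if "x \<in> S" using e[of x] G(2) that closure_subset[of S] by auto
qed

lemma C0_norm_upper:
  assumes "compact A" "continuous_on A g" "x \<in> A"
  shows "norm (g x) \<le> C0_norm A g"
proof -
  have "bounded ((\<lambda>x. norm (g x)) ` A)"
    by (intro compact_imp_bounded compact_continuous_image continuous_intros assms)
  then show ?thesis unfolding C0_norm_def using assms(3) by (intro cSUP_upper bounded_imp_bdd_above)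
qed

text \<open>The width \<mu> and every constant are fixed from \<Omega>, M_0, L_1, L_2 and b_0 before
  f, \<psi> and u appear. A given normal field coincides on the boundary with the constructed one
  because the inward unit normal is unique.\<close>

lemma boundary_gradient_bound:
  fixes \<Omega> :: "'a::euclidean_space set"
  assumes \<Omega>: "bounded_domain \<Omega>" "Ck_boundary 3 \<Omega>"
    and pos: "0 < M\<^sub>0" "0 < L\<^sub>1" "0 < L\<^sub>2" "0 < b\<^sub>0" "b\<^sub>0 < 1"
  shows "\<exists>B>0. \<exists>\<mu>\<^sub>0>0. \<forall>\<gamma> f \<psi> u.
             (\<forall>x\<in>frontier \<Omega>. inward_unit_normal \<Omega> x (\<gamma> x)) \<and>
             admissible_rhs \<Omega> M\<^sub>0 L\<^sub>1 f \<and>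
             Ck_closure 1 \<Omega> \<psi> \<and> C1_norm \<Omega> \<psi> \<le> L\<^sub>2 \<and> C0_norm (frontier \<Omega>) \<psi> \<le> b\<^sub>0 \<and>
             Ck_closure 2 \<Omega> u \<and> Ck_on 3 \<Omega> u \<and>
             (\<forall>x\<in>closure \<Omega>. \<bar>u x\<bar> \<le> M\<^sub>0) \<and>
             mean_curvature_eq \<Omega> f u \<and> capillary_bc \<Omega> \<gamma> \<psi> u \<longrightarrow>
             (\<forall>x\<in>closure (near_boundary \<Omega> \<mu>\<^sub>0). norm (grad_ext \<Omega> u x) \<le> B)"
proof -
  have op: "open \<Omega>" and bdd: "bounded \<Omega>" and ne: "\<Omega> \<noteq> {}" using \<Omega>(1) by (auto simp: bounded_domain_def)
  obtain U rt g \<mu> C c\<^sub>0 where dd: "domain_data \<Omega> U rt g \<mu> C c\<^sub>0"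
    using domain_data_exists[OF op bdd ne \<Omega>(2)] by blast
  interpret domain_data \<Omega> U rt g \<mu> C c\<^sub>0 by (rule dd)
  obtain Ci where "\<forall>(\<Omega> :: 'a set) f u x. mc_solution \<Omega> M\<^sub>0 L\<^sub>1 f u \<and> cball x (\<mu> / 2) \<subseteq> \<Omega> \<longrightarrow> slope (grad u x) \<le> Ci"
    using interior_gradient_bound[OF pos(1,2), of "\<mu> / 2", where 'a='a] \<mu> by auto
  then have Ci: "slope (grad u x) \<le> Ci" if "mc_solution \<Omega> M\<^sub>0 L\<^sub>1 f u" "cball x (\<mu> / 2) \<subseteq> \<Omega>" for f u x
    using that by blast
  define q \<alpha> D where "q = sqrt ((1 + b\<^sub>0) / 2)"
    and "\<alpha> = ((3 * DIM('a) * C + L\<^sub>2) / (1 - b\<^sub>0) + 2) / (c\<^sub>0 * (1 - b\<^sub>0))" and "D = DIM('a) * C + L\<^sub>1"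
  define c where "c = (1 - q) * (1 - q\<^sup>2)\<^sup>2 / (2 + 2 * DIM('a))"
  define M where "M = (27 + 18 / (1 - q\<^sup>2)) * (D\<^sup>2 * (1 + \<alpha>)\<^sup>2) / c"
  define \<beta> where "\<beta> = 2 * M + 2"
  define V where "V = max Ci (max \<beta> (1 / (1 - q\<^sup>2)))"
  define B where "B = V / sqrt (1 - (q\<^sup>2)\<^sup>2) * exp (2 * (\<beta> * M\<^sub>0 + \<alpha> * C)) / (1 - q\<^sup>2)"
  have est: "norm (grad_ext \<Omega> u x) \<le> B"
    if \<gamma>: "\<forall>x\<in>frontier \<Omega>. inward_unit_normal \<Omega> x (\<gamma> x)" and f: "admissible_rhs \<Omega> M\<^sub>0 L\<^sub>1 f"
      and \<psi>: "Ck_closure 1 \<Omega> \<psi>" "C1_norm \<Omega> \<psi> \<le> L\<^sub>2" "C0_norm (frontier \<Omega>) \<psi> \<le> b\<^sub>0"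
      and u: "Ck_closure 2 \<Omega> u" "Ck_on 3 \<Omega> u" "\<forall>x\<in>closure \<Omega>. \<bar>u x\<bar> \<le> M\<^sub>0"
      and eq: "mean_curvature_eq \<Omega> f u" and bc: "capillary_bc \<Omega> \<gamma> \<psi> u"
      and x: "x \<in> closure (near_boundary \<Omega> \<mu>)" for \<gamma> f \<psi> u x
  proof -
    have sol: "mc_solution \<Omega> M\<^sub>0 L\<^sub>1 f u"
      using op f u eq closure_subset[of \<Omega>] by (auto simp: mc_solution_def)
    have "\<exists>G. continuous_on (closure \<Omega>) G \<and> (\<forall>x\<in>\<Omega>. G x = grad (partial_deriv b u) x)" if "b \<in> Basis" for b
      using Ck_closure_grad[OF u(1), of "[b]"] that by (simp add: iter_partial_def)
    then obtain HB where HB: "\<And>b. b \<in> Basis \<Longrightarrow> continuous_on (closure \<Omega>) (HB b)"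
      "\<And>b x. b \<in> Basis \<Longrightarrow> x \<in> \<Omega> \<Longrightarrow> HB b x = grad (partial_deriv b u) x" by metis
    have cc: "compact (closure \<Omega>)" using bdd by (simp add: compact_closure)
    have cf: "compact (frontier \<Omega>)" using bdd by (rule compact_frontier_bounded)
    have fc: "frontier \<Omega> \<subseteq> closure \<Omega>" by (simp add: frontier_def)
    have c\<psi>: "continuous_on (closure \<Omega>) \<psi>" using \<psi>(1) by (simp add: Ck_closure_def)
    have cD\<psi>: "continuous_on (closure \<Omega>) (grad_ext \<Omega> \<psi>)" by (rule grad_ext_closure[OF op \<psi>(1)]) simp
    have uc2: "continuous_on (closure \<Omega>) (grad_ext \<Omega> u)" "\<And>x. x \<in> \<Omega> \<Longrightarrow> grad_ext \<Omega> u x = grad u x"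
      using grad_ext_closure[OF op u(1)] by auto
    interpret s: capillary_solution \<Omega> U rt g \<mu> C c\<^sub>0 M\<^sub>0 L\<^sub>1 L\<^sub>2 b\<^sub>0 f \<psi> u "grad_ext \<Omega> u" "grad_ext \<Omega> \<psi>" HB
    proof
      show "continuous_on (closure \<Omega>) u" using u(1) by (simp add: Ck_closure_def)
      show "GDERIV \<psi> x :> grad_ext \<Omega> \<psi> x" if "x \<in> \<Omega>" for x
      proof -
        have "\<psi> differentiable (at x)" using \<psi>(1) that by (simp add: Ck_closure_def Ck_on_Suc)
        then show ?thesis using grad_ext_closure(2)[OF op \<psi>(1) _ that] GDERIV_grad by fastforce
      qed
      show "\<bar>\<psi> x\<bar> \<le> b\<^sub>0" if "x \<in> frontier \<Omega>" for x
        using C0_norm_upper[OF cf continuous_on_subset[OF c\<psi> fc] that] \<psi>(3) by simp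
      show "norm (grad_ext \<Omega> \<psi> x) \<le> L\<^sub>2" if "x \<in> frontier \<Omega>" for x
      proof -
        have xc: "x \<in> closure \<Omega>" using that fc by auto
        have "0 \<le> C0_norm (closure \<Omega>) \<psi>" using C0_norm_upper[OF cc c\<psi> xc] norm_ge_zero[of "\<psi> x"] by linarith
        then show ?thesis using C0_norm_upper[OF cc cD\<psi> xc] \<psi>(2) unfolding C1_norm_def by linarith
      qed
      show "grad_ext \<Omega> u x \<bullet> g x + \<psi> x * slope (grad_ext \<Omega> u x) = 0" if "x \<in> frontier \<Omega>" for x
      proof -
        have "\<gamma> x = g x" using normal[OF that] \<gamma> that by blast
        then have "(grad_ext \<Omega> u x \<bullet> g x) / slope (grad_ext \<Omega> u x) + \<psi> x = 0"
          using bc[unfolded capillary_bc_def, rule_format, OF that] by (simp add: slope_def power2_norm_eq_inner)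
        then show ?thesis by (simp add: field_simps)
      qed
    qed (use sol pos u(3) uc2 HB c\<psi> cD\<psi> in auto)
    have "slope (grad_ext \<Omega> u x) \<le> B"
      unfolding B_def
      by (rule s.near_boundary_estimate[OF q_def \<alpha>_def D_def c_def M_def \<beta>_def _ V_def x]) (rule Ci[OF sol])
    then show ?thesis using norm_le_slope[of "grad_ext \<Omega> u x"] by linarith
  qed
  show ?thesis
  \<comment> \<open>The maximum with 1 secures the positivity of the constant.\<close>
  proof (rule exI[of _ "max B 1"], rule conjI[OF _ exI[of _ \<mu>]], goal_cases)
    case 1 show ?case by simp
  next
    case 2
    show ?case
    proof (intro conjI allI impI ballI)
    fix \<gamma> f \<psi> u x
    assume A: "(\<forall>x\<in>frontier \<Omega>. inward_unit_normal \<Omega> x (\<gamma> x)) \<and>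
             admissible_rhs \<Omega> M\<^sub>0 L\<^sub>1 f \<and>
             Ck_closure 1 \<Omega> \<psi> \<and> C1_norm \<Omega> \<psi> \<le> L\<^sub>2 \<and> C0_norm (frontier \<Omega>) \<psi> \<le> b\<^sub>0 \<and>
             Ck_closure 2 \<Omega> u \<and> Ck_on 3 \<Omega> u \<and>
             (\<forall>x\<in>closure \<Omega>. \<bar>u x\<bar> \<le> M\<^sub>0) \<and>
             mean_curvature_eq \<Omega> f u \<and> capillary_bc \<Omega> \<gamma> \<psi> u" and x: "x \<in> closure (near_boundary \<Omega> \<mu>)"
    have "norm (grad_ext \<Omega> u x) \<le> B" by (rule est[of \<gamma> f \<psi> u x]) (use A x in auto)
    then show "norm (grad_ext \<Omega> u x) \<le> max B 1" by simp
    qed (rule \<mu>)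
  qed
qed

text \<open>Each point of a subdomain at distance \<delta> from the boundary is the centre of a ball
  of radius \<delta> / 2 inside \<Omega>, and the bound on such balls holds for all domains at once.
  The predicate \<open>bound\<close> demands positivity for all arguments but the estimate for
  positive ones only, so the chosen constant is positive everywhere.\<close>

lemma interior_gradient_estimate_exists:
  "\<exists>M\<^sub>1. interior_gradient_estimate TYPE('a::euclidean_space) M\<^sub>1 \<and> (\<forall>\<delta> M\<^sub>0 L\<^sub>1. 0 < M\<^sub>1 \<delta> M\<^sub>0 L\<^sub>1)"
proof -
  define bound where "bound \<delta> M\<^sub>0 L\<^sub>1 C \<longleftrightarrow> (0::real) < C \<and> (0 < M\<^sub>0 \<and> 0 < L\<^sub>1 \<and> 0 < \<delta> \<longrightarrow> (\<forall>(\<Omega> :: 'a set) f u x\<^sub>0.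
     mc_solution \<Omega> M\<^sub>0 L\<^sub>1 f u \<and> cball x\<^sub>0 (\<delta> / 2) \<subseteq> \<Omega> \<longrightarrow> slope (grad u x\<^sub>0) \<le> C))" for \<delta> M\<^sub>0 L\<^sub>1 C
  define M\<^sub>1 where "M\<^sub>1 \<delta> M\<^sub>0 L\<^sub>1 = (SOME C. bound \<delta> M\<^sub>0 L\<^sub>1 C)" for \<delta> M\<^sub>0 L\<^sub>1
  have "\<exists>C. bound \<delta> M\<^sub>0 L\<^sub>1 C" for \<delta> M\<^sub>0 L\<^sub>1
  proof (cases "0 < M\<^sub>0 \<and> 0 < L\<^sub>1 \<and> 0 < \<delta>")
    case True
    then show ?thesis using interior_gradient_bound[of M\<^sub>0 L\<^sub>1 "\<delta> / 2", where 'a='a] unfolding bound_def by auto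
  next
    case False
    then show ?thesis by (auto simp: bound_def intro: exI[of _ 1])
  qed
  then have bd: "bound \<delta> M\<^sub>0 L\<^sub>1 (M\<^sub>1 \<delta> M\<^sub>0 L\<^sub>1)" for \<delta> M\<^sub>0 L\<^sub>1 unfolding M\<^sub>1_def by (rule someI_ex)
  then have M1: "0 < M\<^sub>1 \<delta> M\<^sub>0 L\<^sub>1" for \<delta> M\<^sub>0 L\<^sub>1 by (simp add: bound_def)
  have "interior_gradient_estimate TYPE('a) M\<^sub>1"
    unfolding interior_gradient_estimate_def
  proof (intro allI impI ballI)
    fix \<Omega> :: "'a set" and M\<^sub>0 L\<^sub>1 f u \<Omega>' x
    assume A: "bounded_domain \<Omega> \<and> 0 < M\<^sub>0 \<and> 0 < L\<^sub>1 \<and> admissible_rhs \<Omega> M\<^sub>0 L\<^sub>1 f \<and>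
        Ck_on 3 \<Omega> u \<and> (\<forall>x\<in>\<Omega>. \<bar>u x\<bar> \<le> M\<^sub>0) \<and> mean_curvature_eq \<Omega> f u"
      and B: "bounded_domain \<Omega>' \<and> closure \<Omega>' \<subseteq> \<Omega>" and x: "x \<in> \<Omega>'"
    have op: "open \<Omega>" "bounded \<Omega>" "\<Omega> \<noteq> {}" using A by (auto simp: bounded_domain_def)
    have sol: "mc_solution \<Omega> M\<^sub>0 L\<^sub>1 f u" using A op by (simp add: mc_solution_def)
    define \<delta> where "\<delta> = setdist \<Omega>' (frontier \<Omega>)"
    have "closure \<Omega>' \<inter> frontier \<Omega> = {}" using B op(1) by (auto simp: frontier_def interior_open)
    moreover have "compact (closure \<Omega>')" using B by (simp add: bounded_domain_def compact_closure)
    moreover have "closure \<Omega>' \<noteq> {}" using x closure_subset by blast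
    ultimately have "setdist (closure \<Omega>') (frontier \<Omega>) > 0"
      using frontier_nonempty_bounded(1)[OF op] by (subst setdist_gt_0_compact_closed) auto
    then have \<delta>: "\<delta> > 0" by (simp add: \<delta>_def)
    have "cball x (\<delta> / 2) \<subseteq> \<Omega>"
    proof (rule ccontr)
      assume "\<not> cball x (\<delta> / 2) \<subseteq> \<Omega>"
      moreover have "x \<in> \<Omega>" using x B closure_subset by blast
      then have "x \<in> cball x (\<delta> / 2) \<inter> \<Omega>" using \<delta> by simp
      then have "cball x (\<delta> / 2) \<inter> \<Omega> \<noteq> {}" by blast
      ultimately have "cball x (\<delta> / 2) \<inter> frontier \<Omega> \<noteq> {}"
        by (intro connected_Int_frontier) auto
      then obtain z where z: "dist x z \<le> \<delta> / 2" "z \<in> frontier \<Omega>" by auto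
      then have "\<delta> \<le> dist x z" unfolding \<delta>_def using x by (intro setdist_le_dist)
      then show False using z \<delta> by simp
    qed
    then have "slope (grad u x) \<le> M\<^sub>1 \<delta> M\<^sub>0 L\<^sub>1" using bd[of \<delta> M\<^sub>0 L\<^sub>1] \<delta> sol A unfolding bound_def by blast
    then show "norm (grad u x) \<le> M\<^sub>1 (setdist \<Omega>' (frontier \<Omega>)) M\<^sub>0 L\<^sub>1"
      using norm_le_slope[of "grad u x"] unfolding \<delta>_def by linarith
  qed
  then show ?thesis using M1 by blast
qed

theorem theorem1p2:
  assumes "CARD('n::finite) \<ge> 2"
  shows "\<exists>(M\<^sub>1 :: real \<Rightarrow> real \<Rightarrow> real \<Rightarrow> real)
          (M\<^sub>2 :: (real ^ 'n) set \<Rightarrow> real \<Rightarrow> real \<Rightarrow> real \<Rightarrow> real \<Rightarrow> real \<Rightarrow> real).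
    interior_gradient_estimate TYPE(real ^ 'n) M\<^sub>1 \<and>
    (\<forall>(\<Omega> :: (real ^ 'n) set) M\<^sub>0 L\<^sub>1 L\<^sub>2 b\<^sub>0.
       bounded_domain \<Omega> \<and> Ck_boundary 3 \<Omega> \<and>
       0 < M\<^sub>0 \<and> 0 < L\<^sub>1 \<and> 0 < L\<^sub>2 \<and> 0 < b\<^sub>0 \<and> b\<^sub>0 < 1 \<longrightarrow>
       (\<exists>\<mu>\<^sub>0>0. 0 < M\<^sub>1 \<mu>\<^sub>0 M\<^sub>0 L\<^sub>1 \<and> 0 < M\<^sub>2 \<Omega> \<mu>\<^sub>0 M\<^sub>0 L\<^sub>1 L\<^sub>2 b\<^sub>0 \<and>
          (\<forall>(\<gamma> :: real ^ 'n \<Rightarrow> real ^ 'n) f \<psi> u.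
             (\<forall>x\<in>frontier \<Omega>. inward_unit_normal \<Omega> x (\<gamma> x)) \<and>
             admissible_rhs \<Omega> M\<^sub>0 L\<^sub>1 f \<and>
             Ck_closure 1 \<Omega> \<psi> \<and> C1_norm \<Omega> \<psi> \<le> L\<^sub>2 \<and> C0_norm (frontier \<Omega>) \<psi> \<le> b\<^sub>0 \<and>
             Ck_closure 2 \<Omega> u \<and> Ck_on 3 \<Omega> u \<and>
             (\<forall>x\<in>closure \<Omega>. \<bar>u x\<bar> \<le> M\<^sub>0) \<and>
             mean_curvature_eq \<Omega> f u \<and> capillary_bc \<Omega> \<gamma> \<psi> u \<longrightarrow>
             (\<forall>x\<in>closure (near_boundary \<Omega> \<mu>\<^sub>0).
                norm (grad_ext \<Omega> u x) \<le> max (M\<^sub>1 \<mu>\<^sub>0 M\<^sub>0 L\<^sub>1) (M\<^sub>2 \<Omega> \<mu>\<^sub>0 M\<^sub>0 L\<^sub>1 L\<^sub>2 b\<^sub>0)))))"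
proof -
  obtain M\<^sub>1 where M1: "interior_gradient_estimate TYPE(real ^ 'n) M\<^sub>1" "\<And>\<delta> M\<^sub>0 L\<^sub>1. 0 < M\<^sub>1 \<delta> M\<^sub>0 L\<^sub>1"
    using interior_gradient_estimate_exists by blast
  define good where "good \<Omega> M\<^sub>0 L\<^sub>1 L\<^sub>2 b\<^sub>0 B \<longleftrightarrow> (0::real) < B \<and> (\<exists>\<mu>\<^sub>0>0. \<forall>\<gamma> f \<psi> u.
             (\<forall>x\<in>frontier \<Omega>. inward_unit_normal \<Omega> x (\<gamma> x)) \<and>
             admissible_rhs \<Omega> M\<^sub>0 L\<^sub>1 f \<and>
             Ck_closure 1 \<Omega> \<psi> \<and> C1_norm \<Omega> \<psi> \<le> L\<^sub>2 \<and> C0_norm (frontier \<Omega>) \<psi> \<le> b\<^sub>0 \<and>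
             Ck_closure 2 \<Omega> u \<and> Ck_on 3 \<Omega> u \<and>
             (\<forall>x\<in>closure \<Omega>. \<bar>u x\<bar> \<le> M\<^sub>0) \<and>
             mean_curvature_eq \<Omega> f u \<and> capillary_bc \<Omega> \<gamma> \<psi> u \<longrightarrow>
             (\<forall>x\<in>closure (near_boundary \<Omega> \<mu>\<^sub>0). norm (grad_ext \<Omega> u x) \<le> B))"
    for \<Omega> :: "(real ^ 'n) set" and M\<^sub>0 L\<^sub>1 L\<^sub>2 b\<^sub>0 B
  \<comment> \<open>The chosen value is the same for all \<mu>_0. The width can therefore be
    extracted from \<open>good\<close> after the bound is fixed, and no circle arises.\<close>
  define M\<^sub>2 where "M\<^sub>2 \<Omega> (\<mu>\<^sub>0::real) M\<^sub>0 L\<^sub>1 L\<^sub>2 b\<^sub>0 = (SOME B. good \<Omega> M\<^sub>0 L\<^sub>1 L\<^sub>2 b\<^sub>0 B)" for \<Omega> \<mu>\<^sub>0 M\<^sub>0 L\<^sub>1 L\<^sub>2 b\<^sub>0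
  show ?thesis
  proof (intro exI[of _ M\<^sub>1] exI[of _ M\<^sub>2] conjI allI impI)
    fix \<Omega> :: "(real ^ 'n) set" and M\<^sub>0 L\<^sub>1 L\<^sub>2 b\<^sub>0 :: real
    assume "bounded_domain \<Omega> \<and> Ck_boundary 3 \<Omega> \<and> 0 < M\<^sub>0 \<and> 0 < L\<^sub>1 \<and> 0 < L\<^sub>2 \<and> 0 < b\<^sub>0 \<and> b\<^sub>0 < 1"
    then have "\<exists>B. good \<Omega> M\<^sub>0 L\<^sub>1 L\<^sub>2 b\<^sub>0 B"
      unfolding good_def using boundary_gradient_bound[of \<Omega> M\<^sub>0 L\<^sub>1 L\<^sub>2 b\<^sub>0] by blast
    then have g: "good \<Omega> M\<^sub>0 L\<^sub>1 L\<^sub>2 b\<^sub>0 (M\<^sub>2 \<Omega> \<mu>\<^sub>0 M\<^sub>0 L\<^sub>1 L\<^sub>2 b\<^sub>0)" for \<mu>\<^sub>0 unfolding M\<^sub>2_def by (rule someI_ex)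
    define B where "B = M\<^sub>2 \<Omega> 0 M\<^sub>0 L\<^sub>1 L\<^sub>2 b\<^sub>0"
    have e: "M\<^sub>2 \<Omega> \<mu>\<^sub>0 M\<^sub>0 L\<^sub>1 L\<^sub>2 b\<^sub>0 = B" for \<mu>\<^sub>0 by (simp add: B_def M\<^sub>2_def)
    have "good \<Omega> M\<^sub>0 L\<^sub>1 L\<^sub>2 b\<^sub>0 B" using g unfolding e .
    then obtain \<mu>\<^sub>0 where \<mu>: "\<mu>\<^sub>0 > 0" "0 < B" and est: "\<forall>\<gamma> f \<psi> u.
             (\<forall>x\<in>frontier \<Omega>. inward_unit_normal \<Omega> x (\<gamma> x)) \<and>
             admissible_rhs \<Omega> M\<^sub>0 L\<^sub>1 f \<and>
             Ck_closure 1 \<Omega> \<psi> \<and> C1_norm \<Omega> \<psi> \<le> L\<^sub>2 \<and> C0_norm (frontier \<Omega>) \<psi> \<le> b\<^sub>0 \<and>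
             Ck_closure 2 \<Omega> u \<and> Ck_on 3 \<Omega> u \<and>
             (\<forall>x\<in>closure \<Omega>. \<bar>u x\<bar> \<le> M\<^sub>0) \<and>
             mean_curvature_eq \<Omega> f u \<and> capillary_bc \<Omega> \<gamma> \<psi> u \<longrightarrow>
             (\<forall>x\<in>closure (near_boundary \<Omega> \<mu>\<^sub>0). norm (grad_ext \<Omega> u x) \<le> B)"
      unfolding good_def by blast
    show "\<exists>\<mu>\<^sub>0>0. 0 < M\<^sub>1 \<mu>\<^sub>0 M\<^sub>0 L\<^sub>1 \<and> 0 < M\<^sub>2 \<Omega> \<mu>\<^sub>0 M\<^sub>0 L\<^sub>1 L\<^sub>2 b\<^sub>0 \<and>
          (\<forall>(\<gamma> :: real ^ 'n \<Rightarrow> real ^ 'n) f \<psi> u.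
             (\<forall>x\<in>frontier \<Omega>. inward_unit_normal \<Omega> x (\<gamma> x)) \<and>
             admissible_rhs \<Omega> M\<^sub>0 L\<^sub>1 f \<and>
             Ck_closure 1 \<Omega> \<psi> \<and> C1_norm \<Omega> \<psi> \<le> L\<^sub>2 \<and> C0_norm (frontier \<Omega>) \<psi> \<le> b\<^sub>0 \<and>
             Ck_closure 2 \<Omega> u \<and> Ck_on 3 \<Omega> u \<and>
             (\<forall>x\<in>closure \<Omega>. \<bar>u x\<bar> \<le> M\<^sub>0) \<and>
             mean_curvature_eq \<Omega> f u \<and> capillary_bc \<Omega> \<gamma> \<psi> u \<longrightarrow>
             (\<forall>x\<in>closure (near_boundary \<Omega> \<mu>\<^sub>0).
                norm (grad_ext \<Omega> u x) \<le> max (M\<^sub>1 \<mu>\<^sub>0 M\<^sub>0 L\<^sub>1) (M\<^sub>2 \<Omega> \<mu>\<^sub>0 M\<^sub>0 L\<^sub>1 L\<^sub>2 b\<^sub>0)))"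
      unfolding e using \<mu> M1(2) est by (intro exI[of _ \<mu>\<^sub>0] conjI allI impI ballI max.coboundedI2) blast+
  qed (rule M1(1))
qed

end
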